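(* Let $\gamma>0$, $L>0$, $k\in\mathbb N$ and $\delta>0$. Consider observations $$Y_{i,j}=\mu(x_j)+Z_i(x_j)+\varepsilon_{i,j},\qquad i=1,\dots,n,\ j=1,\dots,p,$$ with an unknown mean function $\mu$, known non-random design points $x_1<\dots<x_p$ in $[0,1]$, $x_j=x_j(p,n)$, i.i.d. copies $Z_1,\dots,Z_n$ of a centered process $Z$ on $[0,1]$, and errors $\varepsilon_{i,j}$ independent of $Z_1,\dots,Z_n$. Assume that the errors $\varepsilon_{i,j}$ are i.i.d. $\mathcal N(0,\sigma_0^2)$-distributed, $\sigma_0^2>0$. Then, setting $$a_{n,p}=\max\Big(p^{-\gamma},\ \Big(\frac{\log(np)}{np}\Big)^{\frac{\gamma}{2\gamma+1}},\ n^{-1/2}\Big),$$ we have that $$\liminf_{n,p\to\infty}\ \inf_{\hat\phi_{k;n,p}}\ \sup_{Z\in\mathcal P_{\mathcal G}(\gamma;k,L)}\ \mathbb E\Big[w\Big(a_{n,p}^{-1}\,\mathrm d(\hat\phi_{k;n,p},\phi_k)_{\infty,s}\Big)\Big]>0,$$ where the infimum is taken over all estimators $\hat\phi_{k;n,p}$ of $\phi_k$, the normalized eigenfunction (unique up to sign) for the $k$-th largest eigenvalue of the covariance operator of $Z$, and $w(x)$ is a non-negative weight function satisfying $w(x)\ge a\,\mathbf 1_{[b,\infty)}(x)$ for some $a,b>0$.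
   Context: The semimetric is $\mathrm d(\phi,\psi)_{\infty,s}=\min(\|\phi-\psi\|_\infty,\|\phi+\psi\|_\infty)$ for $\phi,\psi\in C[0,1]$, with $\|\cdot\|_\infty$ the supremum norm. $\mathcal P_{\mathcal G}(\gamma;L)$ is the class of centered Gaussian processes $Z:[0,1]\to\mathbb R$ whose covariance kernel $\Gamma_Z(x,y)=\mathbb E[Z(x)Z(y)]$ lies in $\mathcal H(\gamma,L)$. Here $\mathcal H(\gamma,L)=\{f:[0,1]^2\to\mathbb R:\|f\|_{\mathcal H,\gamma}\le L\}$, where, with $m_\gamma:=\max\{m\in\mathbb N_0:m<\gamma\}$ (strict inequality), $D^{s}=\partial_1^{s_1}\partial_2^{s_2}$ and $|s|=s_1+s_2$ for $s\in\mathbb N_0^2$, $$\|f\|_{\mathcal H,\gamma}=\max_{|s|\le m_\gamma}\sup_{v}|D^{s}f(v)|+\max_{|s|=m_\gamma}\sup_{v\ne u}\frac{|D^{s}f(v)-D^{s}f(u)|}{\|v-u\|_\infty^{\gamma-m_\gamma}},$$ all these partial derivatives being required to exist. The covariance operator is $(T_{\Gamma_Z}f)(x)=\int_0^1\Gamma_Z(x,y)f(y)\,dy$ on $L_2[0,1]$, with eigenvalues $\lambda_1\ge\lambda_2\ge\dots\ge0$ repeated according to multiplicity. The $k$-th spectral gap is $\delta_k=\min(\lambda_{k-1}-\lambda_k,\lambda_k-\lambda_{k+1})$ for $k\ge2$ and $\delta_1=\lambda_1-\lambda_2$. For the given $\delta>0$, $\mathcal P_{\mathcal G}(\gamma;k,L)=\{Z\in\mathcal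 P_{\mathcal G}(\gamma;L):\delta_k\ge\delta\}$. Estimators are functions of the data $(Y_{i,j})_{i\le n,\,j\le p}$.
   Formalization: The bound is proved for b at most some b₀>0 depending only on γ, L, k, δ, σ₀ (it fails for large b), and for δ such that the class with gap at least δ' is non-empty for some δ'>δ (otherwise the class may be empty or have only one covariance kernel). *)

theory Defs
  imports "HOL-Probability.Probability" "HOL-Library.Function_Algebras"
begin

subsection \<open>Hoelder classes on the unit square\<close>

definition holder_order :: "real \<Rightarrow> nat" where
  "holder_order \<gamma> = Max {m. real m < \<gamma>}"

definition partial1 :: "(real \<Rightarrow> real \<Rightarrow> real) \<Rightarrow> real \<Rightarrow> real \<Rightarrow> real" where
  "partial1 f x y = vector_derivative (\<lambda>t. f t y) (at x within {0..1})"

definition partial2 :: "(real \<Rightarrow> real \<Rightarrow> real) \<Rightarrow> real \<Rightarrow> real \<Rightarrow> real" where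
  "partial2 f x y = vector_derivative (\<lambda>t. f x t) (at y within {0..1})"

definition mixed_partial :: "nat \<Rightarrow> nat \<Rightarrow> (real \<Rightarrow> real \<Rightarrow> real) \<Rightarrow> real \<Rightarrow> real \<Rightarrow> real" where
  "mixed_partial s1 s2 f = (partial1 ^^ s1) ((partial2 ^^ s2) f)"

text \<open>Existence has to be required separately, because \<^const>\<open>vector_derivative\<close> is total.\<close>

definition partials_exist :: "nat \<Rightarrow> (real \<Rightarrow> real \<Rightarrow> real) \<Rightarrow> bool" where
  "partials_exist m f \<longleftrightarrow>
     (\<forall>x\<in>{0..1}. \<forall>y\<in>{0..1}.
        (\<forall>s2<m. (\<lambda>t. mixed_partial 0 s2 f x t) differentiable (at y within {0..1})) \<and>
        (\<forall>s1 s2. s1 + s2 < m \<longrightarrow>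
           (\<lambda>t. mixed_partial s1 s2 f t y) differentiable (at x within {0..1})))"

definition holder_norm :: "real \<Rightarrow> (real \<Rightarrow> real \<Rightarrow> real) \<Rightarrow> ennreal" where
  "holder_norm \<gamma> f =
     (SUP (s1, s2)\<in>{(s1, s2). s1 + s2 \<le> holder_order \<gamma>}.
        SUP (x, y)\<in>{0..1} \<times> {0..1}. ennreal \<bar>mixed_partial s1 s2 f x y\<bar>) +
     (SUP (s1, s2)\<in>{(s1, s2). s1 + s2 = holder_order \<gamma>}.
        SUP ((x, y), (x', y'))\<in>{(v, u). v \<in> {0..1} \<times> {0..1} \<and> u \<in> {0..1} \<times> {0..1} \<and> v \<noteq> u}.
          ennreal (\<bar>mixed_partial s1 s2 f x y - mixed_partial s1 s2 f x' y'\<bar>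
            / max \<bar>x - x'\<bar> \<bar>y - y'\<bar> powr (\<gamma> - real (holder_order \<gamma>))))"

definition holder_class :: "real \<Rightarrow> real \<Rightarrow> (real \<Rightarrow> real \<Rightarrow> real) set" where
  "holder_class \<gamma> L = {f. partials_exist (holder_order \<gamma>) f \<and> holder_norm \<gamma> f \<le> ennreal L}"

subsection \<open>Centered Gaussian processes\<close>

text \<open>A process indexed by the unit interval is represented by its law on the product space
  of paths, so that the process itself is the coordinate process. This avoids quantifying
  over the underlying probability spaces.\<close>

definition path_space :: "(real \<Rightarrow> real) measure" where
  "path_space = (\<Pi>\<^sub>M t\<in>{0..1}. borel)"

definition centered_gaussian_process :: "(real \<Rightarrow> real) measure \<Rightarrow> bool" where
  "centered_gaussian_process P \<longleftrightarrow>
     prob_space P \<and> sets P = sets path_space \<and>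
     (\<forall>J c. finite J \<and> J \<subseteq> {0..1} \<longrightarrow>
        (\<exists>s\<ge>0. distr P borel (\<lambda>z. \<Sum>t\<in>J. c t * z t) =
           (if s = 0 then return borel 0 else density lborel (normal_density 0 s))))"

definition cov_kernel :: "(real \<Rightarrow> real) measure \<Rightarrow> real \<Rightarrow> real \<Rightarrow> real" where
  "cov_kernel P x y = (\<integral>z. z x * z y \<partial>P)"

definition gaussian_class :: "real \<Rightarrow> real \<Rightarrow> (real \<Rightarrow> real) measure set" where
  "gaussian_class \<gamma> L = {P. centered_gaussian_process P \<and> cov_kernel P \<in> holder_class \<gamma> L}"

subsection \<open>Eigenvalues and eigenfunctions of the covariance operator\<close>

definition square_integrable :: "(real \<Rightarrow> real) \<Rightarrow> bool" where
  "square_integrable f \<longleftrightarrow> f \<in> borel_measurable (lebesgue_on {0..1}) \<and>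
     integrable (lebesgue_on {0..1}) (\<lambda>x. (f x)\<^sup>2)"

definition cov_operator :: "(real \<Rightarrow> real \<Rightarrow> real) \<Rightarrow> (real \<Rightarrow> real) \<Rightarrow> real \<Rightarrow> real" where
  "cov_operator \<Gamma> f x = (\<integral>y. \<Gamma> x y * f y \<partial>lebesgue_on {0..1})"

text \<open>For nonzero \<open>c\<close>, an eigenclass in \<open>L\<^sub>2\<close> contains exactly one function that satisfies the
  eigenvalue equation everywhere on the unit interval (its continuous representative) and
  vanishes elsewhere. Hence this set of functions is isomorphic to the eigenspace.\<close>

definition eigenspace :: "(real \<Rightarrow> real \<Rightarrow> real) \<Rightarrow> real \<Rightarrow> (real \<Rightarrow> real) set" where
  "eigenspace \<Gamma> c = {f. square_integrable f \<and> (\<forall>x. x \<notin> {0..1} \<longrightarrow> f x = 0) \<and>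
     (\<forall>x\<in>{0..1}. cov_operator \<Gamma> f x = c * f x)}"

definition scale_fun :: "real \<Rightarrow> (real \<Rightarrow> real) \<Rightarrow> real \<Rightarrow> real" where
  "scale_fun c f = (\<lambda>x. c * f x)"

lemma vector_space_scale_fun: "vector_space scale_fun"
  by unfold_locales (auto simp: scale_fun_def fun_eq_iff algebra_simps)

definition multiplicity_of :: "(real \<Rightarrow> real \<Rightarrow> real) \<Rightarrow> real \<Rightarrow> nat" where
  "multiplicity_of \<Gamma> c = vector_space.dim scale_fun (eigenspace \<Gamma> c)"

text \<open>\<open>lam 1 \<ge> lam 2 \<ge> \<dots>\<close> are the eigenvalues repeated according to multiplicity, filled up with
  zeros if there are only finitely many nonzero ones; \<open>lam 0\<close> is irrelevant. Finiteness is
  stated because \<^const>\<open>card\<close> is 0 on infinite sets.\<close>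

definition eigenvalue_sequence :: "(real \<Rightarrow> real \<Rightarrow> real) \<Rightarrow> (nat \<Rightarrow> real) \<Rightarrow> bool" where
  "eigenvalue_sequence \<Gamma> lam \<longleftrightarrow>
     (\<forall>j\<ge>1. 0 \<le> lam j \<and> lam (Suc j) \<le> lam j) \<and>
     (\<forall>c>0. finite {j. 1 \<le> j \<and> lam j = c} \<and> card {j. 1 \<le> j \<and> lam j = c} = multiplicity_of \<Gamma> c)"

definition spectral_gap :: "(nat \<Rightarrow> real) \<Rightarrow> nat \<Rightarrow> real" where
  "spectral_gap lam k =
     (if k = 1 then lam 1 - lam 2 else min (lam (k - 1) - lam k) (lam k - lam (k + 1)))"

definition gaussian_gap_class :: "real \<Rightarrow> nat \<Rightarrow> real \<Rightarrow> real \<Rightarrow> (real \<Rightarrow> real) measure set" where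
  "gaussian_gap_class \<gamma> k L \<delta> =
     {P \<in> gaussian_class \<gamma> L.
        \<exists>lam. eigenvalue_sequence (cov_kernel P) lam \<and> \<delta> \<le> spectral_gap lam k}"

definition normalized_eigenfunction :: "(real \<Rightarrow> real \<Rightarrow> real) \<Rightarrow> nat \<Rightarrow> (real \<Rightarrow> real) \<Rightarrow> bool" where
  "normalized_eigenfunction \<Gamma> k \<phi> \<longleftrightarrow>
     (\<exists>lam. eigenvalue_sequence \<Gamma> lam \<and> \<phi> \<in> eigenspace \<Gamma> (lam k)) \<and>
     (\<integral>x. (\<phi> x)\<^sup>2 \<partial>lebesgue_on {0..1}) = 1"

text \<open>On a class with a positive gap the choice is unique up to sign.\<close>

definition eigenfunction :: "(real \<Rightarrow> real) measure \<Rightarrow> nat \<Rightarrow> real \<Rightarrow> real" where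
  "eigenfunction P k = (SOME \<phi>. normalized_eigenfunction (cov_kernel P) k \<phi>)"

definition sign_dist :: "(real \<Rightarrow> real) \<Rightarrow> (real \<Rightarrow> real) \<Rightarrow> real" where
  "sign_dist \<phi> \<psi> = min (SUP t\<in>{0..1}. \<bar>\<phi> t - \<psi> t\<bar>) (SUP t\<in>{0..1}. \<bar>\<phi> t + \<psi> t\<bar>)"

subsection \<open>Observation model and estimators\<close>

definition data_space :: "nat \<Rightarrow> nat \<Rightarrow> (nat \<times> nat \<Rightarrow> real) measure" where
  "data_space n p = (\<Pi>\<^sub>M ij\<in>{1..n} \<times> {1..p}. borel)"

text \<open>Law of \<open>(Y (i, j))\<close> with \<open>Y (i, j) = \<mu> (x j) + Z i (x j) + \<epsilon> (i, j)\<close>: the \<open>Z i\<close> are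
  independent with law \<open>P\<close>, the errors are independent centered normal with standard
  deviation \<open>\<sigma>\<close>, and both families are independent.\<close>

definition data_law ::
  "(real \<Rightarrow> real) \<Rightarrow> (nat \<Rightarrow> real) \<Rightarrow> real \<Rightarrow> nat \<Rightarrow> nat \<Rightarrow> (real \<Rightarrow> real) measure
     \<Rightarrow> (nat \<times> nat \<Rightarrow> real) measure" where
  "data_law \<mu> x \<sigma> n p P =
     distr ((\<Pi>\<^sub>M i\<in>{1..n}. P) \<Otimes>\<^sub>M
            (\<Pi>\<^sub>M ij\<in>{1..n} \<times> {1..p}. density lborel (normal_density 0 \<sigma>)))
       (data_space n p)
       (\<lambda>(z, e). \<lambda>(i, j)\<in>{1..n} \<times> {1..p}. \<mu> (x j) + z i (x j) + e (i, j))"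

definition design :: "nat \<Rightarrow> (nat \<Rightarrow> real) \<Rightarrow> bool" where
  "design p x \<longleftrightarrow> x ` {1..p} \<subseteq> {0..1} \<and> strict_mono_on {1..p} x"

text \<open>Measurable maps from the data space to the continuous functions on the unit interval.
  The Borel sets of the supremum norm are generated by the point evaluations, so
  measurability is pointwise.\<close>

definition estimators :: "nat \<Rightarrow> nat \<Rightarrow> ((nat \<times> nat \<Rightarrow> real) \<Rightarrow> real \<Rightarrow> real) set" where
  "estimators n p =
     {\<Phi>. (\<forall>y\<in>space (data_space n p). continuous_on {0..1} (\<Phi> y)) \<and>
          (\<forall>t\<in>{0..1}. (\<lambda>y. \<Phi> y t) \<in> borel_measurable (data_space n p))}"

definition rate :: "real \<Rightarrow> nat \<Rightarrow> nat \<Rightarrow> real" where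
  "rate \<gamma> n p =
     Max {real p powr (- \<gamma>),
          (ln (real (n * p)) / real (n * p)) powr (\<gamma> / (2 * \<gamma> + 1)),
          real n powr (- 1 / 2)}"

end

theory Submission
  imports Defs "HOL-Computational_Algebra.Polynomial" "HOL-Real_Asymp.Real_Asymp"
begin

text \<open>
  Each of the three rates is obtained separately, by perturbing a law \<open>P\<close> of the class that has
  some slack in the Hoelder norm. Every perturbation replaces the covariance operator \<open>T\<close> by
  \<open>U T U\<^sup>*\<close>, where \<open>U\<close> is a rotation in the plane spanned by two orthonormal functions \<open>e1, e2\<close>. This
  preserves all eigenvalues, hence the spectral gap, and maps the eigenfunction \<open>\<phi>\<close> to \<open>U \<phi>\<close>, so that
  no perturbation theory of eigenvalues is needed. A law with slack is a multiple of a given one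
  if \<open>k \<ge> 2\<close>, and is built from an explicit kernel of rank two if \<open>k = 1\<close>.

  For the rate \<open>n\<^bsup>-1/2\<^esup>\<close>, \<open>e1\<close> and \<open>e2\<close> are two eigenfunctions and the angle is of order \<open>n\<^bsup>-1/2\<^esup>\<close>; this
  only rotates and rescales two independent Gaussian coordinates of each path. For the other rates
  \<open>e1\<close> and \<open>e2\<close> are adjacent bumps of width \<open>h\<close> and the angle is of order \<open>h\<^bsup>\<gamma>\<^esup>\<close>. If \<open>h\<close> is of order \<open>1/p\<close>,
  then some interval contains no design point, and the perturbation does not change the law of the
  data. If \<open>h\<^bsup>2\<gamma>+1\<^esup> = log (np) / (np)\<close>, then, conditionally on the paths, it is a mean shift of the
  Gaussian errors with an energy below a small multiple of \<open>log M\<close>, where \<open>M\<close> is the number of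
  disjoint intervals; but an estimator is close to at most one of the \<open>M\<close> perturbed eigenfunctions.\<close>

subsection \<open>Hoelder bounds\<close>

text \<open>Membership in the class requires a gap of at least \<open>\<delta>\<close>, so a
  perturbation should leave the eigenvalues alone; conjugating by a rotation spends nothing but
  Hoelder norm. Both spanning functions of the local rotations are bumps because the paths then
  change only on the supports of the bumps; a plane containing the eigenfunction would change them
  all over the unit interval.

  A bump of width h with unit L2 norm has height of order h^(-1/2) and integral of order h^(1/2).
  The coefficients of the eigenfunction are therefore of order h^(1/2), and times the height of
  order 1: at the peak the eigenfunction moves by about the angle. The Hoelder norm of a bump, of
  order h^(-1/2 - gamma), enters the kernel multiplied by that of an image under T, of order h^(1/2)
  because T smooths; this allows an angle of order h^gamma.

  Scaling creates slack because \<open>nondegenerate\<close> provides a gap strictly above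
  \<open>\<delta>\<close>. It cannot create a second positive eigenvalue, which may be absent for k
  = 1; hence the explicit kernel there, while for k \<ge> 2 the gap itself guarantees a
  partner.\<close>

text \<open>With an explicit family of derivatives, sums and products of kernels can be handled without
  computing iterated \<^const>\<open>vector_derivative\<close>s.\<close>

definition deriv_family ::
  "nat \<Rightarrow> (real \<Rightarrow> real \<Rightarrow> real) \<Rightarrow> (nat \<Rightarrow> nat \<Rightarrow> real \<Rightarrow> real \<Rightarrow> real) \<Rightarrow> bool" where
  "deriv_family m f D \<longleftrightarrow>
     (\<forall>x\<in>{0..1}. \<forall>y\<in>{0..1}. D 0 0 x y = f x y) \<and>
     (\<forall>s2<m. \<forall>x\<in>{0..1}. \<forall>y\<in>{0..1}.
        ((\<lambda>t. D 0 s2 x t) has_vector_derivative D 0 (Suc s2) x y) (at y within {0..1})) \<and>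
     (\<forall>s1 s2. s1 + s2 < m \<longrightarrow> (\<forall>x\<in>{0..1}. \<forall>y\<in>{0..1}.
        ((\<lambda>t. D s1 s2 t y) has_vector_derivative D (Suc s1) s2 x y) (at x within {0..1})))"

text \<open>The norm is a supremum of derivatives plus a supremum of difference quotients. Bounding
  them separately by \<open>A\<close> and \<open>B\<close> turns membership in the class into
  \<open>A + B \<le> L\<close>, and slack into a strict inequality.\<close>

definition holder_bounds ::
  "nat \<Rightarrow> real \<Rightarrow> real \<Rightarrow> real \<Rightarrow> (real \<Rightarrow> real \<Rightarrow> real) \<Rightarrow> bool" where
  "holder_bounds m \<alpha> A B f \<longleftrightarrow> (\<exists>D. deriv_family m f D \<and>
     (\<forall>s1 s2. s1 + s2 \<le> m \<longrightarrow> (\<forall>x\<in>{0..1}. \<forall>y\<in>{0..1}. \<bar>D s1 s2 x y\<bar> \<le> A)) \<and>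
     (\<forall>s1 s2. s1 + s2 = m \<longrightarrow> (\<forall>x\<in>{0..1}. \<forall>y\<in>{0..1}. \<forall>x'\<in>{0..1}. \<forall>y'\<in>{0..1}.
        \<bar>D s1 s2 x y - D s1 s2 x' y'\<bar> \<le> B * max \<bar>x - x'\<bar> \<bar>y - y'\<bar> powr \<alpha>)))"

definition holder_bound1 :: "nat \<Rightarrow> real \<Rightarrow> real \<Rightarrow> (real \<Rightarrow> real) \<Rightarrow> bool" where
  "holder_bound1 m \<alpha> K f \<longleftrightarrow> (\<exists>d. (\<forall>x\<in>{0..1}. d 0 x = f x) \<and>
     (\<forall>i<m. \<forall>x\<in>{0..1}. (d i has_vector_derivative d (Suc i) x) (at x within {0..1})) \<and>
     (\<forall>i\<le>m. \<forall>x\<in>{0..1}. \<bar>d i x\<bar> \<le> K) \<and>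
     (\<forall>x\<in>{0..1}. \<forall>y\<in>{0..1}. \<bar>d m x - d m y\<bar> \<le> K * \<bar>x - y\<bar> powr \<alpha>))"

lemma holder_boundsI:
  assumes "deriv_family m f D"
    and "\<And>s1 s2 x y. s1 + s2 \<le> m \<Longrightarrow> x \<in> {0..1} \<Longrightarrow> y \<in> {0..1} \<Longrightarrow> \<bar>D s1 s2 x y\<bar> \<le> A"
    and "\<And>s1 s2 x y x' y'. s1 + s2 = m \<Longrightarrow> x \<in> {0..1} \<Longrightarrow> y \<in> {0..1} \<Longrightarrow> x' \<in> {0..1} \<Longrightarrow> y' \<in> {0..1}
       \<Longrightarrow> \<bar>D s1 s2 x y - D s1 s2 x' y'\<bar> \<le> B * max \<bar>x - x'\<bar> \<bar>y - y'\<bar> powr \<alpha>"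
  shows "holder_bounds m \<alpha> A B f"
  unfolding holder_bounds_def
  by (rule exI[of _ D], intro conjI allI impI ballI) (rule assms; assumption)+

lemma holder_boundsE:
  assumes "holder_bounds m \<alpha> A B f"
  obtains D where "deriv_family m f D"
    "\<And>s1 s2 x y. s1 + s2 \<le> m \<Longrightarrow> x \<in> {0..1} \<Longrightarrow> y \<in> {0..1} \<Longrightarrow> \<bar>D s1 s2 x y\<bar> \<le> A"
    "\<And>s1 s2 x y x' y'. s1 + s2 = m \<Longrightarrow> x \<in> {0..1} \<Longrightarrow> y \<in> {0..1} \<Longrightarrow> x' \<in> {0..1} \<Longrightarrow> y' \<in> {0..1}
       \<Longrightarrow> \<bar>D s1 s2 x y - D s1 s2 x' y'\<bar> \<le> B * max \<bar>x - x'\<bar> \<bar>y - y'\<bar> powr \<alpha>"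
proof -
  from assms obtain D where D: "deriv_family m f D \<and>
     (\<forall>s1 s2. s1 + s2 \<le> m \<longrightarrow> (\<forall>x\<in>{0..1}. \<forall>y\<in>{0..1}. \<bar>D s1 s2 x y\<bar> \<le> A)) \<and>
     (\<forall>s1 s2. s1 + s2 = m \<longrightarrow> (\<forall>x\<in>{0..1}. \<forall>y\<in>{0..1}. \<forall>x'\<in>{0..1}. \<forall>y'\<in>{0..1}.
        \<bar>D s1 s2 x y - D s1 s2 x' y'\<bar> \<le> B * max \<bar>x - x'\<bar> \<bar>y - y'\<bar> powr \<alpha>))"
    unfolding holder_bounds_def by (rule exE)
  show ?thesis by (rule that[of D]) (use D in simp_all)
qed

text \<open>The exponent gamma - m thus lies in (0, 1]. It is 1, and not 0, for integer gamma,
  because m is the largest natural number strictly below gamma.\<close>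

lemma holder_order_props:
  assumes "\<gamma> > 0"
  shows "real (holder_order \<gamma>) < \<gamma>" "\<gamma> \<le> real (holder_order \<gamma>) + 1"
proof -
  have fin: "finite {m. real m < \<gamma>}"
    by (rule finite_subset[of _ "{..nat \<lceil>\<gamma>\<rceil>}"]) (auto, linarith)
  have ne: "{m. real m < \<gamma>} \<noteq> {}" using assms by (auto intro!: exI[of _ 0])
  show "real (holder_order \<gamma>) < \<gamma>"
    using Max_in[OF fin ne] by (simp add: holder_order_def)
  show "\<gamma> \<le> real (holder_order \<gamma>) + 1"
  proof (rule ccontr)
    assume "\<not> ?thesis"
    then have "Suc (holder_order \<gamma>) \<in> {m. real m < \<gamma>}" by simp
    from Max_ge[OF fin this] show False by (simp add: holder_order_def)
  qed
qed

lemma vector_derivative_unit_cong: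
  assumes "(g has_vector_derivative g') (at (x::real) within {0..1})"
    "x \<in> {0..1}" "\<And>t. t \<in> {0..1} \<Longrightarrow> f t = g t"
  shows "(f has_vector_derivative (g'::real)) (at x within {0..1})"
    "vector_derivative f (at x within {0..1}) = g'"
proof -
  show *: "(f has_vector_derivative g') (at x within {0..1})"
    using assms by (metis has_vector_derivative_transform)
  show "vector_derivative f (at x within {0..1}) = g'"
    using vector_derivative_within_closed_interval[of 0 1 x f g'] * assms(2) by simp
qed

lemma deriv_familyD:
  assumes "deriv_family m f D" "x \<in> {0..1}" "y \<in> {0..1}"
  shows "D 0 0 x y = f x y"
    "s2 < m \<Longrightarrow> ((\<lambda>t. D 0 s2 x t) has_vector_derivative D 0 (Suc s2) x y) (at y within {0..1})"
    "s1 + s2 < m \<Longrightarrow> ((\<lambda>t. D s1 s2 t y) has_vector_derivative D (Suc s1) s2 x y) (at x within {0..1})"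
  using assms by (simp_all add: deriv_family_def)

text \<open>Derivatives within a nondegenerate interval are unique, so a family of derivatives is
  determined by \<open>f\<close>. \<open>mixed_partial\<close> differentiates in the second variable
  before the first; hence the induction on \<open>s2\<close> nested in the base case of that on
  \<open>s1\<close>.\<close>

lemma mixed_partial_eq_family:
  assumes D: "deriv_family m f D"
  shows "s1 + s2 \<le> m \<Longrightarrow> x \<in> {0..1} \<Longrightarrow> y \<in> {0..1} \<Longrightarrow> mixed_partial s1 s2 f x y = D s1 s2 x y"
proof (induction s1 arbitrary: x y)
  case 0
  then show ?case
  proof (induction s2 arbitrary: x y)
    case 0 then show ?case using deriv_familyD(1)[OF D] by (simp add: mixed_partial_def)
  next
    case (Suc s2)
    have "mixed_partial 0 (Suc s2) f x y
      = vector_derivative (\<lambda>t. mixed_partial 0 s2 f x t) (at y within {0..1})"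
      by (simp add: mixed_partial_def partial2_def)
    also have "\<dots> = D 0 (Suc s2) x y"
      using Suc by (intro vector_derivative_unit_cong(2)[OF deriv_familyD(2)[OF D]]) auto
    finally show ?case .
  qed
next
  case (Suc s1)
  have "mixed_partial (Suc s1) s2 f x y
      = vector_derivative (\<lambda>t. mixed_partial s1 s2 f t y) (at x within {0..1})"
    by (simp add: mixed_partial_def partial1_def)
  also have "\<dots> = D (Suc s1) s2 x y"
    using Suc by (intro vector_derivative_unit_cong(2)[OF deriv_familyD(3)[OF D]]) auto
  finally show ?case .
qed

lemma partials_exist_family:
  assumes D: "deriv_family m f D"
  shows "partials_exist m f"
  unfolding partials_exist_def
proof (intro ballI conjI allI impI)
  fix x y :: real and s2 assume "x \<in> {0..1}" "y \<in> {0..1}" "s2 < m"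
  then have "((\<lambda>t. mixed_partial 0 s2 f x t) has_vector_derivative D 0 (Suc s2) x y) (at y within {0..1})"
    by (intro vector_derivative_unit_cong(1)[OF deriv_familyD(2)[OF D]])
      (auto simp: mixed_partial_eq_family[OF D])
  then show "(\<lambda>t. mixed_partial 0 s2 f x t) differentiable (at y within {0..1})"
    by (rule differentiableI_vector)
next
  fix x y :: real and s1 s2 assume "x \<in> {0..1}" "y \<in> {0..1}" "s1 + s2 < m"
  then have "((\<lambda>t. mixed_partial s1 s2 f t y) has_vector_derivative D (Suc s1) s2 x y) (at x within {0..1})"
    by (intro vector_derivative_unit_cong(1)[OF deriv_familyD(3)[OF D]])
      (auto simp: mixed_partial_eq_family[OF D])
  then show "(\<lambda>t. mixed_partial s1 s2 f t y) differentiable (at x within {0..1})"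
    by (rule differentiableI_vector)
qed

lemma family_partials_exist:
  assumes "partials_exist m f"
  shows "deriv_family m f (\<lambda>s1 s2. mixed_partial s1 s2 f)"
proof -
  have a: "((\<lambda>t. mixed_partial 0 s2 f x t) has_vector_derivative mixed_partial 0 (Suc s2) f x y)
      (at y within {0..1})" if "s2 < m" "x \<in> {0..1}" "y \<in> {0..1}" for s2 x y
  proof -
    have "(\<lambda>t. mixed_partial 0 s2 f x t) differentiable (at y within {0..1})"
      using that assms by (auto simp: partials_exist_def)
    then show ?thesis
      by (subst (asm) vector_derivative_works) (simp add: mixed_partial_def partial2_def)
  qed
  have b: "((\<lambda>t. mixed_partial s1 s2 f t y) has_vector_derivative mixed_partial (Suc s1) s2 f x y)
      (at x within {0..1})" if "s1 + s2 < m" "x \<in> {0..1}" "y \<in> {0..1}" for s1 s2 x y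
  proof -
    have "(\<lambda>t. mixed_partial s1 s2 f t y) differentiable (at x within {0..1})"
      using that assms by (auto simp: partials_exist_def)
    then show ?thesis
      by (subst (asm) vector_derivative_works) (simp add: mixed_partial_def partial1_def)
  qed
  show ?thesis
    using a b by (auto simp: deriv_family_def mixed_partial_def)
qed

text \<open>The bounds are the two suprema of the norm themselves: their sum is at most
  \<open>L\<close>, so they are finite and come from reals.\<close>

lemma holder_class_bounds:
  assumes "\<gamma> > 0" "f \<in> holder_class \<gamma> L" "L \<ge> 0"
  obtains A B where "A \<ge> 0" "B \<ge> 0" "A + B \<le> L"
    "holder_bounds (holder_order \<gamma>) (\<gamma> - real (holder_order \<gamma>)) A B f"
proof -
  define m \<alpha> where "m = holder_order \<gamma>" and "\<alpha> = \<gamma> - real m"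
  define S1 where "S1 = (SUP (s1, s2)\<in>{(s1, s2). s1 + s2 \<le> m}.
        SUP (x, y)\<in>{0..1} \<times> {0..1}. ennreal \<bar>mixed_partial s1 s2 f x y\<bar>)"
  define S2 where "S2 = (SUP (s1, s2)\<in>{(s1, s2). s1 + s2 = m}.
        SUP ((x, y), (x', y'))\<in>{(v, u). v \<in> {0..1} \<times> {0..1} \<and> u \<in> {0..1} \<times> {0..1} \<and> v \<noteq> u}.
          ennreal (\<bar>mixed_partial s1 s2 f x y - mixed_partial s1 s2 f x' y'\<bar>
            / max \<bar>x - x'\<bar> \<bar>y - y'\<bar> powr \<alpha>))"
  have le: "S1 + S2 \<le> ennreal L" and pe: "partials_exist m f"
    using assms by (auto simp: holder_class_def holder_norm_def S1_def S2_def m_def \<alpha>_def)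
  have f1: "S1 < \<top>" and f2: "S2 < \<top>"
    using le by (metis add.commute ennreal_less_top order_le_less_trans add_increasing order_refl zero_le)+
  obtain A where A: "S1 = ennreal A" "A \<ge> 0" using f1 by (cases S1) auto
  obtain B where B: "S2 = ennreal B" "B \<ge> 0" using f2 by (cases S2) auto
  have "ennreal (A + B) \<le> ennreal L" using le A B by simp
  then have AB: "A + B \<le> L" using assms A B by (simp add: ennreal_le_iff del: ennreal_plus)
  have bdA: "\<bar>mixed_partial s1 s2 f x y\<bar> \<le> A"
    if "s1 + s2 \<le> m" "x \<in> {0..1}" "y \<in> {0..1}" for s1 s2 x y
  proof -
    have "ennreal \<bar>mixed_partial s1 s2 f x y\<bar> \<le> S1"
      unfolding S1_def
      by (rule SUP_upper2[of "(s1,s2)"], use that in simp, simp)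
         (rule SUP_upper2[of "(x,y)"], use that in auto)
    then show ?thesis using A by (simp add: ennreal_le_iff)
  qed
  have bdB: "\<bar>mixed_partial s1 s2 f x y - mixed_partial s1 s2 f x' y'\<bar> \<le> B * max \<bar>x - x'\<bar> \<bar>y - y'\<bar> powr \<alpha>"
    if "s1 + s2 = m" "x \<in> {0..1}" "y \<in> {0..1}" "x' \<in> {0..1}" "y' \<in> {0..1}" for s1 s2 x y x' y'
  proof (cases "(x,y) = (x',y')")
    case True then show ?thesis by simp
  next
    case False
    have "ennreal (\<bar>mixed_partial s1 s2 f x y - mixed_partial s1 s2 f x' y'\<bar>
            / max \<bar>x - x'\<bar> \<bar>y - y'\<bar> powr \<alpha>) \<le> S2"
      unfolding S2_def
      by (rule SUP_upper2[of "(s1,s2)"], use that in simp, simp only: prod.case)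
         (rule SUP_upper2[of "((x,y),(x',y'))"], use that False in auto)
    then have "\<bar>mixed_partial s1 s2 f x y - mixed_partial s1 s2 f x' y'\<bar>
            / max \<bar>x - x'\<bar> \<bar>y - y'\<bar> powr \<alpha> \<le> B"
      using B by (simp add: ennreal_le_iff)
    moreover have "max \<bar>x - x'\<bar> \<bar>y - y'\<bar> powr \<alpha> > 0"
      using False by (auto simp: max_def)
    ultimately show ?thesis by (simp add: divide_le_eq)
  qed
  have "holder_bounds m \<alpha> A B f"
    using family_partials_exist[OF pe] bdA bdB by (rule holder_boundsI)
  then show ?thesis using that A B AB by (auto simp: m_def \<alpha>_def)
qed

lemma holder_bounds_class:
  assumes f: "holder_bounds (holder_order \<gamma>) (\<gamma> - real (holder_order \<gamma>)) A B f"
    and AB: "A \<ge> 0" "B \<ge> 0" "A + B \<le> L"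
  shows "f \<in> holder_class \<gamma> L"
proof -
  define m \<alpha> where "m = holder_order \<gamma>" and "\<alpha> = \<gamma> - real m"
  obtain D where D: "deriv_family m f D"
    and dA: "\<And>s1 s2 x y. s1 + s2 \<le> m \<Longrightarrow> x \<in> {0..1} \<Longrightarrow> y \<in> {0..1} \<Longrightarrow> \<bar>D s1 s2 x y\<bar> \<le> A"
    and dB: "\<And>s1 s2 x y x' y'. s1 + s2 = m \<Longrightarrow> x \<in> {0..1} \<Longrightarrow> y \<in> {0..1} \<Longrightarrow> x' \<in> {0..1} \<Longrightarrow> y' \<in> {0..1}
       \<Longrightarrow> \<bar>D s1 s2 x y - D s1 s2 x' y'\<bar> \<le> B * max \<bar>x - x'\<bar> \<bar>y - y'\<bar> powr \<alpha>"
    using f unfolding m_def[symmetric] \<alpha>_def[symmetric] by (rule holder_boundsE) metis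
  have "holder_norm \<gamma> f \<le> ennreal A + ennreal B"
    unfolding holder_norm_def m_def[symmetric] \<alpha>_def[symmetric]
  proof (rule add_mono)
    show "(SUP (s1, s2)\<in>{(s1, s2). s1 + s2 \<le> m}.
        SUP (x, y)\<in>{0..1} \<times> {0..1}. ennreal \<bar>mixed_partial s1 s2 f x y\<bar>) \<le> ennreal A"
      by (auto intro!: SUP_least ennreal_leI dA simp: mixed_partial_eq_family[OF D])
    show "(SUP (s1, s2)\<in>{(s1, s2). s1 + s2 = m}.
        SUP ((x, y), (x', y'))\<in>{(v, u). v \<in> {0..1} \<times> {0..1} \<and> u \<in> {0..1} \<times> {0..1} \<and> v \<noteq> u}.
          ennreal (\<bar>mixed_partial s1 s2 f x y - mixed_partial s1 s2 f x' y'\<bar>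
            / max \<bar>x - x'\<bar> \<bar>y - y'\<bar> powr \<alpha>)) \<le> ennreal B"
    proof -
      have *: "\<bar>mixed_partial s1 s2 f x y - mixed_partial s1 s2 f x' y'\<bar>
            / max \<bar>x - x'\<bar> \<bar>y - y'\<bar> powr \<alpha> \<le> B"
        if h: "s1 + s2 = m" "x \<in> {0..1}" "y \<in> {0..1}" "x' \<in> {0..1}" "y' \<in> {0..1}"
          and ne: "(x, y) \<noteq> (x', y')" for s1 s2 x y x' y'
      proof -
        have "\<bar>mixed_partial s1 s2 f x y - mixed_partial s1 s2 f x' y'\<bar> \<le> B * max \<bar>x - x'\<bar> \<bar>y - y'\<bar> powr \<alpha>"
          using h dB[of s1 s2 x y x' y'] by (simp add: mixed_partial_eq_family[OF D])
        moreover have "max \<bar>x - x'\<bar> \<bar>y - y'\<bar> powr \<alpha> > 0"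
          using ne by (auto simp: max_def)
        ultimately show ?thesis by (simp add: divide_le_eq)
      qed
      show ?thesis
      proof (rule SUP_least, goal_cases)
        case (1 s)
        show ?case
          unfolding split_beta
        proof (rule SUP_least, goal_cases)
          case (1 v)
          with \<open>s \<in> _\<close> show ?case
            by (intro ennreal_leI *) (auto simp: prod_eq_iff mem_Times_iff)
        qed
      qed
    qed
  qed
  also have "\<dots> \<le> ennreal L" using AB by (simp add: ennreal_plus[symmetric] ennreal_leI del: ennreal_plus)
  finally show ?thesis
    using partials_exist_family[OF D] by (simp add: holder_class_def m_def)
qed

lemma holder_bounds_cong:
  assumes "\<And>x y. x \<in> {0..1} \<Longrightarrow> y \<in> {0..1} \<Longrightarrow> f x y = g x y"
    "holder_bounds m \<alpha> A B f"
  shows "holder_bounds m \<alpha> A B g"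
proof -
  have "deriv_family m f = deriv_family m g"
    using assms(1) by (auto simp: deriv_family_def fun_eq_iff)
  then show ?thesis using assms(2) by (simp add: holder_bounds_def)
qed

lemma holder_bounds_add:
  assumes "holder_bounds m \<alpha> A B f" "holder_bounds m \<alpha> A' B' g"
  shows "holder_bounds m \<alpha> (A + A') (B + B') (\<lambda>x y. f x y + g x y)"
proof -
  obtain D where D: "deriv_family m f D"
    "\<And>s1 s2 x y. s1 + s2 \<le> m \<Longrightarrow> x \<in> {0..1} \<Longrightarrow> y \<in> {0..1} \<Longrightarrow> \<bar>D s1 s2 x y\<bar> \<le> A"
    "\<And>s1 s2 x y x' y'. s1 + s2 = m \<Longrightarrow> x \<in> {0..1} \<Longrightarrow> y \<in> {0..1} \<Longrightarrow> x' \<in> {0..1} \<Longrightarrow> y' \<in> {0..1}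
       \<Longrightarrow> \<bar>D s1 s2 x y - D s1 s2 x' y'\<bar> \<le> B * max \<bar>x - x'\<bar> \<bar>y - y'\<bar> powr \<alpha>"
    using assms(1) by (rule holder_boundsE) metis
  obtain E where E: "deriv_family m g E"
    "\<And>s1 s2 x y. s1 + s2 \<le> m \<Longrightarrow> x \<in> {0..1} \<Longrightarrow> y \<in> {0..1} \<Longrightarrow> \<bar>E s1 s2 x y\<bar> \<le> A'"
    "\<And>s1 s2 x y x' y'. s1 + s2 = m \<Longrightarrow> x \<in> {0..1} \<Longrightarrow> y \<in> {0..1} \<Longrightarrow> x' \<in> {0..1} \<Longrightarrow> y' \<in> {0..1}
       \<Longrightarrow> \<bar>E s1 s2 x y - E s1 s2 x' y'\<bar> \<le> B' * max \<bar>x - x'\<bar> \<bar>y - y'\<bar> powr \<alpha>"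
    using assms(2) by (rule holder_boundsE) metis
  define F where "F = (\<lambda>s1 s2 x y. D s1 s2 x y + E s1 s2 x y)"
  show ?thesis
  proof (rule holder_boundsI[where D=F])
    show "deriv_family m (\<lambda>x y. f x y + g x y) F"
      using D(1) E(1) unfolding deriv_family_def F_def by (auto intro!: has_vector_derivative_add)
  next
    fix s1 s2 :: nat and x y :: real
    assume "s1 + s2 \<le> m" "x \<in> {0..1}" "y \<in> {0..1}"
    then show "\<bar>F s1 s2 x y\<bar> \<le> A + A'"
      using D(2)[of s1 s2 x y] E(2)[of s1 s2 x y] unfolding F_def by linarith
  next
    fix s1 s2 :: nat and x y x' y' :: real
    assume "s1 + s2 = m" "x\<in>{0..1}" "y\<in>{0..1}" "x'\<in>{0..1}" "y'\<in>{0..1}"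
    then show "\<bar>F s1 s2 x y - F s1 s2 x' y'\<bar> \<le> (B + B') * max \<bar>x - x'\<bar> \<bar>y - y'\<bar> powr \<alpha>"
      using D(3)[of s1 s2 x y x' y'] E(3)[of s1 s2 x y x' y'] unfolding F_def distrib_right by linarith
  qed
qed

lemma holder_bounds_scale:
  assumes "holder_bounds m \<alpha> A B f"
  shows "holder_bounds m \<alpha> (\<bar>c\<bar> * A) (\<bar>c\<bar> * B) (\<lambda>x y. c * f x y)"
proof -
  obtain D where D: "deriv_family m f D"
    "\<And>s1 s2 x y. s1 + s2 \<le> m \<Longrightarrow> x \<in> {0..1} \<Longrightarrow> y \<in> {0..1} \<Longrightarrow> \<bar>D s1 s2 x y\<bar> \<le> A"
    "\<And>s1 s2 x y x' y'. s1 + s2 = m \<Longrightarrow> x \<in> {0..1} \<Longrightarrow> y \<in> {0..1} \<Longrightarrow> x' \<in> {0..1} \<Longrightarrow> y' \<in> {0..1}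
       \<Longrightarrow> \<bar>D s1 s2 x y - D s1 s2 x' y'\<bar> \<le> B * max \<bar>x - x'\<bar> \<bar>y - y'\<bar> powr \<alpha>"
    using assms by (rule holder_boundsE) metis
  define F where "F = (\<lambda>s1 s2 x y. c * D s1 s2 x y)"
  show ?thesis
  proof (rule holder_boundsI[where D=F])
    show "deriv_family m (\<lambda>x y. c * f x y) F"
      using D(1) unfolding deriv_family_def F_def by (auto intro!: has_vector_derivative_mult_right)
  next
    fix s1 s2 :: nat and x y :: real
    assume "s1 + s2 \<le> m" "x \<in> {0..1}" "y \<in> {0..1}"
    then show "\<bar>F s1 s2 x y\<bar> \<le> \<bar>c\<bar> * A"
      using D(2)[of s1 s2 x y] unfolding F_def abs_mult by (intro mult_left_mono) auto
  next
    fix s1 s2 :: nat and x y x' y' :: real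
    assume h: "s1 + s2 = m" "x\<in>{0..1}" "y\<in>{0..1}" "x'\<in>{0..1}" "y'\<in>{0..1}"
    have "\<bar>F s1 s2 x y - F s1 s2 x' y'\<bar> = \<bar>c\<bar> * \<bar>D s1 s2 x y - D s1 s2 x' y'\<bar>"
      by (simp add: F_def abs_mult right_diff_distrib[symmetric])
    also have "\<dots> \<le> \<bar>c\<bar> * (B * max \<bar>x - x'\<bar> \<bar>y - y'\<bar> powr \<alpha>)"
      using D(3) h by (intro mult_left_mono) auto
    finally show "\<bar>F s1 s2 x y - F s1 s2 x' y'\<bar> \<le> (\<bar>c\<bar> * B) * max \<bar>x - x'\<bar> \<bar>y - y'\<bar> powr \<alpha>"
      by (simp add: mult.assoc)
  qed
qed

lemma holder_bound1E:
  assumes "holder_bound1 m \<alpha> K f"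
  obtains d where "\<And>x. x \<in> {0..1} \<Longrightarrow> d 0 x = f x"
    "\<And>i x. i < m \<Longrightarrow> x \<in> {0..1} \<Longrightarrow> (d i has_vector_derivative d (Suc i) x) (at x within {0..1})"
    "\<And>i x. i \<le> m \<Longrightarrow> x \<in> {0..1} \<Longrightarrow> \<bar>d i x\<bar> \<le> K"
    "\<And>x y. x \<in> {0..1} \<Longrightarrow> y \<in> {0..1} \<Longrightarrow> \<bar>d m x - d m y\<bar> \<le> K * \<bar>x - y\<bar> powr \<alpha>"
proof -
  from assms obtain d where d: "(\<forall>x\<in>{0..1}. d 0 x = f x) \<and>
     (\<forall>i<m. \<forall>x\<in>{0..1}. (d i has_vector_derivative d (Suc i) x) (at x within {0..1})) \<and>
     (\<forall>i\<le>m. \<forall>x\<in>{0..1}. \<bar>d i x\<bar> \<le> K) \<and>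
     (\<forall>x\<in>{0..1}. \<forall>y\<in>{0..1}. \<bar>d m x - d m y\<bar> \<le> K * \<bar>x - y\<bar> powr \<alpha>)"
    unfolding holder_bound1_def by (rule exE)
  show ?thesis by (rule that[of d]) (use d in simp_all)
qed

lemma holder_bound1_nonneg:
  assumes "holder_bound1 m \<alpha> K f"
  shows "K \<ge> 0"
proof -
  obtain d :: "nat \<Rightarrow> real \<Rightarrow> real" where "\<And>i x. i \<le> m \<Longrightarrow> x \<in> {0..1} \<Longrightarrow> \<bar>d i x\<bar> \<le> K"
    using assms by (rule holder_bound1E) metis
  from this[of 0 0] show ?thesis by simp
qed

lemma holder_bound1_mono:
  assumes "holder_bound1 m \<alpha> K f" "K \<le> K'"
  shows "holder_bound1 m \<alpha> K' f"
proof -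
  obtain d where d: "\<And>x. x \<in> {0..1} \<Longrightarrow> d 0 x = f x"
    "\<And>i x. i < m \<Longrightarrow> x \<in> {0..1} \<Longrightarrow> (d i has_vector_derivative d (Suc i) x) (at x within {0..1})"
    "\<And>i x. i \<le> m \<Longrightarrow> x \<in> {0..1} \<Longrightarrow> \<bar>d i x\<bar> \<le> K"
    "\<And>x y. x \<in> {0..1} \<Longrightarrow> y \<in> {0..1} \<Longrightarrow> \<bar>d m x - d m y\<bar> \<le> K * \<bar>x - y\<bar> powr \<alpha>"
    using assms(1) by (rule holder_bound1E) metis
  have "K * \<bar>x - y\<bar> powr \<alpha> \<le> K' * \<bar>x - y\<bar> powr \<alpha>" for x y
    using assms(2) by (intro mult_right_mono) auto
  then have "\<bar>d m x - d m y\<bar> \<le> K' * \<bar>x - y\<bar> powr \<alpha>" if "x \<in> {0..1}" "y \<in> {0..1}" for x y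
    using d(4) that by (meson order_trans)
  moreover have "\<bar>d i x\<bar> \<le> K'" if "i \<le> m" "x \<in> {0..1}" for i x
    using d(3)[OF that] assms(2) by simp
  ultimately show ?thesis unfolding holder_bound1_def
    using d(1,2) by (intro exI[of _ d] conjI ballI allI impI) simp_all
qed

lemma lipschitz_on_unit:
  fixes d d' :: "real \<Rightarrow> real"
  assumes "\<And>x. x \<in> {0..1} \<Longrightarrow> (d has_vector_derivative d' x) (at x within {0..1})"
    "\<And>x. x \<in> {0..1} \<Longrightarrow> \<bar>d' x\<bar> \<le> K" "x \<in> {0..1}" "y \<in> {0..1}"
  shows "\<bar>d x - d y\<bar> \<le> K * \<bar>x - y\<bar>"
proof -
  have "norm (d x - d y) \<le> K * norm (x - y)"
    by (rule field_differentiable_bound[where S="{0..1}" and f'=d'])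
       (use assms in \<open>auto simp: has_real_derivative_iff_has_vector_derivative\<close>)
  then show ?thesis by simp
qed

text \<open>Derivatives of order below m are Lipschitz by the mean value theorem, hence Hoelder with
  exponent \<alpha> on the unit interval, where r \<le> r powr \<alpha>. This controls the
  increments of all mixed derivatives of total order m; the factor 2 comes from splitting the
  increment of a product.\<close>

lemma holder_bounds_tensor:
  assumes a: "holder_bound1 m \<alpha> K f" and b: "holder_bound1 m \<alpha> K' g" and \<alpha>: "0 < \<alpha>" "\<alpha> \<le> 1"
  shows "holder_bounds m \<alpha> (K * K') (2 * (K * K')) (\<lambda>x y. f x * g y)"
proof -
  have K: "K \<ge> 0" "K' \<ge> 0" using a b holder_bound1_nonneg by auto
  obtain d where d: "\<And>x. x \<in> {0..1} \<Longrightarrow> d 0 x = f x"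
    "\<And>i x. i < m \<Longrightarrow> x \<in> {0..1} \<Longrightarrow> (d i has_vector_derivative d (Suc i) x) (at x within {0..1})"
    "\<And>i x. i \<le> m \<Longrightarrow> x \<in> {0..1} \<Longrightarrow> \<bar>d i x\<bar> \<le> K"
    "\<And>x y. x \<in> {0..1} \<Longrightarrow> y \<in> {0..1} \<Longrightarrow> \<bar>d m x - d m y\<bar> \<le> K * \<bar>x - y\<bar> powr \<alpha>"
    using a by (rule holder_bound1E) metis
  obtain e where e: "\<And>x. x \<in> {0..1} \<Longrightarrow> e 0 x = g x"
    "\<And>i x. i < m \<Longrightarrow> x \<in> {0..1} \<Longrightarrow> (e i has_vector_derivative e (Suc i) x) (at x within {0..1})"
    "\<And>i x. i \<le> m \<Longrightarrow> x \<in> {0..1} \<Longrightarrow> \<bar>e i x\<bar> \<le> K'"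
    "\<And>x y. x \<in> {0..1} \<Longrightarrow> y \<in> {0..1} \<Longrightarrow> \<bar>e m x - e m y\<bar> \<le> K' * \<bar>x - y\<bar> powr \<alpha>"
    using b by (rule holder_bound1E) metis
  have pw: "r \<le> r powr \<alpha>" if "0 \<le> r" "r \<le> 1" for r :: real
    using powr_mono'[of \<alpha> 1 r] that \<alpha> by (cases "r = 0") auto
  have hd: "\<bar>d i x - d i y\<bar> \<le> K * \<bar>x - y\<bar> powr \<alpha>" if "i \<le> m" "x \<in> {0..1}" "y \<in> {0..1}" for i x y
  proof (cases "i = m")
    case True then show ?thesis using d that by auto
  next
    case False
    then have "\<bar>d i x - d i y\<bar> \<le> K * \<bar>x - y\<bar>"
      using that d by (intro lipschitz_on_unit[where d'="d (Suc i)"]) auto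
    also have "\<dots> \<le> K * \<bar>x - y\<bar> powr \<alpha>" using that K by (intro mult_left_mono pw) auto
    finally show ?thesis .
  qed
  have he: "\<bar>e i x - e i y\<bar> \<le> K' * \<bar>x - y\<bar> powr \<alpha>" if "i \<le> m" "x \<in> {0..1}" "y \<in> {0..1}" for i x y
  proof (cases "i = m")
    case True then show ?thesis using e that by auto
  next
    case False
    then have "\<bar>e i x - e i y\<bar> \<le> K' * \<bar>x - y\<bar>"
      using that e by (intro lipschitz_on_unit[where d'="e (Suc i)"]) auto
    also have "\<dots> \<le> K' * \<bar>x - y\<bar> powr \<alpha>" using that K by (intro mult_left_mono pw) auto
    finally show ?thesis .
  qed
  define F where "F = (\<lambda>s1 s2 x y. d s1 x * e s2 y)"
  show ?thesis
  proof (rule holder_boundsI[where D=F])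
    show "deriv_family m (\<lambda>x y. f x * g y) F"
      unfolding deriv_family_def F_def using d(1,2) e(1,2)
      by (auto intro!: has_vector_derivative_mult_right has_vector_derivative_mult_left)
  next
    fix s1 s2 :: nat and x y :: real
    assume "s1 + s2 \<le> m" "x \<in> {0..1}" "y \<in> {0..1}"
    then show "\<bar>F s1 s2 x y\<bar> \<le> K * K'"
      using d(3) e(3) K unfolding F_def by (auto simp: abs_mult intro!: mult_mono)
  next
    fix s1 s2 :: nat and x y x' y' :: real
    assume that: "s1 + s2 = m" "x\<in>{0..1}" "y\<in>{0..1}" "x'\<in>{0..1}" "y'\<in>{0..1}"
    let ?r = "max \<bar>x - x'\<bar> \<bar>y - y'\<bar> powr \<alpha>"
    have "\<bar>d s1 x - d s1 x'\<bar> \<le> K * \<bar>x - x'\<bar> powr \<alpha>" using hd that by auto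
    also have "\<dots> \<le> K * ?r" using K \<alpha> by (intro mult_left_mono powr_mono2) auto
    finally have 1: "\<bar>d s1 x - d s1 x'\<bar> \<le> K * ?r" .
    have "\<bar>e s2 y - e s2 y'\<bar> \<le> K' * \<bar>y - y'\<bar> powr \<alpha>" using he that by auto
    also have "\<dots> \<le> K' * ?r" using K \<alpha> by (intro mult_left_mono powr_mono2) auto
    finally have 2: "\<bar>e s2 y - e s2 y'\<bar> \<le> K' * ?r" .
    have "F s1 s2 x y - F s1 s2 x' y' = (d s1 x - d s1 x') * e s2 y + d s1 x' * (e s2 y - e s2 y')"
      by (simp add: F_def algebra_simps)
    then have "\<bar>F s1 s2 x y - F s1 s2 x' y'\<bar> \<le> \<bar>d s1 x - d s1 x'\<bar> * \<bar>e s2 y\<bar> + \<bar>d s1 x'\<bar> * \<bar>e s2 y - e s2 y'\<bar>"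
      by (metis abs_mult abs_triangle_ineq)
    also have "\<dots> \<le> (K * ?r) * K' + K * (K' * ?r)"
      using 1 2 d(3) e(3) that K by (intro add_mono mult_mono) auto
    finally show "\<bar>F s1 s2 x y - F s1 s2 x' y'\<bar> \<le> (2 * (K * K')) * max \<bar>x - x'\<bar> \<bar>y - y'\<bar> powr \<alpha>" by (simp add: algebra_simps)
  qed
qed

lemma holder_bounds_nonneg:
  assumes "holder_bounds m \<alpha> A B f"
  shows "A \<ge> 0" "B \<ge> 0"
proof -
  obtain D where D: "deriv_family m f D"
    "\<And>s1 s2 x y. s1 + s2 \<le> m \<Longrightarrow> x \<in> {0..1} \<Longrightarrow> y \<in> {0..1} \<Longrightarrow> \<bar>D s1 s2 x y\<bar> \<le> A"
    "\<And>s1 s2 x y x' y'. s1 + s2 = m \<Longrightarrow> x \<in> {0..1} \<Longrightarrow> y \<in> {0..1} \<Longrightarrow> x' \<in> {0..1} \<Longrightarrow> y' \<in> {0..1}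
       \<Longrightarrow> \<bar>D s1 s2 x y - D s1 s2 x' y'\<bar> \<le> B * max \<bar>x - x'\<bar> \<bar>y - y'\<bar> powr \<alpha>"
    using assms by (rule holder_boundsE) metis
  have "\<bar>D 0 0 (0::real) (0::real)\<bar> \<le> A" using D(2) by simp
  then show "A \<ge> 0" by linarith
  have "\<bar>D m 0 (0::real) (0::real) - D m 0 1 1\<bar> \<le> B * max \<bar>0 - 1\<bar> \<bar>0 - 1\<bar> powr \<alpha>" using D(3)[of m 0 0 0 1 1] by simp
  then have "\<bar>D m 0 (0::real) (0::real) - D m 0 1 1\<bar> \<le> B" by simp
  then show "B \<ge> 0" by linarith
qed

lemma holder_bounds_abs_le:
  assumes "holder_bounds m \<alpha> A B f" "x \<in> {0..1}" "y \<in> {0..1}"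
  shows "\<bar>f x y\<bar> \<le> A"
proof -
  obtain D where D: "deriv_family m f D"
    "\<And>s1 s2 x y. s1 + s2 \<le> m \<Longrightarrow> x \<in> {0..1} \<Longrightarrow> y \<in> {0..1} \<Longrightarrow> \<bar>D s1 s2 x y\<bar> \<le> A"
    "\<And>s1 s2 x y x' y'. s1 + s2 = m \<Longrightarrow> x \<in> {0..1} \<Longrightarrow> y \<in> {0..1} \<Longrightarrow> x' \<in> {0..1} \<Longrightarrow> y' \<in> {0..1}
       \<Longrightarrow> \<bar>D s1 s2 x y - D s1 s2 x' y'\<bar> \<le> B * max \<bar>x - x'\<bar> \<bar>y - y'\<bar> powr \<alpha>"
    using assms(1) by (rule holder_boundsE) metis
  show ?thesis using D(1) D(2)[of 0 0 x y] assms(2,3) by (simp add: deriv_family_def)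
qed

text \<open>For m = 0 the Hoelder condition is itself a modulus of continuity; for m > 0 the bounded
  first derivatives give a Lipschitz one. The case distinction produces a common modulus
  \<open>g\<close>.\<close>

lemma holder_bounds_continuous:
  assumes f: "holder_bounds m \<alpha> A B f" and \<alpha>: "0 < \<alpha>"
  shows "continuous_on ({0..1} \<times> {0..1}) (\<lambda>(x, y). f x y)"
proof -
  obtain D where *: "deriv_family m f D"
    "\<And>s1 s2 x y. s1 + s2 \<le> m \<Longrightarrow> x \<in> {0..1} \<Longrightarrow> y \<in> {0..1} \<Longrightarrow> \<bar>D s1 s2 x y\<bar> \<le> A"
    "\<And>s1 s2 x y x' y'. s1 + s2 = m \<Longrightarrow> x \<in> {0..1} \<Longrightarrow> y \<in> {0..1} \<Longrightarrow> x' \<in> {0..1} \<Longrightarrow> y' \<in> {0..1}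
       \<Longrightarrow> \<bar>D s1 s2 x y - D s1 s2 x' y'\<bar> \<le> B * max \<bar>x - x'\<bar> \<bar>y - y'\<bar> powr \<alpha>"
    using f by (rule holder_boundsE) metis
  have A: "A \<ge> 0" and B: "B \<ge> 0" using holder_bounds_nonneg[OF f] .
  have D0: "f x y = D 0 0 x y" if "x \<in> {0..1}" "y \<in> {0..1}" for x y
    using *(1) that by (auto simp: deriv_family_def)
  have "\<exists>g. (g \<longlongrightarrow> 0) (at 0 within {0..}) \<and> g 0 = (0::real) \<and> (\<forall>x\<in>{0..1}. \<forall>y\<in>{0..1}. \<forall>x'\<in>{0..1}. \<forall>y'\<in>{0..1}.
     \<bar>f x y - f x' y'\<bar> \<le> g (max \<bar>x - x'\<bar> \<bar>y - y'\<bar>))"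
  proof (cases "m = 0")
    case True
    have "((\<lambda>r. B * r powr \<alpha>) \<longlongrightarrow> B * 0 powr \<alpha>) (at 0 within {0..})"
      using \<alpha> by (intro tendsto_intros) (auto simp: eventually_at_filter)
    then show ?thesis using True *(3) \<alpha>
      by (intro exI[of _ "\<lambda>r. B * r powr \<alpha>"]) (auto simp: D0)
  next
    case False
    have "\<bar>f x y - f x' y'\<bar> \<le> 2 * A * max \<bar>x - x'\<bar> \<bar>y - y'\<bar>"
      if "x\<in>{0..1}" "y\<in>{0..1}" "x'\<in>{0..1}" "y'\<in>{0..1}" for x y x' y'
    proof -
      have "\<bar>D 0 0 x y - D 0 0 x' y\<bar> \<le> A * \<bar>x - x'\<bar>"
        using that False by (intro lipschitz_on_unit[OF deriv_familyD(3)[OF *(1)]] *(2)) auto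
      moreover have "\<bar>D 0 0 x' y - D 0 0 x' y'\<bar> \<le> A * \<bar>y - y'\<bar>"
        using that False by (intro lipschitz_on_unit[OF deriv_familyD(2)[OF *(1)]] *(2)) auto
      moreover have "A * \<bar>x - x'\<bar> \<le> A * max \<bar>x - x'\<bar> \<bar>y - y'\<bar>" "A * \<bar>y - y'\<bar> \<le> A * max \<bar>x - x'\<bar> \<bar>y - y'\<bar>"
        using A by (auto intro!: mult_left_mono)
      moreover have "f x y = D 0 0 x y" "f x' y' = D 0 0 x' y'" using that by (simp_all add: D0)
      ultimately show ?thesis by linarith
    qed
    moreover have "((\<lambda>r. 2 * A * r) \<longlongrightarrow> 2 * A * 0) (at 0 within {0..})"
      by (intro tendsto_intros)
    ultimately show ?thesis by (intro exI[of _ "\<lambda>r. 2 * A * r"]) auto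
  qed
  then obtain g where g: "(g \<longlongrightarrow> 0) (at 0 within {0..})" "g 0 = (0::real)"
    "\<And>x y x' y'. x\<in>{0..1} \<Longrightarrow> y\<in>{0..1} \<Longrightarrow> x'\<in>{0..1} \<Longrightarrow> y'\<in>{0..1} \<Longrightarrow>
     \<bar>f x y - f x' y'\<bar> \<le> g (max \<bar>x - x'\<bar> \<bar>y - y'\<bar>)" by metis
  show ?thesis
    unfolding continuous_on_iff
  proof (intro ballI allI impI)
    fix v :: "real \<times> real" and e :: real assume v: "v \<in> {0..1} \<times> {0..1}" and e: "e > 0"
    from g(1) e obtain d where d: "d > 0" "\<And>r. 0 \<le> r \<Longrightarrow> r \<noteq> 0 \<Longrightarrow> r < d \<Longrightarrow> \<bar>g r\<bar> < e"
      unfolding tendsto_iff eventually_at by (auto simp: dist_real_def)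
    then have d': "g r < e" if "0 \<le> r" "r < d" for r
      using that g(2) e by (cases "r = 0") (auto simp: abs_less_iff)
    show "\<exists>d>0. \<forall>x'\<in>{0..1} \<times> {0..1}. dist x' v < d \<longrightarrow>
       dist (case x' of (x, y) \<Rightarrow> f x y) (case v of (x, y) \<Rightarrow> f x y) < e"
    proof (intro exI[of _ d] conjI ballI impI)
      fix u :: "real \<times> real" assume u: "u \<in> {0..1} \<times> {0..1}" "dist u v < d"
      have "\<bar>fst u - fst v\<bar> < d" "\<bar>snd u - snd v\<bar> < d"
        using u(2) dist_fst_le[of u v] dist_snd_le[of u v] by (auto simp: dist_real_def)
      then have "g (max \<bar>fst u - fst v\<bar> \<bar>snd u - snd v\<bar>) < e" by (intro d') auto
      moreover have "\<bar>f (fst u) (snd u) - f (fst v) (snd v)\<bar> \<le> g (max \<bar>fst u - fst v\<bar> \<bar>snd u - snd v\<bar>)"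
        using u v by (intro g(3)) (auto simp: mem_Times_iff)
      ultimately show "dist (case u of (x, y) \<Rightarrow> f x y) (case v of (x, y) \<Rightarrow> f x y) < e"
        by (simp add: dist_real_def split_beta)
    qed (rule d)
  qed
qed

text \<open>Differentiation passes under the integral and falls on the kernel alone, so the image of
  \<open>g\<close> is as smooth as the kernel, with constants that see \<open>g\<close> only through
  its L1 norm. For a narrow normalised bump this norm is small although its own Hoelder norm is
  large.\<close>

lemma holder_bound1_kernel:
  fixes g :: "real \<Rightarrow> real"
  assumes f: "holder_bounds m \<alpha> A B f" and \<alpha>: "0 < \<alpha>"
    and g: "integrable (lebesgue_on {0..1}) g"
  shows "holder_bound1 m \<alpha> ((A + B) * (\<integral>y. \<bar>g y\<bar> \<partial>lebesgue_on {0..1}))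
           (\<lambda>x. \<integral>y. f x y * g y \<partial>lebesgue_on {0..1})"
proof -
  let ?M = "lebesgue_on {0..1::real}"
  obtain D where D: "deriv_family m f D"
    "\<And>s1 s2 x y. s1 + s2 \<le> m \<Longrightarrow> x \<in> {0..1} \<Longrightarrow> y \<in> {0..1} \<Longrightarrow> \<bar>D s1 s2 x y\<bar> \<le> A"
    "\<And>s1 s2 x y x' y'. s1 + s2 = m \<Longrightarrow> x \<in> {0..1} \<Longrightarrow> y \<in> {0..1} \<Longrightarrow> x' \<in> {0..1} \<Longrightarrow> y' \<in> {0..1}
       \<Longrightarrow> \<bar>D s1 s2 x y - D s1 s2 x' y'\<bar> \<le> B * max \<bar>x - x'\<bar> \<bar>y - y'\<bar> powr \<alpha>"
    using f by (rule holder_boundsE) metis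
  have AB: "A \<ge> 0" "B \<ge> 0" using holder_bounds_nonneg[OF f] by auto
  have gm: "g \<in> borel_measurable ?M" using g by auto
  have gi: "integrable ?M (\<lambda>y. \<bar>g y\<bar>)" using g by auto
  \<comment> \<open>Between the extreme orders the assumptions contain no regularity in y, so
    measurability is proved by induction: each derivative is a pointwise limit of difference
    quotients of the previous one.\<close>
  have meas: "(\<lambda>y. D i 0 x y) \<in> borel_measurable ?M" if "i \<le> m" "x \<in> {0..1}" for i x
    using that
  proof (induction i arbitrary: x)
    case 0
    have "continuous_on {0..1} (\<lambda>y. f x y)"
    proof -
      have "continuous_on {0..1} (\<lambda>y. (x, y))" by (intro continuous_intros)
      moreover have "(\<lambda>y. (x, y)) ` {0..1} \<subseteq> {0..1} \<times> {0..1}" using 0 by auto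
      ultimately show ?thesis
        using continuous_on_compose2[OF holder_bounds_continuous[OF f \<alpha>], of "{0..1}" "\<lambda>y. (x, y)"] by simp
    qed
    then have "continuous_on {0..1} (\<lambda>y. D 0 0 x y)"
      using 0 by (subst continuous_on_cong[OF refl deriv_familyD(1)[OF D(1)]]) auto
    then show ?case by (intro continuous_imp_measurable_on_sets_lebesgue) auto
  next
    case (Suc i)
    \<comment> \<open>Increments point into the interval: to the right from its left half, to the
      left from its right half, and of size at most 1/2.\<close>
    define c :: "nat \<Rightarrow> real" where "c n = (if x \<le> 1/2 then 1 / (real n + 2) else - 1 / (real n + 2))" for n
    have c0: "c n \<noteq> 0" "x + c n \<in> {0..1}" for n
    proof -
      obtain q where "0 < q" "q \<le> 1/2" "c n = (if x \<le> 1/2 then q else - q)"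
        by (rule that[of "1 / (real n + 2)"]) (auto simp: field_simps c_def)
      then show "c n \<noteq> 0" "x + c n \<in> {0..1}" using Suc.prems by auto
    qed
    have "(\<lambda>n. 1 / (real n + 2)) \<longlonglongrightarrow> 0" by real_asymp
    then have cl: "(\<lambda>n. x + c n) \<longlonglongrightarrow> x"
      using tendsto_add[OF tendsto_const[of x], of "\<lambda>n. 1 / (real n + 2)" 0 sequentially]
         tendsto_diff[OF tendsto_const[of x], of "\<lambda>n. 1 / (real n + 2)" 0 sequentially]
      by (cases "x \<le> 1/2") (simp_all add: c_def)
    show ?case
    proof (rule borel_measurable_LIMSEQ_real)
      show "(\<lambda>n. (D i 0 (x + c n) y - D i 0 x y) / ((x + c n) - x)) \<longlonglongrightarrow> D (Suc i) 0 x y"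
        if "y \<in> space ?M" for y
      proof -
        have "((\<lambda>t. D i 0 t y) has_field_derivative D (Suc i) 0 x y) (at x within {0..1})"
          unfolding has_real_derivative_iff_has_vector_derivative
          using that Suc.prems by (intro deriv_familyD(3)[OF D(1)]) auto
        then have "((\<lambda>t. (D i 0 t y - D i 0 x y) / (t - x)) \<longlongrightarrow> D (Suc i) 0 x y) (at x within {0..1})"
          by (simp add: has_field_derivative_iff)
        then show ?thesis
          using cl c0 unfolding tendsto_at_iff_sequentially comp_def
          by (elim allE[of _ "\<lambda>n. x + c n"]) auto
      qed
      show "(\<lambda>y. (D i 0 (x + c n) y - D i 0 x y) / ((x + c n) - x)) \<in> borel_measurable ?M" for n
        using Suc c0 by (intro borel_measurable_divide borel_measurable_diff) auto
    qed
  qed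
  define d where "d i x = (\<integral>y. D i 0 x y * g y \<partial>?M)" for i x
  have int: "integrable ?M (\<lambda>y. D i 0 x y * g y)" if "i \<le> m" "x \<in> {0..1}" for i x
  proof (rule Bochner_Integration.integrable_bound)
    show "integrable ?M (\<lambda>y. A * \<bar>g y\<bar>)" using gi by simp
    show "(\<lambda>y. D i 0 x y * g y) \<in> borel_measurable ?M" using meas[OF that] gm by simp
    show "AE y in ?M. norm (D i 0 x y * g y) \<le> norm (A * \<bar>g y\<bar>)"
      using D(2) that AB by (intro AE_I2) (auto simp: abs_mult intro!: mult_right_mono)
  qed
  let ?G = "\<integral>y. \<bar>g y\<bar> \<partial>?M"
  have G0: "?G \<ge> 0" by simp
  have der: "(d i has_vector_derivative d (Suc i) x) (at x within {0..1})"
    if i: "i < m" and x: "x \<in> {0..1}" for i x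
    unfolding has_real_derivative_iff_has_vector_derivative[symmetric] has_field_derivative_iff
      tendsto_at_iff_sequentially comp_def
  proof (intro allI impI)
    fix X assume X: "\<forall>n. X n \<in> {0..1} - {x}" "X \<longlonglongrightarrow> x"
    have eq: "(d i (X n) - d i x) / (X n - x) = (\<integral>y. (D i 0 (X n) y - D i 0 x y) / (X n - x) * g y \<partial>?M)" for n
    proof -
      have "d i (X n) - d i x = (\<integral>y. D i 0 (X n) y * g y - D i 0 x y * g y \<partial>?M)"
        unfolding d_def using X(1) i x by (intro Bochner_Integration.integral_diff[symmetric] int) auto
      then show ?thesis
        by (simp add: integral_divide_zero[symmetric] left_diff_distrib diff_divide_distrib del: integral_divide_zero)
    qed
    have "(\<lambda>n. \<integral>y. (D i 0 (X n) y - D i 0 x y) / (X n - x) * g y \<partial>?M) \<longlonglongrightarrow> (\<integral>y. D (Suc i) 0 x y * g y \<partial>?M)"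
    proof (rule integral_dominated_convergence[where w="\<lambda>y. A * \<bar>g y\<bar>"])
      show "AE y in ?M. (\<lambda>n. (D i 0 (X n) y - D i 0 x y) / (X n - x) * g y) \<longlonglongrightarrow> D (Suc i) 0 x y * g y"
      proof (rule AE_I2)
        fix y assume y: "y \<in> space ?M"
        have "((\<lambda>t. D i 0 t y) has_field_derivative D (Suc i) 0 x y) (at x within {0..1})"
          unfolding has_real_derivative_iff_has_vector_derivative
          using y x i by (intro deriv_familyD(3)[OF D(1)]) auto
        then have "((\<lambda>t. (D i 0 t y - D i 0 x y) / (t - x)) \<longlongrightarrow> D (Suc i) 0 x y) (at x within {0..1})"
          by (simp add: has_field_derivative_iff)
        then have "(\<lambda>n. (D i 0 (X n) y - D i 0 x y) / (X n - x)) \<longlonglongrightarrow> D (Suc i) 0 x y"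
          unfolding tendsto_at_iff_sequentially comp_def using X by auto
        then show "(\<lambda>n. (D i 0 (X n) y - D i 0 x y) / (X n - x) * g y) \<longlonglongrightarrow> D (Suc i) 0 x y * g y"
          by (intro tendsto_mult_right)
      qed
      show "AE y in ?M. norm ((D i 0 (X n) y - D i 0 x y) / (X n - x) * g y) \<le> A * \<bar>g y\<bar>" for n
      proof (rule AE_I2)
        fix y assume y: "y \<in> space ?M"
        have "\<bar>D i 0 (X n) y - D i 0 x y\<bar> \<le> A * \<bar>X n - x\<bar>"
          using X(1) x i y by (intro lipschitz_on_unit[OF deriv_familyD(3)[OF D(1)]] D(2)) auto
        then have "\<bar>(D i 0 (X n) y - D i 0 x y) / (X n - x)\<bar> \<le> A"
          using X(1) by (simp add: divide_le_eq)
        then show "norm ((D i 0 (X n) y - D i 0 x y) / (X n - x) * g y) \<le> A * \<bar>g y\<bar>"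
          unfolding real_norm_def abs_mult by (rule mult_right_mono) simp
      qed
      show "(\<lambda>y. (D i 0 (X n) y - D i 0 x y) / (X n - x) * g y) \<in> borel_measurable ?M" for n
        using meas[of i] X(1) i x gm by (intro borel_measurable_times borel_measurable_divide borel_measurable_diff) auto
      show "(\<lambda>y. D (Suc i) 0 x y * g y) \<in> borel_measurable ?M"
        using meas[of "Suc i" x] i x gm by simp
    qed (use gi in simp)
    then show "(\<lambda>n. (d i (X n) - d i x) / (X n - x)) \<longlonglongrightarrow> d (Suc i) x"
      unfolding eq d_def[of "Suc i" x] .
  qed
  have bd: "\<bar>d i x\<bar> \<le> (A + B) * ?G" if "i \<le> m" "x \<in> {0..1}" for i x
  proof -
    have "\<bar>d i x\<bar> \<le> (\<integral>y. \<bar>D i 0 x y * g y\<bar> \<partial>?M)"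
      unfolding d_def using integral_norm_bound[of ?M "\<lambda>y. D i 0 x y * g y"] by simp
    also have "\<dots> \<le> (\<integral>y. A * \<bar>g y\<bar> \<partial>?M)"
      using integrable_abs[OF int[OF that]] gi D(2) that
      by (intro integral_mono) (auto simp: abs_mult intro!: mult_right_mono)
    also have "\<dots> \<le> (A + B) * ?G" using AB G0 by (simp add: mult_right_mono)
    finally show ?thesis .
  qed
  have hd: "\<bar>d m x - d m y\<bar> \<le> (A + B) * ?G * \<bar>x - y\<bar> powr \<alpha>" if "x \<in> {0..1}" "y \<in> {0..1}" for x y
  proof -
    have i2: "integrable ?M (\<lambda>t. D m 0 x t * g t - D m 0 y t * g t)"
      using that by (intro Bochner_Integration.integrable_diff int) auto
    have "d m x - d m y = (\<integral>t. D m 0 x t * g t - D m 0 y t * g t \<partial>?M)"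
      unfolding d_def using that by (intro Bochner_Integration.integral_diff[symmetric] int) auto
    then have "\<bar>d m x - d m y\<bar> \<le> (\<integral>t. \<bar>D m 0 x t * g t - D m 0 y t * g t\<bar> \<partial>?M)"
      using integral_norm_bound[of ?M "\<lambda>t. D m 0 x t * g t - D m 0 y t * g t"] by simp
    also have "\<dots> \<le> (\<integral>t. (B * \<bar>x - y\<bar> powr \<alpha>) * \<bar>g t\<bar> \<partial>?M)"
    proof (rule integral_mono)
      fix t assume t: "t \<in> space ?M"
      have "\<bar>D m 0 x t - D m 0 y t\<bar> \<le> B * \<bar>x - y\<bar> powr \<alpha>"
        using D(3)[of m 0 x t y t] that t by simp
      then show "\<bar>D m 0 x t * g t - D m 0 y t * g t\<bar> \<le> (B * \<bar>x - y\<bar> powr \<alpha>) * \<bar>g t\<bar>"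
        unfolding left_diff_distrib[symmetric] abs_mult by (rule mult_right_mono) simp
    qed (use i2 gi in auto)
    also have "\<dots> = B * ?G * \<bar>x - y\<bar> powr \<alpha>" by simp
    also have "\<dots> \<le> (A + B) * ?G * \<bar>x - y\<bar> powr \<alpha>"
      using AB G0 by (intro mult_right_mono) auto
    finally show ?thesis .
  qed
  have d0: "d 0 x = (\<integral>y. f x y * g y \<partial>?M)" if "x \<in> {0..1}" for x
    unfolding d_def using deriv_familyD(1)[OF D(1) that] by (intro Bochner_Integration.integral_cong) auto
  show ?thesis
    unfolding holder_bound1_def using d0 der bd hd
    by (intro exI[of _ d] conjI ballI allI impI) simp_all
qed

section \<open>Smooth bump functions\<close>

lemma poly_cutoff_deriv:
  fixes q :: "real poly"
  assumes "[:0, 1, -1:] ^ 2 dvd q"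
  shows "((\<lambda>x. if x \<in> {0..1} then poly q x else 0) has_real_derivative
           (if x \<in> {0..1} then poly (pderiv q) x else 0)) (at x)"
proof -
  let ?f = "\<lambda>x. if x \<in> {0..1} then poly q x else 0"
  \<comment> \<open>The polynomial \<open>[:0, 1, -1:]\<close> is x(1 - x), so q has zeros of order
    at least two at both ends.\<close>
  obtain r where q: "q = [:0, 1, -1:] ^ 2 * r" using assms by (auto simp: dvd_def)
  have pq: "poly q x = (x * (1 - x))\<^sup>2 * poly r x" for x
    by (simp add: q power2_eq_square algebra_simps)
  have edge: "(?f has_real_derivative 0) (at x)" and z: "poly (pderiv q) x = 0" if "x = 0 \<or> x = 1" for x
  proof -
    have "((\<lambda>y. (poly q y)) has_real_derivative poly (pderiv q) x) (at x)" by (rule poly_DERIV)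
    moreover have "((\<lambda>y. (y * (1 - y))\<^sup>2 * poly r y) has_real_derivative 0) (at x)"
      using that by (auto intro!: derivative_eq_intros poly_DERIV)
    ultimately show z: "poly (pderiv q) x = 0" using DERIV_unique pq by (metis (no_types, lifting) ext)
    have dq: "((\<lambda>y. (poly q y - poly q x) / (y - x)) \<longlongrightarrow> 0) (at x)"
      using poly_DERIV[of q x] z by (simp add: has_field_derivative_iff)
    have qx: "poly q x = 0" "?f x = 0" using that by (auto simp: pq)
    \<comment> \<open>The cut-off can only decrease the modulus of the difference quotients of q,
      and those tend to 0.\<close>
    show "(?f has_real_derivative 0) (at x)"
      unfolding has_field_derivative_iff
      by (rule Lim_null_comparison[OF _ tendsto_norm_zero[OF dq]]) (use qx in \<open>auto simp: abs_divide\<close>)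
  qed
  consider "x = 0 \<or> x = 1" | "x \<in> {0<..<1}" | "x \<in> {..<0}" | "x \<in> {1<..}" by force
  then show ?thesis
  proof cases
    case 1 then show ?thesis using edge[OF 1] z[OF 1] by auto
  next
    case 2
    have "(?f has_real_derivative poly (pderiv q) x) (at x)"
      by (rule has_field_derivative_transform_within_open[OF poly_DERIV, where S="{0<..<1}"]) (use 2 in auto)
    then show ?thesis using 2 by simp
  next
    case 3
    have "(?f has_real_derivative 0) (at x)"
      by (rule has_field_derivative_transform_within_open[where f="\<lambda>_. 0" and S="{..<0}"]) (use 3 in auto)
    then show ?thesis using 3 by simp
  next
    case 4
    have "(?f has_real_derivative 0) (at x)"
      by (rule has_field_derivative_transform_within_open[where f="\<lambda>_. 0" and S="{1<..}"]) (use 4 in auto)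
    then show ?thesis using 4 by simp
  qed
qed

text \<open>Each differentiation costs at most one factor \<open>w\<close>, by the product
  rule.\<close>

lemma power_dvd_pderiv:
  fixes w :: "real poly"
  shows "w ^ (j + n) dvd q \<Longrightarrow> w ^ n dvd (pderiv ^^ j) q"
proof (induction j arbitrary: n)
  case (Suc j)
  have "w ^ (j + Suc n) dvd q" using Suc.prems by simp
  then have "w ^ Suc n dvd (pderiv ^^ j) q" by (rule Suc.IH)
  then obtain r where "(pderiv ^^ j) q = w ^ Suc n * r" by (auto simp: dvd_def)
  then have "(pderiv ^^ Suc j) q = pderiv (w ^ Suc n * r)" by simp
  also have "\<dots> = w ^ n * (w * pderiv r + smult (of_nat (Suc n)) (pderiv w) * r)"
    unfolding pderiv_mult pderiv_power_Suc by (simp add: algebra_simps del: of_nat_Suc)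
  finally have "(pderiv ^^ Suc j) q = w ^ n * (w * pderiv r + smult (of_nat (Suc n)) (pderiv w) * r)" .
  then show ?case by simp
qed simp

text \<open>The bump is (x(1 - x))^(m + 3), cut off outside the unit interval: being polynomial
  inside it has bounded derivatives, and it is flat enough at the ends for the cut-off to have
  derivatives up to order m + 2. Rescaling to width h multiplies the i-th derivative by h^(-i) and
  the Hoelder quotient of the m-th by h^(-(m + \<alpha>)).\<close>

lemma smooth_bump_exists:
  assumes \<alpha>: "0 < \<alpha>" "\<alpha> \<le> 1"
  obtains \<beta> :: "real \<Rightarrow> real" and C where "C > 0" "continuous_on UNIV \<beta>"
    "\<And>x. 0 \<le> \<beta> x" "\<And>x. \<beta> x \<le> C" "\<And>x. x \<notin> {0<..<1} \<Longrightarrow> \<beta> x = 0" "\<beta> (1/2) > 0"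
    "\<And>h y. 0 < h \<Longrightarrow> h \<le> 1 \<Longrightarrow>
       holder_bound1 m \<alpha> (C * h powr (- (real m + \<alpha>))) (\<lambda>x. \<beta> ((x - y) / h))"
proof -
  define p :: "real poly" where "p = [:0, 1, -1:] ^ (m + 3)"
  define d :: "nat \<Rightarrow> real \<Rightarrow> real" where
    "d i x = (if x \<in> {0..1} then poly ((pderiv ^^ i) p) x else 0)" for i x
  have der: "(d i has_real_derivative d (Suc i) x) (at x)" if "i \<le> m + 1" for i x
  proof -
    have "[:0, 1, -1:] ^ (i + 2) dvd p" unfolding p_def using that by (intro le_imp_power_dvd) auto
    from poly_cutoff_deriv[OF power_dvd_pderiv[OF this], of x]
    show ?thesis by (simp only: d_def[abs_def] funpow.simps o_apply)
  qed
  have "\<exists>C. \<forall>x. \<bar>d i x\<bar> \<le> C" for i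
  proof -
    have "compact ((\<lambda>x. poly ((pderiv ^^ i) p) x) ` {0..1})"
      by (intro compact_continuous_image continuous_intros) auto
    then obtain C where "\<forall>x\<in>{0..1}. \<bar>poly ((pderiv ^^ i) p) x\<bar> \<le> C"
      by (auto dest!: compact_imp_bounded simp: bounded_iff)
    then show ?thesis by (intro exI[of _ "max C 0"]) (auto simp: d_def le_max_iff_disj)
  qed
  then obtain C0 where C0: "\<And>i x. \<bar>d i x\<bar> \<le> C0 i" by metis
  define C where "C = (\<Sum>i\<le>m+1. \<bar>C0 i\<bar>) + 1"
  have C: "\<bar>d i x\<bar> \<le> C" if "i \<le> m + 1" for i x
  proof -
    have "\<bar>C0 i\<bar> \<le> (\<Sum>i\<le>m+1. \<bar>C0 i\<bar>)" using that by (intro member_le_sum) auto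
    then show ?thesis using C0[of i x] by (simp add: C_def)
  qed
  have Cpos: "C > 0" by (simp add: C_def add_nonneg_pos sum_nonneg)
  have lip: "\<bar>d m x - d m y\<bar> \<le> C * \<bar>x - y\<bar>" for x y
  proof -
    have "norm (d m x - d m y) \<le> C * norm (x - y)"
      by (rule field_differentiable_bound[where S=UNIV and f'="d (Suc m)"])
         (use der C in auto)
    then show ?thesis by simp
  qed
  have hb: "holder_bound1 m \<alpha> (2 * C * h powr (- (real m + \<alpha>))) (\<lambda>x. d 0 ((x - y) / h))"
    if h: "0 < h" "h \<le> 1" for h y
  proof -
    have hp: "(1 / h) ^ i = h powr (- real i)" for i
      using h by (simp add: powr_minus powr_realpow power_one_over inverse_eq_divide)
    define e where "e i x = (1 / h) ^ i * d i ((x - y) / h)" for i x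
    have "(e i has_vector_derivative e (Suc i) x) (at x within {0..1})" if "i < m" for i x
    proof -
      have "((\<lambda>x. d i ((x - y) / h)) has_real_derivative d (Suc i) ((x - y) / h) * (1 / h)) (at x within {0..1})"
        using that h by (intro DERIV_chain2[OF der]) (auto intro!: derivative_eq_intros)
      then have "((\<lambda>x. (1 / h) ^ i * d i ((x - y) / h)) has_real_derivative (1 / h) ^ i * (d (Suc i) ((x - y) / h) * (1 / h))) (at x within {0..1})"
        by (rule DERIV_cmult)
      then show ?thesis
        unfolding has_real_derivative_iff_has_vector_derivative e_def by (simp add: mult_ac)
    qed
    moreover have "\<bar>e i x\<bar> \<le> 2 * C * h powr (- (real m + \<alpha>))" if "i \<le> m" for i x
    proof -
      have "\<bar>e i x\<bar> = h powr (- real i) * \<bar>d i ((x - y) / h)\<bar>"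
        by (simp add: e_def hp[symmetric] abs_mult h abs_of_pos)
      also have "\<dots> \<le> h powr (- (real m + \<alpha>)) * C"
        using that h \<alpha> C[of i] by (intro mult_mono powr_mono') auto
      also have "\<dots> \<le> 2 * C * h powr (- (real m + \<alpha>))" using Cpos by simp
      finally show ?thesis .
    qed
    moreover have "\<bar>e m x - e m x'\<bar> \<le> 2 * C * h powr (- (real m + \<alpha>)) * \<bar>x - x'\<bar> powr \<alpha>" for x x'
    proof -
      let ?r = "\<bar>x - x'\<bar> / h"
      \<comment> \<open>Nearby points use the Lipschitz bound and r \<le> r powr \<alpha> for r
        \<le> 1; distant points use the bound on the function itself, as r powr \<alpha> is at least
        1 there. The second case is responsible for the constant 2C.\<close>
      have "\<bar>d m ((x - y) / h) - d m ((x' - y) / h)\<bar> \<le> 2 * C * ?r powr \<alpha>"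
      proof (cases "?r \<le> 1")
        case True
        have "\<bar>d m ((x - y) / h) - d m ((x' - y) / h)\<bar> \<le> C * ?r"
          using lip[of "(x - y) / h" "(x' - y) / h"] h by (simp add: diff_divide_distrib[symmetric] abs_divide)
        also have "\<dots> \<le> C * ?r powr \<alpha>"
          using powr_mono'[of \<alpha> 1 ?r] True \<alpha> h Cpos by (intro mult_left_mono) (auto simp: powr_one_gt_zero_iff)
        also have "\<dots> \<le> 2 * C * ?r powr \<alpha>" using Cpos by simp
        finally show ?thesis .
      next
        case False
        have "\<bar>d m ((x - y) / h) - d m ((x' - y) / h)\<bar> \<le> 2 * C"
          using C[of m "(x - y) / h"] C[of m "(x' - y) / h"] by simp
        also have "\<dots> \<le> 2 * C * ?r powr \<alpha>" using False Cpos \<alpha> by (simp add: ge_one_powr_ge_zero)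
        finally show ?thesis .
      qed
      then have "h powr (- real m) * \<bar>d m ((x - y) / h) - d m ((x' - y) / h)\<bar> \<le> h powr (- real m) * (2 * C * ?r powr \<alpha>)"
        by (rule mult_left_mono) simp
      also have "\<dots> = 2 * C * h powr (- (real m + \<alpha>)) * \<bar>x - x'\<bar> powr \<alpha>"
      proof -
        have "?r powr \<alpha> = \<bar>x - x'\<bar> powr \<alpha> * h powr (- \<alpha>)"
          using h by (simp add: powr_divide powr_minus_divide)
        moreover have "h powr (- (real m + \<alpha>)) = h powr (- real m) * h powr (- \<alpha>)"
          by (simp add: powr_add[symmetric])
        ultimately show ?thesis by simp
      qed
      finally show ?thesis
        by (simp add: e_def hp[symmetric] right_diff_distrib[symmetric] abs_mult h abs_of_pos)
    qed
    ultimately show ?thesis unfolding holder_bound1_def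
      by (intro exI[of _ e] conjI ballI allI impI) (simp_all add: e_def)
  qed
  have p: "poly p x = (x * (1 - x)) ^ (m + 3)" for x
    by (simp add: p_def algebra_simps)
  show ?thesis
  proof (rule that[of "2 * C" "d 0"])
    show "continuous_on UNIV (d 0)"
      using der[of 0] by (intro continuous_at_imp_continuous_on ballI DERIV_isCont) auto
    show "0 \<le> d 0 x" for x by (auto simp: d_def p)
    show "d 0 x \<le> 2 * C" for x using C[of 0 x] Cpos by auto
    show "x \<notin> {0<..<1} \<Longrightarrow> d 0 x = 0" for x by (cases "x = 0 \<or> x = 1") (auto simp: d_def p)
    show "0 < d 0 (1 / 2)" by (auto simp: d_def p)
  qed (use Cpos hb in auto)
qed

section \<open>Dimensions of subspaces of functions\<close>

interpretation fun_vs: vector_space scale_fun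
  by (rule vector_space_scale_fun)

interpretation fun_vsp: vector_space_pair scale_fun scale_fun
  by unfold_locales

text \<open>Linearity is asked of \<open>F\<close> on \<open>V\<close> only, which is what rotations
  offer: the integrals in their coefficients are known to be additive for square integrable
  functions. A basis of \<open>V\<close> yields a globally linear \<open>L\<close> that agrees with
  \<open>F\<close> on \<open>V\<close>.\<close>

lemma dim_eq_of_linear_bij:
  assumes V: "fun_vs.subspace V" and W: "F ` V = W" and inj: "inj_on F V"
    and add: "\<And>x y. x \<in> V \<Longrightarrow> y \<in> V \<Longrightarrow> F (x + y) = F x + F y"
    and scl: "\<And>r x. x \<in> V \<Longrightarrow> F (scale_fun r x) = scale_fun r (F x)"
  shows "fun_vs.dim W = fun_vs.dim V"
proof -
  obtain B where B: "B \<subseteq> V" "fun_vs.independent B" "V \<subseteq> fun_vs.span B" "card B = fun_vs.dim V"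
    by (rule fun_vs.basis_exists)
  have sp: "fun_vs.span B = V"
    using B V by (meson fun_vs.span_minimal subset_antisym)
  define L where "L = fun_vsp.construct B F"
  have lin: "Vector_Spaces.linear scale_fun scale_fun L"
    unfolding L_def by (rule fun_vsp.linear_construct[OF B(2)])
  have LB: "L b = F b" if "b \<in> B" for b
    unfolding L_def using fun_vsp.construct_basis[OF B(2) that] .
  have F0: "F 0 = 0"
  proof -
    have "0 \<in> V" using V by (rule fun_vs.subspace_0)
    from scl[OF this, of 0] show ?thesis by (simp add: fun_vs.scale_zero_left)
  qed
  have LF: "x \<in> V \<and> L x = F x" if "x \<in> fun_vs.span B" for x
    using that
  proof (induction rule: fun_vs.span_induct_alt)
    case base
    show ?case using F0 fun_vs.subspace_0[OF V] fun_vsp.linear_0[OF lin] by metis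
  next
    case (step r x y)
    then have xy: "x \<in> V" "y \<in> V" "L y = F y" using B by auto
    have rx: "scale_fun r x \<in> V" by (rule fun_vs.subspace_scale[OF V xy(1)])
    have "L (scale_fun r x + y) = scale_fun r (L x) + L y"
      by (simp only: fun_vsp.linear_add[OF lin] fun_vsp.linear_scale[OF lin])
    also have "\<dots> = F (scale_fun r x + y)"
      by (simp only: add[OF rx xy(2)] scl[OF xy(1)] LB[OF step(1)] xy(3))
    finally show ?case using fun_vs.subspace_add[OF V rx xy(2)] by blast
  qed
  have Wimg: "W = L ` fun_vs.span B" using LF W sp by (auto simp: image_iff)
  have injL: "inj_on L (fun_vs.span B)"
    using inj LF by (simp add: inj_on_def)
  have ind: "fun_vs.independent (L ` B)"
    by (rule fun_vsp.linear_independent_injective_image[OF lin B(2) injL])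
  have "fun_vs.span (L ` B) = W"
    unfolding Wimg by (rule fun_vsp.linear_span_image[OF lin])
  then have "fun_vs.dim W = card (L ` B)"
    using fun_vs.dim_eq_card[OF _ ind, of W] by (metis fun_vs.span_span)
  also have "\<dots> = card B"
    using injL fun_vs.span_superset[of B] by (intro card_image) (meson inj_on_subset)
  finally show ?thesis using B(4) by simp
qed

lemma dim_one_multiple:
  assumes V: "fun_vs.subspace V" and d: "fun_vs.dim V = 1" and f: "f \<in> V" "f \<noteq> 0" and g: "g \<in> V"
  obtains r where "g = scale_fun r f"
proof -
  obtain B where B: "B \<subseteq> V" "fun_vs.independent B" "V \<subseteq> fun_vs.span B" "card B = 1"
    using d fun_vs.basis_exists[of V] by metis
  obtain b where b: "B = {b}" using B(4) by (auto simp: card_1_singleton_iff)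
  from B(3) f(1) obtain p where "f = scale_fun p b"
    unfolding b fun_vs.span_singleton by blast
  moreover from B(3) g obtain q where "g = scale_fun q b"
    unfolding b fun_vs.span_singleton by blast
  moreover from \<open>f = scale_fun p b\<close> have "p \<noteq> 0" using f(2) fun_vs.scale_zero_left by metis
  ultimately have "g = scale_fun (q / p) f" by simp
  then show ?thesis by (rule that)
qed

lemma dim_one_singleton:
  assumes "b \<noteq> 0" "V = range (\<lambda>r. scale_fun r b)"
  shows "fun_vs.dim V = 1"
proof -
  have "V = fun_vs.span {b}" using assms by (simp add: fun_vs.span_singleton)
  moreover have "fun_vs.independent {b}" using assms by simp
  ultimately show ?thesis using fun_vs.dim_eq_card_independent[of "{b}"] by simp
qed

lemma dim_zero: "fun_vs.dim {0} = 0"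
  using fun_vs.dim_eq_card_independent[OF fun_vs.independent_empty] fun_vs.dim_span[of "{}"] by simp

section \<open>The inner product of L2 on the unit interval\<close>

definition l2_inner :: "(real \<Rightarrow> real) \<Rightarrow> (real \<Rightarrow> real) \<Rightarrow> real" where
  "l2_inner f g = (\<integral>x. f x * g x \<partial>lebesgue_on {0..1})"

lemma finite_measure_unit: "finite_measure (lebesgue_on {0..1::real})"
  by (rule finite_measure_lebesgue_on) simp

lemma square_integrable_mult:
  assumes "square_integrable f" "square_integrable g"
  shows "integrable (lebesgue_on {0..1}) (\<lambda>x. f x * g x)"
proof (rule Bochner_Integration.integrable_bound)
  show "integrable (lebesgue_on {0..1}) (\<lambda>x. (f x)\<^sup>2 + (g x)\<^sup>2)"
    using assms by (auto simp: square_integrable_def)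
  show "(\<lambda>x. f x * g x) \<in> borel_measurable (lebesgue_on {0..1})"
    using assms by (auto simp: square_integrable_def)
  have "\<bar>a * b\<bar> \<le> a\<^sup>2 + b\<^sup>2" for a b :: real
  proof -
    have "2 * \<bar>a\<bar> * \<bar>b\<bar> \<le> \<bar>a\<bar>\<^sup>2 + \<bar>b\<bar>\<^sup>2" by (rule sum_squares_bound)
    moreover have "0 \<le> \<bar>a\<bar> * \<bar>b\<bar>" by simp
    ultimately show ?thesis unfolding abs_mult power2_abs by linarith
  qed
  then show "AE x in lebesgue_on {0..1}. norm (f x * g x) \<le> norm ((f x)\<^sup>2 + (g x)\<^sup>2)"
    by (intro AE_I2) (auto simp: abs_of_nonneg)
qed

lemma continuous_square_integrable:
  assumes "continuous_on {0..1} f"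
  shows "square_integrable f"
  unfolding square_integrable_def
  using assms by (auto intro!: continuous_imp_measurable_on_sets_lebesgue
    continuous_imp_integrable_real continuous_intros)

lemma square_integrable_integrable:
  assumes "square_integrable f"
  shows "integrable (lebesgue_on {0..1}) f"
  using square_integrable_mult[OF assms continuous_square_integrable[of "\<lambda>_. 1"]] by simp

lemma square_integrable_scale:
  assumes "square_integrable f"
  shows "square_integrable (\<lambda>x. r * f x)"
  using assms by (auto simp: square_integrable_def power_mult_distrib)

lemma square_integrable_add:
  assumes f: "square_integrable f" and g: "square_integrable g"
  shows "square_integrable (\<lambda>x. f x + g x)"
proof -
  have "integrable (lebesgue_on {0..1}) (\<lambda>x. (f x)\<^sup>2 + (g x)\<^sup>2 + 2 * (f x * g x))"
    using square_integrable_mult[OF f g] f g by (auto simp: square_integrable_def)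
  then show ?thesis using f g by (auto simp: square_integrable_def power2_sum mult.assoc)
qed

lemma l2_inner_commute: "l2_inner f g = l2_inner g f"
  by (simp add: l2_inner_def mult.commute)

lemma l2_inner_comb:
  assumes "square_integrable e" "square_integrable f" "square_integrable g" "square_integrable h"
  shows "l2_inner e (\<lambda>x. f x + a * g x + b * h x) = l2_inner e f + a * l2_inner e g + b * l2_inner e h"
proof -
  let ?M = "lebesgue_on {0..1::real}"
  have i: "integrable ?M (\<lambda>x. e x * f x)" "integrable ?M (\<lambda>x. a * (e x * g x))" "integrable ?M (\<lambda>x. b * (e x * h x))"
    using assms square_integrable_mult by auto
  have "l2_inner e (\<lambda>x. f x + a * g x + b * h x) = (\<integral>x. (e x * f x + a * (e x * g x)) + b * (e x * h x) \<partial>?M)"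
    unfolding l2_inner_def by (intro Bochner_Integration.integral_cong) (auto simp: algebra_simps)
  also have "\<dots> = l2_inner e f + a * l2_inner e g + b * l2_inner e h"
    using i unfolding l2_inner_def by (simp add: Bochner_Integration.integral_add)
  finally show ?thesis .
qed

subsection \<open>Integral operators with continuous kernel\<close>

abbreviation continuous_kernel :: "(real \<Rightarrow> real \<Rightarrow> real) \<Rightarrow> bool" where
  "continuous_kernel \<Gamma> \<equiv> continuous_on ({0..1} \<times> {0..1}) (\<lambda>(x, y). \<Gamma> x y)"

lemma kernel_section_continuous:
  assumes "continuous_kernel \<Gamma>" "x \<in> {0..1}"
  shows "continuous_on {0..1} (\<lambda>y. \<Gamma> x y)"
proof -
  have "continuous_on {0..1} (\<lambda>y. (x, y))" by (intro continuous_intros)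
  moreover have "(\<lambda>y. (x, y)) ` {0..1} \<subseteq> {0..1} \<times> {0..1}" using assms by auto
  ultimately show ?thesis
    using continuous_on_compose2[OF assms(1), of "{0..1}" "\<lambda>y. (x, y)"] by simp
qed

lemma kernel_measurable_pair:
  assumes "continuous_kernel \<Gamma>"
  shows "(\<lambda>(x, y). \<Gamma> x y) \<in> borel_measurable (lebesgue_on {0..1} \<Otimes>\<^sub>M lebesgue_on {0..1})"
proof -
  let ?M = "lebesgue_on {0..1::real}"
  \<comment> \<open>Clamping to the unit interval extends the kernel continuously to the plane,
    where continuity gives Borel measurability.\<close>
  define cl where "cl x = max 0 (min 1 (x::real))" for x
  have "continuous_on UNIV (\<lambda>z. (\<lambda>(x, y). \<Gamma> x y) (cl (fst z), cl (snd z)))"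
    unfolding cl_def
    by (rule continuous_on_compose2[OF assms]) (auto intro!: continuous_intros)
  then have b: "(\<lambda>z. \<Gamma> (cl (fst z)) (cl (snd z))) \<in> borel_measurable (borel \<Otimes>\<^sub>M borel)"
    unfolding borel_prod by (auto intro: borel_measurable_continuous_onI)
  have id: "(\<lambda>x. x) \<in> measurable ?M borel"
    by (auto intro!: measurable_restrict_space1 measurable_completion)
  have "(\<lambda>z. (fst z, snd z)) \<in> measurable (?M \<Otimes>\<^sub>M ?M) (borel \<Otimes>\<^sub>M borel)"
    by (intro measurable_Pair measurable_compose[OF measurable_fst id] measurable_compose[OF measurable_snd id])
  from measurable_compose[OF this b]
  have "(\<lambda>z. \<Gamma> (cl (fst z)) (cl (snd z))) \<in> borel_measurable (?M \<Otimes>\<^sub>M ?M)" by simp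
  then show ?thesis
    by (rule measurable_cong[THEN iffD1, rotated]) (auto simp: space_pair_measure cl_def)
qed

lemma kernel_bounded:
  assumes "continuous_kernel \<Gamma>"
  obtains C where "\<And>x y. x \<in> {0..1} \<Longrightarrow> y \<in> {0..1} \<Longrightarrow> \<bar>\<Gamma> x y\<bar> \<le> C" "C \<ge> 0"
proof -
  have "compact ((\<lambda>(x, y). \<Gamma> x y) ` ({0..1} \<times> {0..1}))"
    using assms by (intro compact_continuous_image compact_Times compact_Icc)
  then obtain C where "\<forall>z\<in>(\<lambda>(x, y). \<Gamma> x y) ` ({0..1} \<times> {0..1}). norm z \<le> C"
    using compact_imp_bounded bounded_iff by metis
  then have "\<bar>\<Gamma> x y\<bar> \<le> max C 0" if "x \<in> {0..1}" "y \<in> {0..1}" for x y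
    using that by (force simp: le_max_iff_disj)
  then show ?thesis by (rule that) auto
qed

lemma kernel_integrable:
  assumes "continuous_kernel \<Gamma>" "x \<in> {0..1}" "square_integrable f"
  shows "integrable (lebesgue_on {0..1}) (\<lambda>y. \<Gamma> x y * f y)"
  by (rule square_integrable_mult[OF continuous_square_integrable[OF kernel_section_continuous[OF assms(1,2)]] assms(3)])

lemma kernel_pair_integrable:
  assumes \<Gamma>: "continuous_kernel \<Gamma>"
    and f: "square_integrable f" and g: "square_integrable g"
  shows "integrable (lebesgue_on {0..1} \<Otimes>\<^sub>M lebesgue_on {0..1}) (\<lambda>(x, y). f x * \<Gamma> x y * g y)"
proof -
  let ?M = "lebesgue_on {0..1::real}"
  interpret finite_measure ?M by (rule finite_measure_unit)
  interpret pair_sigma_finite ?M ?M by unfold_locales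
  have fm[measurable]: "f \<in> borel_measurable ?M" "g \<in> borel_measurable ?M"
    using f g by (auto simp: square_integrable_def)
  note km[measurable] = kernel_measurable_pair[OF \<Gamma>]
  obtain C where C: "\<And>x y. x \<in> {0..1} \<Longrightarrow> y \<in> {0..1} \<Longrightarrow> \<bar>\<Gamma> x y\<bar> \<le> C" "C \<ge> 0"
    using kernel_bounded[OF \<Gamma>] by metis
  have gi: "integrable ?M (\<lambda>y. \<bar>g y\<bar>)" "integrable ?M (\<lambda>y. \<bar>f y\<bar>)"
    using square_integrable_integrable f g by auto
  have dom: "integrable (?M \<Otimes>\<^sub>M ?M) (\<lambda>(x, y). (C * \<bar>f x\<bar>) * \<bar>g y\<bar>)"
  proof (rule Fubini_integrable)
    show "integrable ?M (\<lambda>x. \<integral>y. norm (case (x, y) of (x, y) \<Rightarrow> C * \<bar>f x\<bar> * \<bar>g y\<bar>) \<partial>?M)"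
      using gi C(2) by (simp add: abs_mult)
  qed (use gi in auto)
  show ?thesis
  proof (rule Bochner_Integration.integrable_bound[OF dom])
    have "(\<lambda>z. f (fst z) * (\<lambda>(x, y). \<Gamma> x y) z * g (snd z)) \<in> borel_measurable (?M \<Otimes>\<^sub>M ?M)"
      by measurable
    then show "(\<lambda>(x, y). f x * \<Gamma> x y * g y) \<in> borel_measurable (?M \<Otimes>\<^sub>M ?M)"
      by (simp add: split_beta')
    show "AE z in ?M \<Otimes>\<^sub>M ?M. norm (case z of (x, y) \<Rightarrow> f x * \<Gamma> x y * g y) \<le> norm (case z of (x, y) \<Rightarrow> C * \<bar>f x\<bar> * \<bar>g y\<bar>)"
    proof (rule AE_I2)
      fix z assume "z \<in> space (?M \<Otimes>\<^sub>M ?M)"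
      then obtain x y where z: "z = (x, y)" "x \<in> {0..1}" "y \<in> {0..1}" by (auto simp: space_pair_measure)
      have "\<bar>f x\<bar> * \<bar>\<Gamma> x y\<bar> * \<bar>g y\<bar> \<le> \<bar>f x\<bar> * C * \<bar>g y\<bar>"
        using C(1)[OF z(2,3)] by (intro mult_mono) auto
      then show "norm (case z of (x, y) \<Rightarrow> f x * \<Gamma> x y * g y) \<le> norm (case z of (x, y) \<Rightarrow> C * \<bar>f x\<bar> * \<bar>g y\<bar>)"
        using C(2) by (simp add: z abs_mult mult_ac)
    qed
  qed
qed

lemma cov_operator_symmetric:
  assumes \<Gamma>: "continuous_kernel \<Gamma>"
    and sym: "\<And>x y. x \<in> {0..1} \<Longrightarrow> y \<in> {0..1} \<Longrightarrow> \<Gamma> x y = \<Gamma> y x"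
    and f: "square_integrable f" and g: "square_integrable g"
  shows "l2_inner f (cov_operator \<Gamma> g) = l2_inner (cov_operator \<Gamma> f) g"
proof -
  let ?M = "lebesgue_on {0..1::real}"
  interpret finite_measure ?M by (rule finite_measure_unit)
  interpret pair_sigma_finite ?M ?M by unfold_locales
  have "l2_inner f (cov_operator \<Gamma> g) = (\<integral>x. \<integral>y. f x * \<Gamma> x y * g y \<partial>?M \<partial>?M)"
    unfolding l2_inner_def cov_operator_def by (simp add: mult.assoc)
  also have "\<dots> = (\<integral>y. \<integral>x. f x * \<Gamma> x y * g y \<partial>?M \<partial>?M)"
    using Fubini_integral[OF kernel_pair_integrable[OF \<Gamma> f g]] by simp
  also have "\<dots> = (\<integral>y. (\<integral>x. \<Gamma> y x * f x \<partial>?M) * g y \<partial>?M)"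
  proof (intro Bochner_Integration.integral_cong refl)
    fix y assume "y \<in> space ?M"
    then have "(\<integral>x. f x * \<Gamma> x y * g y \<partial>?M) = (\<integral>x. \<Gamma> y x * f x * g y \<partial>?M)"
      using sym by (intro Bochner_Integration.integral_cong) (auto simp: mult_ac)
    then show "(\<integral>x. f x * \<Gamma> x y * g y \<partial>?M) = (\<integral>x. \<Gamma> y x * f x \<partial>?M) * g y" by simp
  qed
  also have "\<dots> = l2_inner (cov_operator \<Gamma> f) g" by (simp add: l2_inner_def cov_operator_def)
  finally show ?thesis .
qed

lemma cov_operator_cong:
  assumes "\<And>x y. x \<in> {0..1} \<Longrightarrow> y \<in> {0..1} \<Longrightarrow> \<Gamma> x y = \<Gamma>' x y" "x \<in> {0..1}"
    "\<And>y. y \<in> {0..1} \<Longrightarrow> f y = g y"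
  shows "cov_operator \<Gamma> f x = cov_operator \<Gamma>' g x"
  unfolding cov_operator_def using assms by (intro Bochner_Integration.integral_cong) auto

lemma eigenspace_cong:
  assumes "\<And>x y. x \<in> {0..1} \<Longrightarrow> y \<in> {0..1} \<Longrightarrow> \<Gamma> x y = \<Gamma>' x y"
  shows "eigenspace \<Gamma> c = eigenspace \<Gamma>' c"
  using cov_operator_cong[OF assms] by (auto simp: eigenspace_def)

lemma eigenvalue_sequence_cong:
  assumes "\<And>c. 0 < c \<Longrightarrow> multiplicity_of \<Gamma> c = multiplicity_of \<Gamma>' c"
  shows "eigenvalue_sequence \<Gamma> lam \<longleftrightarrow> eigenvalue_sequence \<Gamma>' lam"
  using assms by (auto simp: eigenvalue_sequence_def)

lemma eigenspace_subspace:
  assumes \<Gamma>: "continuous_kernel \<Gamma>"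
  shows "fun_vs.subspace (eigenspace \<Gamma> c)"
proof (rule fun_vs.subspaceI)
  show "0 \<in> eigenspace \<Gamma> c"
    by (auto simp: eigenspace_def square_integrable_def cov_operator_def zero_fun_def)
next
  fix f g assume fg: "f \<in> eigenspace \<Gamma> c" "g \<in> eigenspace \<Gamma> c"
  have "cov_operator \<Gamma> (f + g) x = cov_operator \<Gamma> f x + cov_operator \<Gamma> g x" if "x \<in> {0..1}" for x
    using kernel_integrable[OF \<Gamma> that] fg
    by (simp add: cov_operator_def distrib_left eigenspace_def)
  then show "f + g \<in> eigenspace \<Gamma> c"
    using fg square_integrable_add[of f g] by (auto simp: eigenspace_def plus_fun_def distrib_left)
next
  fix r f assume f: "f \<in> eigenspace \<Gamma> c"
  have "cov_operator \<Gamma> (scale_fun r f) x = r * cov_operator \<Gamma> f x" for x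
    by (simp add: cov_operator_def scale_fun_def mult.left_commute[of _ r])
  then show "scale_fun r f \<in> eigenspace \<Gamma> c"
    using f square_integrable_scale[of f r] by (auto simp: eigenspace_def scale_fun_def)
qed

subsection \<open>Uniqueness of the eigenvalue sequence and of the eigenfunction\<close>

lemma eigenvalue_sequence_mono:
  assumes "eigenvalue_sequence \<Gamma> lam" "1 \<le> i" "i \<le> j"
  shows "lam j \<le> lam i"
  using assms(3,2)
proof (induction j rule: dec_induct)
  case (step j)
  then have "lam (Suc j) \<le> lam j" using assms(1) by (auto simp: eigenvalue_sequence_def)
  with step show ?case by simp
qed simp

text \<open>Suppose the sequences agree before j and c = \<open>lam j\<close> exceeds
  \<open>lam' j\<close>. By monotonicity all indices at which \<open>lam'\<close> equals c precede
  j, so \<open>lam\<close> equals c there too, and also at j. But both sequences take the value c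
  equally often, namely as often as its multiplicity.\<close>

lemma eigenvalue_sequence_le:
  assumes lam: "eigenvalue_sequence \<Gamma> lam" and lam': "eigenvalue_sequence \<Gamma> lam'"
    and j: "1 \<le> j" and eq: "\<And>i. 1 \<le> i \<Longrightarrow> i < j \<Longrightarrow> lam i = lam' i"
  shows "lam j \<le> lam' j"
proof (rule ccontr)
  assume "\<not> lam j \<le> lam' j"
  then have gt: "lam' j < lam j" by simp
  define c where "c = lam j"
  have "0 \<le> lam' j" using lam' j by (auto simp: eigenvalue_sequence_def)
  then have c: "c > 0" using gt by (simp add: c_def)
  have fin: "finite {i. 1 \<le> i \<and> lam i = c}" "card {i. 1 \<le> i \<and> lam i = c} = card {i. 1 \<le> i \<and> lam' i = c}"
    using lam lam' c by (auto simp: eigenvalue_sequence_def)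
  have "{i. 1 \<le> i \<and> lam' i = c} \<subset> {i. 1 \<le> i \<and> lam i = c}"
  proof
    show "{i. 1 \<le> i \<and> lam' i = c} \<subseteq> {i. 1 \<le> i \<and> lam i = c}"
    proof safe
      fix i assume i: "1 \<le> i" "c = lam' i"
      have "i < j"
      proof (rule ccontr)
        assume "\<not> i < j"
        then have "lam' i \<le> lam' j" using eigenvalue_sequence_mono[OF lam' j] by simp
        then show False using gt i by (simp add: c_def)
      qed
      then show "lam i = lam' i" using eq i by simp
    qed
    show "{i. 1 \<le> i \<and> lam' i = c} \<noteq> {i. 1 \<le> i \<and> lam i = c}"
      using j gt by (auto simp: c_def set_eq_iff intro!: exI[of _ j])
  qed
  from psubset_card_mono[OF fin(1) this] fin(2) show False by simp
qed

lemma eigenvalue_sequence_unique: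
  assumes lam: "eigenvalue_sequence \<Gamma> lam" and lam': "eigenvalue_sequence \<Gamma> lam'"
  shows "1 \<le> j \<Longrightarrow> lam j = lam' j"
proof (induction j rule: less_induct)
  case (less j)
  then show ?case
    using eigenvalue_sequence_le[OF lam lam'] eigenvalue_sequence_le[OF lam' lam]
    by (intro antisym) auto
qed

lemma spectral_gap_simple:
  assumes lam: "eigenvalue_sequence \<Gamma> lam" and k: "1 \<le> k" and gap: "0 < spectral_gap lam k"
  shows "{j. 1 \<le> j \<and> lam j = lam k} = {k}" "0 < lam k"
proof -
  have g1: "lam (k + 1) < lam k"
    using gap k by (cases "k = 1") (auto simp: spectral_gap_def numeral_2_eq_2)
  have g2: "lam k < lam (k - 1)" if "k \<noteq> 1"
    using gap that by (auto simp: spectral_gap_def)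
  have "j = k" if j: "1 \<le> j" "lam j = lam k" for j
  proof (rule ccontr)
    assume "j \<noteq> k"
    then consider "j < k" | "k + 1 \<le> j" by linarith
    then show False
    proof cases
      case 1
      then have "lam (k - 1) \<le> lam j" using eigenvalue_sequence_mono[OF lam, of j "k - 1"] j by simp
      then show False using g2 j 1 by fastforce
    next
      case 2
      then have "lam j \<le> lam (k + 1)" using eigenvalue_sequence_mono[OF lam, of "k + 1" j] by simp
      then show False using g1 j by simp
    qed
  qed
  then show "{j. 1 \<le> j \<and> lam j = lam k} = {k}" using k by auto
  have "0 \<le> lam (k + 1)" using lam by (auto simp: eigenvalue_sequence_def)
  then show "0 < lam k" using g1 by simp
qed

lemma spectral_gap_multiplicity:
  assumes lam: "eigenvalue_sequence \<Gamma> lam" and k: "1 \<le> k" and gap: "0 < spectral_gap lam k"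
  shows "fun_vs.dim (eigenspace \<Gamma> (lam k)) = 1"
  using spectral_gap_simple[OF assms] lam
  by (auto simp: eigenvalue_sequence_def multiplicity_of_def)

text \<open>\<open>eigenfunction\<close> is a choice, but the eigenvalue sequence is unique and a
  positive gap makes the k-th eigenspace one-dimensional, so the chosen function is a multiple of
  any other unit vector in it. The equality holds at every point because eigenspaces consist of
  functions and not of classes.\<close>

lemma eigenfunction_abs_eq:
  assumes \<Gamma>: "continuous_kernel (cov_kernel P)"
    and lam: "eigenvalue_sequence (cov_kernel P) lam" and k: "1 \<le> k" and gap: "0 < spectral_gap lam k"
    and \<psi>: "\<psi> \<in> eigenspace (cov_kernel P) (lam k)" and norm: "l2_inner \<psi> \<psi> = 1"
  obtains r where "r = 1 \<or> r = -1" "eigenfunction P k = (\<lambda>t. r * \<psi> t)"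
proof -
  define \<phi> where "\<phi> = eigenfunction P k"
  have "normalized_eigenfunction (cov_kernel P) k \<psi>"
    using lam \<psi> norm by (auto simp: normalized_eigenfunction_def l2_inner_def power2_eq_square)
  then have "normalized_eigenfunction (cov_kernel P) k \<phi>"
    unfolding \<phi>_def eigenfunction_def by (rule someI[of "normalized_eigenfunction (cov_kernel P) k"])
  then obtain lam' where lam': "eigenvalue_sequence (cov_kernel P) lam'"
    and \<phi>: "\<phi> \<in> eigenspace (cov_kernel P) (lam' k)" and n\<phi>: "l2_inner \<phi> \<phi> = 1"
    by (auto simp: normalized_eigenfunction_def l2_inner_def power2_eq_square)
  have eq: "lam' k = lam k" by (rule eigenvalue_sequence_unique[OF lam' lam k])
  have "\<psi> \<noteq> 0" using norm by (auto simp: l2_inner_def)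
  then obtain r where r: "\<phi> = scale_fun r \<psi>"
    using dim_one_multiple[OF eigenspace_subspace[OF \<Gamma>] spectral_gap_multiplicity[OF lam k gap] \<psi>] \<phi>
    unfolding eq by metis
  have "l2_inner \<phi> \<phi> = r * r * l2_inner \<psi> \<psi>"
    unfolding l2_inner_def r scale_fun_def
    by (subst integral_mult_right_zero[symmetric]) (simp add: mult_ac)
  then have "r\<^sup>2 = 1" using n\<phi> norm by (simp add: power2_eq_square)
  then have "r = 1 \<or> r = -1" by (simp add: power2_eq_1_iff)
  then show ?thesis using that r by (simp add: \<phi>_def scale_fun_def)
qed

lemma cov_operator_continuous:
  assumes \<Gamma>: "continuous_kernel \<Gamma>" and f: "square_integrable f"
  shows "continuous_on {0..1} (cov_operator \<Gamma> f)"
proof (rule continuous_on_sequentiallyI)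
  let ?M = "lebesgue_on {0..1::real}"
  fix u :: "nat \<Rightarrow> real" and a assume u: "\<forall>n. u n \<in> {0..1}" "a \<in> {0..1}" "u \<longlonglongrightarrow> a"
  obtain C where C: "\<And>x y. x \<in> {0..1} \<Longrightarrow> y \<in> {0..1} \<Longrightarrow> \<bar>\<Gamma> x y\<bar> \<le> C" "C \<ge> 0"
    using kernel_bounded[OF \<Gamma>] by metis
  show "(\<lambda>n. cov_operator \<Gamma> f (u n)) \<longlonglongrightarrow> cov_operator \<Gamma> f a"
    unfolding cov_operator_def
  proof (rule integral_dominated_convergence[where w="\<lambda>y. C * \<bar>f y\<bar>"])
    show "AE y in ?M. (\<lambda>n. \<Gamma> (u n) y * f y) \<longlonglongrightarrow> \<Gamma> a y * f y"
    proof (rule AE_I2)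
      fix y assume y: "y \<in> space ?M"
      have "(\<lambda>n. (\<lambda>(x, y). \<Gamma> x y) (u n, y)) \<longlonglongrightarrow> (\<lambda>(x, y). \<Gamma> x y) (a, y)"
        using u y by (intro continuous_on_tendsto_compose[OF \<Gamma>] tendsto_intros) auto
      then show "(\<lambda>n. \<Gamma> (u n) y * f y) \<longlonglongrightarrow> \<Gamma> a y * f y" by (intro tendsto_mult_right) simp
    qed
    show "AE y in ?M. norm (\<Gamma> (u n) y * f y) \<le> C * \<bar>f y\<bar>" for n
      using C u by (intro AE_I2) (auto simp: abs_mult intro!: mult_right_mono)
    show "(\<lambda>y. \<Gamma> (u n) y * f y) \<in> borel_measurable ?M" for n
      using kernel_integrable[OF \<Gamma> _ f, of "u n"] u by auto
    show "(\<lambda>y. \<Gamma> a y * f y) \<in> borel_measurable ?M"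
      using kernel_integrable[OF \<Gamma> _ f, of a] u by auto
    show "integrable ?M (\<lambda>y. C * \<bar>f y\<bar>)"
      using square_integrable_integrable[OF f] by simp
  qed
qed

lemma cov_operator_comb:
  assumes \<Gamma>: "continuous_kernel \<Gamma>" and x: "x \<in> {0..1}"
    and "square_integrable f" "square_integrable g" "square_integrable h"
  shows "cov_operator \<Gamma> (\<lambda>x. f x + a * g x + b * h x) x
    = cov_operator \<Gamma> f x + a * cov_operator \<Gamma> g x + b * cov_operator \<Gamma> h x"
  using l2_inner_comb[OF continuous_square_integrable[OF kernel_section_continuous[OF \<Gamma> x]], of f g h a b] assms
  by (simp add: l2_inner_def cov_operator_def)

section \<open>Rotations in a plane of functions and the kernels that they produce\<close>

definition rot_fun :: "(real \<Rightarrow> real) \<Rightarrow> (real \<Rightarrow> real) \<Rightarrow> real \<Rightarrow> real \<Rightarrow> (real \<Rightarrow> real) \<Rightarrow> real \<Rightarrow> real" where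
  "rot_fun e1 e2 c s f = (\<lambda>x. f x + ((c - 1) * l2_inner e1 f - s * l2_inner e2 f) * e1 x
     + (s * l2_inner e1 f + (c - 1) * l2_inner e2 f) * e2 x)"

text \<open>The kernel of U T U^*. Write U = I + M on the plane of \<open>e1\<close> and
  \<open>e2\<close>, where M has the rows (c - 1, -s) and (s, c - 1). Then \<open>b1\<close> and
  \<open>b2\<close> are the rows of M applied to T e1 and T e2, and the q's are the entries of M G
  M^t for the matrix G of T on the plane. In this form all correction terms carry a small factor s
  or c - 1.\<close>

definition rot_kernel :: "(real \<Rightarrow> real \<Rightarrow> real) \<Rightarrow> (real \<Rightarrow> real) \<Rightarrow> (real \<Rightarrow> real) \<Rightarrow> real \<Rightarrow> real \<Rightarrow> real \<Rightarrow> real \<Rightarrow> real" where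
  "rot_kernel \<Gamma> e1 e2 c s = (\<lambda>x y.
     let b1 = (\<lambda>x. (c - 1) * cov_operator \<Gamma> e1 x - s * cov_operator \<Gamma> e2 x);
         b2 = (\<lambda>x. s * cov_operator \<Gamma> e1 x + (c - 1) * cov_operator \<Gamma> e2 x);
         G11 = l2_inner e1 (cov_operator \<Gamma> e1); G12 = l2_inner e1 (cov_operator \<Gamma> e2);
         G22 = l2_inner e2 (cov_operator \<Gamma> e2);
         q11 = (c - 1)\<^sup>2 * G11 - 2 * s * (c - 1) * G12 + s\<^sup>2 * G22;
         q12 = s * (c - 1) * G11 + ((c - 1)\<^sup>2 - s\<^sup>2) * G12 - s * (c - 1) * G22;
         q22 = s\<^sup>2 * G11 + 2 * s * (c - 1) * G12 + (c - 1)\<^sup>2 * G22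
     in \<Gamma> x y + e1 x * b1 y + e2 x * b2 y + b1 x * e1 y + b2 x * e2 y
        + q11 * (e1 x * e1 y) + q12 * (e1 x * e2 y) + q12 * (e2 x * e1 y) + q22 * (e2 x * e2 y))"

text \<open>\<open>c\<close> and \<open>s\<close> are cosine and sine of the angle. Since
  \<open>e1\<close> and \<open>e2\<close> vanish off the unit interval, U preserves the convention
  of \<open>eigenspace\<close> that functions are zero there.\<close>

locale rotation =
  fixes \<Gamma> :: "real \<Rightarrow> real \<Rightarrow> real" and e1 e2 :: "real \<Rightarrow> real" and c s :: real
  assumes \<Gamma>: "continuous_kernel \<Gamma>"
    and sym: "\<And>x y. x \<in> {0..1} \<Longrightarrow> y \<in> {0..1} \<Longrightarrow> \<Gamma> x y = \<Gamma> y x"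
    and e1: "continuous_on {0..1} e1" and e2: "continuous_on {0..1} e2"
    and zero: "\<And>x. x \<notin> {0..1} \<Longrightarrow> e1 x = 0" "\<And>x. x \<notin> {0..1} \<Longrightarrow> e2 x = 0"
    and n11: "l2_inner e1 e1 = 1" and n12: "l2_inner e1 e2 = 0" and n22: "l2_inner e2 e2 = 1"
    and cs: "c\<^sup>2 + s\<^sup>2 = 1"
begin

lemma si: "square_integrable e1" "square_integrable e2"
  using e1 e2 by (auto intro: continuous_square_integrable)

lemma Tsi: "square_integrable f \<Longrightarrow> square_integrable (cov_operator \<Gamma> f)"
  by (rule continuous_square_integrable[OF cov_operator_continuous[OF \<Gamma>]])

lemma n21: "l2_inner e2 e1 = 0" using n12 by (simp add: l2_inner_commute)

abbreviation "U \<equiv> rot_fun e1 e2 c s"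
abbreviation "\<Gamma>' \<equiv> rot_kernel \<Gamma> e1 e2 c s"

lemma rot_square_integrable: "square_integrable f \<Longrightarrow> square_integrable (U f)"
  unfolding rot_fun_def
  by (rule square_integrable_add[OF square_integrable_add[OF _ square_integrable_scale[OF si(1)]]
        square_integrable_scale[OF si(2)]])

lemma rot_inner:
  assumes f: "square_integrable f"
  shows "l2_inner e1 (U f) = c * l2_inner e1 f - s * l2_inner e2 f"
    "l2_inner e2 (U f) = s * l2_inner e1 f + c * l2_inner e2 f"
  unfolding rot_fun_def l2_inner_comb[OF si(1) f si] l2_inner_comb[OF si(2) f si] n11 n12 n21 n22
  by (simp_all add: algebra_simps)

lemma rot_norm:
  assumes f: "square_integrable f"
  shows "l2_inner (U f) (U f) = l2_inner f f"
proof -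
  have gen: "l2_inner e (U f) = l2_inner e f
      + ((c - 1) * l2_inner e1 f - s * l2_inner e2 f) * l2_inner e e1
      + (s * l2_inner e1 f + (c - 1) * l2_inner e2 f) * l2_inner e e2"
    if "square_integrable e" for e
    unfolding rot_fun_def by (rule l2_inner_comb[OF that f si])
  note gen[OF rot_square_integrable[OF f]]
  moreover have "l2_inner (U f) f = l2_inner f f
      + ((c - 1) * l2_inner e1 f - s * l2_inner e2 f) * l2_inner e1 f
      + (s * l2_inner e1 f + (c - 1) * l2_inner e2 f) * l2_inner e2 f"
    using gen[OF f] by (simp only: l2_inner_commute[of "U f" f] l2_inner_commute[of f e1] l2_inner_commute[of f e2])
  moreover have "l2_inner (U f) e1 = c * l2_inner e1 f - s * l2_inner e2 f"
    "l2_inner (U f) e2 = s * l2_inner e1 f + c * l2_inner e2 f"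
    using rot_inner[OF f] by (simp_all add: l2_inner_commute)
  ultimately show ?thesis using cs by algebra
qed

text \<open>U T U^* applied to U f is U T f, because U^* U = I. The computation expresses both sides
  by the same inner products; what remains is a polynomial identity modulo
  \<open>c\<^sup>2 + s\<^sup>2 = 1\<close>.\<close>

lemma rot_operator:
  assumes f: "square_integrable f" and x: "x \<in> {0..1}"
  shows "cov_operator \<Gamma>' (U f) x = U (cov_operator \<Gamma> f) x"
proof -
  let ?M = "lebesgue_on {0..1::real}"
  define T where "T = cov_operator \<Gamma>"
  define g where "g = U f"
  define b1 where "b1 x = (c - 1) * T e1 x - s * T e2 x" for x
  define b2 where "b2 x = s * T e1 x + (c - 1) * T e2 x" for x
  define G11 G12 G22 where G: "G11 = l2_inner e1 (T e1)" "G12 = l2_inner e1 (T e2)" "G22 = l2_inner e2 (T e2)"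
  define q11 q12 q22 where q: "q11 = (c - 1)\<^sup>2 * G11 - 2 * s * (c - 1) * G12 + s\<^sup>2 * G22"
    "q12 = s * (c - 1) * G11 + ((c - 1)\<^sup>2 - s\<^sup>2) * G12 - s * (c - 1) * G22"
    "q22 = s\<^sup>2 * G11 + 2 * s * (c - 1) * G12 + (c - 1)\<^sup>2 * G22"
  define a1 where "a1 = b1 x + q11 * e1 x + q12 * e2 x"
  define a2 where "a2 = b2 x + q12 * e1 x + q22 * e2 x"
  have g: "square_integrable g" unfolding g_def by (rule rot_square_integrable[OF f])
  have G21: "l2_inner e2 (T e1) = G12"
    unfolding G T_def using cov_operator_symmetric[OF \<Gamma> sym si(2) si(1)] by (simp add: l2_inner_commute)
  have tsi: "square_integrable (T e1)" "square_integrable (T e2)" "square_integrable (T f)" "square_integrable (T g)"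
    unfolding T_def using si f g Tsi by auto
  have i: "integrable ?M (\<lambda>y. \<Gamma> x y * g y)" "integrable ?M (\<lambda>y. e1 y * g y)" "integrable ?M (\<lambda>y. e2 y * g y)"
    "integrable ?M (\<lambda>y. T e1 y * g y)" "integrable ?M (\<lambda>y. T e2 y * g y)"
    using kernel_integrable[OF \<Gamma> x g] square_integrable_mult[OF _ g] si tsi by auto
  have "cov_operator \<Gamma>' g x = (\<integral>y. \<Gamma> x y * g y + a1 * (e1 y * g y) + a2 * (e2 y * g y)
      + ((c - 1) * e1 x + s * e2 x) * (T e1 y * g y) + ((c - 1) * e2 x - s * e1 x) * (T e2 y * g y) \<partial>?M)"
    unfolding cov_operator_def rot_kernel_def Let_def T_def[symmetric] unfolding a1_def a2_def b1_def b2_def q G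
      cov_operator_def[symmetric] T_def[symmetric]
    by (intro Bochner_Integration.integral_cong refl) (simp add: algebra_simps)
  also have "\<dots> = T g x + a1 * l2_inner e1 g + a2 * l2_inner e2 g
      + ((c - 1) * e1 x + s * e2 x) * l2_inner (T e1) g + ((c - 1) * e2 x - s * e1 x) * l2_inner (T e2) g"
    unfolding l2_inner_def T_def[of] using i[unfolded T_def] by (simp add: cov_operator_def[of _ g])
  also have "l2_inner (T e1) g = l2_inner e1 (T g)"
    unfolding T_def using cov_operator_symmetric[OF \<Gamma> sym si(1) g] by simp
  also have "l2_inner (T e2) g = l2_inner e2 (T g)"
    unfolding T_def using cov_operator_symmetric[OF \<Gamma> sym si(2) g] by simp
  finally have 1: "cov_operator \<Gamma>' g x = T g x + a1 * l2_inner e1 g + a2 * l2_inner e2 g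
      + ((c - 1) * e1 x + s * e2 x) * l2_inner e1 (T g) + ((c - 1) * e2 x - s * e1 x) * l2_inner e2 (T g)" .
  define p1 p2 where p: "p1 = l2_inner e1 f" "p2 = l2_inner e2 f"
  define \<alpha>1 \<alpha>2 where \<alpha>: "\<alpha>1 = (c - 1) * p1 - s * p2" "\<alpha>2 = s * p1 + (c - 1) * p2"
  have Tg: "T g y = T f y + \<alpha>1 * T e1 y + \<alpha>2 * T e2 y" if "y \<in> {0..1}" for y
    unfolding T_def g_def rot_fun_def \<alpha> p by (rule cov_operator_comb[OF \<Gamma> that f si])
  have ig: "l2_inner e (T g) = l2_inner e (T f) + \<alpha>1 * l2_inner e (T e1) + \<alpha>2 * l2_inner e (T e2)"
    if e: "square_integrable e" for e
  proof -
    have "l2_inner e (T g) = l2_inner e (\<lambda>y. T f y + \<alpha>1 * T e1 y + \<alpha>2 * T e2 y)"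
      unfolding l2_inner_def using Tg by (intro Bochner_Integration.integral_cong) auto
    then show ?thesis using l2_inner_comb[OF e tsi(3,1,2)] by simp
  qed
  define t1 t2 where t: "t1 = l2_inner e1 (T f)" "t2 = l2_inner e2 (T f)"
  have 2: "l2_inner e1 (T g) = t1 + \<alpha>1 * G11 + \<alpha>2 * G12" "l2_inner e2 (T g) = t2 + \<alpha>1 * G12 + \<alpha>2 * G22"
    using ig[OF si(1)] ig[OF si(2)] by (simp_all add: t G(1,2,3)[symmetric] G21)
  have 3: "l2_inner e1 g = c * p1 - s * p2" "l2_inner e2 g = s * p1 + c * p2"
    using rot_inner[OF f] by (simp_all add: g_def p)
  have "cov_operator \<Gamma>' g x = T f x + ((c - 1) * t1 - s * t2) * e1 x + (s * t1 + (c - 1) * t2) * e2 x"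
    unfolding 1 2 3 Tg[OF x] a1_def a2_def b1_def b2_def q \<alpha> using cs by algebra
  then show ?thesis by (simp add: g_def rot_fun_def t T_def)
qed

lemma rot_inverse:
  assumes f: "square_integrable f"
  shows "rot_fun e1 e2 c (- s) (U f) = f"
proof
  fix x
  show "rot_fun e1 e2 c (- s) (U f) x = f x"
    unfolding rot_fun_def[of e1 e2 c "- s"] rot_inner[OF f] unfolding rot_fun_def using cs by algebra
qed

lemma rotation_inverse: "rotation \<Gamma> e1 e2 c (- s)"
  using \<Gamma> sym e1 e2 zero n11 n12 n22 cs by unfold_locales auto

lemma rot_inverse':
  assumes f: "square_integrable f"
  shows "U (rot_fun e1 e2 c (- s) f) = f"
  using rotation.rot_inverse[OF rotation_inverse f] by simp

lemma rot_cong: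
  assumes "\<And>y. y \<in> {0..1} \<Longrightarrow> f y = g y" "x \<in> {0..1}"
  shows "rot_fun e1 e2 c' s' f x = rot_fun e1 e2 c' s' g x"
proof -
  have "l2_inner e f = l2_inner e g" for e
    unfolding l2_inner_def using assms by (intro Bochner_Integration.integral_cong) auto
  then show ?thesis using assms by (simp add: rot_fun_def)
qed

lemma rot_scale: "rot_fun e1 e2 c' s' (\<lambda>x. r * f x) x = r * rot_fun e1 e2 c' s' f x"
proof -
  have "l2_inner e (\<lambda>x. r * f x) = r * l2_inner e f" for e
  proof -
    have "(\<lambda>x. e x * (r * f x)) = (\<lambda>x. r * (e x * f x))" by (auto simp: mult_ac)
    then show ?thesis unfolding l2_inner_def by simp
  qed
  then show ?thesis by (simp add: rot_fun_def algebra_simps)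
qed

text \<open>By \<open>rot_operator\<close> U carries eigenfunctions to eigenfunctions with the same
  eigenvalue, and the rotation by the opposite angle inverts it.\<close>

lemma rot_eigenspace: "eigenspace \<Gamma>' \<kappa> = U ` eigenspace \<Gamma> \<kappa>"
proof (intro equalityI subsetI)
  fix g assume "g \<in> U ` eigenspace \<Gamma> \<kappa>"
  then obtain f where f: "g = U f" "square_integrable f" "\<And>x. x \<notin> {0..1} \<Longrightarrow> f x = 0"
     "\<And>x. x \<in> {0..1} \<Longrightarrow> cov_operator \<Gamma> f x = \<kappa> * f x" by (auto simp: eigenspace_def)
  have "cov_operator \<Gamma>' g x = \<kappa> * g x" if x: "x \<in> {0..1}" for x
    using rot_operator[OF f(2) x] rot_cong[of "cov_operator \<Gamma> f" "\<lambda>x. \<kappa> * f x" x c s] f(4) x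
    by (simp add: f(1) rot_scale)
  moreover have "g x = 0" if "x \<notin> {0..1}" for x
    using f(3)[OF that] zero[OF that] by (simp add: f(1) rot_fun_def)
  ultimately show "g \<in> eigenspace \<Gamma>' \<kappa>"
    using rot_square_integrable[OF f(2)] by (auto simp: eigenspace_def f(1))
next
  fix g assume "g \<in> eigenspace \<Gamma>' \<kappa>"
  then have g: "square_integrable g" "\<And>x. x \<notin> {0..1} \<Longrightarrow> g x = 0"
     "\<And>x. x \<in> {0..1} \<Longrightarrow> cov_operator \<Gamma>' g x = \<kappa> * g x" by (auto simp: eigenspace_def)
  define f where "f = rot_fun e1 e2 c (- s) g"
  have f: "square_integrable f"
    unfolding f_def by (rule rotation.rot_square_integrable[OF rotation_inverse g(1)])
  have gf: "g = U f" unfolding f_def by (simp add: rot_inverse'[OF g(1)])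
  have "cov_operator \<Gamma> f x = \<kappa> * f x" if x: "x \<in> {0..1}" for x
  proof -
    have "U (cov_operator \<Gamma> f) y = \<kappa> * g y" if "y \<in> {0..1}" for y
      using rot_operator[OF f that] g(3)[OF that] gf by simp
    then have "rot_fun e1 e2 c (- s) (U (cov_operator \<Gamma> f)) x = rot_fun e1 e2 c (- s) (\<lambda>y. \<kappa> * g y) x"
      using x by (intro rot_cong) auto
    then show ?thesis unfolding rot_inverse[OF Tsi[OF f]] rot_scale f_def[symmetric] .
  qed
  moreover have "f x = 0" if "x \<notin> {0..1}" for x
    using g(2)[OF that] zero[OF that] by (simp add: f_def rot_fun_def)
  ultimately have "f \<in> eigenspace \<Gamma> \<kappa>" using f by (auto simp: eigenspace_def)
  then show "g \<in> U ` eigenspace \<Gamma> \<kappa>" using gf by auto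
qed

lemma rot_multiplicity: "multiplicity_of \<Gamma>' \<kappa> = multiplicity_of \<Gamma> \<kappa>"
  unfolding multiplicity_of_def
proof (rule dim_eq_of_linear_bij[where F=U])
  show "fun_vs.subspace (eigenspace \<Gamma> \<kappa>)" by (rule eigenspace_subspace[OF \<Gamma>])
  show "U ` eigenspace \<Gamma> \<kappa> = eigenspace \<Gamma>' \<kappa>" by (simp add: rot_eigenspace)
  show "inj_on U (eigenspace \<Gamma> \<kappa>)"
    by (rule inj_on_inverseI[where g="rot_fun e1 e2 c (- s)"]) (auto simp: eigenspace_def rot_inverse)
  show "U (scale_fun r f) = scale_fun r (U f)" for r f
    by (auto simp: scale_fun_def rot_scale)
  fix f g assume "f \<in> eigenspace \<Gamma> \<kappa>" "g \<in> eigenspace \<Gamma> \<kappa>"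
  then have fg: "square_integrable f" "square_integrable g" by (auto simp: eigenspace_def)
  have "l2_inner e (f + g) = l2_inner e f + l2_inner e g" if "square_integrable e" for e
    using l2_inner_comb[OF that fg(1) fg(2) fg(2), of 1 0] by (simp add: plus_fun_def)
  then show "U (f + g) = U f + U g"
    using si by (auto simp: rot_fun_def fun_eq_iff algebra_simps)
qed

lemma rot_eigenvalue_sequence: "eigenvalue_sequence \<Gamma>' lam \<longleftrightarrow> eigenvalue_sequence \<Gamma> lam"
  by (rule eigenvalue_sequence_cong[OF rot_multiplicity])

end

text \<open>Besides the original kernel there are twelve tensor products. Eight pair one of the e's
  with an image under T and have coefficients of modulus at most |s|; four pair e's with e's and
  have coefficients of modulus at most 4 s^2 g. In the terms of first order in s the large norm
  \<open>K\<close> thus meets only the small norm \<open>K'\<close>.\<close>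

lemma rot_kernel_holder:
  fixes \<Gamma> :: "real \<Rightarrow> real \<Rightarrow> real"
  assumes \<alpha>: "0 < \<alpha>" "\<alpha> \<le> 1" and \<Gamma>: "holder_bounds m \<alpha> A B \<Gamma>"
    and e: "holder_bound1 m \<alpha> K e1" "holder_bound1 m \<alpha> K e2"
    and te: "holder_bound1 m \<alpha> K' (cov_operator \<Gamma> e1)" "holder_bound1 m \<alpha> K' (cov_operator \<Gamma> e2)"
    and G: "\<bar>l2_inner e1 (cov_operator \<Gamma> e1)\<bar> \<le> g" "\<bar>l2_inner e1 (cov_operator \<Gamma> e2)\<bar> \<le> g"
      "\<bar>l2_inner e2 (cov_operator \<Gamma> e2)\<bar> \<le> g"
    and s: "\<bar>s\<bar> \<le> 1" "\<bar>c - 1\<bar> \<le> \<bar>s\<bar>"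
    and R: "8 * \<bar>s\<bar> * (K * K') + 16 * s\<^sup>2 * g * (K * K) \<le> R"
  shows "holder_bounds m \<alpha> (A + R) (B + 2 * R) (rot_kernel \<Gamma> e1 e2 c s)"
proof -
  let ?T = "cov_operator \<Gamma>"
  \<comment> \<open>For tensor products the second bound is twice the first, so one number describes
    the whole perturbation.\<close>
  let ?hb = "\<lambda>r f. holder_bounds m \<alpha> r (2 * r) f"
  have mono: "?hb r f \<Longrightarrow> r \<le> r' \<Longrightarrow> ?hb r' f" for r r' f
  proof -
    assume h: "?hb r f" "r \<le> r'"
    obtain D where D: "deriv_family m f D"
    "\<And>s1 s2 x y. s1 + s2 \<le> m \<Longrightarrow> x \<in> {0..1} \<Longrightarrow> y \<in> {0..1} \<Longrightarrow> \<bar>D s1 s2 x y\<bar> \<le> r"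
    "\<And>s1 s2 x y x' y'. s1 + s2 = m \<Longrightarrow> x \<in> {0..1} \<Longrightarrow> y \<in> {0..1} \<Longrightarrow> x' \<in> {0..1} \<Longrightarrow> y' \<in> {0..1}
       \<Longrightarrow> \<bar>D s1 s2 x y - D s1 s2 x' y'\<bar> \<le> 2 * r * max \<bar>x - x'\<bar> \<bar>y - y'\<bar> powr \<alpha>"
      using h(1) by (rule holder_boundsE) metis
    show "?hb r' f"
    proof (rule holder_boundsI[OF D(1)])
      show "\<bar>D s1 s2 x y\<bar> \<le> r'" if "s1 + s2 \<le> m" "x \<in> {0..1}" "y \<in> {0..1}" for s1 s2 x y
        using D(2)[OF that] h(2) by simp
      show "\<bar>D s1 s2 x y - D s1 s2 x' y'\<bar> \<le> 2 * r' * max \<bar>x - x'\<bar> \<bar>y - y'\<bar> powr \<alpha>"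
        if "s1 + s2 = m" "x \<in> {0..1}" "y \<in> {0..1}" "x' \<in> {0..1}" "y' \<in> {0..1}" for s1 s2 x y x' y'
        using D(3)[OF that] mult_right_mono[of "2 * r" "2 * r'" "max \<bar>x - x'\<bar> \<bar>y - y'\<bar> powr \<alpha>"] h(2) by simp
    qed
  qed
  have scl: "?hb (\<bar>q\<bar> * r) (\<lambda>x y. q * f x y)" if "?hb r f" for q r f
    using holder_bounds_scale[OF that, of q] by (simp add: mult_ac)
  have add: "?hb (r + r') (\<lambda>x y. f x y + f' x y)" if "?hb r f" "?hb r' f'" for r r' f f'
    using holder_bounds_add[OF that] by (simp add: distrib_left)
  note K = holder_bound1_nonneg[OF e(1)] holder_bound1_nonneg[OF te(1)]
  have g0: "g \<ge> 0" using G(1) by linarith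
  have c2: "(c - 1)\<^sup>2 \<le> s\<^sup>2" using s(2) by (simp add: abs_le_square_iff)
  have sc: "\<bar>s * (c - 1)\<bar> \<le> s\<^sup>2"
    using mult_left_mono[OF s(2), of "\<bar>s\<bar>"] by (simp add: abs_mult power2_eq_square)
  define b1 where "b1 x = (c - 1) * ?T e1 x - s * ?T e2 x" for x
  define b2 where "b2 x = s * ?T e1 x + (c - 1) * ?T e2 x" for x
  define G11 G12 G22 where Gd: "G11 = l2_inner e1 (?T e1)" "G12 = l2_inner e1 (?T e2)" "G22 = l2_inner e2 (?T e2)"
  define q11 q12 q22 where q: "q11 = (c - 1)\<^sup>2 * G11 - 2 * s * (c - 1) * G12 + s\<^sup>2 * G22"
    "q12 = s * (c - 1) * G11 + ((c - 1)\<^sup>2 - s\<^sup>2) * G12 - s * (c - 1) * G22"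
    "q22 = s\<^sup>2 * G11 + 2 * s * (c - 1) * G12 + (c - 1)\<^sup>2 * G22"
  have bnd: "\<bar>u * G\<bar> \<le> s\<^sup>2 * g" if "\<bar>u\<bar> \<le> s\<^sup>2" "\<bar>G\<bar> \<le> g" for u G
    using that g0 unfolding abs_mult by (intro mult_mono) auto
  have B: "\<bar>(c - 1)\<^sup>2 * G11\<bar> \<le> s\<^sup>2 * g" "\<bar>(c - 1)\<^sup>2 * G22\<bar> \<le> s\<^sup>2 * g" "\<bar>s\<^sup>2 * G11\<bar> \<le> s\<^sup>2 * g" "\<bar>s\<^sup>2 * G22\<bar> \<le> s\<^sup>2 * g"
    "\<bar>(s * (c - 1)) * G12\<bar> \<le> s\<^sup>2 * g" "\<bar>(s * (c - 1)) * G11\<bar> \<le> s\<^sup>2 * g" "\<bar>(s * (c - 1)) * G22\<bar> \<le> s\<^sup>2 * g"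
    "\<bar>((c - 1)\<^sup>2 - s\<^sup>2) * G12\<bar> \<le> s\<^sup>2 * g"
    using c2 sc G by (simp_all add: Gd bnd)
  have qb: "\<bar>q11\<bar> \<le> 4 * (s\<^sup>2 * g)" "\<bar>q12\<bar> \<le> 4 * (s\<^sup>2 * g)" "\<bar>q22\<bar> \<le> 4 * (s\<^sup>2 * g)"
    unfolding q using B by (simp_all add: mult.assoc abs_le_iff)
  have tens: "?hb (\<bar>s\<bar> * (K * K')) (\<lambda>x y. v * (e x * t y))" "?hb (\<bar>s\<bar> * (K * K')) (\<lambda>x y. v * (t x * e y))"
    if "holder_bound1 m \<alpha> K e" "holder_bound1 m \<alpha> K' t" "\<bar>v\<bar> \<le> \<bar>s\<bar>" for e t v
  proof -
    have le: "\<bar>v\<bar> * (K * K') \<le> \<bar>s\<bar> * (K * K')" using that K by (intro mult_right_mono) auto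
    show "?hb (\<bar>s\<bar> * (K * K')) (\<lambda>x y. v * (e x * t y))"
      by (rule mono[OF scl[OF holder_bounds_tensor[OF that(1,2) \<alpha>]] le])
    have "?hb (\<bar>v\<bar> * (K' * K)) (\<lambda>x y. v * (t x * e y))"
      by (rule scl[OF holder_bounds_tensor[OF that(2,1) \<alpha>]])
    then show "?hb (\<bar>s\<bar> * (K * K')) (\<lambda>x y. v * (t x * e y))"
      by (rule mono) (use le in \<open>simp add: mult_ac\<close>)
  qed
  have tens2: "?hb (4 * (s\<^sup>2 * g) * (K * K)) (\<lambda>x y. v * (e x * f y))"
    if "holder_bound1 m \<alpha> K e" "holder_bound1 m \<alpha> K f" "\<bar>v\<bar> \<le> 4 * (s\<^sup>2 * g)" for e f v
    by (rule mono[OF scl[OF holder_bounds_tensor[OF that(1,2) \<alpha>]]])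
       (use that K in \<open>intro mult_right_mono, auto\<close>)
  have ss: "\<bar>-s\<bar> \<le> \<bar>s\<bar>" "\<bar>s\<bar> \<le> \<bar>s\<bar>" by auto
  let ?P = "\<lambda>x y. (c - 1) * (e1 x * ?T e1 y) + (- s) * (e1 x * ?T e2 y) + s * (e2 x * ?T e1 y) + (c - 1) * (e2 x * ?T e2 y)
     + (c - 1) * (?T e1 x * e1 y) + (- s) * (?T e2 x * e1 y) + s * (?T e1 x * e2 y) + (c - 1) * (?T e2 x * e2 y)
     + q11 * (e1 x * e1 y) + q12 * (e1 x * e2 y) + q12 * (e2 x * e1 y) + q22 * (e2 x * e2 y)"
  let ?a = "\<bar>s\<bar> * (K * K')" and ?b = "4 * (s\<^sup>2 * g) * (K * K)"
  have "?hb (?a + ?a + ?a + ?a + ?a + ?a + ?a + ?a + ?b + ?b + ?b + ?b) ?P"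
    by (intro add tens tens2 e te qb s ss)
  then have "?hb R ?P"
    by (rule mono) (use R in \<open>simp add: algebra_simps\<close>)
  from holder_bounds_add[OF \<Gamma> this]
  show ?thesis
    by (rule holder_bounds_cong[rotated])
       (simp add: rot_kernel_def Let_def q Gd algebra_simps)
qed

subsection \<open>Centered normal random variables\<close>

text \<open>Normality is encoded by the characteristic function: this covers the degenerate case v =
  0, turns independent sums into products and passes to limits in mean square.\<close>

definition centered_normal :: "'a measure \<Rightarrow> ('a \<Rightarrow> real) \<Rightarrow> real \<Rightarrow> bool" where
  "centered_normal M X v \<longleftrightarrow> X \<in> borel_measurable M \<and> 0 \<le> v \<and>
     (\<forall>t. (CLINT \<omega>|M. iexp (t * X \<omega>)) = complex_of_real (exp (- v * t\<^sup>2 / 2)))"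

text \<open>Repeats the case distinction in \<open>centered_gaussian_process\<close> literally, so
  that it can be folded there.\<close>

definition normal_law :: "real \<Rightarrow> real measure" where
  "normal_law s = (if s = 0 then return borel 0 else density lborel (normal_density 0 s))"

lemma char_distr: "X \<in> borel_measurable M \<Longrightarrow> char (distr M borel X) t = (CLINT \<omega>|M. iexp (t * X \<omega>))"
  unfolding char_def by (subst integral_distr) auto

lemma normal_law_real_distribution:
  assumes "s \<ge> 0"
  shows "real_distribution (normal_law s)"
proof (cases "s = 0")
  case True
  then show ?thesis
    unfolding real_distribution_def real_distribution_axioms_def normal_law_def
    by (auto intro!: prob_space_return)
next
  case False
  then show ?thesis
    unfolding real_distribution_def real_distribution_axioms_def normal_law_def
    using assms by (auto intro!: prob_space_normal_density)
qed

lemma normal_law_std: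
  assumes "s > 0"
  shows "distr std_normal_distribution borel (\<lambda>x. s * x) = normal_law s"
proof -
  interpret real_distribution std_normal_distribution by (rule real_dist_normal_dist)
  have "distributed std_normal_distribution lborel (\<lambda>x. x) std_normal_density"
    unfolding distributed_def by (auto simp: distr_id2)
  from normal_density_affine[OF this, of s 0] assms
  have "distributed std_normal_distribution lborel (\<lambda>x. s * x) (normal_density 0 s)" by simp
  then have "distr std_normal_distribution lborel (\<lambda>x. s * x) = density lborel (normal_density 0 s)"
    by (rule distributed_distr_eq_density)
  moreover have "distr std_normal_distribution lborel (\<lambda>x. s * x) = distr std_normal_distribution borel (\<lambda>x. s * x)"
    by (rule distr_cong) auto
  ultimately show ?thesis using assms by (simp add: normal_law_def)
qed

lemma char_normal_law:
  assumes "s \<ge> 0"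
  shows "char (normal_law s) t = complex_of_real (exp (- s\<^sup>2 * t\<^sup>2 / 2))"
proof (cases "s = 0")
  case True
  then show ?thesis by (simp add: normal_law_def char_def integral_return)
next
  case False
  then have s: "s > 0" using assms by simp
  have "char (normal_law s) t = (CLINT x|std_normal_distribution. iexp ((t * s) * x))"
    unfolding normal_law_std[OF s, symmetric] by (subst char_distr) (auto simp: mult.assoc)
  also have "\<dots> = char std_normal_distribution (t * s)" by (simp add: char_def)
  also have "\<dots> = complex_of_real (exp (- s\<^sup>2 * t\<^sup>2 / 2))"
    by (simp add: char_std_normal_distribution power_mult_distrib mult_ac)
  finally show ?thesis .
qed

lemma centered_normal_distr:
  assumes "prob_space M" "centered_normal M X v"
  shows "distr M borel X = normal_law (sqrt v)"
proof (rule Levy_uniqueness)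
  interpret prob_space M by fact
  have X: "X \<in> borel_measurable M" "v \<ge> 0" using assms(2) by (auto simp: centered_normal_def)
  show "real_distribution (distr M borel X)" using X by auto
  show "real_distribution (normal_law (sqrt v))" using X by (auto intro: normal_law_real_distribution)
  show "char (distr M borel X) = char (normal_law (sqrt v))"
    using assms(2) X by (auto simp: char_distr char_normal_law centered_normal_def)
qed

lemma centered_normalI:
  assumes "X \<in> borel_measurable M" "s \<ge> 0" "distr M borel X = normal_law s"
  shows "centered_normal M X (s\<^sup>2)"
  using assms char_distr[OF assms(1)] char_normal_law[OF assms(2)]
  by (auto simp: centered_normal_def)

lemma normal_law_second_moment:
  assumes "s \<ge> 0"
  shows "integrable (normal_law s) (\<lambda>x. x\<^sup>2)" "(\<integral>x. x\<^sup>2 \<partial>normal_law s) = s\<^sup>2"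
proof -
  have "integrable (normal_law s) (\<lambda>x. x\<^sup>2) \<and> (\<integral>x. x\<^sup>2 \<partial>normal_law s) = s\<^sup>2"
  proof (cases "s = 0")
    case True
    then show ?thesis by (auto simp: normal_law_def integral_return intro!: integrableI_bounded)
       (simp add: nn_integral_return)
  next
    case False
    then have s: "s > 0" using assms by simp
    have "has_bochner_integral lborel (\<lambda>x. normal_density 0 s x * (x - 0) ^ (2 * 1)) (s\<^sup>2)"
      using normal_moment_even[OF s, of 0 1] s by (simp add: field_simps fact_numeral)
    then have "has_bochner_integral lborel (\<lambda>x. normal_density 0 s x *\<^sub>R x\<^sup>2) (s\<^sup>2)" by simp
    then have "has_bochner_integral (normal_law s) (\<lambda>x. x\<^sup>2) (s\<^sup>2)"
      unfolding normal_law_def using s by (auto intro!: has_bochner_integral_density)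
    then show ?thesis by (auto simp: has_bochner_integral_iff)
  qed
  then show "integrable (normal_law s) (\<lambda>x. x\<^sup>2)" "(\<integral>x. x\<^sup>2 \<partial>normal_law s) = s\<^sup>2" by auto
qed

lemma centered_normal_second_moment:
  assumes "prob_space M" "centered_normal M X v"
  shows "integrable M (\<lambda>\<omega>. (X \<omega>)\<^sup>2)" "(\<integral>\<omega>. (X \<omega>)\<^sup>2 \<partial>M) = v"
proof -
  have X: "X \<in> borel_measurable M" "v \<ge> 0" using assms(2) by (auto simp: centered_normal_def)
  have m: "integrable (distr M borel X) (\<lambda>x. x\<^sup>2)" "(\<integral>x. x\<^sup>2 \<partial>distr M borel X) = v"
    unfolding centered_normal_distr[OF assms] using normal_law_second_moment[of "sqrt v"] X by auto
  show "integrable M (\<lambda>\<omega>. (X \<omega>)\<^sup>2)" "(\<integral>\<omega>. (X \<omega>)\<^sup>2 \<partial>M) = v"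
    using m X by (auto simp: integrable_distr_eq integral_distr)
qed

lemma centered_normal_std:
  "centered_normal std_normal_distribution (\<lambda>x. r * x) (r\<^sup>2)"
proof -
  have "(CLINT x|std_normal_distribution. iexp (t * (r * x))) = char std_normal_distribution (t * r)" for t
    by (simp add: char_def mult.assoc)
  then show ?thesis
    by (simp add: centered_normal_def char_std_normal_distribution power_mult_distrib mult_ac)
qed

lemma centered_normal_pair:
  assumes M: "prob_space M" and N: "prob_space N"
    and X: "centered_normal M X v" and Y: "centered_normal N Y w"
  shows "centered_normal (M \<Otimes>\<^sub>M N) (\<lambda>(x, y). X x + Y y) (v + w)"
proof -
  interpret M: prob_space M by fact
  interpret N: prob_space N by fact
  interpret pair_prob_space M N by unfold_locales
  have [measurable]: "X \<in> borel_measurable M" "Y \<in> borel_measurable N"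
    using X Y by (auto simp: centered_normal_def)
  have "(CLINT z|M \<Otimes>\<^sub>M N. iexp (t * (case z of (x, y) \<Rightarrow> X x + Y y))) = complex_of_real (exp (- (v + w) * t\<^sup>2 / 2))" for t
  proof -
    have int: "integrable (M \<Otimes>\<^sub>M N) (\<lambda>(x, y). iexp (t * (X x + Y y)))"
      by (rule integrable_const_bound[of _ 1]) auto
    have "(CLINT z|M \<Otimes>\<^sub>M N. iexp (t * (case z of (x, y) \<Rightarrow> X x + Y y)))
       = (CLINT z|M \<Otimes>\<^sub>M N. (\<lambda>(x, y). iexp (t * (X x + Y y))) z)"
      by (intro Bochner_Integration.integral_cong) auto
    also have "\<dots> = (CLINT x|M. CLINT y|N. iexp (t * (X x + Y y)))"
      using integral_fst'[OF int] by simp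
    also have "\<dots> = (CLINT x|M. CLINT y|N. iexp (t * X x) * iexp (t * Y y))"
      by (simp add: distrib_left exp_add)
    also have "\<dots> = (CLINT x|M. iexp (t * X x)) * (CLINT y|N. iexp (t * Y y))"
      by simp
    also have "\<dots> = complex_of_real (exp (- v * t\<^sup>2 / 2)) * complex_of_real (exp (- w * t\<^sup>2 / 2))"
      using X Y by (simp add: centered_normal_def)
    also have "\<dots> = complex_of_real (exp (- (v + w) * t\<^sup>2 / 2))"
      unfolding of_real_mult[symmetric] exp_add[symmetric] by (simp add: field_simps)
    finally show ?thesis .
  qed
  then show ?thesis using X Y unfolding centered_normal_def by auto
qed

subsection \<open>Square integrable random variables\<close>

definition sq_rv :: "'a measure \<Rightarrow> ('a \<Rightarrow> real) \<Rightarrow> bool" where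
  "sq_rv M X \<longleftrightarrow> X \<in> borel_measurable M \<and> integrable M (\<lambda>\<omega>. (X \<omega>)\<^sup>2)"

lemma sq_rv_mult:
  assumes X: "sq_rv M X" and Y: "sq_rv M Y"
  shows "integrable M (\<lambda>\<omega>. X \<omega> * Y \<omega>)"
proof (rule Bochner_Integration.integrable_bound)
  show "integrable M (\<lambda>x. (X x)\<^sup>2 + (Y x)\<^sup>2)" using X Y by (auto simp: sq_rv_def)
  show "(\<lambda>x. X x * Y x) \<in> borel_measurable M" using X Y by (auto simp: sq_rv_def)
  have "\<bar>a * b\<bar> \<le> a\<^sup>2 + b\<^sup>2" for a b :: real
  proof -
    have "2 * \<bar>a\<bar> * \<bar>b\<bar> \<le> \<bar>a\<bar>\<^sup>2 + \<bar>b\<bar>\<^sup>2" by (rule sum_squares_bound)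
    moreover have "0 \<le> \<bar>a\<bar> * \<bar>b\<bar>" by simp
    ultimately show ?thesis unfolding abs_mult power2_abs by linarith
  qed
  then show "AE x in M. norm (X x * Y x) \<le> norm ((X x)\<^sup>2 + (Y x)\<^sup>2)"
    by (intro AE_I2) (auto simp: abs_of_nonneg)
qed

lemma sq_rv_comb:
  assumes X: "sq_rv M X" and Y: "sq_rv M Y"
  shows "sq_rv M (\<lambda>\<omega>. a * X \<omega> + b * Y \<omega>)"
    "(\<integral>\<omega>. (a * X \<omega> + b * Y \<omega>)\<^sup>2 \<partial>M) = a\<^sup>2 * (\<integral>\<omega>. (X \<omega>)\<^sup>2 \<partial>M) + 2 * a * b * (\<integral>\<omega>. X \<omega> * Y \<omega> \<partial>M) + b\<^sup>2 * (\<integral>\<omega>. (Y \<omega>)\<^sup>2 \<partial>M)"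
proof -
  have i: "integrable M (\<lambda>\<omega>. (X \<omega>)\<^sup>2)" "integrable M (\<lambda>\<omega>. (Y \<omega>)\<^sup>2)" "integrable M (\<lambda>\<omega>. X \<omega> * Y \<omega>)"
    using X Y sq_rv_mult[OF X Y] by (auto simp: sq_rv_def)
  have eq: "(a * X \<omega> + b * Y \<omega>)\<^sup>2 = a\<^sup>2 * (X \<omega>)\<^sup>2 + 2 * a * b * (X \<omega> * Y \<omega>) + b\<^sup>2 * (Y \<omega>)\<^sup>2" for \<omega>
    by (simp add: power2_eq_square algebra_simps)
  show "sq_rv M (\<lambda>\<omega>. a * X \<omega> + b * Y \<omega>)"
    unfolding sq_rv_def eq using X Y i by (auto simp: sq_rv_def)
  show "(\<integral>\<omega>. (a * X \<omega> + b * Y \<omega>)\<^sup>2 \<partial>M) = a\<^sup>2 * (\<integral>\<omega>. (X \<omega>)\<^sup>2 \<partial>M) + 2 * a * b * (\<integral>\<omega>. X \<omega> * Y \<omega> \<partial>M) + b\<^sup>2 * (\<integral>\<omega>. (Y \<omega>)\<^sup>2 \<partial>M)"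
    unfolding eq using i by simp
qed

lemma sq_rv_cauchy_schwarz:
  assumes X: "sq_rv M X" and Y: "sq_rv M Y"
  shows "(\<integral>\<omega>. X \<omega> * Y \<omega> \<partial>M)\<^sup>2 \<le> (\<integral>\<omega>. (X \<omega>)\<^sup>2 \<partial>M) * (\<integral>\<omega>. (Y \<omega>)\<^sup>2 \<partial>M)"
proof -
  define a b c where "a = (\<integral>\<omega>. (X \<omega>)\<^sup>2 \<partial>M)" "b = (\<integral>\<omega>. X \<omega> * Y \<omega> \<partial>M)" "c = (\<integral>\<omega>. (Y \<omega>)\<^sup>2 \<partial>M)"
  have nn: "0 \<le> u\<^sup>2 * a + 2 * u * v * b + v\<^sup>2 * c" for u v
  proof -
    have "0 \<le> (\<integral>\<omega>. (u * X \<omega> + v * Y \<omega>)\<^sup>2 \<partial>M)" by simp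
    then show ?thesis unfolding sq_rv_comb(2)[OF X Y] a_b_c_def .
  qed
  have ac: "a \<ge> 0" "c \<ge> 0" by (simp_all add: a_b_c_def)
  have "b\<^sup>2 \<le> a * c"
  proof (cases "c = 0")
    case False
    then have "c > 0" using ac by simp
    \<comment> \<open>The nonnegative quadratic form is tested at (c, -b), which is, up to scaling,
      its minimiser in the second argument.\<close>
    have "0 \<le> c\<^sup>2 * a + 2 * c * (- b) * b + (- b)\<^sup>2 * c" by (rule nn)
    also have "\<dots> = c * (a * c - b\<^sup>2)" by (simp add: power2_eq_square algebra_simps)
    finally show ?thesis using \<open>c > 0\<close> by (simp add: zero_le_mult_iff)
  next
    case True
    have "0 \<le> 1\<^sup>2 * a + 2 * 1 * (- b * (a + 1)) * b + (- b * (a + 1))\<^sup>2 * c" by (rule nn)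
    also have "\<dots> = a - 2 * (a + 1) * b\<^sup>2" using True by (simp add: power2_eq_square algebra_simps)
    finally have 1: "2 * (a + 1) * b\<^sup>2 \<le> a" by simp
    have 2: "0 \<le> v * b * 2 + a" for v using nn[of 1 v] True by simp
    show ?thesis
    proof (cases "b = 0")
      case False
      \<comment> \<open>With c = 0 the form is affine in v and stays nonnegative only if b = 0; this
        v would make it -1.\<close>
      from 2[of "- (a + 1) / (2 * b)"] False have "0 \<le> - (a + 1) + a" by (simp add: field_simps)
      then show ?thesis by simp
    qed (use True in simp)
  qed
  then show ?thesis by (simp add: a_b_c_def)
qed

lemma sq_rv_cauchy_schwarz_abs:
  assumes X: "sq_rv M X" and Y: "sq_rv M Y"
  shows "\<bar>\<integral>\<omega>. X \<omega> * Y \<omega> \<partial>M\<bar> \<le> sqrt (\<integral>\<omega>. (X \<omega>)\<^sup>2 \<partial>M) * sqrt (\<integral>\<omega>. (Y \<omega>)\<^sup>2 \<partial>M)"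
  unfolding real_sqrt_mult[symmetric] using sq_rv_cauchy_schwarz[OF assms] by (intro real_le_rsqrt) simp

lemma sq_rv_const: "prob_space M \<Longrightarrow> sq_rv M (\<lambda>_. a)"
  by (simp add: sq_rv_def prob_space.emeasure_space_1 prob_space_def finite_measure.integrable_const)

lemma sq_rv_abs: "sq_rv M X \<Longrightarrow> sq_rv M (\<lambda>\<omega>. \<bar>X \<omega>\<bar>)"
  by (auto simp: sq_rv_def)

lemma sq_rv_L1_le:
  assumes M: "prob_space M" and X: "sq_rv M X"
  shows "integrable M X" "(\<integral>\<omega>. \<bar>X \<omega>\<bar> \<partial>M) \<le> sqrt (\<integral>\<omega>. (X \<omega>)\<^sup>2 \<partial>M)"
proof -
  interpret prob_space M by fact
  show "integrable M X" using sq_rv_mult[OF X sq_rv_const[OF M, of 1]] by simp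
  show "(\<integral>\<omega>. \<bar>X \<omega>\<bar> \<partial>M) \<le> sqrt (\<integral>\<omega>. (X \<omega>)\<^sup>2 \<partial>M)"
    using sq_rv_cauchy_schwarz_abs[OF sq_rv_abs[OF X] sq_rv_const[OF M, of 1]] by (simp add: prob_space)
qed

lemma sq_rv_inner_tendsto:
  assumes S: "\<And>n. sq_rv M (S n)" and X: "sq_rv M X" and Y: "sq_rv M Y"
    and lim: "(\<lambda>n. \<integral>\<omega>. (S n \<omega> - X \<omega>)\<^sup>2 \<partial>M) \<longlonglongrightarrow> 0"
  shows "(\<lambda>n. \<integral>\<omega>. S n \<omega> * Y \<omega> \<partial>M) \<longlonglongrightarrow> (\<integral>\<omega>. X \<omega> * Y \<omega> \<partial>M)"
proof (rule LIM_zero_cancel, rule Lim_null_comparison)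
  have D: "sq_rv M (\<lambda>\<omega>. S n \<omega> - X \<omega>)" for n using sq_rv_comb(1)[OF S X, where a=1 and b="-1"] by simp
  have "\<bar>(\<integral>\<omega>. S n \<omega> * Y \<omega> \<partial>M) - (\<integral>\<omega>. X \<omega> * Y \<omega> \<partial>M)\<bar> \<le> sqrt (\<integral>\<omega>. (S n \<omega> - X \<omega>)\<^sup>2 \<partial>M) * sqrt (\<integral>\<omega>. (Y \<omega>)\<^sup>2 \<partial>M)" for n
    using sq_rv_cauchy_schwarz_abs[OF D Y] sq_rv_mult[OF S Y] sq_rv_mult[OF X Y]
    by (simp add: left_diff_distrib)
  then show "\<forall>\<^sub>F n in sequentially. norm ((\<integral>\<omega>. S n \<omega> * Y \<omega> \<partial>M) - (\<integral>\<omega>. X \<omega> * Y \<omega> \<partial>M)) \<le> sqrt (\<integral>\<omega>. (S n \<omega> - X \<omega>)\<^sup>2 \<partial>M) * sqrt (\<integral>\<omega>. (Y \<omega>)\<^sup>2 \<partial>M)"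
    by simp
  have "(\<lambda>n. sqrt (\<integral>\<omega>. (S n \<omega> - X \<omega>)\<^sup>2 \<partial>M) * sqrt (\<integral>\<omega>. (Y \<omega>)\<^sup>2 \<partial>M)) \<longlonglongrightarrow> sqrt 0 * sqrt (\<integral>\<omega>. (Y \<omega>)\<^sup>2 \<partial>M)"
    by (intro tendsto_intros lim)
  then show "(\<lambda>n. sqrt (\<integral>\<omega>. (S n \<omega> - X \<omega>)\<^sup>2 \<partial>M) * sqrt (\<integral>\<omega>. (Y \<omega>)\<^sup>2 \<partial>M)) \<longlonglongrightarrow> 0" by simp
qed

lemma sq_rv_square_tendsto:
  assumes S: "\<And>n. sq_rv M (S n)" and X: "sq_rv M X"
    and lim: "(\<lambda>n. \<integral>\<omega>. (S n \<omega> - X \<omega>)\<^sup>2 \<partial>M) \<longlonglongrightarrow> 0"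
  shows "(\<lambda>n. \<integral>\<omega>. (S n \<omega>)\<^sup>2 \<partial>M) \<longlonglongrightarrow> (\<integral>\<omega>. (X \<omega>)\<^sup>2 \<partial>M)"
proof -
  have eq: "(\<integral>\<omega>. (S n \<omega>)\<^sup>2 \<partial>M) = (\<integral>\<omega>. (S n \<omega> - X \<omega>)\<^sup>2 \<partial>M) + 2 * (\<integral>\<omega>. S n \<omega> * X \<omega> \<partial>M) - (\<integral>\<omega>. X \<omega> * X \<omega> \<partial>M)" for n
    using sq_rv_comb(2)[OF S X, where a=1 and b="-1"] by (simp add: power2_eq_square)
  have "(\<lambda>n. (\<integral>\<omega>. (S n \<omega> - X \<omega>)\<^sup>2 \<partial>M) + 2 * (\<integral>\<omega>. S n \<omega> * X \<omega> \<partial>M) - (\<integral>\<omega>. X \<omega> * X \<omega> \<partial>M))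
    \<longlonglongrightarrow> 0 + 2 * (\<integral>\<omega>. X \<omega> * X \<omega> \<partial>M) - (\<integral>\<omega>. X \<omega> * X \<omega> \<partial>M)"
    by (intro tendsto_intros lim sq_rv_inner_tendsto[OF S X X])
  then show ?thesis unfolding eq by (simp add: power2_eq_square)
qed

lemma iexp_diff_le: "cmod (iexp x - iexp y) \<le> \<bar>x - y\<bar>"
proof -
  have "iexp x - iexp y = iexp y * (iexp (x - y) - 1)"
    by (simp add: right_diff_distrib exp_add[symmetric] algebra_simps)
  then have "cmod (iexp x - iexp y) = cmod (iexp (x - y) - 1)" by (simp add: norm_mult)
  also have "\<dots> \<le> \<bar>x - y\<bar>" using iexp_approx1[of "x - y" 0] by simp
  finally show ?thesis .
qed

text \<open>The function \<open>iexp\<close> is Lipschitz with constant 1, so the characteristic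
  functions at t differ by at most |t| times the L1 distance, hence by at most |t| times the L2
  distance. The variances converge as well, which identifies the limit.\<close>

lemma centered_normal_limit:
  assumes M: "prob_space M" and S: "\<And>n. centered_normal M (S n) (v n)" and X: "sq_rv M X"
    and lim: "(\<lambda>n. \<integral>\<omega>. (S n \<omega> - X \<omega>)\<^sup>2 \<partial>M) \<longlonglongrightarrow> 0"
  shows "centered_normal M X (\<integral>\<omega>. (X \<omega>)\<^sup>2 \<partial>M)"
proof -
  interpret prob_space M by fact
  have Ss: "sq_rv M (S n)" and v: "(\<integral>\<omega>. (S n \<omega>)\<^sup>2 \<partial>M) = v n" for n
    using centered_normal_second_moment[OF M S] S[of n] by (auto simp: sq_rv_def centered_normal_def)
  have [measurable]: "X \<in> borel_measurable M" "S n \<in> borel_measurable M" for n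
    using X Ss by (auto simp: sq_rv_def)
  let ?v = "\<integral>\<omega>. (X \<omega>)\<^sup>2 \<partial>M"
  have vl: "v \<longlonglongrightarrow> ?v" using sq_rv_square_tendsto[OF Ss X lim] by (simp add: v)
  have "(CLINT \<omega>|M. iexp (t * X \<omega>)) = complex_of_real (exp (- ?v * t\<^sup>2 / 2))" for t
  proof -
    have ii: "integrable M (\<lambda>\<omega>. iexp (t * X \<omega>))" "integrable M (\<lambda>\<omega>. iexp (t * S n \<omega>))" for n
      by (rule integrable_const_bound[of _ 1]; simp)+
    have "(\<lambda>n. CLINT \<omega>|M. iexp (t * S n \<omega>)) \<longlonglongrightarrow> (CLINT \<omega>|M. iexp (t * X \<omega>))"
    proof (rule LIM_zero_cancel, rule Lim_null_comparison)
      show "\<forall>\<^sub>F n in sequentially. norm ((CLINT \<omega>|M. iexp (t * S n \<omega>)) - (CLINT \<omega>|M. iexp (t * X \<omega>)))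
         \<le> \<bar>t\<bar> * sqrt (\<integral>\<omega>. (S n \<omega> - X \<omega>)\<^sup>2 \<partial>M)"
      proof (intro always_eventually allI)
        fix n
        have D: "sq_rv M (\<lambda>\<omega>. S n \<omega> - X \<omega>)" using sq_rv_comb(1)[OF Ss X, where a=1 and b="-1"] by simp
        have "norm ((CLINT \<omega>|M. iexp (t * S n \<omega>)) - (CLINT \<omega>|M. iexp (t * X \<omega>)))
           = norm (CLINT \<omega>|M. iexp (t * S n \<omega>) - iexp (t * X \<omega>))" using ii by simp
        also have "\<dots> \<le> (\<integral>\<omega>. norm (iexp (t * S n \<omega>) - iexp (t * X \<omega>)) \<partial>M)" by (rule integral_norm_bound)
        also have "\<dots> \<le> (\<integral>\<omega>. \<bar>t\<bar> * \<bar>S n \<omega> - X \<omega>\<bar> \<partial>M)"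
        proof (rule integral_mono)
          show "integrable M (\<lambda>\<omega>. norm (iexp (t * S n \<omega>) - iexp (t * X \<omega>)))"
            using ii by (intro integrable_norm Bochner_Integration.integrable_diff)
          show "integrable M (\<lambda>\<omega>. \<bar>t\<bar> * \<bar>S n \<omega> - X \<omega>\<bar>)" using sq_rv_L1_le(1)[OF M D] by auto
          show "norm (iexp (t * S n \<omega>) - iexp (t * X \<omega>)) \<le> \<bar>t\<bar> * \<bar>S n \<omega> - X \<omega>\<bar>" for \<omega>
            using iexp_diff_le[of "t * S n \<omega>" "t * X \<omega>"] by (simp add: abs_mult[symmetric] right_diff_distrib)
        qed
        also have "\<dots> \<le> \<bar>t\<bar> * sqrt (\<integral>\<omega>. (S n \<omega> - X \<omega>)\<^sup>2 \<partial>M)"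
          using sq_rv_L1_le(2)[OF M D] by (simp add: mult_left_mono)
        finally show "norm ((CLINT \<omega>|M. iexp (t * S n \<omega>)) - (CLINT \<omega>|M. iexp (t * X \<omega>)))
         \<le> \<bar>t\<bar> * sqrt (\<integral>\<omega>. (S n \<omega> - X \<omega>)\<^sup>2 \<partial>M)" .
      qed
      have "(\<lambda>n. \<bar>t\<bar> * sqrt (\<integral>\<omega>. (S n \<omega> - X \<omega>)\<^sup>2 \<partial>M)) \<longlonglongrightarrow> \<bar>t\<bar> * sqrt 0"
        by (intro tendsto_intros lim)
      then show "(\<lambda>n. \<bar>t\<bar> * sqrt (\<integral>\<omega>. (S n \<omega> - X \<omega>)\<^sup>2 \<partial>M)) \<longlonglongrightarrow> 0" by simp
    qed
    moreover have "(\<lambda>n. CLINT \<omega>|M. iexp (t * S n \<omega>)) \<longlonglongrightarrow> complex_of_real (exp (- ?v * t\<^sup>2 / 2))"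
    proof -
      have "(\<lambda>n. complex_of_real (exp (- v n * t\<^sup>2 / 2))) \<longlonglongrightarrow> complex_of_real (exp (- ?v * t\<^sup>2 / 2))"
        by (intro tendsto_intros vl) auto
      then show ?thesis using S by (simp add: centered_normal_def)
    qed
    ultimately show ?thesis by (rule LIMSEQ_unique)
  qed
  then show ?thesis using X by (auto simp: centered_normal_def sq_rv_def)
qed

subsection \<open>The Gaussian Hilbert space of a process\<close>

definition lin_comb :: "(real \<Rightarrow> real) set \<Rightarrow> ((real \<Rightarrow> real) \<Rightarrow> real) \<Rightarrow> bool" where
  "lin_comb \<Omega> X \<longleftrightarrow> (\<exists>J c. finite J \<and> J \<subseteq> {0..1} \<and> (\<forall>z\<in>\<Omega>. X z = (\<Sum>t\<in>J. c t * z t)))"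

text \<open>The closure in mean square of the linear span of the coordinates. It is a linear space
  whose elements are all centered normal, so random coefficients taken from it keep a modified
  process Gaussian.\<close>

definition gauss_space :: "(real \<Rightarrow> real) measure \<Rightarrow> ((real \<Rightarrow> real) \<Rightarrow> real) \<Rightarrow> bool" where
  "gauss_space P X \<longleftrightarrow> sq_rv P X \<and>
     (\<exists>S. (\<forall>n. S n \<in> borel_measurable P \<and> lin_comb UNIV (S n)) \<and> (\<lambda>n. \<integral>z. (S n z - X z)\<^sup>2 \<partial>P) \<longlonglongrightarrow> 0)"

lemma lin_comb_comb:
  assumes "lin_comb \<Omega> X" "lin_comb \<Omega> Y"
  shows "lin_comb \<Omega> (\<lambda>z. a * X z + b * Y z)"
proof -
  obtain J c where X: "finite J" "J \<subseteq> {0..1}" "\<And>z. z \<in> \<Omega> \<Longrightarrow> X z = (\<Sum>t\<in>J. c t * z t)"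
    using assms(1) unfolding lin_comb_def by blast
  obtain K d where Y: "finite K" "K \<subseteq> {0..1}" "\<And>z. z \<in> \<Omega> \<Longrightarrow> Y z = (\<Sum>t\<in>K. d t * z t)"
    using assms(2) unfolding lin_comb_def by blast
  define e where "e t = a * (if t \<in> J then c t else 0) + b * (if t \<in> K then d t else 0)" for t
  have "a * X z + b * Y z = (\<Sum>t\<in>J \<union> K. e t * z t)" if "z \<in> \<Omega>" for z
  proof -
    have "X z = (\<Sum>t\<in>J \<union> K. (if t \<in> J then c t else 0) * z t)"
      unfolding X(3)[OF that] using X(1) Y(1) by (intro sum.mono_neutral_cong_left) auto
    moreover have "Y z = (\<Sum>t\<in>J \<union> K. (if t \<in> K then d t else 0) * z t)"
      unfolding Y(3)[OF that] using X(1) Y(1) by (intro sum.mono_neutral_cong_left) auto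
    ultimately show ?thesis
      by (simp add: e_def sum_distrib_left sum.distrib[symmetric] algebra_simps)
  qed
  then show ?thesis unfolding lin_comb_def using X Y
    by (intro exI[of _ "J \<union> K"] exI[of _ e]) auto
qed

locale gauss_process =
  fixes P :: "(real \<Rightarrow> real) measure"
  assumes gp: "centered_gaussian_process P"
begin

sublocale prob_space P using gp by (simp add: centered_gaussian_process_def)

lemma sets_P: "sets P = sets path_space" using gp by (simp add: centered_gaussian_process_def)

lemma coord_measurable [measurable]: "t \<in> {0..1} \<Longrightarrow> (\<lambda>z. z t) \<in> borel_measurable P"
  unfolding measurable_cong_sets[OF sets_P refl] path_space_def by (rule measurable_component_singleton)

lemma lin_comb_measurable: "lin_comb UNIV X \<Longrightarrow> X \<in> borel_measurable P"
proof -
  assume "lin_comb UNIV X"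
  then obtain J c where X: "finite J" "J \<subseteq> {0..1}" "X = (\<lambda>z. \<Sum>t\<in>J. c t * z t)"
    unfolding lin_comb_def by (auto simp: fun_eq_iff)
  show ?thesis unfolding X(3) using X(2)
    by (intro borel_measurable_sum borel_measurable_times coord_measurable) auto
qed

lemma lin_comb_normal:
  assumes "lin_comb UNIV X"
  shows "\<exists>v. centered_normal P X v"
proof -
  obtain J c where X: "finite J" "J \<subseteq> {0..1}" "X = (\<lambda>z. \<Sum>t\<in>J. c t * z t)"
    using assms unfolding lin_comb_def by (auto simp: fun_eq_iff)
  obtain s where "s \<ge> 0" "distr P borel X = normal_law s"
    using gp X unfolding centered_gaussian_process_def normal_law_def by blast
  then show ?thesis using centered_normalI lin_comb_measurable[OF assms] by blast
qed

lemma lin_comb_sq: "lin_comb UNIV X \<Longrightarrow> sq_rv P X"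
  using lin_comb_normal[of X] centered_normal_second_moment[OF prob_space_axioms, of X] lin_comb_measurable[of X]
  by (auto simp: sq_rv_def)

lemma gauss_space_normal:
  assumes "gauss_space P X"
  shows "centered_normal P X (\<integral>z. (X z)\<^sup>2 \<partial>P)"
proof -
  obtain S where X: "sq_rv P X" and S: "\<And>n. lin_comb UNIV (S n)" "(\<lambda>n. \<integral>z. (S n z - X z)\<^sup>2 \<partial>P) \<longlonglongrightarrow> 0"
    using assms unfolding gauss_space_def by blast
  obtain v where "\<And>n. centered_normal P (S n) (v n)"
    using lin_comb_normal[OF S(1)] by metis
  from centered_normal_limit[OF prob_space_axioms this X S(2)] show ?thesis .
qed

lemma gauss_space_sq: "gauss_space P X \<Longrightarrow> sq_rv P X"
  by (simp add: gauss_space_def)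

lemma lin_comb_gauss_space: "lin_comb UNIV X \<Longrightarrow> gauss_space P X"
  unfolding gauss_space_def using lin_comb_sq[of X] lin_comb_measurable[of X]
  by (auto intro!: exI[of _ "\<lambda>_. X"])

lemma lin_comb_coord: "t \<in> {0..1} \<Longrightarrow> lin_comb UNIV (\<lambda>z. z t)"
  unfolding lin_comb_def by (intro exI[of _ "{t}"] exI[of _ "\<lambda>_. 1"]) auto

lemma gauss_space_coord: "t \<in> {0..1} \<Longrightarrow> gauss_space P (\<lambda>z. z t)"
  by (intro lin_comb_gauss_space lin_comb_coord)

lemma gauss_space_comb:
  assumes X: "gauss_space P X" and Y: "gauss_space P Y"
  shows "gauss_space P (\<lambda>z. a * X z + b * Y z)"
proof -
  obtain S where S: "\<And>n. lin_comb UNIV (S n)" "(\<lambda>n. \<integral>z. (S n z - X z)\<^sup>2 \<partial>P) \<longlonglongrightarrow> 0"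
    using X unfolding gauss_space_def by blast
  obtain R where R: "\<And>n. lin_comb UNIV (R n)" "(\<lambda>n. \<integral>z. (R n z - Y z)\<^sup>2 \<partial>P) \<longlonglongrightarrow> 0"
    using Y unfolding gauss_space_def by blast
  have XY: "sq_rv P X" "sq_rv P Y" using X Y gauss_space_sq by auto
  have D: "sq_rv P (\<lambda>z. S n z - X z)" "sq_rv P (\<lambda>z. R n z - Y z)" for n
    using sq_rv_comb(1)[OF lin_comb_sq[OF S(1)] XY(1), where a=1 and b="-1"]
      sq_rv_comb(1)[OF lin_comb_sq[OF R(1)] XY(2), where a=1 and b="-1"] by simp_all
  define Q where "Q n z = a * S n z + b * R n z" for n z
  have Q: "lin_comb UNIV (Q n)" for n unfolding Q_def by (rule lin_comb_comb[OF S(1) R(1)])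
  have le: "(\<integral>z. (Q n z - (a * X z + b * Y z))\<^sup>2 \<partial>P) \<le> 2 * a\<^sup>2 * (\<integral>z. (S n z - X z)\<^sup>2 \<partial>P) + 2 * b\<^sup>2 * (\<integral>z. (R n z - Y z)\<^sup>2 \<partial>P)" for n
  proof -
    let ?U = "\<lambda>z. S n z - X z" and ?V = "\<lambda>z. R n z - Y z"
    have "(\<integral>z. (Q n z - (a * X z + b * Y z))\<^sup>2 \<partial>P) = (\<integral>z. (a * ?U z + b * ?V z)\<^sup>2 \<partial>P)"
      by (simp add: Q_def algebra_simps)
    \<comment> \<open>Expanding this second nonnegative square as well gives the inequality (x +
      y)^2 \<le> 2 x^2 + 2 y^2 in the mean.\<close>
    moreover have "0 \<le> (\<integral>z. (a * ?U z + (- b) * ?V z)\<^sup>2 \<partial>P)" by simp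
    ultimately show ?thesis
      unfolding sq_rv_comb(2)[OF D[of n]] by simp
  qed
  have "(\<lambda>n. 2 * a\<^sup>2 * (\<integral>z. (S n z - X z)\<^sup>2 \<partial>P) + 2 * b\<^sup>2 * (\<integral>z. (R n z - Y z)\<^sup>2 \<partial>P)) \<longlonglongrightarrow> 2 * a\<^sup>2 * 0 + 2 * b\<^sup>2 * 0"
    by (intro tendsto_add tendsto_mult_left S(2) R(2))
  then have l0: "(\<lambda>n. 2 * a\<^sup>2 * (\<integral>z. (S n z - X z)\<^sup>2 \<partial>P) + 2 * b\<^sup>2 * (\<integral>z. (R n z - Y z)\<^sup>2 \<partial>P)) \<longlonglongrightarrow> 0" by simp
  have "(\<lambda>n. \<integral>z. (Q n z - (a * X z + b * Y z))\<^sup>2 \<partial>P) \<longlonglongrightarrow> 0"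
  proof (rule Lim_null_comparison[OF always_eventually l0], rule allI)
    show "norm (\<integral>z. (Q n z - (a * X z + b * Y z))\<^sup>2 \<partial>P) \<le> 2 * a\<^sup>2 * (\<integral>z. (S n z - X z)\<^sup>2 \<partial>P) + 2 * b\<^sup>2 * (\<integral>z. (R n z - Y z)\<^sup>2 \<partial>P)" for n
      using le[of n] by simp
  qed
  then show ?thesis unfolding gauss_space_def
    using sq_rv_comb(1)[OF XY] Q lin_comb_measurable[OF Q] by (intro conjI exI[of _ Q]) auto
qed

lemma gauss_space_zero: "gauss_space P (\<lambda>z. 0)"
  by (rule lin_comb_gauss_space) (auto simp: lin_comb_def intro!: exI[of _ "{}"])

lemma gauss_space_sum:
  assumes "finite J" "\<And>t. t \<in> J \<Longrightarrow> gauss_space P (X t)"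
  shows "gauss_space P (\<lambda>z. \<Sum>t\<in>J. c t * X t z)"
  using assms
proof (induction J rule: finite_induct)
  case empty then show ?case by (simp add: gauss_space_zero)
next
  case (insert t J)
  then show ?case using gauss_space_comb[of "X t" "\<lambda>z. \<Sum>t\<in>J. c t * X t z" "c t" 1] by simp
qed

lemma cov_kernel_sym: "cov_kernel P x y = cov_kernel P y x"
  by (simp add: cov_kernel_def mult.commute)

end

section \<open>Riemann sums\<close>

lemma riemann_sum_bound:
  fixes h :: "real \<Rightarrow> real"
  assumes h: "continuous_on {0..1} h" and N: "0 < N"
    and osc: "\<And>x y. x \<in> {0..1} \<Longrightarrow> y \<in> {0..1} \<Longrightarrow> \<bar>x - y\<bar> \<le> 1 / real N \<Longrightarrow> \<bar>h x - h y\<bar> \<le> \<epsilon>"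
  shows "\<bar>(\<Sum>i<N. h (real i / real N)) / real N - (\<integral>x. h x \<partial>lebesgue_on {0..1})\<bar> \<le> \<epsilon>"
proof -
  have io: "h integrable_on {a..b}" if "0 \<le> a" "b \<le> 1" for a b
    using h that by (intro integrable_continuous_interval continuous_on_subset[OF h]) auto
  \<comment> \<open>Induction over the cells: the sum over the first k cells is compared with the
    integral up to k/N, and each cell contributes an error of at most \<epsilon>/N.\<close>
  have "\<bar>(\<Sum>i<k. h (real i / real N)) / real N - integral {0..real k / real N} h\<bar> \<le> real k * \<epsilon> / real N"
    if "k \<le> N" for k
    using that
  proof (induction k)
    case (Suc k)
    let ?a = "real k / real N" and ?b = "real (Suc k) / real N"
    have ab: "0 \<le> ?a" "?a \<le> ?b" "?b \<le> 1" "?b - ?a = 1 / real N"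
      using Suc N by (auto simp: field_simps)
    have split: "integral {0..?b} h = integral {0..?a} h + integral {?a..?b} h"
      using Henstock_Kurzweil_Integration.integral_combine[OF ab(1,2) io[of 0 ?b]] ab by simp
    have c: "continuous_on {?a..?b} h" using ab by (intro continuous_on_subset[OF h]) auto
    have "integral {?a..?b} (\<lambda>x. h ?a - h x) = h ?a * (1 / real N) - integral {?a..?b} h"
      using io[of ?a ?b] ab by (subst Henstock_Kurzweil_Integration.integral_diff) auto
    moreover have "norm (integral {?a..?b} (\<lambda>x. h ?a - h x)) \<le> \<epsilon> * (?b - ?a)"
    proof (rule integral_bound[OF ab(2)])
      show "continuous_on {?a..?b} (\<lambda>x. h ?a - h x)" using c by (intro continuous_intros)
      show "norm (h ?a - h x) \<le> \<epsilon>" if "x \<in> {?a..?b}" for x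
      proof -
        have x: "x \<in> {0..1}" "?a \<in> {0..1}" using that ab(1,2,3) unfolding atLeastAtMost_iff by linarith+
        have "\<bar>?a - x\<bar> \<le> 1 / real N" using that ab(4) unfolding atLeastAtMost_iff by linarith
        from osc[OF x(2,1) this] show ?thesis by simp
      qed
    qed
    ultimately have 1: "\<bar>h ?a / real N - integral {?a..?b} h\<bar> \<le> \<epsilon> / real N"
      using ab(4) by simp
    have 2: "\<bar>(\<Sum>i<k. h (real i / real N)) / real N - integral {0..?a} h\<bar> \<le> real k * \<epsilon> / real N"
      using Suc by simp
    have "(\<Sum>i<Suc k. h (real i / real N)) / real N - integral {0..?b} h
       = ((\<Sum>i<k. h (real i / real N)) / real N - integral {0..?a} h) + (h ?a / real N - integral {?a..?b} h)"
      unfolding split sum.lessThan_Suc add_divide_distrib by simp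
    then have "\<bar>(\<Sum>i<Suc k. h (real i / real N)) / real N - integral {0..?b} h\<bar> \<le> real k * \<epsilon> / real N + \<epsilon> / real N"
      using 1 2 by linarith
    also have "\<dots> = real (Suc k) * \<epsilon> / real N" by (simp add: add_divide_distrib[symmetric] algebra_simps)
    finally show ?case .
  qed simp
  from this[of N] N have "\<bar>(\<Sum>i<N. h (real i / real N)) / real N - integral {0..1} h\<bar> \<le> \<epsilon>" by simp
  moreover have "integral {0..1} h = (\<integral>x. h x \<partial>lebesgue_on {0..1})"
    using h by (intro lebesgue_integral_eq_integral[symmetric] continuous_imp_integrable_real) auto
  ultimately show ?thesis by simp
qed

text \<open>Uniformity in x is what makes double Riemann sums converge: the inner sum has to be
  close to its integral at every node of the outer one.\<close>

lemma riemann_sum_uniform: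
  fixes H :: "real \<Rightarrow> real \<Rightarrow> real"
  assumes H: "continuous_kernel H" and e: "\<epsilon> > 0"
  shows "\<exists>N0. \<forall>N\<ge>N0. \<forall>x\<in>{0..1}. \<bar>(\<Sum>i<N. H x (real i / real N)) / real N - (\<integral>y. H x y \<partial>lebesgue_on {0..1})\<bar> \<le> \<epsilon>"
proof -
  have "uniformly_continuous_on ({0..1} \<times> {0..1}) (\<lambda>(x, y). H x y)"
    by (intro compact_uniformly_continuous[OF H] compact_Times compact_Icc)
  then obtain d where d: "d > 0" "\<And>u v. u \<in> {0..1} \<times> {0..1} \<Longrightarrow> v \<in> {0..1} \<times> {0..1} \<Longrightarrow> dist v u < d
     \<Longrightarrow> dist (case v of (x, y) \<Rightarrow> H x y) (case u of (x, y) \<Rightarrow> H x y) < \<epsilon>"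
    using e unfolding uniformly_continuous_on_def by metis
  obtain N0 where N0: "1 / real (Suc N0) < d" using d(1) by (meson nat_approx_posE)
  show ?thesis
  proof (intro exI[of _ "Suc N0"] allI impI ballI)
    fix N x assume N: "Suc N0 \<le> N" and x: "x \<in> {0..1::real}"
    have N': "1 / real N < d"
      using N0 N by (smt (verit) frac_le of_nat_0_less_iff of_nat_mono zero_less_Suc)
    show "\<bar>(\<Sum>i<N. H x (real i / real N)) / real N - (\<integral>y. H x y \<partial>lebesgue_on {0..1})\<bar> \<le> \<epsilon>"
    proof (rule riemann_sum_bound)
      show "continuous_on {0..1} (H x)" by (rule kernel_section_continuous[OF H x])
      show "0 < N" using N by simp
      fix y y' :: real assume yy: "y \<in> {0..1}" "y' \<in> {0..1}" "\<bar>y - y'\<bar> \<le> 1 / real N"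
      have "dist (x, y) (x, y') < d" using yy N' by (simp add: dist_Pair_Pair dist_real_def)
      from d(2)[OF _ _ this] x yy show "\<bar>H x y - H x y'\<bar> \<le> \<epsilon>" by (simp add: dist_real_def)
    qed
  qed
qed

lemma riemann_sum_tendsto:
  fixes h :: "real \<Rightarrow> real"
  assumes h: "continuous_on {0..1} h"
  shows "(\<lambda>N. (\<Sum>i<N. h (real i / real N)) / real N) \<longlonglongrightarrow> (\<integral>y. h y \<partial>lebesgue_on {0..1})"
proof (rule LIMSEQ_I)
  fix r :: real assume r: "0 < r"
  have "continuous_kernel (\<lambda>x. h)"
  proof -
    have "continuous_on ({0..1} \<times> {0..1}) (\<lambda>z::real\<times>real. h (snd z))"
      by (rule continuous_on_compose2[OF h]) (auto intro!: continuous_intros)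
    then show ?thesis by (simp add: split_beta')
  qed
  from riemann_sum_uniform[OF this, of "r / 2"] r obtain N0 where
    "\<And>N. N \<ge> N0 \<Longrightarrow> \<forall>x\<in>{0..1::real}. \<bar>(\<Sum>i<N. h (real i / real N)) / real N - (\<integral>y. h y \<partial>lebesgue_on {0..1})\<bar> \<le> r / 2"
    by auto
  then have "\<forall>N\<ge>N0. norm ((\<Sum>i<N. h (real i / real N)) / real N - (\<integral>y. h y \<partial>lebesgue_on {0..1})) < r"
    using r by (force dest!: bspec[where x=0])
  then show "\<exists>N0. \<forall>N\<ge>N0. norm ((\<Sum>i<N. h (real i / real N)) / real N - (\<integral>y. h y \<partial>lebesgue_on {0..1})) < r" by blast
qed

section \<open>Integrals of the process against continuous functions\<close>

context gauss_process
begin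

definition riem :: "(real \<Rightarrow> real) \<Rightarrow> nat \<Rightarrow> (real \<Rightarrow> real) \<Rightarrow> real" where
  "riem g N z = (\<Sum>i<N. g (real i / real N) * z (real i / real N)) / real N"

lemma riem_lin_comb: "lin_comb UNIV (riem g N)"
proof (cases "N = 0")
  case True
  then show ?thesis by (auto simp: lin_comb_def riem_def intro!: exI[of _ "{}"])
next
  case False
  then have inj: "inj_on (\<lambda>i. real i / real N) {..<N}" by (auto simp: inj_on_def)
  show ?thesis
    unfolding lin_comb_def
  proof (intro exI[of _ "(\<lambda>i. real i / real N) ` {..<N}"] exI[of _ "\<lambda>t. g t / real N"] conjI ballI)
    show "(\<lambda>i. real i / real N) ` {..<N} \<subseteq> {0..1}" using False by (auto simp: field_simps)
    show "riem g N z = (\<Sum>t\<in>(\<lambda>i. real i / real N) ` {..<N}. g t / real N * z t)" for z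
      by (subst sum.reindex[OF inj]) (simp add: riem_def sum_divide_distrib)
  qed simp
qed

lemma riem_inner:
  assumes Y: "sq_rv P Y"
  shows "(\<integral>z. riem g N z * Y z \<partial>P) = (\<Sum>i<N. g (real i / real N) * (\<integral>z. z (real i / real N) * Y z \<partial>P)) / real N"
proof -
  have I: "real i / real N \<in> {0..1}" if "i < N" for i using that by (auto simp: field_simps)
  have int: "integrable P (\<lambda>z. z t * Y z)" if "t \<in> {0..1}" for t
    using sq_rv_mult[OF gauss_space_sq[OF gauss_space_coord[OF that]] Y] .
  have "(\<integral>z. riem g N z * Y z \<partial>P) = (\<integral>z. (\<Sum>i<N. g (real i / real N) * (z (real i / real N) * Y z)) \<partial>P) / real N"
    by (simp add: riem_def sum_distrib_right mult.assoc)
  also have "(\<integral>z. (\<Sum>i<N. g (real i / real N) * (z (real i / real N) * Y z)) \<partial>P)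
     = (\<Sum>i<N. g (real i / real N) * (\<integral>z. z (real i / real N) * Y z \<partial>P))"
    using int I by (subst Bochner_Integration.integral_sum) auto
  finally show ?thesis .
qed

text \<open>The covariance of two Riemann sums is a double Riemann sum of g(x) Gamma(x, y) g(y),
  close to the same number Q whenever both indices are large. Expanding the square leaves Q - 2 Q +
  Q = 0.\<close>

lemma riem_cauchy:
  assumes \<Gamma>: "continuous_kernel (cov_kernel P)" and g: "continuous_on {0..1} g" and e: "\<epsilon> > 0"
  shows "\<exists>N0. \<forall>N\<ge>N0. \<forall>M\<ge>N0. (\<integral>z. (riem g N z - riem g M z)\<^sup>2 \<partial>P) \<le> \<epsilon>"
proof -
  let ?M = "lebesgue_on {0..1::real}" and ?T = "cov_operator (cov_kernel P) g"
  define Q where "Q = (\<integral>x. g x * ?T x \<partial>?M)"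
  have gT: "continuous_on {0..1} ?T"
    by (rule cov_operator_continuous[OF \<Gamma> continuous_square_integrable[OF g]])
  obtain C where C: "C > 0" "\<And>x. x \<in> {0..1} \<Longrightarrow> \<bar>g x\<bar> \<le> C"
  proof -
    have "compact (g ` {0..1})" by (intro compact_continuous_image g compact_Icc)
    then obtain C where "\<forall>x\<in>{0..1}. \<bar>g x\<bar> \<le> C" by (auto dest!: compact_imp_bounded simp: bounded_iff)
    then show ?thesis by (intro that[of "max C 1"]) (auto simp: le_max_iff_disj)
  qed
  define H where "H x y = cov_kernel P x y * g y" for x y
  have H: "continuous_kernel H"
  proof -
    have "continuous_on ({0..1} \<times> {0..1}) (\<lambda>z::real\<times>real. g (snd z))"
      by (rule continuous_on_compose2[OF g]) (auto intro!: continuous_intros)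
    from continuous_on_mult[OF \<Gamma> this] show ?thesis by (simp add: H_def split_beta')
  qed
  have HT: "(\<integral>y. H x y \<partial>?M) = ?T x" for x by (simp add: H_def cov_operator_def)
  obtain N1 where N1: "\<And>N x. N \<ge> N1 \<Longrightarrow> x \<in> {0..1} \<Longrightarrow> \<bar>(\<Sum>i<N. H x (real i / real N)) / real N - ?T x\<bar> \<le> \<epsilon> / (8 * C)"
  proof -
    have "0 < \<epsilon> / (8 * C)" using e C(1) by simp
    from riemann_sum_uniform[OF H this] obtain N1 where "\<forall>N\<ge>N1. \<forall>x\<in>{0..1}. \<bar>(\<Sum>i<N. H x (real i / real N)) / real N - ?T x\<bar> \<le> \<epsilon> / (8 * C)"
      unfolding HT by blast
    then show ?thesis by (intro that[of N1]) blast
  qed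
  have "(\<lambda>N. (\<Sum>i<N. g (real i / real N) * ?T (real i / real N)) / real N) \<longlonglongrightarrow> Q"
    unfolding Q_def by (rule riemann_sum_tendsto) (intro continuous_on_mult g gT)
  from LIMSEQ_D[OF this, of "\<epsilon> / 8"] e obtain N2 where
    N2: "\<And>N. N \<ge> N2 \<Longrightarrow> \<bar>(\<Sum>i<N. g (real i / real N) * ?T (real i / real N)) / real N - Q\<bar> < \<epsilon> / 8" by auto
  \<comment> \<open>One \<epsilon>/8 pays for replacing the inner sums by T g, weighted by |g| \<le>
    C, the other for the outer sum. The expanded square contains four times this error, counting the
    mixed term twice.\<close>
  have key: "\<bar>(\<integral>z. riem g N z * riem g M z \<partial>P) - Q\<bar> \<le> \<epsilon> / 4" if "N \<ge> Suc (N1 + N2)" "M \<ge> Suc (N1 + N2)" for N M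
  proof -
    have I: "real i / real N \<in> {0..1}" if "i < N" for i using that by (auto simp: field_simps)
    define r where "r i = (\<Sum>j<M. H (real i / real N) (real j / real M)) / real M" for i
    have "(\<integral>z. z x * riem g M z \<partial>P) = (\<Sum>j<M. H x (real j / real M)) / real M" if "x \<in> {0..1}" for x
      using riem_inner[OF gauss_space_sq[OF gauss_space_coord[OF that]], of g M]
      by (simp add: mult.commute H_def cov_kernel_def)
    then have "(\<integral>z. riem g N z * riem g M z \<partial>P) = (\<Sum>i<N. g (real i / real N) * r i) / real N"
      using riem_inner[OF lin_comb_sq[OF riem_lin_comb], of g N g M] I by (simp add: r_def)
    moreover have "\<bar>(\<Sum>i<N. g (real i / real N) * r i) / real N - (\<Sum>i<N. g (real i / real N) * ?T (real i / real N)) / real N\<bar> \<le> \<epsilon> / 8"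
    proof -
      have "\<bar>\<Sum>i<N. g (real i / real N) * (r i - ?T (real i / real N))\<bar> \<le> (\<Sum>i<N. C * (\<epsilon> / (8 * C)))"
      proof (rule order_trans[OF sum_abs], rule sum_mono)
        fix i assume "i \<in> {..<N}"
        then have i: "real i / real N \<in> {0..1}" using I by simp
        have "\<bar>r i - ?T (real i / real N)\<bar> \<le> \<epsilon> / (8 * C)"
          unfolding r_def by (rule N1[OF _ i]) (use that in simp)
        then show "\<bar>g (real i / real N) * (r i - ?T (real i / real N))\<bar> \<le> C * (\<epsilon> / (8 * C))"
          unfolding abs_mult using C(1) C(2)[OF i] by (intro mult_mono) simp_all
      qed
      then have "\<bar>\<Sum>i<N. g (real i / real N) * (r i - ?T (real i / real N))\<bar> \<le> real N * (\<epsilon> / 8)"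
        using C(1) by simp
      moreover have "(\<Sum>i<N. g (real i / real N) * r i) / real N - (\<Sum>i<N. g (real i / real N) * ?T (real i / real N)) / real N
        = (\<Sum>i<N. g (real i / real N) * (r i - ?T (real i / real N))) / real N"
        by (simp add: diff_divide_distrib sum_subtractf right_diff_distrib)
      ultimately show ?thesis using that by (simp add: divide_le_eq mult.commute)
    qed
    moreover have "\<bar>(\<Sum>i<N. g (real i / real N) * ?T (real i / real N)) / real N - Q\<bar> < \<epsilon> / 8" using N2 that by simp
    ultimately show ?thesis by linarith
  qed
  show ?thesis
  proof (intro exI[of _ "Suc (N1 + N2)"] allI impI)
    fix N M assume NM: "Suc (N1 + N2) \<le> N" "Suc (N1 + N2) \<le> M"
    have "(\<integral>z. (riem g N z - riem g M z)\<^sup>2 \<partial>P) = (\<integral>z. riem g N z * riem g N z \<partial>P)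
       - 2 * (\<integral>z. riem g N z * riem g M z \<partial>P) + (\<integral>z. riem g M z * riem g M z \<partial>P)"
      using sq_rv_comb(2)[OF lin_comb_sq[OF riem_lin_comb] lin_comb_sq[OF riem_lin_comb], of 1 g N "-1" g M]
      by (simp add: power2_eq_square)
    then show "(\<integral>z. (riem g N z - riem g M z)\<^sup>2 \<partial>P) \<le> \<epsilon>"
      using key[OF NM(1,1)] key[OF NM(1,2)] key[OF NM(2,2)] by linarith
  qed
qed

text \<open>The random variable \<open>\<xi>\<close> plays the role of \<open>\<integral> Z(t) g(t) dt\<close>, which need not exist as a
  pathwise integral, since the paths are not assumed to be measurable.\<close>

lemma gauss_integral_exists:
  assumes \<Gamma>: "continuous_kernel (cov_kernel P)" and g: "continuous_on {0..1} g"
  obtains \<xi> where "gauss_space P \<xi>" "(\<lambda>N. \<integral>z. (riem g N z - \<xi> z)\<^sup>2 \<partial>P) \<longlonglongrightarrow> 0"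
proof -
  let ?S = "riem g"
  have S: "sq_rv P (?S N)" for N by (rule lin_comb_sq[OF riem_lin_comb])
  have [measurable]: "?S N \<in> borel_measurable P" for N using S by (auto simp: sq_rv_def)
  have D: "sq_rv P (\<lambda>z. ?S N z - ?S M z)" for N M using sq_rv_comb(1)[OF S S, of 1 N "-1" M] by simp
  have L1: "\<exists>N0. \<forall>N\<ge>N0. \<forall>M\<ge>N0. (\<integral>z. norm (?S N z - ?S M z) \<partial>P) < e" if "e > 0" for e
  proof -
    have "0 < (e / 2)\<^sup>2" using that by simp
    from riem_cauchy[OF \<Gamma> g this] obtain N0 where N0: "\<And>N M. N \<ge> N0 \<Longrightarrow> M \<ge> N0 \<Longrightarrow> (\<integral>z. (?S N z - ?S M z)\<^sup>2 \<partial>P) \<le> (e / 2)\<^sup>2"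
      by blast
    have "(\<integral>z. norm (?S N z - ?S M z) \<partial>P) < e" if "N \<ge> N0" "M \<ge> N0" for N M
    proof -
      have "(\<integral>z. \<bar>?S N z - ?S M z\<bar> \<partial>P) \<le> sqrt (\<integral>z. (?S N z - ?S M z)\<^sup>2 \<partial>P)"
        by (rule sq_rv_L1_le(2)[OF prob_space_axioms D])
      also have "\<dots> \<le> sqrt ((e / 2)\<^sup>2)" using N0[OF that] by (rule real_sqrt_le_mono)
      also have "\<dots> < e" using \<open>e > 0\<close> by simp
      finally show ?thesis by simp
    qed
    then show ?thesis by blast
  qed
  \<comment> \<open>A subsequence that converges almost surely provides a concrete random variable
    as candidate for the limit in mean square.\<close>
  obtain r where r: "strict_mono r" "AE z in P. Cauchy (\<lambda>i. ?S (r i) z)"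
    by (rule cauchy_L1_AE_cauchy_subseq[of P ?S, OF sq_rv_L1_le(1)[OF prob_space_axioms S] L1])
  define \<xi> where "\<xi> z = lim (\<lambda>i. ?S (r i) z)" for z
  have [measurable]: "\<xi> \<in> borel_measurable P" unfolding \<xi>_def by (rule borel_measurable_lim_metric) simp
  have conv: "AE z in P. (\<lambda>i. ?S (r i) z) \<longlonglongrightarrow> \<xi> z"
    using r(2) by eventually_elim (simp add: \<xi>_def convergent_LIMSEQ_iff[symmetric] Cauchy_convergent)
  \<comment> \<open>Fatou's lemma carries the Cauchy estimate in mean square over to the almost sure
    limit.\<close>
  have bound: "(\<integral>\<^sup>+z. ennreal ((?S N z - \<xi> z)\<^sup>2) \<partial>P) \<le> ennreal e"
    if N0: "\<And>N M. N \<ge> N0 \<Longrightarrow> M \<ge> N0 \<Longrightarrow> (\<integral>z. (?S N z - ?S M z)\<^sup>2 \<partial>P) \<le> e" and N: "N \<ge> N0" and e: "e \<ge> 0" for N N0 e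
  proof -
    have "(\<integral>\<^sup>+z. ennreal ((?S N z - \<xi> z)\<^sup>2) \<partial>P) = (\<integral>\<^sup>+z. liminf (\<lambda>i. ennreal ((?S N z - ?S (r i) z)\<^sup>2)) \<partial>P)"
    proof (rule nn_integral_cong_AE)
      show "AE z in P. ennreal ((?S N z - \<xi> z)\<^sup>2) = liminf (\<lambda>i. ennreal ((?S N z - ?S (r i) z)\<^sup>2))"
        using conv
      proof eventually_elim
        case (elim z)
        then have "(\<lambda>i. ennreal ((?S N z - ?S (r i) z)\<^sup>2)) \<longlonglongrightarrow> ennreal ((?S N z - \<xi> z)\<^sup>2)"
          by (intro tendsto_intros tendsto_ennrealI)
        then show ?case by (rule lim_imp_Liminf[OF sequentially_bot, symmetric])
      qed
    qed
    also have "\<dots> \<le> liminf (\<lambda>i. \<integral>\<^sup>+z. ennreal ((?S N z - ?S (r i) z)\<^sup>2) \<partial>P)"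
      by (rule nn_integral_liminf) simp
    also have "\<dots> \<le> ennreal e"
    proof (rule Liminf_le)
      have "\<forall>i\<ge>N0. (\<integral>\<^sup>+z. ennreal ((?S N z - ?S (r i) z)\<^sup>2) \<partial>P) \<le> ennreal e"
      proof (intro allI impI)
        fix i assume "N0 \<le> i"
        then have "r i \<ge> N0" using seq_suble[OF r(1), of i] by simp
        have "(\<integral>\<^sup>+z. ennreal ((?S N z - ?S (r i) z)\<^sup>2) \<partial>P) = ennreal (\<integral>z. (?S N z - ?S (r i) z)\<^sup>2 \<partial>P)"
          using D by (intro nn_integral_eq_integral) (auto simp: sq_rv_def)
        also have "\<dots> \<le> ennreal e" using N0[OF N \<open>r i \<ge> N0\<close>] e by (simp add: ennreal_leI)
        finally show "(\<integral>\<^sup>+z. ennreal ((?S N z - ?S (r i) z)\<^sup>2) \<partial>P) \<le> ennreal e" .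
      qed
      then show "\<forall>\<^sub>F i in sequentially. (\<integral>\<^sup>+z. ennreal ((?S N z - ?S (r i) z)\<^sup>2) \<partial>P) \<le> ennreal e"
        by (auto simp: eventually_sequentially)
    qed simp
    finally show ?thesis .
  qed
  have Dsq: "sq_rv P (\<lambda>z. ?S N z - \<xi> z) \<and> (\<integral>z. (?S N z - \<xi> z)\<^sup>2 \<partial>P) \<le> e"
    if N0: "\<And>N M. N \<ge> N0 \<Longrightarrow> M \<ge> N0 \<Longrightarrow> (\<integral>z. (?S N z - ?S M z)\<^sup>2 \<partial>P) \<le> e" and N: "N \<ge> N0" and e: "e \<ge> 0" for N N0 e
  proof -
    note b = bound[OF N0 N e]
    have int: "integrable P (\<lambda>z. (?S N z - \<xi> z)\<^sup>2)"
      using b by (intro integrableI_bounded) (auto intro: order_le_less_trans[OF _ ennreal_less_top])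
    then have "ennreal (\<integral>z. (?S N z - \<xi> z)\<^sup>2 \<partial>P) \<le> ennreal e"
      using b by (subst nn_integral_eq_integral[symmetric]) auto
    then show ?thesis using int e by (auto simp: sq_rv_def ennreal_le_iff)
  qed
  have lim: "(\<lambda>N. \<integral>z. (?S N z - \<xi> z)\<^sup>2 \<partial>P) \<longlonglongrightarrow> 0"
  proof (rule LIMSEQ_I)
    fix e :: real assume e: "0 < e"
    obtain N0 where N0: "\<And>N M. N \<ge> N0 \<Longrightarrow> M \<ge> N0 \<Longrightarrow> (\<integral>z. (?S N z - ?S M z)\<^sup>2 \<partial>P) \<le> e / 2"
      using riem_cauchy[OF \<Gamma> g, of "e / 2"] e half_gt_zero by blast
    have "(\<integral>z. (?S N z - \<xi> z)\<^sup>2 \<partial>P) \<le> e / 2" if "N \<ge> N0" for N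
      using Dsq[OF N0 that] e by auto
    then show "\<exists>N0. \<forall>N\<ge>N0. norm ((\<integral>z. (?S N z - \<xi> z)\<^sup>2 \<partial>P) - 0) < e"
      using e by (intro exI[of _ N0]) fastforce
  qed
  have "sq_rv P \<xi>"
  proof -
    obtain N0 where N0: "\<And>N M. N \<ge> N0 \<Longrightarrow> M \<ge> N0 \<Longrightarrow> (\<integral>z. (?S N z - ?S M z)\<^sup>2 \<partial>P) \<le> 1"
      using riem_cauchy[OF \<Gamma> g zero_less_one] by blast
    have "sq_rv P (\<lambda>z. ?S N0 z - \<xi> z)" using Dsq[OF N0, of N0] by auto
    from sq_rv_comb(1)[OF S[of N0] this, of 1 "-1"] show ?thesis by simp
  qed
  then have "gauss_space P \<xi>"
    unfolding gauss_space_def using lim riem_lin_comb by (intro conjI exI[of _ ?S]) auto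
  then show ?thesis using lim by (rule that)
qed

text \<open>These are the identities that Fubini's theorem would give for a pathwise integral. They
  hold approximately for Riemann sums, and inner products are continuous in mean square.\<close>

lemma gauss_integral_moments:
  assumes \<Gamma>: "continuous_kernel (cov_kernel P)" and g: "continuous_on {0..1} g"
    and \<xi>: "gauss_space P \<xi>" "(\<lambda>N. \<integral>z. (riem g N z - \<xi> z)\<^sup>2 \<partial>P) \<longlonglongrightarrow> 0"
  shows "t \<in> {0..1} \<Longrightarrow> (\<integral>z. z t * \<xi> z \<partial>P) = cov_operator (cov_kernel P) g t"
    "sq_rv P Y \<Longrightarrow> continuous_on {0..1} (\<lambda>t. \<integral>z. z t * Y z \<partial>P) \<Longrightarrow>
      (\<integral>z. \<xi> z * Y z \<partial>P) = l2_inner g (\<lambda>t. \<integral>z. z t * Y z \<partial>P)"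
proof -
  have S: "sq_rv P (riem g N)" for N by (rule lin_comb_sq[OF riem_lin_comb])
  show 2: "(\<integral>z. \<xi> z * Y z \<partial>P) = l2_inner g (\<lambda>t. \<integral>z. z t * Y z \<partial>P)"
    if Y: "sq_rv P Y" and c: "continuous_on {0..1} (\<lambda>t. \<integral>z. z t * Y z \<partial>P)" for Y
  proof -
    have "(\<lambda>N. \<integral>z. riem g N z * Y z \<partial>P) \<longlonglongrightarrow> (\<integral>z. \<xi> z * Y z \<partial>P)"
      by (rule sq_rv_inner_tendsto[OF S gauss_space_sq[OF \<xi>(1)] Y \<xi>(2)])
    moreover have "(\<lambda>N. \<integral>z. riem g N z * Y z \<partial>P) \<longlonglongrightarrow> l2_inner g (\<lambda>t. \<integral>z. z t * Y z \<partial>P)"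
      unfolding riem_inner[OF Y] l2_inner_def
      by (rule riemann_sum_tendsto) (intro continuous_on_mult g c)
    ultimately show ?thesis by (rule LIMSEQ_unique)
  qed
  show "(\<integral>z. z t * \<xi> z \<partial>P) = cov_operator (cov_kernel P) g t" if t: "t \<in> {0..1}"
  proof -
    have eq: "(\<lambda>x. \<integral>z. z x * z t \<partial>P) = cov_kernel P t"
      by (auto simp: cov_kernel_def fun_eq_iff mult.commute)
    have "(\<integral>z. \<xi> z * z t \<partial>P) = l2_inner g (cov_kernel P t)"
      using 2[OF gauss_space_sq[OF gauss_space_coord[OF t]]] kernel_section_continuous[OF \<Gamma> t] unfolding eq by simp
    then show ?thesis by (simp add: cov_operator_def l2_inner_def mult.commute)
  qed
qed

end

section \<open>Laws of processes built on other probability spaces\<close>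

lemma path_measurable:
  assumes "\<And>t. t \<in> {0..1} \<Longrightarrow> X t \<in> borel_measurable M"
  shows "(\<lambda>\<omega>. \<lambda>t\<in>{0..1}. X t \<omega>) \<in> measurable M path_space"
  unfolding path_space_def using assms by (intro measurable_restrict) auto

lemma process_law:
  assumes M: "prob_space M" and X: "\<And>t. t \<in> {0..1} \<Longrightarrow> X t \<in> borel_measurable M"
    and normal: "\<And>J c. finite J \<Longrightarrow> J \<subseteq> {0..1} \<Longrightarrow> \<exists>v. centered_normal M (\<lambda>\<omega>. \<Sum>t\<in>J. c t * X t \<omega>) v"
  shows "centered_gaussian_process (distr M path_space (\<lambda>\<omega>. \<lambda>t\<in>{0..1}. X t \<omega>))"
    "\<And>x y. x \<in> {0..1} \<Longrightarrow> y \<in> {0..1} \<Longrightarrow>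
      cov_kernel (distr M path_space (\<lambda>\<omega>. \<lambda>t\<in>{0..1}. X t \<omega>)) x y = (\<integral>\<omega>. X x \<omega> * X y \<omega> \<partial>M)"
proof -
  let ?W = "\<lambda>\<omega>. \<lambda>t\<in>{0..1}. X t \<omega>" and ?P = "distr M path_space (\<lambda>\<omega>. \<lambda>t\<in>{0..1}. X t \<omega>)"
  have W: "?W \<in> measurable M path_space" using X by (rule path_measurable)
  have comp: "(\<lambda>z. z t) \<in> borel_measurable path_space" if "t \<in> {0..1}" for t :: real
    using that unfolding path_space_def by (rule measurable_component_singleton)
  show "cov_kernel ?P x y = (\<integral>\<omega>. X x \<omega> * X y \<omega> \<partial>M)" if "x \<in> {0..1}" "y \<in> {0..1}" for x y
    unfolding cov_kernel_def using that W comp by (subst integral_distr) auto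
  have "\<exists>s\<ge>0. distr ?P borel (\<lambda>z. \<Sum>t\<in>J. c t * z t) = normal_law s"
    if J: "finite J" "J \<subseteq> {0..1}" for J c
  proof -
    obtain v where v: "centered_normal M (\<lambda>\<omega>. \<Sum>t\<in>J. c t * X t \<omega>) v" using normal[OF J] by blast
    have "distr ?P borel (\<lambda>z. \<Sum>t\<in>J. c t * z t) = distr M borel ((\<lambda>z. \<Sum>t\<in>J. c t * z t) \<circ> ?W)"
      using J comp by (intro distr_distr W borel_measurable_sum borel_measurable_times) auto
    also have "(\<lambda>z. \<Sum>t\<in>J. c t * z t) \<circ> ?W = (\<lambda>\<omega>. \<Sum>t\<in>J. c t * X t \<omega>)"
      using J by (auto simp: fun_eq_iff intro!: sum.cong)
    also have "distr M borel (\<lambda>\<omega>. \<Sum>t\<in>J. c t * X t \<omega>) = normal_law (sqrt v)"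
      by (rule centered_normal_distr[OF M v])
    finally have "distr ?P borel (\<lambda>z. \<Sum>t\<in>J. c t * z t) = normal_law (sqrt v)" .
    moreover have "0 \<le> sqrt v" using v by (simp add: centered_normal_def)
    ultimately show ?thesis by blast
  qed
  then show "centered_gaussian_process ?P"
    unfolding centered_gaussian_process_def normal_law_def[symmetric]
    using prob_space.prob_space_distr[OF M W] by auto
qed

lemma sq_rv_bilinear:
  assumes "sq_rv M A" "sq_rv M B" "sq_rv M C" "sq_rv M D"
  shows "(\<integral>\<omega>. (A \<omega> + a * B \<omega> + b * C \<omega>) * D \<omega> \<partial>M)
    = (\<integral>\<omega>. A \<omega> * D \<omega> \<partial>M) + a * (\<integral>\<omega>. B \<omega> * D \<omega> \<partial>M) + b * (\<integral>\<omega>. C \<omega> * D \<omega> \<partial>M)"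
proof -
  have i: "integrable M (\<lambda>\<omega>. A \<omega> * D \<omega>)" "integrable M (\<lambda>\<omega>. a * (B \<omega> * D \<omega>))" "integrable M (\<lambda>\<omega>. b * (C \<omega> * D \<omega>))"
    using assms sq_rv_mult by auto
  have "(\<integral>\<omega>. (A \<omega> + a * B \<omega> + b * C \<omega>) * D \<omega> \<partial>M) = (\<integral>\<omega>. A \<omega> * D \<omega> + a * (B \<omega> * D \<omega>) + b * (C \<omega> * D \<omega>) \<partial>M)"
    by (simp add: algebra_simps)
  then show ?thesis using i by (simp add: Bochner_Integration.integral_add)
qed

lemma sq_rv_bilinear0:
  assumes "sq_rv M B" "sq_rv M C" "sq_rv M D"
  shows "(\<integral>\<omega>. (a * B \<omega> + b * C \<omega>) * D \<omega> \<partial>M)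
    = a * (\<integral>\<omega>. B \<omega> * D \<omega> \<partial>M) + b * (\<integral>\<omega>. C \<omega> * D \<omega> \<partial>M)"
proof -
  have i: "integrable M (\<lambda>\<omega>. a * (B \<omega> * D \<omega>))" "integrable M (\<lambda>\<omega>. b * (C \<omega> * D \<omega>))"
    using assms sq_rv_mult by auto
  have "(\<integral>\<omega>. (a * B \<omega> + b * C \<omega>) * D \<omega> \<partial>M) = (\<integral>\<omega>. a * (B \<omega> * D \<omega>) + b * (C \<omega> * D \<omega>) \<partial>M)"
    by (simp add: algebra_simps)
  then show ?thesis using i by (simp add: Bochner_Integration.integral_add)
qed

context gauss_process
begin

lemma gauss_pair_exists:
  assumes \<Gamma>: "continuous_kernel (cov_kernel P)" and e: "continuous_on {0..1} e1" "continuous_on {0..1} e2"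
  obtains \<xi>1 \<xi>2 where "gauss_space P \<xi>1" "gauss_space P \<xi>2"
    "\<And>t. t \<in> {0..1} \<Longrightarrow> (\<integral>z. z t * \<xi>1 z \<partial>P) = cov_operator (cov_kernel P) e1 t"
    "\<And>t. t \<in> {0..1} \<Longrightarrow> (\<integral>z. z t * \<xi>2 z \<partial>P) = cov_operator (cov_kernel P) e2 t"
    "(\<integral>z. \<xi>1 z * \<xi>1 z \<partial>P) = l2_inner e1 (cov_operator (cov_kernel P) e1)"
    "(\<integral>z. \<xi>1 z * \<xi>2 z \<partial>P) = l2_inner e1 (cov_operator (cov_kernel P) e2)"
    "(\<integral>z. \<xi>2 z * \<xi>2 z \<partial>P) = l2_inner e2 (cov_operator (cov_kernel P) e2)"
proof -
  let ?T = "cov_operator (cov_kernel P)"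
  obtain \<xi>1 where 1: "gauss_space P \<xi>1" "(\<lambda>N. \<integral>z. (riem e1 N z - \<xi>1 z)\<^sup>2 \<partial>P) \<longlonglongrightarrow> 0"
    by (rule gauss_integral_exists[OF \<Gamma> e(1)])
  obtain \<xi>2 where 2: "gauss_space P \<xi>2" "(\<lambda>N. \<integral>z. (riem e2 N z - \<xi>2 z)\<^sup>2 \<partial>P) \<longlonglongrightarrow> 0"
    by (rule gauss_integral_exists[OF \<Gamma> e(2)])
  note m1 = gauss_integral_moments[OF \<Gamma> e(1) 1] and m2 = gauss_integral_moments[OF \<Gamma> e(2) 2]
  have T: "continuous_on {0..1} (?T g)" if "continuous_on {0..1} g" for g
    by (rule cov_operator_continuous[OF \<Gamma> continuous_square_integrable[OF that]])
  have c1: "continuous_on {0..1} (\<lambda>t. \<integral>z. z t * \<xi>1 z \<partial>P)"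
    by (subst continuous_on_cong[OF refl m1(1)]) (use T e in auto)
  have c2: "continuous_on {0..1} (\<lambda>t. \<integral>z. z t * \<xi>2 z \<partial>P)"
    by (subst continuous_on_cong[OF refl m2(1)]) (use T e in auto)
  have ip1: "l2_inner g (\<lambda>t. \<integral>z. z t * \<xi>1 z \<partial>P) = l2_inner g (?T e1)" for g
    unfolding l2_inner_def by (intro Bochner_Integration.integral_cong) (use m1(1) in auto)
  have ip2: "l2_inner g (\<lambda>t. \<integral>z. z t * \<xi>2 z \<partial>P) = l2_inner g (?T e2)" for g
    unfolding l2_inner_def by (intro Bochner_Integration.integral_cong) (use m2(1) in auto)
  show ?thesis
    by (rule that[OF 1(1) 2(1)])
       (use m1 m2 m1(2)[OF gauss_space_sq[OF 1(1)] c1] m1(2)[OF gauss_space_sq[OF 2(1)] c2]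
          m2(2)[OF gauss_space_sq[OF 2(1)] c2] in \<open>simp_all add: ip1 ip2\<close>)
qed

text \<open>The matrix m is kept general for two uses: U - I, which rotates the process, and -I,
  which removes its components along \<open>e1\<close> and \<open>e2\<close>.\<close>

lemma shifted_covariance:
  fixes e1 e2 :: "real \<Rightarrow> real" and m11 m12 m21 m22 :: real
  assumes \<xi>: "gauss_space P \<xi>1" "gauss_space P \<xi>2"
    and m: "\<And>t. t \<in> {0..1} \<Longrightarrow> (\<integral>z. z t * \<xi>1 z \<partial>P) = T1 t" "\<And>t. t \<in> {0..1} \<Longrightarrow> (\<integral>z. z t * \<xi>2 z \<partial>P) = T2 t"
      "(\<integral>z. \<xi>1 z * \<xi>1 z \<partial>P) = G11" "(\<integral>z. \<xi>1 z * \<xi>2 z \<partial>P) = G12" "(\<integral>z. \<xi>2 z * \<xi>2 z \<partial>P) = G22"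
  defines "\<zeta>1 \<equiv> \<lambda>z. m11 * \<xi>1 z + m12 * \<xi>2 z" and "\<zeta>2 \<equiv> \<lambda>z. m21 * \<xi>1 z + m22 * \<xi>2 z"
  defines "X \<equiv> \<lambda>t z. z t + e1 t * \<zeta>1 z + e2 t * \<zeta>2 z"
  shows "\<And>t. t \<in> {0..1} \<Longrightarrow> gauss_space P (X t)"
    "gauss_space P \<zeta>1" "gauss_space P \<zeta>2"
    "(\<integral>z. \<zeta>1 z * \<zeta>1 z \<partial>P) = m11\<^sup>2 * G11 + 2 * m11 * m12 * G12 + m12\<^sup>2 * G22"
    "(\<integral>z. \<zeta>2 z * \<zeta>2 z \<partial>P) = m21\<^sup>2 * G11 + 2 * m21 * m22 * G12 + m22\<^sup>2 * G22"
    "\<And>x y. x \<in> {0..1} \<Longrightarrow> y \<in> {0..1} \<Longrightarrow> (\<integral>z. X x z * X y z \<partial>P) = cov_kernel P x y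
      + e1 x * (m11 * T1 y + m12 * T2 y) + e2 x * (m21 * T1 y + m22 * T2 y)
      + (m11 * T1 x + m12 * T2 x) * e1 y + (m21 * T1 x + m22 * T2 x) * e2 y
      + (m11\<^sup>2 * G11 + 2 * m11 * m12 * G12 + m12\<^sup>2 * G22) * (e1 x * e1 y)
      + (m11 * m21 * G11 + (m11 * m22 + m12 * m21) * G12 + m12 * m22 * G22) * (e1 x * e2 y)
      + (m11 * m21 * G11 + (m11 * m22 + m12 * m21) * G12 + m12 * m22 * G22) * (e2 x * e1 y)
      + (m21\<^sup>2 * G11 + 2 * m21 * m22 * G12 + m22\<^sup>2 * G22) * (e2 x * e2 y)"
proof -
  show \<zeta>: "gauss_space P \<zeta>1" "gauss_space P \<zeta>2"
    unfolding \<zeta>1_def \<zeta>2_def by (intro gauss_space_comb \<xi>)+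
  have gX: "gauss_space P (X t)" if "t \<in> {0..1}" for t
    using gauss_space_comb[OF gauss_space_comb[OF gauss_space_coord[OF that] \<zeta>(1), where a=1 and b="e1 t"] \<zeta>(2), where a=1 and b="e2 t"]
    by (simp add: X_def)
  then show "\<And>t. t \<in> {0..1} \<Longrightarrow> gauss_space P (X t)" .
  note sq = gauss_space_sq[OF \<xi>(1)] gauss_space_sq[OF \<xi>(2)] gauss_space_sq[OF \<zeta>(1)] gauss_space_sq[OF \<zeta>(2)]
  have G21: "(\<integral>z. \<xi>2 z * \<xi>1 z \<partial>P) = G12" using m(4) by (simp add: mult.commute)
  have a: "(\<integral>z. \<zeta>1 z * D z \<partial>P) = m11 * (\<integral>z. \<xi>1 z * D z \<partial>P) + m12 * (\<integral>z. \<xi>2 z * D z \<partial>P)"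
      "(\<integral>z. \<zeta>2 z * D z \<partial>P) = m21 * (\<integral>z. \<xi>1 z * D z \<partial>P) + m22 * (\<integral>z. \<xi>2 z * D z \<partial>P)" if "sq_rv P D" for D
    unfolding \<zeta>1_def \<zeta>2_def using sq_rv_bilinear0[OF sq(1,2) that] by simp_all
  have b: "(\<integral>z. \<xi>1 z * \<zeta>1 z \<partial>P) = m11 * G11 + m12 * G12" "(\<integral>z. \<xi>2 z * \<zeta>1 z \<partial>P) = m11 * G12 + m12 * G22"
     "(\<integral>z. \<xi>1 z * \<zeta>2 z \<partial>P) = m21 * G11 + m22 * G12" "(\<integral>z. \<xi>2 z * \<zeta>2 z \<partial>P) = m21 * G12 + m22 * G22"
    using a[OF sq(1)] a[OF sq(2)] m G21 by (simp_all add: mult.commute)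
  have zz: "(\<integral>z. \<zeta>1 z * \<zeta>1 z \<partial>P) = m11\<^sup>2 * G11 + 2 * m11 * m12 * G12 + m12\<^sup>2 * G22"
    "(\<integral>z. \<zeta>2 z * \<zeta>2 z \<partial>P) = m21\<^sup>2 * G11 + 2 * m21 * m22 * G12 + m22\<^sup>2 * G22"
    "(\<integral>z. \<zeta>1 z * \<zeta>2 z \<partial>P) = m11 * m21 * G11 + (m11 * m22 + m12 * m21) * G12 + m12 * m22 * G22"
    using a[OF sq(3)] a[OF sq(4)] b by (simp_all add: power2_eq_square algebra_simps)
  show "(\<integral>z. \<zeta>1 z * \<zeta>1 z \<partial>P) = m11\<^sup>2 * G11 + 2 * m11 * m12 * G12 + m12\<^sup>2 * G22"
    "(\<integral>z. \<zeta>2 z * \<zeta>2 z \<partial>P) = m21\<^sup>2 * G11 + 2 * m21 * m22 * G12 + m22\<^sup>2 * G22" using zz by auto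
  have zz21: "(\<integral>z. \<zeta>2 z * \<zeta>1 z \<partial>P) = (\<integral>z. \<zeta>1 z * \<zeta>2 z \<partial>P)" by (simp add: mult.commute)
  fix x y :: real assume xy: "x \<in> {0..1}" "y \<in> {0..1}"
  have sx: "sq_rv P (\<lambda>z. z x)" "sq_rv P (\<lambda>z. z y)" "sq_rv P (X y)" "sq_rv P (X x)"
    using xy gauss_space_sq gauss_space_coord gX by auto
  have zt: "(\<integral>z. \<zeta>1 z * z t \<partial>P) = m11 * T1 t + m12 * T2 t" "(\<integral>z. \<zeta>2 z * z t \<partial>P) = m21 * T1 t + m22 * T2 t"
    if "t \<in> {0..1}" for t
    using a[OF gauss_space_sq[OF gauss_space_coord[OF that]]] m(1,2)[OF that] by (simp_all add: mult.commute)
  have Xe: "X t = (\<lambda>z. z t + e1 t * \<zeta>1 z + e2 t * \<zeta>2 z)" for t by (simp add: X_def)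
  have com: "(\<integral>z. f z * g z \<partial>P) = (\<integral>z. g z * f z \<partial>P)" for f g :: "(real \<Rightarrow> real) \<Rightarrow> real"
    by (simp add: mult.commute)
  have bil: "(\<integral>z. X t z * D z \<partial>P) = (\<integral>z. z t * D z \<partial>P) + e1 t * (\<integral>z. \<zeta>1 z * D z \<partial>P) + e2 t * (\<integral>z. \<zeta>2 z * D z \<partial>P)"
    if "t \<in> {0..1}" "sq_rv P D" for t D
    unfolding Xe by (rule sq_rv_bilinear[OF gauss_space_sq[OF gauss_space_coord[OF that(1)]] sq(3,4) that(2)])
  have 1: "(\<integral>z. z x * X y z \<partial>P) = cov_kernel P x y + e1 y * (m11 * T1 x + m12 * T2 x) + e2 y * (m21 * T1 x + m22 * T2 x)"
    unfolding com[of "\<lambda>z. z x" "X y"] bil[OF xy(2) sx(1)] zt[OF xy(1)] com[of "\<lambda>z. z y" "\<lambda>z. z x"]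
    by (simp add: cov_kernel_def)
  have 2: "(\<integral>z. \<zeta>1 z * X y z \<partial>P) = (m11 * T1 y + m12 * T2 y) + e1 y * (\<integral>z. \<zeta>1 z * \<zeta>1 z \<partial>P) + e2 y * (\<integral>z. \<zeta>1 z * \<zeta>2 z \<partial>P)"
    unfolding com[of \<zeta>1 "X y"] bil[OF xy(2) sq(3)] zz21 com[of "\<lambda>z. z y" \<zeta>1] zt[OF xy(2)] ..
  have 3: "(\<integral>z. \<zeta>2 z * X y z \<partial>P) = (m21 * T1 y + m22 * T2 y) + e1 y * (\<integral>z. \<zeta>1 z * \<zeta>2 z \<partial>P) + e2 y * (\<integral>z. \<zeta>2 z * \<zeta>2 z \<partial>P)"
    unfolding com[of \<zeta>2 "X y"] bil[OF xy(2) sq(4)] com[of "\<lambda>z. z y" \<zeta>2] zt[OF xy(2)] ..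
  have "(\<integral>z. X x z * X y z \<partial>P) = (\<integral>z. z x * X y z \<partial>P) + e1 x * (\<integral>z. \<zeta>1 z * X y z \<partial>P) + e2 x * (\<integral>z. \<zeta>2 z * X y z \<partial>P)"
    by (rule bil[OF xy(1) sx(3)])
  then show "(\<integral>z. X x z * X y z \<partial>P) = cov_kernel P x y
      + e1 x * (m11 * T1 y + m12 * T2 y) + e2 x * (m21 * T1 y + m22 * T2 y)
      + (m11 * T1 x + m12 * T2 x) * e1 y + (m21 * T1 x + m22 * T2 x) * e2 y
      + (m11\<^sup>2 * G11 + 2 * m11 * m12 * G12 + m12\<^sup>2 * G22) * (e1 x * e1 y)
      + (m11 * m21 * G11 + (m11 * m22 + m12 * m21) * G12 + m12 * m22 * G22) * (e1 x * e2 y)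
      + (m11 * m21 * G11 + (m11 * m22 + m12 * m21) * G12 + m12 * m22 * G22) * (e2 x * e1 y)
      + (m21\<^sup>2 * G11 + 2 * m21 * m22 * G12 + m22\<^sup>2 * G22) * (e2 x * e2 y)"
    unfolding 1 2 3 zz by (simp add: algebra_simps)
qed

text \<open>The rotated kernel is realised on the same probability space by applying the rotation to
  the paths. The correction lives where \<open>e1\<close> or \<open>e2\<close> is nonzero, and the
  second moments of its random coefficients are explicit.\<close>

lemma rotated_process:
  assumes \<Gamma>: "continuous_kernel (cov_kernel P)" and e: "continuous_on {0..1} e1" "continuous_on {0..1} e2"
  obtains \<zeta>1 \<zeta>2 where "sq_rv P \<zeta>1" "sq_rv P \<zeta>2"
    "(\<integral>z. (\<zeta>1 z)\<^sup>2 \<partial>P) = (c - 1)\<^sup>2 * l2_inner e1 (cov_operator (cov_kernel P) e1)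
       - 2 * s * (c - 1) * l2_inner e1 (cov_operator (cov_kernel P) e2) + s\<^sup>2 * l2_inner e2 (cov_operator (cov_kernel P) e2)"
    "(\<integral>z. (\<zeta>2 z)\<^sup>2 \<partial>P) = s\<^sup>2 * l2_inner e1 (cov_operator (cov_kernel P) e1)
       + 2 * s * (c - 1) * l2_inner e1 (cov_operator (cov_kernel P) e2) + (c - 1)\<^sup>2 * l2_inner e2 (cov_operator (cov_kernel P) e2)"
    "centered_gaussian_process (distr P path_space (\<lambda>z. \<lambda>t\<in>{0..1}. z t + e1 t * \<zeta>1 z + e2 t * \<zeta>2 z))"
    "\<And>x y. x \<in> {0..1} \<Longrightarrow> y \<in> {0..1} \<Longrightarrow>
      cov_kernel (distr P path_space (\<lambda>z. \<lambda>t\<in>{0..1}. z t + e1 t * \<zeta>1 z + e2 t * \<zeta>2 z)) x y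
        = rot_kernel (cov_kernel P) e1 e2 c s x y"
proof -
  obtain \<xi>1 \<xi>2 where \<xi>: "gauss_space P \<xi>1" "gauss_space P \<xi>2"
    "\<And>t. t \<in> {0..1} \<Longrightarrow> (\<integral>z. z t * \<xi>1 z \<partial>P) = cov_operator (cov_kernel P) e1 t"
    "\<And>t. t \<in> {0..1} \<Longrightarrow> (\<integral>z. z t * \<xi>2 z \<partial>P) = cov_operator (cov_kernel P) e2 t"
    "(\<integral>z. \<xi>1 z * \<xi>1 z \<partial>P) = l2_inner e1 (cov_operator (cov_kernel P) e1)"
    "(\<integral>z. \<xi>1 z * \<xi>2 z \<partial>P) = l2_inner e1 (cov_operator (cov_kernel P) e2)"
    "(\<integral>z. \<xi>2 z * \<xi>2 z \<partial>P) = l2_inner e2 (cov_operator (cov_kernel P) e2)"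
    by (rule gauss_pair_exists[OF \<Gamma> e], rule that)
  define \<zeta>1 where "\<zeta>1 = (\<lambda>z. (c - 1) * \<xi>1 z + (- s) * \<xi>2 z)"
  define \<zeta>2 where "\<zeta>2 = (\<lambda>z. s * \<xi>1 z + (c - 1) * \<xi>2 z)"
  define X where "X t z = z t + e1 t * \<zeta>1 z + e2 t * \<zeta>2 z" for t z
  note sc1 = shifted_covariance(1)[OF \<xi>, where ?m11.0="c - 1" and ?m12.0="- s" and ?m21.0=s and ?m22.0="c - 1"]
    and sc2 = shifted_covariance(2)[OF \<xi>, where ?m11.0="c - 1" and ?m12.0="- s"]
    and sc3 = shifted_covariance(3)[OF \<xi>, where ?m21.0=s and ?m22.0="c - 1"]
    and sc4 = shifted_covariance(4)[OF \<xi>, where ?m11.0="c - 1" and ?m12.0="- s"]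
    and sc5 = shifted_covariance(5)[OF \<xi>, where ?m21.0=s and ?m22.0="c - 1"]
    and sc6 = shifted_covariance(6)[OF \<xi>, where ?m11.0="c - 1" and ?m12.0="- s" and ?m21.0=s and ?m22.0="c - 1"]
  have gX: "gauss_space P (X t)" if "t \<in> {0..1}" for t
    using sc1[of t e1 e2] that unfolding X_def[abs_def] \<zeta>1_def \<zeta>2_def by simp
  have pl: "centered_gaussian_process (distr P path_space (\<lambda>z. \<lambda>t\<in>{0..1}. X t z))"
    "\<And>x y. x \<in> {0..1} \<Longrightarrow> y \<in> {0..1} \<Longrightarrow>
      cov_kernel (distr P path_space (\<lambda>z. \<lambda>t\<in>{0..1}. X t z)) x y = (\<integral>z. X x z * X y z \<partial>P)"
  proof -
    have m: "X t \<in> borel_measurable P" if "t \<in> {0..1}" for t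
      using gauss_space_sq[OF gX[OF that]] by (simp add: sq_rv_def)
    have n: "\<exists>v. centered_normal P (\<lambda>z. \<Sum>t\<in>J. c t * X t z) v" if "finite J" "J \<subseteq> {0..1}" for J c
    proof -
      have "gauss_space P (\<lambda>z. \<Sum>t\<in>J. c t * X t z)"
        by (rule gauss_space_sum[OF that(1)]) (use gX that(2) in auto)
      from gauss_space_normal[OF this] show ?thesis by blast
    qed
    show "centered_gaussian_process (distr P path_space (\<lambda>z. \<lambda>t\<in>{0..1}. X t z))"
     "\<And>x y. x \<in> {0..1} \<Longrightarrow> y \<in> {0..1} \<Longrightarrow>
      cov_kernel (distr P path_space (\<lambda>z. \<lambda>t\<in>{0..1}. X t z)) x y = (\<integral>z. X x z * X y z \<partial>P)"
      using process_law[OF prob_space_axioms m n] by blast+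
  qed
  show ?thesis
  proof (rule that[of \<zeta>1 \<zeta>2])
    show "sq_rv P \<zeta>1" "sq_rv P \<zeta>2" unfolding \<zeta>1_def \<zeta>2_def using sc2 sc3 by (auto intro: gauss_space_sq)
    show "centered_gaussian_process (distr P path_space (\<lambda>z. \<lambda>t\<in>{0..1}. z t + e1 t * \<zeta>1 z + e2 t * \<zeta>2 z))"
      using pl(1) by (simp add: X_def)
    show "cov_kernel (distr P path_space (\<lambda>z. \<lambda>t\<in>{0..1}. z t + e1 t * \<zeta>1 z + e2 t * \<zeta>2 z)) x y
        = rot_kernel (cov_kernel P) e1 e2 c s x y" if "x \<in> {0..1}" "y \<in> {0..1}" for x y
    proof -
      have "(\<integral>z. X x z * X y z \<partial>P) = rot_kernel (cov_kernel P) e1 e2 c s x y"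
        using sc6[of x y e1 e2] that unfolding X_def \<zeta>1_def \<zeta>2_def
        by (simp add: rot_kernel_def Let_def power2_eq_square algebra_simps)
      then show ?thesis using pl(2)[OF that] by (simp add: X_def)
    qed
      show "(\<integral>z. (\<zeta>1 z)\<^sup>2 \<partial>P) = (c - 1)\<^sup>2 * l2_inner e1 (cov_operator (cov_kernel P) e1)
       - 2 * s * (c - 1) * l2_inner e1 (cov_operator (cov_kernel P) e2) + s\<^sup>2 * l2_inner e2 (cov_operator (cov_kernel P) e2)"
      using sc4 unfolding \<zeta>1_def power2_eq_square by (simp add: algebra_simps)
    show "(\<integral>z. (\<zeta>2 z)\<^sup>2 \<partial>P) = s\<^sup>2 * l2_inner e1 (cov_operator (cov_kernel P) e1)
       + 2 * s * (c - 1) * l2_inner e1 (cov_operator (cov_kernel P) e2) + (c - 1)\<^sup>2 * l2_inner e2 (cov_operator (cov_kernel P) e2)"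
      using sc5 unfolding \<zeta>2_def power2_eq_square by (simp add: algebra_simps)
  qed
qed

text \<open>If \<open>e1\<close> and \<open>e2\<close> are eigenfunctions, the components of the
  process along them are uncorrelated with each other and with the remainder \<open>R\<close>. Fresh
  independent normals a and b, scaled by the square roots of the eigenvalues, therefore reproduce
  the covariance. A rotation leaves \<open>R\<close> alone and turns e1 into c e1 + s e2 and e2 into
  c e2 - s e1.\<close>

lemma decomposed_process:
  assumes \<Gamma>: "continuous_kernel (cov_kernel P)" and e: "continuous_on {0..1} e1" "continuous_on {0..1} e2"
    and T: "\<And>t. t \<in> {0..1} \<Longrightarrow> cov_operator (cov_kernel P) e1 t = l1 * e1 t"
      "\<And>t. t \<in> {0..1} \<Longrightarrow> cov_operator (cov_kernel P) e2 t = l2 * e2 t"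
    and n: "l2_inner e1 e1 = 1" "l2_inner e1 e2 = 0" "l2_inner e2 e2 = 1"
    and l: "l1 \<ge> 0" "l2 \<ge> 0"
  defines "W \<equiv> \<lambda>R c s (z, a, b). \<lambda>t\<in>{0..1}. R t z + sqrt l1 * (c * e1 t + s * e2 t) * a + sqrt l2 * (c * e2 t - s * e1 t) * b"
  obtains R where "\<And>t. t \<in> {0..1} \<Longrightarrow> R t \<in> borel_measurable P"
    "\<And>c s. c\<^sup>2 + s\<^sup>2 = 1 \<Longrightarrow> centered_gaussian_process
       (distr (P \<Otimes>\<^sub>M (std_normal_distribution \<Otimes>\<^sub>M std_normal_distribution)) path_space (W R c s))"
    "\<And>c s x y. c\<^sup>2 + s\<^sup>2 = 1 \<Longrightarrow> x \<in> {0..1} \<Longrightarrow> y \<in> {0..1} \<Longrightarrow>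
       cov_kernel (distr (P \<Otimes>\<^sub>M (std_normal_distribution \<Otimes>\<^sub>M std_normal_distribution)) path_space (W R c s)) x y
        = rot_kernel (cov_kernel P) e1 e2 c s x y"
proof -
  let ?N = "std_normal_distribution"
  let ?\<Omega> = "P \<Otimes>\<^sub>M (?N \<Otimes>\<^sub>M ?N)"
  interpret N: real_distribution ?N by (rule real_dist_normal_dist)
  interpret NN: pair_prob_space ?N ?N by unfold_locales
  interpret \<Omega>: pair_prob_space P "?N \<Otimes>\<^sub>M ?N" by unfold_locales
  obtain \<xi>1 \<xi>2 where \<xi>: "gauss_space P \<xi>1" "gauss_space P \<xi>2"
    "\<And>t. t \<in> {0..1} \<Longrightarrow> (\<integral>z. z t * \<xi>1 z \<partial>P) = cov_operator (cov_kernel P) e1 t"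
    "\<And>t. t \<in> {0..1} \<Longrightarrow> (\<integral>z. z t * \<xi>2 z \<partial>P) = cov_operator (cov_kernel P) e2 t"
    "(\<integral>z. \<xi>1 z * \<xi>1 z \<partial>P) = l2_inner e1 (cov_operator (cov_kernel P) e1)"
    "(\<integral>z. \<xi>1 z * \<xi>2 z \<partial>P) = l2_inner e1 (cov_operator (cov_kernel P) e2)"
    "(\<integral>z. \<xi>2 z * \<xi>2 z \<partial>P) = l2_inner e2 (cov_operator (cov_kernel P) e2)"
    by (rule gauss_pair_exists[OF \<Gamma> e], rule that)
  have ip: "l2_inner f (cov_operator (cov_kernel P) e1) = l1 * l2_inner f e1"
    "l2_inner f (cov_operator (cov_kernel P) e2) = l2 * l2_inner f e2" for f
  proof -
    have "l2_inner f (cov_operator (cov_kernel P) e1) = (\<integral>x. l1 * (f x * e1 x) \<partial>lebesgue_on {0..1})"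
      unfolding l2_inner_def by (intro Bochner_Integration.integral_cong) (auto simp: T)
    then show "l2_inner f (cov_operator (cov_kernel P) e1) = l1 * l2_inner f e1" by (simp add: l2_inner_def)
    have "l2_inner f (cov_operator (cov_kernel P) e2) = (\<integral>x. l2 * (f x * e2 x) \<partial>lebesgue_on {0..1})"
      unfolding l2_inner_def by (intro Bochner_Integration.integral_cong) (auto simp: T)
    then show "l2_inner f (cov_operator (cov_kernel P) e2) = l2 * l2_inner f e2" by (simp add: l2_inner_def)
  qed
  define R where "R t z = z t - e1 t * \<xi>1 z - e2 t * \<xi>2 z" for t z
  note sc1 = shifted_covariance(1)[OF \<xi>, where ?m11.0="-1" and ?m12.0=0 and ?m21.0=0 and ?m22.0="-1"]
    and sc6 = shifted_covariance(6)[OF \<xi>, where ?m11.0="-1" and ?m12.0=0 and ?m21.0=0 and ?m22.0="-1"]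
  have gR: "gauss_space P (R t)" if "t \<in> {0..1}" for t
    using sc1[of t e1 e2] that by (simp add: R_def[abs_def])
  have covR: "(\<integral>z. R x z * R y z \<partial>P) = cov_kernel P x y - l1 * (e1 x * e1 y) - l2 * (e2 x * e2 y)"
    if "x \<in> {0..1}" "y \<in> {0..1}" for x y
    using sc6[of x y e1 e2] that by (simp add: R_def T ip n algebra_simps)
  define X where "X = (\<lambda>c s t (z, a, b). R t z + sqrt l1 * (c * e1 t + s * e2 t) * a + sqrt l2 * (c * e2 t - s * e1 t) * b)"
  have Wx: "W R c s = (\<lambda>\<omega>. \<lambda>t\<in>{0..1}. X c s t \<omega>)" for c s by (auto simp: W_def X_def fun_eq_iff)
  have norm: "centered_normal ?\<Omega> (\<lambda>\<omega>. \<Sum>t\<in>J. d t * X c s t \<omega>)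
      ((\<integral>z. (\<Sum>t\<in>J. d t * R t z)\<^sup>2 \<partial>P) + ((\<Sum>t\<in>J. d t * (sqrt l1 * (c * e1 t + s * e2 t)))\<^sup>2 + (\<Sum>t\<in>J. d t * (sqrt l2 * (c * e2 t - s * e1 t)))\<^sup>2))"
    if J: "finite J" "J \<subseteq> {0..1}" for J d c s
  proof -
    let ?u = "\<Sum>t\<in>J. d t * (sqrt l1 * (c * e1 t + s * e2 t))" and ?v = "\<Sum>t\<in>J. d t * (sqrt l2 * (c * e2 t - s * e1 t))"
    have eq: "(\<lambda>\<omega>. \<Sum>t\<in>J. d t * X c s t \<omega>) = (\<lambda>(z, y). (\<Sum>t\<in>J. d t * R t z) + (\<lambda>(a, b). ?u * a + ?v * b) y)"
    proof -
      have gen: "(\<Sum>t\<in>J. d t * (R t z + p t * a + q t * b)) = (\<Sum>t\<in>J. d t * R t z) + ((\<Sum>t\<in>J. d t * p t) * a + (\<Sum>t\<in>J. d t * q t) * b)"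
        for p q :: "real \<Rightarrow> real" and z a b
        by (simp add: sum_distrib_right sum.distrib[symmetric] distrib_left mult.assoc add.assoc)
      show ?thesis
        by (auto simp: X_def fun_eq_iff gen simp del: distrib_left)
    qed
    show ?thesis
      unfolding eq
      by (intro centered_normal_pair gauss_space_normal gauss_space_sum centered_normal_std J(1)
           prob_space_axioms NN.prob_space_axioms N.prob_space_axioms gR) (use J in auto)
  qed
  have pl: "centered_gaussian_process (distr ?\<Omega> path_space (W R c s))"
      "\<And>x y. x \<in> {0..1} \<Longrightarrow> y \<in> {0..1} \<Longrightarrow>
      cov_kernel (distr ?\<Omega> path_space (W R c s)) x y = (\<integral>\<omega>. X c s x \<omega> * X c s y \<omega> \<partial>?\<Omega>)" for c s
  proof -
    have m: "X c s t \<in> borel_measurable ?\<Omega>" if "t \<in> {0..1}" for t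
      using norm[of "{t}" "\<lambda>_. 1" c s] that by (simp add: centered_normal_def)
    have n: "\<exists>v. centered_normal ?\<Omega> (\<lambda>\<omega>. \<Sum>t\<in>J. d t * X c s t \<omega>) v" if "finite J" "J \<subseteq> {0..1}" for J d
      using norm[OF that] by blast
    show "centered_gaussian_process (distr ?\<Omega> path_space (W R c s))"
      "\<And>x y. x \<in> {0..1} \<Longrightarrow> y \<in> {0..1} \<Longrightarrow>
      cov_kernel (distr ?\<Omega> path_space (W R c s)) x y = (\<integral>\<omega>. X c s x \<omega> * X c s y \<omega> \<partial>?\<Omega>)"
      unfolding Wx using process_law[OF \<Omega>.prob_space_axioms m n] by blast+
  qed
  have cov: "(\<integral>\<omega>. X c s x \<omega> * X c s y \<omega> \<partial>?\<Omega>) = rot_kernel (cov_kernel P) e1 e2 c s x y"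
    if cs: "c\<^sup>2 + s\<^sup>2 = 1" and xy: "x \<in> {0..1}" "y \<in> {0..1}" for c s x y
  proof -
    define f1 f2 where f: "f1 = (\<lambda>t. sqrt l1 * (c * e1 t + s * e2 t))" "f2 = (\<lambda>t. sqrt l2 * (c * e2 t - s * e1 t))"
    have one: "centered_normal ?\<Omega> (X c s t) ((\<integral>z. (R t z)\<^sup>2 \<partial>P) + ((f1 t)\<^sup>2 + (f2 t)\<^sup>2))" if "t \<in> {0..1}" for t
      using norm[of "{t}" "\<lambda>_. 1" c s] that by (simp add: f)
    have sqX: "sq_rv ?\<Omega> (X c s t)" "(\<integral>\<omega>. (X c s t \<omega>)\<^sup>2 \<partial>?\<Omega>) = (\<integral>z. (R t z)\<^sup>2 \<partial>P) + ((f1 t)\<^sup>2 + (f2 t)\<^sup>2)"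
      if "t \<in> {0..1}" for t
      using centered_normal_second_moment[OF \<Omega>.prob_space_axioms one[OF that]] one[OF that]
      by (auto simp: sq_rv_def centered_normal_def)
    have sqR: "sq_rv P (R t)" if "t \<in> {0..1}" for t using gauss_space_sq[OF gR[OF that]] .
    \<comment> \<open>\<open>norm\<close> provides variances of linear combinations, so the
      covariance comes by polarisation. For x = y the index set {x, y} collapses to one coordinate,
      which is the separate case.\<close>
    have "(\<integral>\<omega>. X c s x \<omega> * X c s y \<omega> \<partial>?\<Omega>) = (\<integral>z. R x z * R y z \<partial>P) + f1 x * f1 y + f2 x * f2 y"
    proof (cases "x = y")
      case True
      then show ?thesis using sqX(2)[OF xy(1)] by (simp add: power2_eq_square)
    next
      case False
      have "centered_normal ?\<Omega> (\<lambda>\<omega>. 1 * X c s x \<omega> + 1 * X c s y \<omega>)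
        ((\<integral>z. (1 * R x z + 1 * R y z)\<^sup>2 \<partial>P) + ((f1 x + f1 y)\<^sup>2 + (f2 x + f2 y)\<^sup>2))"
        using norm[of "{x, y}" "\<lambda>_. 1" c s] xy False by (simp add: f)
      from centered_normal_second_moment(2)[OF \<Omega>.prob_space_axioms this]
      show ?thesis
        unfolding sq_rv_comb(2)[OF sqX(1)[OF xy(1)] sqX(1)[OF xy(2)]] sq_rv_comb(2)[OF sqR[OF xy(1)] sqR[OF xy(2)]]
          sqX(2)[OF xy(1)] sqX(2)[OF xy(2)]
        by (simp add: power2_eq_square algebra_simps)
    qed
    also have "\<dots> = cov_kernel P x y - l1 * (e1 x * e1 y) - l2 * (e2 x * e2 y)
        + l1 * ((c * e1 x + s * e2 x) * (c * e1 y + s * e2 y)) + l2 * ((c * e2 x - s * e1 x) * (c * e2 y - s * e1 y))"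
    proof -
      have q: "sqrt l * u * (sqrt l * v) = l * (u * v)" if "l \<ge> 0" for l u v :: real
      proof -
        have "sqrt l * u * (sqrt l * v) = (sqrt l * sqrt l) * (u * v)" by (simp only: mult_ac)
        then show ?thesis using that by simp
      qed
      show ?thesis unfolding covR[OF xy] f q[OF l(1)] q[OF l(2)] ..
    qed
    also have "\<dots> = rot_kernel (cov_kernel P) e1 e2 c s x y"
      unfolding rot_kernel_def Let_def ip n T[OF xy(1)] T[OF xy(2)]
      by (simp add: power2_eq_square algebra_simps)
    finally show ?thesis .
  qed
  show ?thesis
    by (rule that[of R]) (use gauss_space_sq[OF gR] pl cov in \<open>simp_all add: sq_rv_def\<close>)
qed

end

subsection \<open>Change of measure\<close>

text \<open>Where the density is at most \<open>K\<close> the first term dominates, elsewhere \<open>dens \<le> dens\<^sup>2 / K\<close>.\<close>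

lemma change_of_measure_bound:
  fixes dens :: "'a \<Rightarrow> real"
  assumes [measurable]: "dens \<in> borel_measurable M" and pos: "\<And>x. 0 \<le> dens x"
    and B[measurable]: "B \<in> sets M" and K: "K > 0"
  shows "emeasure (density M dens) B \<le> ennreal K * emeasure M B + (\<integral>\<^sup>+x. ennreal ((dens x)\<^sup>2) \<partial>M) / ennreal K"
proof -
  have pt: "l * indicator B x \<le> K * indicator B x + l\<^sup>2 / K" if "l \<ge> 0" for l :: real and x :: 'a
  proof (cases "l \<le> K")
    case True
    then show ?thesis using K by (auto simp: indicator_def add_increasing2)
  next
    case False
    then have "K * l \<le> l * l" using that by (intro mult_right_mono) auto
    then have "l \<le> l\<^sup>2 / K" using K by (simp add: le_divide_eq power2_eq_square mult.commute)
    then show ?thesis using K that by (auto simp: indicator_def add_increasing)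
  qed
  have "emeasure (density M dens) B = (\<integral>\<^sup>+x. ennreal (dens x) * indicator B x \<partial>M)"
    by (simp add: emeasure_density)
  also have "\<dots> \<le> (\<integral>\<^sup>+x. ennreal K * indicator B x + ennreal ((dens x)\<^sup>2) * ennreal (1 / K) \<partial>M)"
  proof (rule nn_integral_mono)
    fix x
    have "ennreal (dens x) * indicator B x = ennreal (dens x * indicator B x)"
      by (simp add: indicator_def)
    also have "\<dots> \<le> ennreal (K * indicator B x + (dens x)\<^sup>2 * (1 / K))"
      using pt[OF pos, of x x] by (simp add: ennreal_leI)
    also have "\<dots> = ennreal (K * indicator B x) + ennreal ((dens x)\<^sup>2 * (1 / K))"
      using K by (intro ennreal_plus) auto
    also have "\<dots> = ennreal K * indicator B x + ennreal ((dens x)\<^sup>2) * ennreal (1 / K)"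
      using K by (subst ennreal_mult) (auto simp: indicator_def)
    finally show "ennreal (dens x) * indicator B x \<le> ennreal K * indicator B x + ennreal ((dens x)\<^sup>2) * ennreal (1 / K)" .
  qed
  also have "\<dots> = ennreal K * emeasure M B + (\<integral>\<^sup>+x. ennreal ((dens x)\<^sup>2) \<partial>M) * ennreal (1 / K)"
    by (subst nn_integral_add) (auto simp: nn_integral_cmult nn_integral_multc)
  also have "(\<integral>\<^sup>+x. ennreal ((dens x)\<^sup>2) \<partial>M) * ennreal (1 / K) = (\<integral>\<^sup>+x. ennreal ((dens x)\<^sup>2) \<partial>M) / ennreal K"
    using K by (simp add: divide_ennreal_def inverse_ennreal inverse_eq_divide)
  finally show ?thesis .
qed

text \<open>The image and the reweighted measure agree on rectangles, so both are the product of the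
  transformed laws. Likelihood ratios multiply over the coordinates, and so do their second moments;
  this is what \<open>change_of_measure_bound\<close> asks for.\<close>

lemma PiM_change_of_measure:
  fixes dens :: "'i \<Rightarrow> 'a \<Rightarrow> real"
  assumes I: "finite I" and M: "\<And>i. prob_space (M i)"
    and f: "\<And>i. f i \<in> measurable (M i) (M i)"
    and dens: "\<And>i. dens i \<in> borel_measurable (M i)" and pos: "\<And>i x. 0 \<le> dens i x"
    and eq: "\<And>i. distr (M i) (M i) (f i) = density (M i) (dens i)"
    and c0: "\<And>i. 0 \<le> c i" and c: "\<And>i. (\<integral>\<^sup>+x. ennreal ((dens i x)\<^sup>2) \<partial>M i) \<le> ennreal (c i)"
    and B: "B \<in> sets (PiM I M)" and K: "K > 0"
  shows "emeasure (PiM I M) {\<omega> \<in> space (PiM I M). (\<lambda>i\<in>I. f i (\<omega> i)) \<in> B}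
    \<le> ennreal K * emeasure (PiM I M) B + ennreal (\<Prod>i\<in>I. c i) / ennreal K"
proof -
  interpret M: product_prob_space M by (intro product_prob_spaceI M)
  define N where "N i = distr (M i) (M i) (f i)" for i
  have pN: "prob_space (N i)" for i
    unfolding N_def by (rule prob_space.prob_space_distr[OF M f])
  interpret N: product_prob_space N by (intro product_prob_spaceI pN)
  let ?F = "\<lambda>\<omega>. \<lambda>i\<in>I. f i (\<omega> i)"
  have sets: "sets (PiM I N) = sets (PiM I M)" by (intro sets_PiM_cong) (auto simp: N_def)
  have F: "?F \<in> measurable (PiM I M) (PiM I M)"
  proof (rule measurable_restrict)
    fix i assume "i \<in> I"
    from measurable_compose[OF measurable_component_singleton[OF this, of M] f[of i]]
    show "(\<lambda>\<omega>. f i (\<omega> i)) \<in> measurable (PiM I M) (M i)" .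
  qed
  define L where "L \<omega> = (\<Prod>i\<in>I. dens i (\<omega> i))" for \<omega>
  have L: "L \<in> borel_measurable (PiM I M)"
    unfolding L_def
  proof (rule borel_measurable_prod)
    fix i assume "i \<in> I"
    from measurable_compose[OF measurable_component_singleton[OF this, of M] dens[of i]]
    show "(\<lambda>\<omega>. dens i (\<omega> i)) \<in> borel_measurable (PiM I M)" .
  qed
  have L0: "0 \<le> L \<omega>" for \<omega> unfolding L_def by (intro prod_nonneg pos)
  have 1: "distr (PiM I M) (PiM I M) ?F = PiM I N"
  proof (rule N.PiM_eqI[OF I])
    show "sets (distr (PiM I M) (PiM I M) ?F) = PiM I N" using sets by simp
    fix A assume A: "\<And>i. i \<in> I \<Longrightarrow> A i \<in> sets (N i)"
    then have A': "\<And>i. i \<in> I \<Longrightarrow> A i \<in> sets (M i)" by (simp add: N_def)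
    have "?F -` (Pi\<^sub>E I A) \<inter> space (PiM I M) = (Pi\<^sub>E I (\<lambda>i. f i -` A i \<inter> space (M i)))"
      by (auto simp: space_PiM PiE_iff extensional_def)
    then have "emeasure (distr (PiM I M) (PiM I M) ?F) (Pi\<^sub>E I A)
        = emeasure (PiM I M) (Pi\<^sub>E I (\<lambda>i. f i -` A i \<inter> space (M i)))"
      using A' F I by (subst emeasure_distr) (auto intro: sets_PiM_I_finite)
    also have "\<dots> = (\<Prod>i\<in>I. emeasure (M i) (f i -` A i \<inter> space (M i)))"
      using A' f I by (intro M.emeasure_PiM) (auto intro: measurable_sets)
    also have "\<dots> = (\<Prod>i\<in>I. emeasure (N i) (A i))"
      using A' f by (intro prod.cong refl) (simp add: N_def emeasure_distr)
    finally show "emeasure (distr (PiM I M) (PiM I M) ?F) (Pi\<^sub>E I A) = (\<Prod>i\<in>I. emeasure (N i) (A i))" .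
  qed
  have 2: "density (PiM I M) L = PiM I N"
  proof (rule N.PiM_eqI[OF I])
    show "sets (density (PiM I M) L) = PiM I N" using sets by simp
    fix A assume A: "\<And>i. i \<in> I \<Longrightarrow> A i \<in> sets (N i)"
    then have A': "\<And>i. i \<in> I \<Longrightarrow> A i \<in> sets (M i)" by (simp add: N_def)
    have "emeasure (density (PiM I M) L) (Pi\<^sub>E I A) = (\<integral>\<^sup>+\<omega>. ennreal (L \<omega>) * indicator (Pi\<^sub>E I A) \<omega> \<partial>PiM I M)"
      using A' I L by (intro emeasure_density) (auto intro: sets_PiM_I_finite)
    also have "\<dots> = (\<integral>\<^sup>+\<omega>. (\<Prod>i\<in>I. ennreal (dens i (\<omega> i)) * indicator (A i) (\<omega> i)) \<partial>PiM I M)"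
    proof (rule nn_integral_cong)
      fix \<omega> assume "\<omega> \<in> space (PiM I M)"
      then have "indicator (Pi\<^sub>E I A) \<omega> = (\<Prod>i\<in>I. indicator (A i) (\<omega> i) :: ennreal)"
        using I by (auto simp: indicator_def space_PiM PiE_iff)
      then show "ennreal (L \<omega>) * indicator (Pi\<^sub>E I A) \<omega> = (\<Prod>i\<in>I. ennreal (dens i (\<omega> i)) * indicator (A i) (\<omega> i))"
        by (simp add: L_def prod.distrib prod_ennreal pos)
    qed
    also have "\<dots> = (\<Prod>i\<in>I. \<integral>\<^sup>+x. ennreal (dens i x) * indicator (A i) x \<partial>M i)"
      using A' dens I by (intro M.product_nn_integral_prod) auto
    also have "\<dots> = (\<Prod>i\<in>I. emeasure (N i) (A i))"
      unfolding N_def eq using A' dens by (intro prod.cong refl) (simp add: emeasure_density)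
    finally show "emeasure (density (PiM I M) L) (Pi\<^sub>E I A) = (\<Prod>i\<in>I. emeasure (N i) (A i))" .
  qed
  have "{\<omega> \<in> space (PiM I M). ?F \<omega> \<in> B} = ?F -` B \<inter> space (PiM I M)" by auto
  then have "emeasure (PiM I M) {\<omega> \<in> space (PiM I M). ?F \<omega> \<in> B} = emeasure (distr (PiM I M) (PiM I M) ?F) B"
    using F B by (simp add: emeasure_distr)
  also have "\<dots> = emeasure (density (PiM I M) L) B" by (simp add: 1 2)
  also have "\<dots> \<le> ennreal K * emeasure (PiM I M) B + (\<integral>\<^sup>+\<omega>. ennreal ((L \<omega>)\<^sup>2) \<partial>PiM I M) / ennreal K"
    by (rule change_of_measure_bound[OF L L0 B K])
  also have "(\<integral>\<^sup>+\<omega>. ennreal ((L \<omega>)\<^sup>2) \<partial>PiM I M) = (\<integral>\<^sup>+\<omega>. (\<Prod>i\<in>I. ennreal ((dens i (\<omega> i))\<^sup>2)) \<partial>PiM I M)"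
    by (simp add: L_def prod_power_distrib prod_ennreal)
  also have "\<dots> = (\<Prod>i\<in>I. \<integral>\<^sup>+x. ennreal ((dens i x)\<^sup>2) \<partial>M i)"
    using dens I by (intro M.product_nn_integral_prod) auto
  finally have "emeasure (PiM I M) {\<omega> \<in> space (PiM I M). ?F \<omega> \<in> B}
    \<le> ennreal K * emeasure (PiM I M) B + (\<Prod>i\<in>I. \<integral>\<^sup>+x. ennreal ((dens i x)\<^sup>2) \<partial>M i) / ennreal K" .
  moreover have "(\<Prod>i\<in>I. \<integral>\<^sup>+x. ennreal ((dens i x)\<^sup>2) \<partial>M i) \<le> ennreal (\<Prod>i\<in>I. c i)"
    unfolding prod_ennreal[OF c0, symmetric] by (intro prod_mono_ennreal c)
  ultimately show ?thesis
    using add_left_mono[OF divide_right_mono_ennreal] order_trans by blast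
qed

section \<open>Shifts of Gaussian measures\<close>

lemma gauss_shift_density:
  assumes \<sigma>: "\<sigma> > 0"
  defines "N \<equiv> density lborel (normal_density 0 \<sigma>)"
  shows "distr N N (\<lambda>x. x + a) = density N (\<lambda>x. exp ((2 * a * x - a\<^sup>2) / (2 * \<sigma>\<^sup>2)))"
    "(\<integral>\<^sup>+x. ennreal ((exp ((2 * a * x - a\<^sup>2) / (2 * \<sigma>\<^sup>2)))\<^sup>2) \<partial>N) = ennreal (exp (a\<^sup>2 / \<sigma>\<^sup>2))"
proof -
  interpret N: prob_space N unfolding N_def by (rule prob_space_normal_density[OF \<sigma>])
  have shift: "normal_density 0 \<sigma> x * exp ((2 * a * x - a\<^sup>2) / (2 * \<sigma>\<^sup>2)) = normal_density a \<sigma> x" for x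
  proof -
    have "- x\<^sup>2 / (2 * \<sigma>\<^sup>2) + (2 * a * x - a\<^sup>2) / (2 * \<sigma>\<^sup>2) = - (x - a)\<^sup>2 / (2 * \<sigma>\<^sup>2)"
      unfolding add_divide_distrib[symmetric] by (simp add: power2_eq_square algebra_simps)
    then show ?thesis by (simp add: normal_density_def exp_add[symmetric])
  qed
  have "distributed N lborel (\<lambda>x. x) (normal_density 0 \<sigma>)"
    unfolding distributed_def N_def by (auto simp: distr_id2)
  from N.normal_density_affine[OF this \<sigma>, of 1 a]
  have "distributed N lborel (\<lambda>x. x + a) (normal_density a \<sigma>)" by (simp add: add.commute)
  then have "distr N lborel (\<lambda>x. x + a) = density lborel (normal_density a \<sigma>)"
    by (rule distributed_distr_eq_density)
  moreover have "distr N lborel (\<lambda>x. x + a) = distr N N (\<lambda>x. x + a)"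
    by (rule distr_cong) (auto simp: N_def)
  moreover have "density N (\<lambda>x. exp ((2 * a * x - a\<^sup>2) / (2 * \<sigma>\<^sup>2))) = density lborel (normal_density a \<sigma>)"
    unfolding N_def by (subst density_density_eq) (auto simp: ennreal_mult[symmetric] shift)
  ultimately show "distr N N (\<lambda>x. x + a) = density N (\<lambda>x. exp ((2 * a * x - a\<^sup>2) / (2 * \<sigma>\<^sup>2)))" by simp
  \<comment> \<open>Completing the square: the squared likelihood ratio moves the mean from 0 to 2a
    and leaves the factor exp(a^2 / \<sigma>^2).\<close>
  have sq: "normal_density 0 \<sigma> x * (exp ((2 * a * x - a\<^sup>2) / (2 * \<sigma>\<^sup>2)))\<^sup>2 = exp (a\<^sup>2 / \<sigma>\<^sup>2) * normal_density (2 * a) \<sigma> x" for x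
  proof -
    have "- x\<^sup>2 / (2 * \<sigma>\<^sup>2) + 2 * ((2 * a * x - a\<^sup>2) / (2 * \<sigma>\<^sup>2)) = a\<^sup>2 / \<sigma>\<^sup>2 + (- (x - 2 * a)\<^sup>2 / (2 * \<sigma>\<^sup>2))"
      using \<sigma> by (simp add: power2_eq_square field_simps)
    then have "exp (- x\<^sup>2 / (2 * \<sigma>\<^sup>2)) * exp (2 * ((2 * a * x - a\<^sup>2) / (2 * \<sigma>\<^sup>2)))
       = exp (a\<^sup>2 / \<sigma>\<^sup>2) * exp (- (x - 2 * a)\<^sup>2 / (2 * \<sigma>\<^sup>2))"
      unfolding exp_add[symmetric] by simp
    then show ?thesis by (simp add: normal_density_def exp_double[symmetric])
  qed
  interpret N2: prob_space "density lborel (normal_density (2 * a) \<sigma>)" by (rule prob_space_normal_density[OF \<sigma>])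
  have "(\<integral>\<^sup>+x. ennreal ((exp ((2 * a * x - a\<^sup>2) / (2 * \<sigma>\<^sup>2)))\<^sup>2) \<partial>N)
     = (\<integral>\<^sup>+x. ennreal (exp (a\<^sup>2 / \<sigma>\<^sup>2)) * ennreal (normal_density (2 * a) \<sigma> x) \<partial>lborel)"
    unfolding N_def by (subst nn_integral_density) (auto simp: ennreal_mult[symmetric] sq)
  also have "\<dots> = ennreal (exp (a\<^sup>2 / \<sigma>\<^sup>2)) * (\<integral>\<^sup>+x. ennreal (normal_density (2 * a) \<sigma> x) \<partial>lborel)"
    by (rule nn_integral_cmult) simp
  also have "(\<integral>\<^sup>+x. ennreal (normal_density (2 * a) \<sigma> x) \<partial>lborel) = 1"
    using N2.emeasure_space_1 by (simp add: emeasure_density)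
  finally show "(\<integral>\<^sup>+x. ennreal ((exp ((2 * a * x - a\<^sup>2) / (2 * \<sigma>\<^sup>2)))\<^sup>2) \<partial>N) = ennreal (exp (a\<^sup>2 / \<sigma>\<^sup>2))" by simp
qed

lemma gauss_shift_bound:
  assumes I: "finite I" and \<sigma>: "\<sigma> > 0" and K: "K > 0"
  defines "N \<equiv> density lborel (normal_density 0 \<sigma>)"
  assumes B: "B \<in> sets (PiM I (\<lambda>_. N))"
  shows "emeasure (PiM I (\<lambda>_. N)) {e \<in> space (PiM I (\<lambda>_. N)). (\<lambda>i\<in>I. e i + a i) \<in> B}
    \<le> ennreal K * emeasure (PiM I (\<lambda>_. N)) B + ennreal (exp ((\<Sum>i\<in>I. (a i)\<^sup>2) / \<sigma>\<^sup>2)) / ennreal K"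
proof -
  have "emeasure (PiM I (\<lambda>_. N)) {e \<in> space (PiM I (\<lambda>_. N)). (\<lambda>i\<in>I. e i + a i) \<in> B}
    \<le> ennreal K * emeasure (PiM I (\<lambda>_. N)) B + ennreal (\<Prod>i\<in>I. exp ((a i)\<^sup>2 / \<sigma>\<^sup>2)) / ennreal K"
    by (rule PiM_change_of_measure[where dens="\<lambda>i x. exp ((2 * a i * x - (a i)\<^sup>2) / (2 * \<sigma>\<^sup>2))" and f="\<lambda>i x. x + a i", OF I _ _ _ _ _ _ _ B K])
       (use gauss_shift_density[OF \<sigma>] prob_space_normal_density[OF \<sigma>] in \<open>auto simp: N_def\<close>)
  then show ?thesis using I by (simp add: exp_sum sum_divide_distrib)
qed

text \<open>This averages the second moment of the likelihood ratio of a shear over the coordinate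
  that drives the shift. The integral is (1 - 2 \<beta>^2)^(-1/2), and the bound comes from 1 / (1 -
  y) \<le> exp(2 y) on [0, 1/2] with y = 2 \<beta>^2.\<close>

lemma std_normal_exp_square:
  assumes "\<beta>\<^sup>2 \<le> 1 / 4"
  shows "(\<integral>\<^sup>+x. ennreal (exp ((\<beta> * x)\<^sup>2)) \<partial>density lborel (normal_density 0 1)) \<le> ennreal (exp (2 * \<beta>\<^sup>2))"
proof -
  define v where "v = 1 - 2 * \<beta>\<^sup>2"
  have v: "1 / 2 \<le> v" "v \<le> 1" using assms by (auto simp: v_def)
  define \<sigma> where "\<sigma> = 1 / sqrt v"
  have \<sigma>: "\<sigma> > 0" "\<sigma>\<^sup>2 = 1 / v" using v by (auto simp: \<sigma>_def power_divide)
  have eq: "normal_density 0 1 x * exp ((\<beta> * x)\<^sup>2) = \<sigma> * normal_density 0 \<sigma> x" for x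
  proof -
    have "- x\<^sup>2 / 2 + (\<beta> * x)\<^sup>2 = - x\<^sup>2 / (2 * \<sigma>\<^sup>2)"
      unfolding \<sigma>(2) v_def by (simp add: power_mult_distrib algebra_simps)
    then have "exp (- x\<^sup>2 / 2) * exp ((\<beta> * x)\<^sup>2) = exp (- x\<^sup>2 / (2 * \<sigma>\<^sup>2))" by (simp add: exp_add[symmetric])
    moreover have "sqrt (2 * pi * \<sigma>\<^sup>2) = sqrt (2 * pi) * \<sigma>" using \<sigma>(1) by (simp add: real_sqrt_mult)
    ultimately show ?thesis using \<sigma>(1) by (simp add: normal_density_def field_simps)
  qed
  interpret N: prob_space "density lborel (normal_density 0 \<sigma>)" by (rule prob_space_normal_density[OF \<sigma>(1)])
  have "(\<integral>\<^sup>+x. ennreal (exp ((\<beta> * x)\<^sup>2)) \<partial>density lborel (normal_density 0 1)) = (\<integral>\<^sup>+x. ennreal \<sigma> * ennreal (normal_density 0 \<sigma> x) \<partial>lborel)"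
    using \<sigma>(1) by (subst nn_integral_density) (auto simp: ennreal_mult[symmetric] eq)
  also have "\<dots> = ennreal \<sigma> * (\<integral>\<^sup>+x. ennreal (normal_density 0 \<sigma> x) \<partial>lborel)"
    by (rule nn_integral_cmult) simp
  also have "(\<integral>\<^sup>+x. ennreal (normal_density 0 \<sigma> x) \<partial>lborel) = 1"
    using N.emeasure_space_1 by (simp add: emeasure_density)
  finally have "(\<integral>\<^sup>+x. ennreal (exp ((\<beta> * x)\<^sup>2)) \<partial>density lborel (normal_density 0 1)) = ennreal \<sigma>" by simp
  moreover have "\<sigma> \<le> exp (2 * \<beta>\<^sup>2)"
  proof -
    define y where "y = 2 * \<beta>\<^sup>2"
    have y: "0 \<le> y" "y \<le> 1 / 2" "v = 1 - y" using assms by (auto simp: y_def v_def)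
    have "y * y \<le> y * (1/2)" using y by (intro mult_left_mono) auto
    then have "1 \<le> (1 + 2 * y) * v" unfolding y(3) by (simp add: algebra_simps)
    also have "\<dots> \<le> exp (2 * y) * v" using v exp_ge_add_one_self[of "2 * y"] by (intro mult_right_mono) auto
    finally have "1 / v \<le> (exp y)\<^sup>2" using v by (simp add: divide_le_eq exp_double)
    then have "\<sigma>\<^sup>2 \<le> (exp y)\<^sup>2" using \<sigma>(2) by simp
    then show ?thesis unfolding y_def by (rule power2_le_imp_le) simp
  qed
  ultimately show ?thesis by (simp add: ennreal_leI)
qed

section \<open>Shears and rotations of pairs of normal variables\<close>

abbreviation std_normal :: "real measure" where
  "std_normal \<equiv> density lborel (normal_density 0 1)"

lemma prob_space_std_normal: "prob_space std_normal"
  by (rule prob_space_normal_density) simp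

lemma nn_integral_std_normal_shift:
  assumes f: "f \<in> borel_measurable borel"
  shows "(\<integral>\<^sup>+x. f (x + a) \<partial>std_normal) = (\<integral>\<^sup>+x. ennreal (exp ((2 * a * x - a\<^sup>2) / 2)) * f x \<partial>std_normal)"
proof -
  have "(\<integral>\<^sup>+x. f (x + a) \<partial>std_normal) = (\<integral>\<^sup>+x. f x \<partial>distr std_normal std_normal (\<lambda>x. x + a))"
    using f by (subst nn_integral_distr) auto
  also have "\<dots> = (\<integral>\<^sup>+x. ennreal (exp ((2 * a * x - a\<^sup>2) / 2)) * f x \<partial>std_normal)"
    using gauss_shift_density(1)[of 1 a] f by (simp add: nn_integral_density)
  finally show ?thesis .
qed

lemma nn_integral_std_normal_likelihood:
  "(\<integral>\<^sup>+x. ennreal ((exp ((2 * a * x - a\<^sup>2) / 2))\<^sup>2) \<partial>std_normal) = ennreal (exp (a\<^sup>2))"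
  using gauss_shift_density(2)[of 1 a] by simp

text \<open>A shear of a pair of independent standard normal variables is a Gaussian mean shift
  of one of them, conditionally on the other.\<close>

lemma shear_snd:
  fixes \<beta> :: real
  defines "Y \<equiv> std_normal \<Otimes>\<^sub>M std_normal"
  shows "distr Y Y (\<lambda>(a, b). (a, b + \<beta> * a)) = density Y (\<lambda>(a, b). exp ((2 * (\<beta> * a) * b - (\<beta> * a)\<^sup>2) / 2))"
    "(\<integral>\<^sup>+y. ennreal ((case y of (a, b) \<Rightarrow> exp ((2 * (\<beta> * a) * b - (\<beta> * a)\<^sup>2) / 2))\<^sup>2) \<partial>Y)
       = (\<integral>\<^sup>+a. ennreal (exp ((\<beta> * a)\<^sup>2)) \<partial>std_normal)"
proof -
  interpret N: prob_space std_normal by (rule prob_space_std_normal)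
  interpret pair_prob_space std_normal std_normal by unfold_locales
  show "distr Y Y (\<lambda>(a, b). (a, b + \<beta> * a)) = density Y (\<lambda>(a, b). exp ((2 * (\<beta> * a) * b - (\<beta> * a)\<^sup>2) / 2))"
  proof (rule measure_eqI)
    fix A assume "A \<in> sets (distr Y Y (\<lambda>(a, b). (a, b + \<beta> * a)))"
    then have A[measurable]: "A \<in> sets Y" by simp
    have "sets Y = sets (borel \<Otimes>\<^sub>M borel)" unfolding Y_def by (intro sets_pair_measure_cong) simp_all
    then have A'[measurable]: "A \<in> sets (borel \<Otimes>\<^sub>M borel)" using A by simp
    have f: "(\<lambda>(a, b). (a, b + \<beta> * a)) \<in> measurable Y Y" unfolding Y_def by measurable
    have "emeasure (distr Y Y (\<lambda>(a, b). (a, b + \<beta> * a))) A = (\<integral>\<^sup>+y. indicator A y \<partial>distr Y Y (\<lambda>(a, b). (a, b + \<beta> * a)))"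
      by simp
    also have "\<dots> = (\<integral>\<^sup>+y. indicator A (fst y, snd y + \<beta> * fst y) \<partial>Y)"
      using f by (subst nn_integral_distr) (auto simp: split_beta')
    also have "\<dots> = (\<integral>\<^sup>+a. \<integral>\<^sup>+b. indicator A (a, b + \<beta> * a) \<partial>std_normal \<partial>std_normal)"
      unfolding Y_def by (subst N.nn_integral_fst[symmetric]) auto
    also have "\<dots> = (\<integral>\<^sup>+a. \<integral>\<^sup>+b. ennreal (exp ((2 * (\<beta> * a) * b - (\<beta> * a)\<^sup>2) / 2)) * indicator A (a, b) \<partial>std_normal \<partial>std_normal)"
      by (intro nn_integral_cong nn_integral_std_normal_shift) measurable
    also have "\<dots> = (\<integral>\<^sup>+y. ennreal (exp ((2 * (\<beta> * fst y) * snd y - (\<beta> * fst y)\<^sup>2) / 2)) * indicator A y \<partial>Y)"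
      unfolding Y_def by (subst N.nn_integral_fst[symmetric]) auto
    also have "\<dots> = emeasure (density Y (\<lambda>(a, b). exp ((2 * (\<beta> * a) * b - (\<beta> * a)\<^sup>2) / 2))) A"
      by (subst emeasure_density) (auto simp: Y_def split_beta')
    finally show "emeasure (distr Y Y (\<lambda>(a, b). (a, b + \<beta> * a))) A = emeasure (density Y (\<lambda>(a, b). exp ((2 * (\<beta> * a) * b - (\<beta> * a)\<^sup>2) / 2))) A" .
  qed simp
  show "(\<integral>\<^sup>+y. ennreal ((case y of (a, b) \<Rightarrow> exp ((2 * (\<beta> * a) * b - (\<beta> * a)\<^sup>2) / 2))\<^sup>2) \<partial>Y)
       = (\<integral>\<^sup>+a. ennreal (exp ((\<beta> * a)\<^sup>2)) \<partial>std_normal)"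
    unfolding Y_def
    by (subst N.nn_integral_fst[symmetric]) (auto simp: nn_integral_std_normal_likelihood)
qed

lemma shear_fst:
  fixes \<beta> :: real
  defines "Y \<equiv> std_normal \<Otimes>\<^sub>M std_normal"
  shows "distr Y Y (\<lambda>(a, b). (a + \<beta> * b, b)) = density Y (\<lambda>(a, b). exp ((2 * (\<beta> * b) * a - (\<beta> * b)\<^sup>2) / 2))"
    "(\<integral>\<^sup>+y. ennreal ((case y of (a, b) \<Rightarrow> exp ((2 * (\<beta> * b) * a - (\<beta> * b)\<^sup>2) / 2))\<^sup>2) \<partial>Y)
       = (\<integral>\<^sup>+a. ennreal (exp ((\<beta> * a)\<^sup>2)) \<partial>std_normal)"
proof -
  interpret N: prob_space std_normal by (rule prob_space_std_normal)
  interpret pair_prob_space std_normal std_normal by unfold_locales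
  show "distr Y Y (\<lambda>(a, b). (a + \<beta> * b, b)) = density Y (\<lambda>(a, b). exp ((2 * (\<beta> * b) * a - (\<beta> * b)\<^sup>2) / 2))"
  proof (rule measure_eqI)
    fix A assume "A \<in> sets (distr Y Y (\<lambda>(a, b). (a + \<beta> * b, b)))"
    then have A[measurable]: "A \<in> sets Y" by simp
    have "sets Y = sets (borel \<Otimes>\<^sub>M borel)" unfolding Y_def by (intro sets_pair_measure_cong) simp_all
    then have A'[measurable]: "A \<in> sets (borel \<Otimes>\<^sub>M borel)" using A by simp
    have f: "(\<lambda>(a, b). (a + \<beta> * b, b)) \<in> measurable Y Y" unfolding Y_def by measurable
    have "emeasure (distr Y Y (\<lambda>(a, b). (a + \<beta> * b, b))) A = (\<integral>\<^sup>+y. indicator A y \<partial>distr Y Y (\<lambda>(a, b). (a + \<beta> * b, b)))"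
      by simp
    also have "\<dots> = (\<integral>\<^sup>+y. indicator A (fst y + \<beta> * snd y, snd y) \<partial>Y)"
      using f by (subst nn_integral_distr) (auto simp: split_beta')
    also have "\<dots> = (\<integral>\<^sup>+b. \<integral>\<^sup>+a. indicator A (a + \<beta> * b, b) \<partial>std_normal \<partial>std_normal)"
      unfolding Y_def by (subst nn_integral_snd[symmetric]) auto
    also have "\<dots> = (\<integral>\<^sup>+b. \<integral>\<^sup>+a. ennreal (exp ((2 * (\<beta> * b) * a - (\<beta> * b)\<^sup>2) / 2)) * indicator A (a, b) \<partial>std_normal \<partial>std_normal)"
      by (intro nn_integral_cong nn_integral_std_normal_shift) measurable
    also have "\<dots> = (\<integral>\<^sup>+y. ennreal (exp ((2 * (\<beta> * snd y) * fst y - (\<beta> * snd y)\<^sup>2) / 2)) * indicator A y \<partial>Y)"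
      unfolding Y_def by (subst nn_integral_snd[symmetric]) auto
    also have "\<dots> = emeasure (density Y (\<lambda>(a, b). exp ((2 * (\<beta> * b) * a - (\<beta> * b)\<^sup>2) / 2))) A"
      by (subst emeasure_density) (auto simp: Y_def split_beta')
    finally show "emeasure (distr Y Y (\<lambda>(a, b). (a + \<beta> * b, b))) A = emeasure (density Y (\<lambda>(a, b). exp ((2 * (\<beta> * b) * a - (\<beta> * b)\<^sup>2) / 2))) A" .
  qed simp
  show "(\<integral>\<^sup>+y. ennreal ((case y of (a, b) \<Rightarrow> exp ((2 * (\<beta> * b) * a - (\<beta> * b)\<^sup>2) / 2))\<^sup>2) \<partial>Y)
       = (\<integral>\<^sup>+a. ennreal (exp ((\<beta> * a)\<^sup>2)) \<partial>std_normal)"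
    unfolding Y_def
    by (subst nn_integral_snd[symmetric]) (auto simp: nn_integral_std_normal_likelihood)
qed

text \<open>The factor \<open>P\<close> is a spectator that carries along the rest of the path, to
  which the map does nothing.\<close>

lemma lift_density:
  assumes P: "prob_space P" and Y: "prob_space Y" and f: "f \<in> measurable Y Y"
    and l[measurable]: "l \<in> borel_measurable Y" and eq: "distr Y Y f = density Y (\<lambda>y. ennreal (l y))"
  shows "distr (P \<Otimes>\<^sub>M Y) (P \<Otimes>\<^sub>M Y) (\<lambda>(z, y). (z, f y)) = density (P \<Otimes>\<^sub>M Y) (\<lambda>w. ennreal (l (snd w)))"
    "(\<integral>\<^sup>+w. ennreal ((l (snd w))\<^sup>2) \<partial>(P \<Otimes>\<^sub>M Y)) = (\<integral>\<^sup>+y. ennreal ((l y)\<^sup>2) \<partial>Y)"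
proof -
  interpret P: prob_space P by fact
  interpret Y: prob_space Y by fact
  interpret PY: pair_prob_space P Y by unfold_locales
  note f[measurable]
  show "distr (P \<Otimes>\<^sub>M Y) (P \<Otimes>\<^sub>M Y) (\<lambda>(z, y). (z, f y)) = density (P \<Otimes>\<^sub>M Y) (\<lambda>w. ennreal (l (snd w)))"
  proof (rule measure_eqI)
    fix A assume "A \<in> sets (distr (P \<Otimes>\<^sub>M Y) (P \<Otimes>\<^sub>M Y) (\<lambda>(z, y). (z, f y)))"
    then have A[measurable]: "A \<in> sets (P \<Otimes>\<^sub>M Y)" by simp
    have "emeasure (distr (P \<Otimes>\<^sub>M Y) (P \<Otimes>\<^sub>M Y) (\<lambda>(z, y). (z, f y))) A
       = (\<integral>\<^sup>+w. indicator A w \<partial>distr (P \<Otimes>\<^sub>M Y) (P \<Otimes>\<^sub>M Y) (\<lambda>(z, y). (z, f y)))" by simp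
    also have "\<dots> = (\<integral>\<^sup>+w. indicator A (fst w, f (snd w)) \<partial>(P \<Otimes>\<^sub>M Y))"
      by (subst nn_integral_distr) (auto simp: split_beta')
    also have "\<dots> = (\<integral>\<^sup>+z. \<integral>\<^sup>+y. indicator A (z, f y) \<partial>Y \<partial>P)"
      by (subst Y.nn_integral_fst[symmetric]) auto
    also have "\<dots> = (\<integral>\<^sup>+z. \<integral>\<^sup>+y. ennreal (l y) * indicator A (z, y) \<partial>Y \<partial>P)"
    proof (rule nn_integral_cong)
      fix z assume z: "z \<in> space P"
      have [measurable]: "(\<lambda>y. indicator A (z, y) :: ennreal) \<in> borel_measurable Y"
        using z by measurable
      have "(\<integral>\<^sup>+y. indicator A (z, f y) \<partial>Y) = (\<integral>\<^sup>+y. indicator A (z, y) \<partial>distr Y Y f)"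
        by (subst nn_integral_distr) auto
      also have "\<dots> = (\<integral>\<^sup>+y. ennreal (l y) * indicator A (z, y) \<partial>Y)"
        unfolding eq by (subst nn_integral_density) auto
      finally show "(\<integral>\<^sup>+y. indicator A (z, f y) \<partial>Y) = (\<integral>\<^sup>+y. ennreal (l y) * indicator A (z, y) \<partial>Y)" .
    qed
    also have "\<dots> = (\<integral>\<^sup>+w. ennreal (l (snd w)) * indicator A w \<partial>(P \<Otimes>\<^sub>M Y))"
      by (subst Y.nn_integral_fst[symmetric]) auto
    also have "\<dots> = emeasure (density (P \<Otimes>\<^sub>M Y) (\<lambda>w. ennreal (l (snd w)))) A"
      by (subst emeasure_density) auto
    finally show "emeasure (distr (P \<Otimes>\<^sub>M Y) (P \<Otimes>\<^sub>M Y) (\<lambda>(z, y). (z, f y))) A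
       = emeasure (density (P \<Otimes>\<^sub>M Y) (\<lambda>w. ennreal (l (snd w)))) A" .
  qed simp
  show "(\<integral>\<^sup>+w. ennreal ((l (snd w))\<^sup>2) \<partial>(P \<Otimes>\<^sub>M Y)) = (\<integral>\<^sup>+y. ennreal ((l y)\<^sup>2) \<partial>Y)"
    by (subst Y.nn_integral_fst[symmetric]) (auto simp: P.emeasure_space_1)
qed

text \<open>Each copy contributes a factor of at most exp(2 \<beta>^2) to the second moment of the
  likelihood ratio, so a slope of order n^(-1/2) keeps the product over n copies below exp(1/2)
  \<le> 2.\<close>

lemma shear_bounds:
  fixes \<beta> K :: real and n :: nat
  assumes P: "prob_space P" and \<beta>: "real n * \<beta>\<^sup>2 \<le> 1 / 4" and K: "K > 0"
  defines "\<Omega> \<equiv> P \<Otimes>\<^sub>M (std_normal \<Otimes>\<^sub>M std_normal)"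
  assumes B: "B \<in> sets (PiM {1..n} (\<lambda>_. \<Omega>))"
  shows "emeasure (PiM {1..n} (\<lambda>_. \<Omega>)) {\<omega> \<in> space (PiM {1..n} (\<lambda>_. \<Omega>)). (\<lambda>i\<in>{1..n}. (\<lambda>(z, y). (z, (\<lambda>(a, b). (a, b + \<beta> * a)) y)) (\<omega> i)) \<in> B}
     \<le> ennreal K * emeasure (PiM {1..n} (\<lambda>_. \<Omega>)) B + ennreal (2 / K)"
   "emeasure (PiM {1..n} (\<lambda>_. \<Omega>)) {\<omega> \<in> space (PiM {1..n} (\<lambda>_. \<Omega>)). (\<lambda>i\<in>{1..n}. (\<lambda>(z, y). (z, (\<lambda>(a, b). (a + \<beta> * b, b)) y)) (\<omega> i)) \<in> B}
     \<le> ennreal K * emeasure (PiM {1..n} (\<lambda>_. \<Omega>)) B + ennreal (2 / K)"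
proof -
  let ?Y = "std_normal \<Otimes>\<^sub>M std_normal"
  interpret N: prob_space std_normal by (rule prob_space_std_normal)
  interpret Y: pair_prob_space std_normal std_normal by unfold_locales
  interpret P: prob_space P by fact
  interpret \<Omega>: pair_prob_space P ?Y by unfold_locales
  have gen: "emeasure (PiM {1..n} (\<lambda>_. \<Omega>)) {\<omega> \<in> space (PiM {1..n} (\<lambda>_. \<Omega>)). (\<lambda>i\<in>{1..n}. (\<lambda>(z, y). (z, f y)) (\<omega> i)) \<in> B}
     \<le> ennreal K * emeasure (PiM {1..n} (\<lambda>_. \<Omega>)) B + ennreal (2 / K)"
    if f: "f \<in> measurable ?Y ?Y" and l: "l \<in> borel_measurable ?Y" "\<And>y. 0 \<le> l y"
      and eq: "distr ?Y ?Y f = density ?Y (\<lambda>y. ennreal (l y))"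
      and sq: "(\<integral>\<^sup>+y. ennreal ((l y)\<^sup>2) \<partial>?Y) = (\<integral>\<^sup>+a. ennreal (exp ((\<beta> * a)\<^sup>2)) \<partial>std_normal)" for f l
  proof (cases "n = 0")
    case False
    have b4: "\<beta>\<^sup>2 \<le> 1 / 4"
    proof -
      have "1 * \<beta>\<^sup>2 \<le> real n * \<beta>\<^sup>2" using False by (intro mult_right_mono) auto
      then show ?thesis using \<beta> by simp
    qed
    note ld = lift_density[OF P Y.prob_space_axioms f l(1) eq]
    have "emeasure (PiM {1..n} (\<lambda>_. \<Omega>)) {\<omega> \<in> space (PiM {1..n} (\<lambda>_. \<Omega>)). (\<lambda>i\<in>{1..n}. (\<lambda>(z, y). (z, f y)) (\<omega> i)) \<in> B}
       \<le> ennreal K * emeasure (PiM {1..n} (\<lambda>_. \<Omega>)) B + ennreal (\<Prod>i\<in>{1..n}. exp (2 * \<beta>\<^sup>2)) / ennreal K"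
    proof (rule PiM_change_of_measure[where dens="\<lambda>_ w. l (snd w)", OF _ _ _ _ _ _ _ _ B K])
      show "prob_space \<Omega>" unfolding \<Omega>_def by (rule \<Omega>.prob_space_axioms)
      show "(\<lambda>(z, y). (z, f y)) \<in> measurable \<Omega> \<Omega>" using f unfolding \<Omega>_def by measurable
      show "(\<lambda>w. l (snd w)) \<in> borel_measurable \<Omega>" using l unfolding \<Omega>_def by measurable
      show "distr \<Omega> \<Omega> (\<lambda>(z, y). (z, f y)) = density \<Omega> (\<lambda>w. ennreal (l (snd w)))"
        unfolding \<Omega>_def by (rule ld(1))
      show "(\<integral>\<^sup>+w. ennreal ((l (snd w))\<^sup>2) \<partial>\<Omega>) \<le> ennreal (exp (2 * \<beta>\<^sup>2))"
        unfolding \<Omega>_def ld(2) sq by (rule std_normal_exp_square[OF b4])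
    qed (use l in auto)
    also have "(\<Prod>i\<in>{1..n}. exp (2 * \<beta>\<^sup>2)) = exp (2 * (real n * \<beta>\<^sup>2))"
      by (simp add: exp_of_nat_mult[symmetric] mult_ac)
    also have "ennreal (exp (2 * (real n * \<beta>\<^sup>2))) / ennreal K = ennreal (exp (2 * (real n * \<beta>\<^sup>2)) / K)"
      using K by (simp add: divide_ennreal)
    finally have 1: "emeasure (PiM {1..n} (\<lambda>_. \<Omega>)) {\<omega> \<in> space (PiM {1..n} (\<lambda>_. \<Omega>)). (\<lambda>i\<in>{1..n}. (\<lambda>(z, y). (z, f y)) (\<omega> i)) \<in> B}
       \<le> ennreal K * emeasure (PiM {1..n} (\<lambda>_. \<Omega>)) B + ennreal (exp (2 * (real n * \<beta>\<^sup>2)) / K)" .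
    have "exp (2 * (real n * \<beta>\<^sup>2)) \<le> exp (1 / 2)" using \<beta> by simp
    also have "\<dots> \<le> (2 :: real)"
      using exp_bound[of "1/2"] by (simp add: power2_eq_square)
    finally have "exp (2 * (real n * \<beta>\<^sup>2)) / K \<le> 2 / K" using K by (intro divide_right_mono) auto
    then have "ennreal K * emeasure (PiM {1..n} (\<lambda>_. \<Omega>)) B + ennreal (exp (2 * (real n * \<beta>\<^sup>2)) / K)
      \<le> ennreal K * emeasure (PiM {1..n} (\<lambda>_. \<Omega>)) B + ennreal (2 / K)"
      by (intro add_left_mono ennreal_leI)
    with 1 show ?thesis by (rule order_trans)
  next
    \<comment> \<open>For n = 0 the hypothesis does not bound \<beta>. The product space is then a
      single point, on which the shear acts trivially.\<close>
    case True
    have sp: "\<omega> = (\<lambda>_. undefined)" if "\<omega> \<in> space (PiM {1..n} (\<lambda>_. \<Omega>))" for \<omega>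
      using that True by (auto simp: space_PiM)
    interpret PM: prob_space "PiM {1..n} (\<lambda>_. \<Omega>)"
      unfolding \<Omega>_def by (intro prob_space_PiM \<Omega>.prob_space_axioms)
    let ?G = "{\<omega> \<in> space (PiM {1..n} (\<lambda>_. \<Omega>)). (\<lambda>i\<in>{1..n}. (\<lambda>(z, y). (z, f y)) (\<omega> i)) \<in> B}"
    have G: "?G = B" using sp sets.sets_into_space[OF B] True by (auto simp: restrict_def)
    show ?thesis
    proof (cases "K \<ge> 1")
      case True
      have "1 * emeasure (PiM {1..n} (\<lambda>_. \<Omega>)) B \<le> ennreal K * emeasure (PiM {1..n} (\<lambda>_. \<Omega>)) B"
        using True by (intro mult_right_mono) (auto simp: ennreal_1[symmetric] simp del: ennreal_1)
      then show ?thesis unfolding G by (simp add: add_increasing2)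
    next
      case False
      then have "ennreal 1 \<le> ennreal (2 / K)" using K by (intro ennreal_leI) (simp add: field_simps)
      then have "emeasure (PiM {1..n} (\<lambda>_. \<Omega>)) B \<le> ennreal (2 / K)"
        using PM.emeasure_le_1[of B] by (simp add: order_trans)
      then show ?thesis unfolding G by (simp add: add_increasing)
    qed
  qed
  show "emeasure (PiM {1..n} (\<lambda>_. \<Omega>)) {\<omega> \<in> space (PiM {1..n} (\<lambda>_. \<Omega>)). (\<lambda>i\<in>{1..n}. (\<lambda>(z, y). (z, (\<lambda>(a, b). (a, b + \<beta> * a)) y)) (\<omega> i)) \<in> B}
     \<le> ennreal K * emeasure (PiM {1..n} (\<lambda>_. \<Omega>)) B + ennreal (2 / K)"
  proof -
    have e: "distr ?Y ?Y (\<lambda>(a, b). (a, b + \<beta> * a)) = density ?Y (\<lambda>y. ennreal ((\<lambda>(a, b). exp ((2 * (\<beta> * a) * b - (\<beta> * a)\<^sup>2) / 2)) y))"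
      using shear_snd(1)[of \<beta>] by (simp add: split_beta')
    show ?thesis
      by (rule gen[OF _ _ _ e shear_snd(2)]) auto
  qed
  show "emeasure (PiM {1..n} (\<lambda>_. \<Omega>)) {\<omega> \<in> space (PiM {1..n} (\<lambda>_. \<Omega>)). (\<lambda>i\<in>{1..n}. (\<lambda>(z, y). (z, (\<lambda>(a, b). (a + \<beta> * b, b)) y)) (\<omega> i)) \<in> B}
     \<le> ennreal K * emeasure (PiM {1..n} (\<lambda>_. \<Omega>)) B + ennreal (2 / K)"
  proof -
    have e: "distr ?Y ?Y (\<lambda>(a, b). (a + \<beta> * b, b)) = density ?Y (\<lambda>y. ennreal ((\<lambda>(a, b). exp ((2 * (\<beta> * b) * a - (\<beta> * b)\<^sup>2) / 2)) y))"
      using shear_fst(1)[of \<beta>] by (simp add: split_beta')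
    show ?thesis
      by (rule gen[OF _ _ _ e shear_fst(2)]) auto
  qed
qed

text \<open>The planar map below is the product of three shears, each of which is close to the identity.\<close>

lemma rotation_bound:
  fixes r s c :: real and n :: nat
  assumes P: "prob_space P" and r: "r > 0" and s: "s \<noteq> 0" and c: "0 \<le> c" "c\<^sup>2 + s\<^sup>2 = 1"
    and n: "real n * (s * r)\<^sup>2 \<le> 1 / 4" "real n * (s / r)\<^sup>2 \<le> 1 / 4"
  defines "\<Omega> \<equiv> P \<Otimes>\<^sub>M (std_normal \<Otimes>\<^sub>M std_normal)"
  assumes B: "B \<in> sets (PiM {1..n} (\<lambda>_. \<Omega>))"
  shows "emeasure (PiM {1..n} (\<lambda>_. \<Omega>)) {\<omega> \<in> space (PiM {1..n} (\<lambda>_. \<Omega>)).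
       (\<lambda>i\<in>{1..n}. (\<lambda>(z, a, b). (z, c * a - s * r * b, s / r * a + c * b)) (\<omega> i)) \<in> B}
     \<le> ennreal (16 * 256 * 65536) * emeasure (PiM {1..n} (\<lambda>_. \<Omega>)) B + ennreal (3 / 8)"
proof -
  \<comment> \<open>For the angle theta this is -r tan(theta/2), the slope in the classical
    factorisation of a rotation into three shears; r and 1/r account for the conjugation by a
    diagonal scaling.\<close>
  define \<alpha> where "\<alpha> = - (1 - c) * r / s"
  define \<beta> where "\<beta> = s / r"
  let ?M = "PiM {1..n} (\<lambda>_. \<Omega>)"
  interpret N: prob_space std_normal by (rule prob_space_std_normal)
  interpret Y: pair_prob_space std_normal std_normal by unfold_locales
  define S where "S = (\<lambda>(z :: 'a, y). (z, (\<lambda>(a, b). (a + \<alpha> * b, b)) y))"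
  define T where "T = (\<lambda>(z :: 'a, y). (z, (\<lambda>(a, b). (a, b + \<beta> * a)) y))"
  define R where "R = (\<lambda>(z :: 'a, a, b). (z, c * a - s * r * b, s / r * a + c * b))"
  have ab: "1 + \<alpha> * \<beta> = c" "\<alpha> * (1 + c) = - s * r"
  proof -
    show "1 + \<alpha> * \<beta> = c" using r s by (simp add: \<alpha>_def \<beta>_def field_simps)
    have "(1 - c) * (1 + c) = s\<^sup>2" using c by (simp add: power2_eq_square algebra_simps)
    moreover have "\<alpha> * (1 + c) = - ((1 - c) * (1 + c)) * r / s" using s by (simp add: \<alpha>_def field_simps)
    ultimately have "\<alpha> * (1 + c) = - (s\<^sup>2) * r / s" by simp
    then show "\<alpha> * (1 + c) = - s * r" using s by (simp add: power2_eq_square)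
  qed
  have RST: "R w = S (T (S w))" for w
  proof -
    obtain z a b where w: "w = (z, a, b)" by (metis surj_pair)
    have 1: "b + \<beta> * (a + \<alpha> * b) = s / r * a + c * b"
      using ab(1) by (simp add: \<beta>_def[symmetric] algebra_simps flip: ab(1))
    have "a + \<alpha> * b + \<alpha> * (s / r * a + c * b) = a * (1 + \<alpha> * \<beta>) + \<alpha> * (1 + c) * b"
      by (simp add: \<beta>_def algebra_simps)
    also have "\<dots> = c * a - s * r * b" unfolding ab by simp
    finally show ?thesis by (simp add: w R_def S_def T_def 1)
  qed
  have Sm: "S \<in> measurable \<Omega> \<Omega>" and Tm: "T \<in> measurable \<Omega> \<Omega>"
    unfolding S_def T_def \<Omega>_def by measurable
  have a: "real n * \<alpha>\<^sup>2 \<le> 1 / 4" "real n * \<beta>\<^sup>2 \<le> 1 / 4"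
  proof -
    have "c \<le> 1" using c by (metis abs_le_square_iff abs_of_nonneg le_add_same_cancel1 one_power2 zero_le_one zero_le_power2)
    have "1 - c \<le> s\<^sup>2"
    proof -
      have "s\<^sup>2 = (1 - c) * (1 + c)" using c by (simp add: power2_eq_square algebra_simps)
      moreover have "(1 - c) * 1 \<le> (1 - c) * (1 + c)" using \<open>c \<le> 1\<close> c by (intro mult_left_mono) auto
      ultimately show ?thesis by simp
    qed
    then have "\<bar>\<alpha>\<bar> \<le> s\<^sup>2 * r / \<bar>s\<bar>"
      using \<open>c \<le> 1\<close> r s by (simp add: \<alpha>_def abs_mult divide_right_mono mult_right_mono)
    also have "\<dots> = \<bar>s * r\<bar>" using s r by (simp add: power2_eq_square abs_mult field_simps)
    finally have "\<alpha>\<^sup>2 \<le> (s * r)\<^sup>2" by (simp add: abs_le_square_iff)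
    then have "real n * \<alpha>\<^sup>2 \<le> real n * (s * r)\<^sup>2" by (intro mult_left_mono) auto
    then show "real n * \<alpha>\<^sup>2 \<le> 1 / 4" using n by simp
    show "real n * \<beta>\<^sup>2 \<le> 1 / 4" using n by (simp add: \<beta>_def)
  qed
  define G where "G h D = {\<omega> \<in> space ?M. (\<lambda>i\<in>{1..n}. h (\<omega> i)) \<in> D}" for h :: "'a \<times> real \<times> real \<Rightarrow> 'a \<times> real \<times> real" and D
  have Gm: "G h D \<in> sets ?M" if "h \<in> measurable \<Omega> \<Omega>" "D \<in> sets ?M" for h D
  proof -
    have "(\<lambda>\<omega>. \<lambda>i\<in>{1..n}. h (\<omega> i)) \<in> measurable ?M ?M"
      using that(1) by (intro measurable_restrict) (auto intro: measurable_compose[OF measurable_component_singleton])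
    from measurable_sets[OF this that(2)] show ?thesis by (simp add: G_def vimage_def Int_def conj_commute)
  qed
  have Gbound: "emeasure ?M (G S D) \<le> ennreal K * emeasure ?M D + ennreal (2 / K)"
     "emeasure ?M (G T D) \<le> ennreal K * emeasure ?M D + ennreal (2 / K)" if "D \<in> sets ?M" "K > 0" for D K
    using shear_bounds[OF P a(2) that(2), folded \<Omega>_def, OF that(1)] shear_bounds[OF P a(1) that(2), folded \<Omega>_def, OF that(1)]
    by (simp_all add: G_def S_def T_def)
  have comp: "G R B = G S (G T (G S B))"
  proof -
    have sp: "(\<lambda>i\<in>{1..n}. h (\<omega> i)) \<in> space ?M" if "\<omega> \<in> space ?M" "h \<in> measurable \<Omega> \<Omega>" for \<omega> h
      using that by (auto simp: space_PiM PiE_iff dest: measurable_space)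
    show ?thesis
      using sp[OF _ Sm] sp[OF _ measurable_compose[OF Sm Tm]]
      by (auto simp: G_def RST cong: restrict_cong)
  qed
  have mm: "ennreal a * ennreal b = ennreal (a * b)" if "a \<ge> 0" "b \<ge> 0" for a b
    using that by (simp add: ennreal_mult)
  \<comment> \<open>The constants 16, 256 and 65536 make the three remainders 2/16, 16 * 2/256 and
    16 * 256 * 2/65536 all equal to 1/8.\<close>
  have e: "ennreal 16 * ennreal (2 / 256) = ennreal (1 / 8)"
    "ennreal 16 * (ennreal 256 * ennreal (2 / 65536)) = ennreal (1 / 8)"
    "ennreal (2 / 16) = ennreal (1 / 8)"
    using mm[of 16 "2 / 256"] mm[of 16 "256 * (2 / 65536)"] mm[of 256 "2 / 65536"] by simp_all
  have e4: "ennreal 16 * (ennreal 256 * (ennreal 65536 * m)) = ennreal (16 * 256 * 65536) * m" for m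
  proof -
    have "ennreal 16 * (ennreal 256 * (ennreal 65536 * m)) = (ennreal 16 * ennreal 256 * ennreal 65536) * m"
      by (simp only: mult.assoc)
    also have "ennreal 16 * ennreal 256 * ennreal 65536 = ennreal (16 * 256 * 65536)"
      using mm[of 16 256] mm[of "16 * 256" 65536] by simp
    finally show ?thesis .
  qed
  have "emeasure ?M (G R B) \<le> ennreal 16 * emeasure ?M (G T (G S B)) + ennreal (2 / 16)"
    unfolding comp by (intro Gbound Gm Sm Tm B) simp
  also have "\<dots> \<le> ennreal 16 * (ennreal 256 * emeasure ?M (G S B) + ennreal (2 / 256)) + ennreal (2 / 16)"
    by (intro add_right_mono mult_left_mono Gbound Gm Sm Tm B) simp_all
  also have "\<dots> \<le> ennreal 16 * (ennreal 256 * (ennreal 65536 * emeasure ?M B + ennreal (2 / 65536)) + ennreal (2 / 256)) + ennreal (2 / 16)"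
    by (intro add_right_mono mult_left_mono Gbound Gm Sm Tm B) simp_all
  also have "\<dots> = ennreal (16 * 256 * 65536) * emeasure ?M B + (ennreal (1 / 8) + ennreal (1 / 8) + ennreal (1 / 8))"
    by (simp only: distrib_left e e4 add.assoc)
  also have "ennreal (1 / 8) + ennreal (1 / 8) + ennreal (1 / 8) = ennreal (3 / 8)"
    by (subst ennreal_plus[symmetric], simp, simp)+ simp
  finally show ?thesis by (simp add: G_def R_def)
qed

section \<open>The law of the data when the paths are generated on an arbitrary space\<close>

lemma data_law_distr:
  fixes n p :: nat and \<mu> :: "real \<Rightarrow> real"
  assumes M: "prob_space M" and W: "W \<in> measurable M path_space" and x: "x ` {1..p} \<subseteq> {0..1}" and \<sigma>: "\<sigma> > 0"
  defines "N \<equiv> PiM ({1..n} \<times> {1..p}) (\<lambda>_. density lborel (normal_density 0 \<sigma>))"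
  defines "F \<equiv> \<lambda>(\<omega>, e). \<lambda>(i, j)\<in>{1..n} \<times> {1..p}. \<mu> (x j) + W (\<omega> i) (x j) + e (i, j)"
  shows "data_law \<mu> x \<sigma> n p (distr M path_space W) = distr (PiM {1..n} (\<lambda>_. M) \<Otimes>\<^sub>M N) (data_space n p) F"
    "F \<in> measurable (PiM {1..n} (\<lambda>_. M) \<Otimes>\<^sub>M N) (data_space n p)"
proof -
  interpret M: prob_space M by fact
  interpret N: prob_space N unfolding N_def by (intro prob_space_PiM prob_space_normal_density \<sigma>)
  let ?Q = "distr M path_space W"
  have pQ: "prob_space ?Q" by (rule M.prob_space_distr[OF W])
  define H where "H = (\<lambda>(z, e). \<lambda>(i, j)\<in>{1..n} \<times> {1..p}. \<mu> (x j) + z i (x j) + e (i, j) :: real)"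
  let ?g = "compose {1..n} W"
  have g: "?g \<in> measurable (PiM {1..n} (\<lambda>_. M)) (PiM {1..n} (\<lambda>_. path_space))"
    unfolding compose_def using W by (intro measurable_restrict) (auto intro: measurable_compose[OF measurable_component_singleton])
  have PQ: "PiM {1..n} (\<lambda>_. ?Q) = distr (PiM {1..n} (\<lambda>_. M)) (PiM {1..n} (\<lambda>_. ?Q)) ?g"
  proof -
    have "distr (PiM {1..n} (\<lambda>_. M)) (PiM {1..n} (\<lambda>_. ?Q)) ?g = PiM {1..n} (\<lambda>_. distr M ?Q W)"
      by (rule distr_PiM_finite_prob_space') (use M pQ W in \<open>auto\<close>)
    also have "distr M ?Q W = ?Q" by (rule distr_cong) auto
    finally show ?thesis by simp
  qed
  have comp: "(\<lambda>z. z t) \<in> borel_measurable path_space" if "t \<in> {0..1}" for t :: real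
    using that unfolding path_space_def by (rule measurable_component_singleton)
  have Hm: "H \<in> measurable (PiM {1..n} (\<lambda>_. ?Q) \<Otimes>\<^sub>M N) (data_space n p)"
  proof -
    have "(\<lambda>w. \<lambda>ij\<in>{1..n} \<times> {1..p}. \<mu> (x (snd ij)) + (fst w) (fst ij) (x (snd ij)) + (snd w) ij)
       \<in> measurable (PiM {1..n} (\<lambda>_. ?Q) \<Otimes>\<^sub>M N) (data_space n p)"
      unfolding data_space_def
    proof (rule measurable_restrict)
      fix ij assume ij: "ij \<in> {1..n} \<times> {1..p}"
      have 1: "(\<lambda>z. z (fst ij)) \<in> measurable (PiM {1..n} (\<lambda>_. ?Q)) ?Q"
        using ij by (intro measurable_component_singleton) auto
      have t: "x (snd ij) \<in> {0..1}" using ij x by auto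
      have 2: "(\<lambda>z. z (x (snd ij))) \<in> borel_measurable ?Q" using comp[OF t] by simp
      have 3: "(\<lambda>e. e ij) \<in> borel_measurable N"
        unfolding N_def using ij measurable_component_singleton[of ij "{1..n} \<times> {1..p}" "\<lambda>_. density lborel (normal_density 0 \<sigma>)"] by simp
      show "(\<lambda>w. \<mu> (x (snd ij)) + (fst w) (fst ij) (x (snd ij)) + (snd w) ij) \<in> borel_measurable (PiM {1..n} (\<lambda>_. ?Q) \<Otimes>\<^sub>M N)"
        by (intro borel_measurable_add borel_measurable_const measurable_compose[OF measurable_snd 3]
            measurable_compose[OF measurable_compose[OF measurable_fst 1] 2])
    qed
    also have "(\<lambda>w. \<lambda>ij\<in>{1..n} \<times> {1..p}. \<mu> (x (snd ij)) + (fst w) (fst ij) (x (snd ij)) + (snd w) ij) = H"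
      by (auto simp: H_def fun_eq_iff restrict_def split_beta')
    finally show ?thesis .
  qed
  have gN: "(\<lambda>(\<omega>, e). (?g \<omega>, e)) \<in> measurable (PiM {1..n} (\<lambda>_. M) \<Otimes>\<^sub>M N) (PiM {1..n} (\<lambda>_. ?Q) \<Otimes>\<^sub>M N)"
  proof -
    have "?g \<in> measurable (PiM {1..n} (\<lambda>_. M)) (PiM {1..n} (\<lambda>_. ?Q))"
      using g by (subst measurable_cong_sets[OF refl sets_PiM_cong[OF refl]]) auto
    then show ?thesis by measurable
  qed
  have "F w = H ((\<lambda>(\<omega>, e). (?g \<omega>, e)) w)" for w
    by (auto simp: F_def H_def compose_def split_beta' restrict_def fun_eq_iff)
  then have Fc: "F = H \<circ> (\<lambda>(\<omega>, e). (?g \<omega>, e))" by auto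
  show "F \<in> measurable (PiM {1..n} (\<lambda>_. M) \<Otimes>\<^sub>M N) (data_space n p)"
    unfolding Fc by (rule measurable_comp[OF gN Hm])
  have "PiM {1..n} (\<lambda>_. ?Q) \<Otimes>\<^sub>M N = distr (PiM {1..n} (\<lambda>_. M)) (PiM {1..n} (\<lambda>_. ?Q)) ?g \<Otimes>\<^sub>M distr N N (\<lambda>e. e)"
    using PQ by (simp add: distr_id2)
  also have "\<dots> = distr (PiM {1..n} (\<lambda>_. M) \<Otimes>\<^sub>M N) (PiM {1..n} (\<lambda>_. ?Q) \<Otimes>\<^sub>M N) (\<lambda>(\<omega>, e). (?g \<omega>, e))"
  proof (rule pair_measure_distr)
    show "?g \<in> measurable (PiM {1..n} (\<lambda>_. M)) (PiM {1..n} (\<lambda>_. ?Q))"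
      using g by (subst measurable_cong_sets[OF refl sets_PiM_cong[OF refl]]) auto
    show "sigma_finite_measure (distr N N (\<lambda>e. e))" by (simp add: distr_id2 N.sigma_finite_measure_axioms)
  qed simp
  finally have "distr (PiM {1..n} (\<lambda>_. ?Q) \<Otimes>\<^sub>M N) (data_space n p) H
     = distr (PiM {1..n} (\<lambda>_. M) \<Otimes>\<^sub>M N) (data_space n p) F"
    using distr_distr[OF Hm gN] Fc by simp
  then show "data_law \<mu> x \<sigma> n p ?Q = distr (PiM {1..n} (\<lambda>_. M) \<Otimes>\<^sub>M N) (data_space n p) F"
    by (simp add: data_law_def H_def N_def)
qed

subsection \<open>Eigenfunctions of a kernel\<close>

text \<open>Positive multiplicity provides a nonzero function g, but a nonzero function may still
  have L2 norm 0. Here g = T g / lam j is continuous on the unit interval and zero elsewhere, so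
  norm 0 would force it to vanish everywhere; hence it can be normalised.\<close>

lemma eigenfunction_exists:
  assumes \<Gamma>: "continuous_kernel \<Gamma>" and lam: "eigenvalue_sequence \<Gamma> lam" and j: "1 \<le> j" "0 < lam j"
  obtains f where "f \<in> eigenspace \<Gamma> (lam j)" "continuous_on {0..1} f" "l2_inner f f = 1"
proof -
  let ?V = "eigenspace \<Gamma> (lam j)"
  have fin: "finite {i. 1 \<le> i \<and> lam i = lam j}" "card {i. 1 \<le> i \<and> lam i = lam j} = multiplicity_of \<Gamma> (lam j)"
    using lam j by (auto simp: eigenvalue_sequence_def)
  have "{i. 1 \<le> i \<and> lam i = lam j} \<noteq> {}" using j by auto
  with fin(1) have "0 < card {i. 1 \<le> i \<and> lam i = lam j}" unfolding card_gt_0_iff by blast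
  then have "fun_vs.dim ?V \<noteq> 0" unfolding fin(2) multiplicity_of_def by (rule gr_implies_not0)
  then have "?V \<noteq> {0}" by (rule contrapos_nn) (simp only: dim_zero)
  moreover have "0 \<in> ?V" using fun_vs.subspace_0[OF eigenspace_subspace[OF \<Gamma>]] .
  ultimately obtain g where g: "g \<in> ?V" "g \<noteq> 0" by blast
  then have sg: "square_integrable g" and gz: "\<And>x. x \<notin> {0..1} \<Longrightarrow> g x = 0"
    and gT: "\<And>x. x \<in> {0..1} \<Longrightarrow> cov_operator \<Gamma> g x = lam j * g x" unfolding eigenspace_def by simp_all
  have gc: "continuous_on {0..1} g"
  proof -
    have "continuous_on {0..1} (\<lambda>x. cov_operator \<Gamma> g x / lam j)"
      using j by (intro continuous_on_divide cov_operator_continuous[OF \<Gamma> sg] continuous_on_const) auto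
    then show ?thesis
      by (subst (asm) continuous_on_cong[OF refl, of _ _ g]) (use gT j in auto)
  qed
  have nn: "0 \<le> l2_inner g g" by (simp add: l2_inner_def)
  have "l2_inner g g \<noteq> 0"
  proof
    assume 0: "l2_inner g g = 0"
    have i: "((\<lambda>x. g x * g x) has_integral 0) {0..1}"
    proof -
      have "(\<lambda>x. g x * g x) integrable_on {0..1}" using gc by (intro integrable_continuous_interval continuous_intros)
      moreover have "integral {0..1} (\<lambda>x. g x * g x) = 0"
        using 0 gc unfolding l2_inner_def
        by (subst lebesgue_integral_eq_integral[symmetric]) (auto intro!: continuous_imp_integrable_real continuous_intros)
      ultimately show ?thesis by (simp add: has_integral_integrable_integral)
    qed
    have c: "continuous_on (cbox 0 1) (\<lambda>x. g x * g x)" using gc by (auto intro!: continuous_intros)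
    have "g x * g x = 0" if "x \<in> {0..1}" for x
      by (rule has_integral_0_cbox_imp_0[OF c]) (use i that in \<open>simp_all add: box_real\<close>)
    then have "g x = 0" if "x \<in> {0..1}" for x using that by (metis mult_eq_0_iff)
    then have "g x = 0" for x using gz by blast
    then have "g = 0" by (intro ext) simp
    then show False using g(2) by blast
  qed
  with nn have pos: "0 < l2_inner g g" by simp
  define a where "a = 1 / sqrt (l2_inner g g)"
  have "scale_fun a g \<in> ?V" using fun_vs.subspace_scale[OF eigenspace_subspace[OF \<Gamma>] g(1)] .
  moreover have "continuous_on {0..1} (scale_fun a g)" unfolding scale_fun_def using gc by (intro continuous_intros)
  moreover have "l2_inner (scale_fun a g) (scale_fun a g) = 1"
  proof -
    have "(\<lambda>x. scale_fun a g x * scale_fun a g x) = (\<lambda>x. (a * a) * (g x * g x))" by (auto simp: scale_fun_def mult_ac)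
    then have "l2_inner (scale_fun a g) (scale_fun a g) = (a * a) * l2_inner g g" by (simp add: l2_inner_def)
    also have "\<dots> = 1" using pos by (simp add: a_def real_sqrt_mult_self)
    finally show ?thesis .
  qed
  ultimately show ?thesis by (rule that)
qed

lemma eigenfunctions_orthogonal:
  assumes \<Gamma>: "continuous_kernel \<Gamma>" and sym: "\<And>x y. x \<in> {0..1} \<Longrightarrow> y \<in> {0..1} \<Longrightarrow> \<Gamma> x y = \<Gamma> y x"
    and f: "f \<in> eigenspace \<Gamma> a" and g: "g \<in> eigenspace \<Gamma> b" and ab: "a \<noteq> b"
  shows "l2_inner f g = 0"
proof -
  have fg: "square_integrable f" "square_integrable g" "\<And>x. x \<in> {0..1} \<Longrightarrow> cov_operator \<Gamma> f x = a * f x"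
     "\<And>x. x \<in> {0..1} \<Longrightarrow> cov_operator \<Gamma> g x = b * g x"
    using f g by (auto simp: eigenspace_def)
  have "l2_inner (cov_operator \<Gamma> f) g = (\<integral>x. a * (f x * g x) \<partial>lebesgue_on {0..1})"
    unfolding l2_inner_def by (intro Bochner_Integration.integral_cong) (auto simp: fg)
  then have 1: "l2_inner (cov_operator \<Gamma> f) g = a * l2_inner f g" by (simp add: l2_inner_def)
  have "l2_inner f (cov_operator \<Gamma> g) = (\<integral>x. b * (f x * g x) \<partial>lebesgue_on {0..1})"
    unfolding l2_inner_def by (intro Bochner_Integration.integral_cong) (auto simp: fg)
  then have 2: "l2_inner f (cov_operator \<Gamma> g) = b * l2_inner f g" by (simp add: l2_inner_def)
  have "a * l2_inner f g = b * l2_inner f g"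
    using cov_operator_symmetric[OF \<Gamma> sym fg(1,2)] unfolding 1 2 by (rule HOL.sym)
  then show ?thesis using ab by simp
qed

lemma eigenspaceD:
  assumes "f \<in> eigenspace \<Gamma> a"
  shows "square_integrable f" "\<And>x. x \<notin> {0..1} \<Longrightarrow> f x = 0" "\<And>x. x \<in> {0..1} \<Longrightarrow> cov_operator \<Gamma> f x = a * f x"
  using assms by (auto simp: eigenspace_def)

lemma holder_bound1_scale:
  assumes f: "holder_bound1 m \<alpha> K f"
  shows "holder_bound1 m \<alpha> (\<bar>c\<bar> * K) (\<lambda>x. c * f x)"
proof -
  obtain d :: "nat \<Rightarrow> real \<Rightarrow> real" where d: "\<And>x. x \<in> {0..1} \<Longrightarrow> d 0 x = f x"
    "\<And>i x. i < m \<Longrightarrow> x \<in> {0..1} \<Longrightarrow> (d i has_vector_derivative d (Suc i) x) (at x within {0..1})"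
    "\<And>i x. i \<le> m \<Longrightarrow> x \<in> {0..1} \<Longrightarrow> \<bar>d i x\<bar> \<le> K"
    "\<And>x y. x \<in> {0..1} \<Longrightarrow> y \<in> {0..1} \<Longrightarrow> \<bar>d m x - d m y\<bar> \<le> K * \<bar>x - y\<bar> powr \<alpha>"
    using f by (rule holder_bound1E) metis
  show ?thesis unfolding holder_bound1_def
  proof (intro exI[of _ "\<lambda>i x. c * d i x"] conjI ballI allI impI)
    show "c * d 0 x = c * f x" if "x \<in> {0..1}" for x using d(1)[OF that] by simp
    show "((\<lambda>x. c * d i x) has_vector_derivative c * d (Suc i) x) (at x within {0..1})" if "i < m" "x \<in> {0..1}" for i x
      using d(2)[OF that] by (rule has_vector_derivative_mult_right)
    show "\<bar>c * d i x\<bar> \<le> \<bar>c\<bar> * K" if "i \<le> m" "x \<in> {0..1}" for i x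
      unfolding abs_mult using d(3)[OF that] by (rule mult_left_mono) simp
    show "\<bar>c * d m x - c * d m y\<bar> \<le> \<bar>c\<bar> * K * \<bar>x - y\<bar> powr \<alpha>" if "x \<in> {0..1}" "y \<in> {0..1}" for x y
      using mult_left_mono[OF d(4)[OF that], of "\<bar>c\<bar>"] by (simp add: abs_mult[symmetric] right_diff_distrib mult.assoc)
  qed
qed

lemma holder_bound1_cong:
  assumes f: "holder_bound1 m \<alpha> K f" and eq: "\<And>x. x \<in> {0..1} \<Longrightarrow> f x = g x"
  shows "holder_bound1 m \<alpha> K g"
  using f eq unfolding holder_bound1_def by simp

text \<open>Dividing the eigenvalue equation by \<open>l\<close> exhibits f as an image under the
  operator, which inherits the smoothness of the kernel.\<close>

lemma eigenfunction_holder: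
  assumes \<Gamma>: "holder_bounds m \<alpha> A B \<Gamma>" "0 < \<alpha>" and f: "f \<in> eigenspace \<Gamma> l" and l: "0 < l"
  obtains K where "holder_bound1 m \<alpha> K f"
proof -
  have i: "integrable (lebesgue_on {0..1}) f" using eigenspaceD(1)[OF f] by (rule square_integrable_integrable)
  have "holder_bound1 m \<alpha> (\<bar>1 / l\<bar> * ((A + B) * (\<integral>y. \<bar>f y\<bar> \<partial>lebesgue_on {0..1}))) (\<lambda>x. 1 / l * (\<integral>y. \<Gamma> x y * f y \<partial>lebesgue_on {0..1}))"
    by (rule holder_bound1_scale[OF holder_bound1_kernel[OF \<Gamma> i]])
  then have "holder_bound1 m \<alpha> (\<bar>1 / l\<bar> * ((A + B) * (\<integral>y. \<bar>f y\<bar> \<partial>lebesgue_on {0..1}))) f"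
    by (rule holder_bound1_cong) (use eigenspaceD(3)[OF f] l in \<open>auto simp: cov_operator_def\<close>)
  then show ?thesis by (rule that)
qed

subsection \<open>Base laws\<close>

text \<open>The strict inequality \<open>A + B < L\<close> leaves room for perturbations. The second positive eigenvalue
  supplies the partner of the \<open>k\<close>-th eigenfunction in the rotation for the parametric rate.\<close>

definition base_law :: "real \<Rightarrow> real \<Rightarrow> nat \<Rightarrow> real \<Rightarrow> (real \<Rightarrow> real) measure \<Rightarrow> (nat \<Rightarrow> real) \<Rightarrow> real \<Rightarrow> real \<Rightarrow> bool" where
  "base_law \<gamma> L k \<delta> P lam A B \<longleftrightarrow>
     centered_gaussian_process P \<and>
     holder_bounds (holder_order \<gamma>) (\<gamma> - real (holder_order \<gamma>)) A B (cov_kernel P) \<and> A + B < L \<and>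
     eigenvalue_sequence (cov_kernel P) lam \<and> \<delta> \<le> spectral_gap lam k \<and>
     (\<exists>j\<ge>1. 0 < lam j \<and> lam j \<noteq> lam k)"

lemma eigenspace_scale_kernel:
  assumes "r > 0"
  shows "eigenspace (\<lambda>x y. r * \<Gamma> x y) c = eigenspace \<Gamma> (c / r)"
proof -
  have "cov_operator (\<lambda>x y. r * \<Gamma> x y) f x = r * cov_operator \<Gamma> f x" for f x
    by (simp add: cov_operator_def mult.assoc)
  then show ?thesis using assms by (auto simp: eigenspace_def field_simps)
qed

lemma eigenvalue_sequence_scale:
  assumes lam: "eigenvalue_sequence \<Gamma> lam" and r: "r > 0"
  shows "eigenvalue_sequence (\<lambda>x y. r * \<Gamma> x y) (\<lambda>j. r * lam j)"
proof -
  have "{j. 1 \<le> j \<and> r * lam j = c} = {j. 1 \<le> j \<and> lam j = c / r}" for c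
    using r by (auto simp: field_simps)
  then show ?thesis
    using lam r unfolding eigenvalue_sequence_def multiplicity_of_def eigenspace_scale_kernel[OF r] by auto
qed

lemma eigenvalue_sequence_kernel_cong:
  assumes "\<And>x y. x \<in> {0..1} \<Longrightarrow> y \<in> {0..1} \<Longrightarrow> \<Gamma> x y = \<Gamma>' x y"
  shows "eigenvalue_sequence \<Gamma> lam \<longleftrightarrow> eigenvalue_sequence \<Gamma>' lam"
  by (rule eigenvalue_sequence_cong) (simp only: multiplicity_of_def eigenspace_cong[of \<Gamma> \<Gamma>', OF assms])

lemma scaled_process:
  assumes P: "centered_gaussian_process P" and r: "r \<ge> 0"
  obtains P' where "centered_gaussian_process P'"
    "\<And>x y. x \<in> {0..1} \<Longrightarrow> y \<in> {0..1} \<Longrightarrow> cov_kernel P' x y = r * cov_kernel P x y"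
proof -
  interpret gauss_process P by unfold_locales (rule P)
  define X where "X t z = sqrt r * z t" for t and z :: "real \<Rightarrow> real"
  have m: "X t \<in> borel_measurable P" if "t \<in> {0..1}" for t
    unfolding X_def using coord_measurable[OF that] by simp
  have n: "\<exists>v. centered_normal P (\<lambda>z. \<Sum>t\<in>J. c t * X t z) v" if J: "finite J" "J \<subseteq> {0..1}" for J c
  proof (rule lin_comb_normal)
    show "lin_comb UNIV (\<lambda>z. \<Sum>t\<in>J. c t * X t z)"
      unfolding lin_comb_def using J by (intro exI[of _ J] exI[of _ "\<lambda>t. c t * sqrt r"]) (auto simp: X_def mult_ac)
  qed
  have pl: "centered_gaussian_process (distr P path_space (\<lambda>z. \<lambda>t\<in>{0..1}. X t z))"
    "\<And>x y. x \<in> {0..1} \<Longrightarrow> y \<in> {0..1} \<Longrightarrow>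
      cov_kernel (distr P path_space (\<lambda>z. \<lambda>t\<in>{0..1}. X t z)) x y = (\<integral>z. X x z * X y z \<partial>P)"
    using process_law[OF prob_space_axioms m n] by blast+
  show ?thesis
  proof (rule that[OF pl(1)])
    fix x y :: real assume xy: "x \<in> {0..1}" "y \<in> {0..1}"
    have "X x z * X y z = r * (z x * z y)" for z
    proof -
      have "X x z * X y z = (sqrt r * sqrt r) * (z x * z y)" unfolding X_def by (simp only: mult_ac)
      then show ?thesis using r by simp
    qed
    then show "cov_kernel (distr P path_space (\<lambda>\<omega>. \<lambda>t\<in>{0..1}. X t \<omega>)) x y = r * cov_kernel P x y"
      unfolding pl(2)[OF xy] by (simp add: cov_kernel_def)
  qed
qed

text \<open>Scaling the kernel by \<delta> / \<delta>' < 1 makes its Hoelder norm strictly smaller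
  than L, while the gap stays at least \<delta>. The partner eigenvalue is the one before k, which
  the gap keeps above the k-th and hence positive.\<close>

lemma base_law_exists_ge2:
  assumes \<gamma>: "\<gamma> > 0" and L: "L > 0" and k: "k \<ge> 2" and \<delta>: "0 < \<delta>" "\<delta> < \<delta>'"
    and P: "P \<in> gaussian_gap_class \<gamma> k L \<delta>'"
  obtains P' lam A B where "base_law \<gamma> L k \<delta> P' lam A B"
proof -
  obtain lam where gp: "centered_gaussian_process P" and hc: "cov_kernel P \<in> holder_class \<gamma> L"
    and lam: "eigenvalue_sequence (cov_kernel P) lam" and gap: "\<delta>' \<le> spectral_gap lam k"
    using P by (auto simp: gaussian_gap_class_def gaussian_class_def)
  obtain A B where AB: "A \<ge> 0" "B \<ge> 0" "A + B \<le> L"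
    and hb: "holder_bounds (holder_order \<gamma>) (\<gamma> - real (holder_order \<gamma>)) A B (cov_kernel P)"
    by (rule holder_class_bounds[OF \<gamma> hc less_imp_le[OF L]])
  define r where "r = \<delta> / \<delta>'"
  have r: "0 < r" "r < 1" "r * \<delta>' = \<delta>" using \<delta> by (auto simp: r_def)
  obtain P' where P': "centered_gaussian_process P'"
    "\<And>x y. x \<in> {0..1} \<Longrightarrow> y \<in> {0..1} \<Longrightarrow> cov_kernel P' x y = r * cov_kernel P x y"
    by (rule scaled_process[OF gp less_imp_le[OF r(1)]], rule that)
  have hb': "holder_bounds (holder_order \<gamma>) (\<gamma> - real (holder_order \<gamma>)) (r * A) (r * B) (cov_kernel P')"
  proof (rule holder_bounds_cong)
    show "holder_bounds (holder_order \<gamma>) (\<gamma> - real (holder_order \<gamma>)) (r * A) (r * B) (\<lambda>x y. r * cov_kernel P x y)"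
      using holder_bounds_scale[OF hb, of r] r(1) by simp
    show "r * cov_kernel P x y = cov_kernel P' x y" if "x \<in> {0..1}" "y \<in> {0..1}" for x y
      using P'(2)[OF that] by simp
  qed
  have "r * A + r * B \<le> r * L" using AB r by (simp add: distrib_left[symmetric])
  also have "\<dots> < L" using r L by simp
  finally have lt: "r * A + r * B < L" .
  have es: "eigenvalue_sequence (cov_kernel P') (\<lambda>j. r * lam j)"
    by (rule eigenvalue_sequence_kernel_cong[THEN iffD2, OF P'(2) eigenvalue_sequence_scale[OF lam r(1)]])
  have sg: "spectral_gap (\<lambda>j. r * lam j) k = r * spectral_gap lam k"
    using k r by (simp add: spectral_gap_def min_def right_diff_distrib[symmetric])
  have "r * \<delta>' \<le> r * spectral_gap lam k" using gap r by (intro mult_left_mono) auto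
  then have g: "\<delta> \<le> spectral_gap (\<lambda>j. r * lam j) k" by (simp add: sg r(3))
  have "lam k < lam (k - 1)" using gap k \<delta> by (auto simp: spectral_gap_def)
  moreover have "0 \<le> lam k" using lam k by (auto simp: eigenvalue_sequence_def)
  ultimately have "\<exists>j\<ge>1. 0 < r * lam j \<and> r * lam j \<noteq> r * lam k"
    using k r by (intro exI[of _ "k - 1"]) auto
  then show ?thesis using P' hb' lt es g by (intro that[of P' "\<lambda>j. r * lam j" "r * A" "r * B"]) (simp add: base_law_def)
qed

text \<open>Where the modulus of an eigenfunction is maximal, the eigenvalue equation gives lam 1
  \<le> sup |Gamma| \<le> L. With a gap strictly above \<delta> this shows \<delta> < L, which is
  the room for the explicit kernel when k = 1.\<close>

lemma gap_one_less:
  assumes \<gamma>: "\<gamma> > 0" and L: "L > 0" and \<delta>: "0 < \<delta>'"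
    and P: "P \<in> gaussian_gap_class \<gamma> 1 L \<delta>'"
  shows "\<delta>' \<le> L"
proof -
  obtain lam where gp: "centered_gaussian_process P" and hc: "cov_kernel P \<in> holder_class \<gamma> L"
    and lam: "eigenvalue_sequence (cov_kernel P) lam" and gap: "\<delta>' \<le> spectral_gap lam 1"
    using P by (auto simp: gaussian_gap_class_def gaussian_class_def)
  obtain A B where AB: "A \<ge> 0" "B \<ge> 0" "A + B \<le> L"
    and hb: "holder_bounds (holder_order \<gamma>) (\<gamma> - real (holder_order \<gamma>)) A B (cov_kernel P)"
    by (rule holder_class_bounds[OF \<gamma> hc less_imp_le[OF L]])
  have \<Gamma>: "continuous_kernel (cov_kernel P)"
    by (rule holder_bounds_continuous[OF hb]) (use holder_order_props[OF \<gamma>] in simp)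
  have "0 \<le> lam 2" using lam by (auto simp: eigenvalue_sequence_def)
  then have l1: "\<delta>' \<le> lam 1" using gap by (simp add: spectral_gap_def)
  then have "0 < lam 1" using \<delta> by simp
  then obtain f where f: "f \<in> eigenspace (cov_kernel P) (lam 1)" "continuous_on {0..1} f" "l2_inner f f = 1"
    using eigenfunction_exists[OF \<Gamma> lam, of 1] by auto
  have "continuous_on {0..1} (\<lambda>x. \<bar>f x\<bar>)" using f(2) by (rule continuous_on_rabs)
  from continuous_attains_sup[OF compact_Icc _ this] obtain x where
    x: "x \<in> {0..1}" "\<And>y. y \<in> {0..1} \<Longrightarrow> \<bar>f y\<bar> \<le> \<bar>f x\<bar>" by auto
  have "f x \<noteq> 0"
  proof
    assume "f x = 0"
    then have "f y = 0" if "y \<in> {0..1}" for y using x(2)[OF that] by simp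
    then have "l2_inner f f = (\<integral>x. 0 \<partial>lebesgue_on {0..1::real})"
      unfolding l2_inner_def by (intro Bochner_Integration.integral_cong) auto
    then show False using f(3) by simp
  qed
  have "lam 1 * \<bar>f x\<bar> = \<bar>\<integral>y. cov_kernel P x y * f y \<partial>lebesgue_on {0..1}\<bar>"
    using eigenspaceD(3)[OF f(1) x(1)] \<open>0 < lam 1\<close> by (simp add: cov_operator_def abs_mult)
  also have "\<dots> \<le> (\<integral>y. \<bar>cov_kernel P x y * f y\<bar> \<partial>lebesgue_on {0..1})"
    using integral_norm_bound[of "lebesgue_on {0..1}" "\<lambda>y. cov_kernel P x y * f y"] by simp
  also have "\<dots> \<le> (\<integral>y. A * \<bar>f x\<bar> \<partial>lebesgue_on {0..1::real})"
  proof (rule integral_mono)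
    show "integrable (lebesgue_on {0..1}) (\<lambda>y. \<bar>cov_kernel P x y * f y\<bar>)"
      using kernel_integrable[OF \<Gamma> x(1) eigenspaceD(1)[OF f(1)]] by (rule integrable_abs)
    show "integrable (lebesgue_on {0..1::real}) (\<lambda>y. A * \<bar>f x\<bar>)"
      using finite_measure.integrable_const[OF finite_measure_unit] .
    show "\<bar>cov_kernel P x y * f y\<bar> \<le> A * \<bar>f x\<bar>" if "y \<in> space (lebesgue_on {0..1})" for y
      unfolding abs_mult using that x holder_bounds_abs_le[OF hb x(1)] AB by (intro mult_mono) auto
  qed
  also have "\<dots> = A * \<bar>f x\<bar>" by (simp add: measure_restrict_space)
  finally have "lam 1 \<le> A" using \<open>f x \<noteq> 0\<close> by simp
  then show ?thesis using l1 AB by simp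
qed

subsection \<open>A base law for the first eigenvalue\<close>

text \<open>\<open>lin_fun\<close> and \<open>one_fun\<close> are the normalised shifted Legendre
  polynomials of degree 1 and 0, set to zero off the unit interval.\<close>

definition lin_fun :: "real \<Rightarrow> real" where
  "lin_fun x = (if x \<in> {0..1} then sqrt 3 * (2 * x - 1) else 0)"

definition one_fun :: "real \<Rightarrow> real" where
  "one_fun x = (if x \<in> {0..1} then 1 else 0)"

lemma continuous_lin_one: "continuous_on {0..1} lin_fun" "continuous_on {0..1} one_fun"
proof -
  have "continuous_on {0..1} (\<lambda>x::real. sqrt 3 * (2 * x - 1))" by (intro continuous_intros)
  then show "continuous_on {0..1} lin_fun"
    by (rule continuous_on_cong[THEN iffD1, rotated 2]) (auto simp: lin_fun_def)
  have "continuous_on {0..1} (\<lambda>x::real. 1::real)" by (intro continuous_intros)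
  then show "continuous_on {0..1} one_fun"
    by (rule continuous_on_cong[THEN iffD1, rotated 2]) (auto simp: one_fun_def)
qed

lemma unit_integral_FTC:
  assumes "\<And>x. x \<in> {0..1} \<Longrightarrow> (F has_real_derivative f x) (at x)" "continuous_on {0..1} f"
    "\<And>x. x \<in> {0..1} \<Longrightarrow> g x = f x"
  shows "(\<integral>x. g x \<partial>lebesgue_on {0..1}) = F 1 - F 0"
proof -
  have "(f has_integral F 1 - F 0) {0..1}"
    using assms(1) by (intro fundamental_theorem_of_calculus)
      (auto simp: has_real_derivative_iff_has_vector_derivative[symmetric] intro: has_field_derivative_at_within)
  moreover have "(\<integral>x. g x \<partial>lebesgue_on {0..1}) = (\<integral>x. f x \<partial>lebesgue_on {0..1})"
    using assms(3) by (intro Bochner_Integration.integral_cong) auto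
  moreover have "(\<integral>x. f x \<partial>lebesgue_on {0..1}) = integral {0..1} f"
    using assms(2) by (intro lebesgue_integral_eq_integral continuous_imp_integrable_real) auto
  ultimately show ?thesis by (simp add: integral_unique)
qed

lemma lin_one_inner:
  "l2_inner one_fun one_fun = 1" "l2_inner one_fun lin_fun = 0" "l2_inner lin_fun lin_fun = 1"
proof -
  have "l2_inner one_fun one_fun = 1 - 0"
    unfolding l2_inner_def by (rule unit_integral_FTC[where f="\<lambda>_. 1"]) (auto simp: one_fun_def)
  then show "l2_inner one_fun one_fun = 1" by simp
  have "l2_inner one_fun lin_fun = sqrt 3 * (1\<^sup>2 - 1) - sqrt 3 * (0\<^sup>2 - 0)"
    unfolding l2_inner_def by (rule unit_integral_FTC[where f="\<lambda>x. sqrt 3 * (2 * x - 1)"])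
      (auto simp: one_fun_def lin_fun_def intro!: derivative_eq_intros continuous_intros)
  then show "l2_inner one_fun lin_fun = 0" by simp
  have "l2_inner lin_fun lin_fun = (2 * 1 - 1) ^ 3 / 2 - (2 * 0 - 1) ^ 3 / (2::real)"
    unfolding l2_inner_def
  proof (rule unit_integral_FTC[where f="\<lambda>x. 3 * (2 * x - 1)\<^sup>2"])
    show "((\<lambda>x. (2 * x - 1) ^ 3 / 2) has_real_derivative 3 * (2 * x - 1)\<^sup>2) (at x)" for x :: real
      by (auto intro!: derivative_eq_intros)
    show "continuous_on {0..1} (\<lambda>x::real. 3 * (2 * x - 1)\<^sup>2)" by (intro continuous_intros)
    show "lin_fun x * lin_fun x = 3 * (2 * x - 1)\<^sup>2" if "x \<in> {0..1}" for x
    proof -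
      have "lin_fun x * lin_fun x = (sqrt 3 * sqrt 3) * (2 * x - 1)\<^sup>2"
        using that by (simp only: lin_fun_def if_True power2_eq_square mult_ac)
      then show ?thesis by simp
    qed
  qed
  then show "l2_inner lin_fun lin_fun = 1" by simp
qed

lemma lin_fun_holder:
  assumes "0 < \<alpha>" "\<alpha> \<le> 1"
  shows "holder_bound1 m \<alpha> 4 lin_fun"
proof -
  have s3: "sqrt 3 \<le> 2" by (rule real_le_lsqrt) auto
  define d where "d i x = (if i = 0 then sqrt 3 * (2 * x - 1) else if i = 1 then 2 * sqrt 3 else 0)" for i :: nat and x :: real
  have b: "\<bar>2 * x - 1\<bar> \<le> 1" if "x \<in> {0..1}" for x :: real
    using that unfolding atLeastAtMost_iff by linarith
  have "\<bar>d m x - d m y\<bar> \<le> 4 * \<bar>x - y\<bar> powr \<alpha>" if "x \<in> {0..1}" "y \<in> {0..1}" for x y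
  proof (cases "m = 0")
    case True
    have "d m x - d m y = (2 * sqrt 3) * (x - y)" using True by (simp add: d_def algebra_simps)
    then have "\<bar>d m x - d m y\<bar> = (2 * sqrt 3) * \<bar>x - y\<bar>" by (simp add: abs_mult)
    also have "\<dots> \<le> 4 * \<bar>x - y\<bar>" using s3 by (intro mult_right_mono) auto
    also have "\<bar>x - y\<bar> \<le> \<bar>x - y\<bar> powr \<alpha>"
      using powr_mono'[of \<alpha> 1 "\<bar>x - y\<bar>"] that assms by (cases "x = y") auto
    finally show ?thesis by simp
  qed (simp add: d_def)
  moreover have "\<bar>d i x\<bar> \<le> 4" if "x \<in> {0..1}" for i x
  proof -
    have "sqrt 3 * \<bar>2 * x - 1\<bar> \<le> 2 * 1" using s3 b[OF that] by (intro mult_mono) auto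
    then show ?thesis using s3 by (auto simp: d_def abs_mult)
  qed
  moreover have "(d i has_vector_derivative d (Suc i) x) (at x within {0..1})" for i x
  proof -
    consider "i = 0" | "i = 1" | "i \<ge> 2" by linarith
    then show ?thesis
      unfolding has_real_derivative_iff_has_vector_derivative[symmetric]
      by cases (auto simp: d_def[abs_def] intro!: derivative_eq_intros)
  qed
  ultimately show ?thesis
    unfolding holder_bound1_def
    by (intro exI[of _ d] conjI ballI allI impI) (simp_all add: d_def lin_fun_def)
qed

lemma holder_bounds_const:
  "holder_bounds m \<alpha> \<bar>c\<bar> 0 (\<lambda>x y. c)"
  by (rule holder_boundsI[where D="\<lambda>s1 s2 x y. if s1 = 0 \<and> s2 = 0 then c else 0"])
     (auto simp: deriv_family_def intro!: derivative_eq_intros)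

text \<open>A constant kernel c has the smallest Hoelder norm that a largest eigenvalue c permits. A
  small multiple of a second rank-one kernel adds the eigenvalue \<epsilon>, the partner for the
  rotation.\<close>

locale rank_two =
  fixes c \<epsilon> :: real
  assumes eps: "0 < \<epsilon>" "\<epsilon> < c"
begin

definition kern :: "real \<Rightarrow> real \<Rightarrow> real" where
  "kern x y = c + \<epsilon> * (lin_fun x * lin_fun y)"

lemma kern_holder:
  assumes "0 < \<alpha>" "\<alpha> \<le> 1"
  shows "holder_bounds m \<alpha> (c + \<epsilon> * 16) (\<epsilon> * 32) kern"
  using holder_bounds_add[OF holder_bounds_const[of m \<alpha> c] holder_bounds_scale[OF
      holder_bounds_tensor[OF lin_fun_holder[OF assms] lin_fun_holder[OF assms] assms], where c=\<epsilon>]] eps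
  by (simp add: kern_def[abs_def])

lemma kern_op:
  assumes f: "square_integrable f" and x: "x \<in> {0..1}"
  shows "cov_operator kern f x = c * l2_inner one_fun f * one_fun x + \<epsilon> * l2_inner lin_fun f * lin_fun x"
proof -
  let ?M = "lebesgue_on {0..1::real}"
  have i: "integrable ?M (\<lambda>y. one_fun y * f y)" "integrable ?M (\<lambda>y. lin_fun y * f y)"
    using square_integrable_mult[OF continuous_square_integrable f] continuous_lin_one by auto
  have "cov_operator kern f x = (\<integral>y. c * (one_fun y * f y) + \<epsilon> * lin_fun x * (lin_fun y * f y) \<partial>?M)"
    unfolding cov_operator_def
    by (intro Bochner_Integration.integral_cong) (auto simp: kern_def one_fun_def algebra_simps)
  also have "\<dots> = c * l2_inner one_fun f + \<epsilon> * lin_fun x * l2_inner lin_fun f"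
    using i by (simp add: l2_inner_def)
  finally show ?thesis using x by (simp add: one_fun_def)
qed

lemma kern_eigenspace:
  assumes \<kappa>: "\<kappa> > 0"
  shows "eigenspace kern \<kappa> = (if \<kappa> = c then range (\<lambda>r. scale_fun r one_fun)
    else if \<kappa> = \<epsilon> then range (\<lambda>r. scale_fun r lin_fun) else {0})"
proof (intro equalityI subsetI)
  have si: "square_integrable one_fun" "square_integrable lin_fun"
    using continuous_lin_one by (auto intro: continuous_square_integrable)
  fix f assume f: "f \<in> eigenspace kern \<kappa>"
  define p q where "p = l2_inner one_fun f" "q = l2_inner lin_fun f"
  note fD = eigenspaceD[OF f]
  have fx: "\<kappa> * f x = 0 + c * p * one_fun x + \<epsilon> * q * lin_fun x" for x
  proof (cases "x \<in> {0..1}")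
    case True
    then show ?thesis using fD(3)[OF True] kern_op[OF fD(1) True] by (simp add: p_q_def)
  next
    case False
    then have "one_fun x = 0" "lin_fun x = 0" by (auto simp: one_fun_def lin_fun_def)
    then show ?thesis using fD(2)[OF False] by simp
  qed
  have s0: "square_integrable (\<lambda>x. 0)" by (rule continuous_square_integrable) simp
  have ip: "\<kappa> * l2_inner e f = c * p * l2_inner e one_fun + \<epsilon> * q * l2_inner e lin_fun" if "square_integrable e" for e
  proof -
    have "\<kappa> * l2_inner e f = l2_inner e (\<lambda>x. \<kappa> * f x)"
      by (simp add: l2_inner_def mult.left_commute[of _ \<kappa>])
    also have "\<dots> = l2_inner e (\<lambda>x. 0) + c * p * l2_inner e one_fun + \<epsilon> * q * l2_inner e lin_fun"
      unfolding fx by (rule l2_inner_comb[OF that s0 si])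
    finally show ?thesis by (simp add: l2_inner_def)
  qed
  \<comment> \<open>Orthonormality decouples the two coefficients: each can be nonzero only if
    \<kappa> is its own eigenvalue.\<close>
  have pq: "\<kappa> * p = c * p" "\<kappa> * q = \<epsilon> * q"
    using ip[OF si(1)] ip[OF si(2)] lin_one_inner
    by (simp_all add: p_q_def l2_inner_commute[of lin_fun one_fun])
  have fe: "f = scale_fun p one_fun" if "\<kappa> = c"
  proof -
    have "q = 0" using pq(2) that eps by simp
    then have "c * f x = c * (p * one_fun x)" for x using fx[of x] that by simp
    then show ?thesis using eps by (auto simp: scale_fun_def fun_eq_iff)
  qed
  have fl: "f = scale_fun q lin_fun" if "\<kappa> = \<epsilon>"
  proof -
    have "p = 0" using pq(1) that eps by simp
    then have "\<epsilon> * f x = \<epsilon> * (q * lin_fun x)" for x using fx[of x] that by simp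
    then show ?thesis using eps by (auto simp: scale_fun_def fun_eq_iff)
  qed
  have f0: "f = 0" if "\<kappa> \<noteq> c" "\<kappa> \<noteq> \<epsilon>"
  proof -
    have "p = 0" "q = 0" using pq that by simp_all
    then show ?thesis using fx \<kappa> by (auto simp: fun_eq_iff)
  qed
  show "f \<in> (if \<kappa> = c then range (\<lambda>r. scale_fun r one_fun)
    else if \<kappa> = \<epsilon> then range (\<lambda>r. scale_fun r lin_fun) else {0})"
    using fe fl f0 by auto
next
  fix f assume f: "f \<in> (if \<kappa> = c then range (\<lambda>r. scale_fun r one_fun)
    else if \<kappa> = \<epsilon> then range (\<lambda>r. scale_fun r lin_fun) else {0})"
  have \<Gamma>: "continuous_kernel kern"
    by (rule holder_bounds_continuous[OF kern_holder[of 1 0]]) simp_all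
  have si: "square_integrable one_fun" "square_integrable lin_fun"
    using continuous_lin_one by (auto intro: continuous_square_integrable)
  have 1: "one_fun \<in> eigenspace kern c"
    using kern_op[OF si(1)] si lin_one_inner by (auto simp: eigenspace_def one_fun_def l2_inner_commute[of lin_fun one_fun])
  have 2: "lin_fun \<in> eigenspace kern \<epsilon>"
    using kern_op[OF si(2)] si lin_one_inner by (auto simp: eigenspace_def lin_fun_def)
  note sub = fun_vs.subspace_scale[OF eigenspace_subspace[OF \<Gamma>]]
  show "f \<in> eigenspace kern \<kappa>"
    using f sub[OF 1] sub[OF 2] fun_vs.subspace_0[OF eigenspace_subspace[OF \<Gamma>]]
    by (auto split: if_splits)
qed

definition kern_lam :: "nat \<Rightarrow> real" where
  "kern_lam j = (if j = 1 then c else if j = 2 then \<epsilon> else 0)"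

lemma kern_eigenvalue_sequence: "eigenvalue_sequence kern kern_lam"
  unfolding eigenvalue_sequence_def
proof (intro conjI allI impI)
  fix \<kappa> :: real assume \<kappa>: "0 < \<kappa>"
  have S: "{j. 1 \<le> j \<and> kern_lam j = \<kappa>} = (if \<kappa> = c then {1} else if \<kappa> = \<epsilon> then {2} else {})"
    using \<kappa> eps by (auto simp: kern_lam_def)
  show "finite {j. 1 \<le> j \<and> kern_lam j = \<kappa>}" unfolding S by simp
  have nz: "one_fun \<noteq> 0" "lin_fun \<noteq> 0"
    using lin_one_inner by (auto simp: l2_inner_def)
  have "multiplicity_of kern \<kappa> = (if \<kappa> = c \<or> \<kappa> = \<epsilon> then 1 else 0)"
    unfolding multiplicity_of_def kern_eigenspace[OF \<kappa>]
    using dim_one_singleton[OF nz(1) refl] dim_one_singleton[OF nz(2) refl] dim_zero by (simp del: One_nat_def)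
  then show "card {j. 1 \<le> j \<and> kern_lam j = \<kappa>} = multiplicity_of kern \<kappa>"
    unfolding S by simp
qed (use eps in \<open>auto simp: kern_lam_def\<close>)

lemma kern_process:
  obtains P where "centered_gaussian_process P"
    "\<And>x y. x \<in> {0..1} \<Longrightarrow> y \<in> {0..1} \<Longrightarrow> cov_kernel P x y = kern x y"
proof -
  let ?N = "std_normal_distribution"
  interpret N: real_distribution ?N by (rule real_dist_normal_dist)
  interpret NN: pair_prob_space ?N ?N by unfold_locales
  define X where "X t = (\<lambda>(a, b). sqrt c * a + sqrt \<epsilon> * lin_fun t * b)" for t
  have n0: "centered_normal (?N \<Otimes>\<^sub>M ?N) (\<lambda>\<omega>. \<Sum>t\<in>J. d t * X t \<omega>)
      ((\<Sum>t\<in>J. d t * sqrt c)\<^sup>2 + (\<Sum>t\<in>J. d t * (sqrt \<epsilon> * lin_fun t))\<^sup>2)" for J d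
  proof -
    have eq: "(\<lambda>\<omega>. \<Sum>t\<in>J. d t * X t \<omega>) = (\<lambda>(a, b). (\<Sum>t\<in>J. d t * sqrt c) * a + (\<Sum>t\<in>J. d t * (sqrt \<epsilon> * lin_fun t)) * b)"
      by (auto simp: X_def fun_eq_iff sum_distrib_right sum.distrib[symmetric] distrib_left mult.assoc)
    show ?thesis unfolding eq
      by (intro centered_normal_pair centered_normal_std N.prob_space_axioms)
  qed
  have m: "X t \<in> borel_measurable (?N \<Otimes>\<^sub>M ?N)" for t
    unfolding X_def by measurable
  have pl: "centered_gaussian_process (distr (?N \<Otimes>\<^sub>M ?N) path_space (\<lambda>z. \<lambda>t\<in>{0..1}. X t z))"
    "\<And>x y. x \<in> {0..1} \<Longrightarrow> y \<in> {0..1} \<Longrightarrow>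
      cov_kernel (distr (?N \<Otimes>\<^sub>M ?N) path_space (\<lambda>z. \<lambda>t\<in>{0..1}. X t z)) x y = (\<integral>z. X x z * X y z \<partial>(?N \<Otimes>\<^sub>M ?N))"
  proof -
    have n: "\<exists>v. centered_normal (?N \<Otimes>\<^sub>M ?N) (\<lambda>\<omega>. \<Sum>t\<in>J. d t * X t \<omega>) v" for J d using n0 by blast
    show "centered_gaussian_process (distr (?N \<Otimes>\<^sub>M ?N) path_space (\<lambda>z. \<lambda>t\<in>{0..1}. X t z))"
    "\<And>x y. x \<in> {0..1} \<Longrightarrow> y \<in> {0..1} \<Longrightarrow>
      cov_kernel (distr (?N \<Otimes>\<^sub>M ?N) path_space (\<lambda>z. \<lambda>t\<in>{0..1}. X t z)) x y = (\<integral>z. X x z * X y z \<partial>(?N \<Otimes>\<^sub>M ?N))"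
      using process_law[OF NN.prob_space_axioms m n] by blast+
  qed
  have sqc: "sqrt c * sqrt c = c" "sqrt \<epsilon> * u * (sqrt \<epsilon> * v) = \<epsilon> * (u * v)" for u v
  proof -
    show "sqrt c * sqrt c = c" using eps by simp
    have "sqrt \<epsilon> * u * (sqrt \<epsilon> * v) = (sqrt \<epsilon> * sqrt \<epsilon>) * (u * v)" by (simp only: mult_ac)
    then show "sqrt \<epsilon> * u * (sqrt \<epsilon> * v) = \<epsilon> * (u * v)" using eps by simp
  qed
  have one: "centered_normal (?N \<Otimes>\<^sub>M ?N) (X t) ((sqrt c)\<^sup>2 + (sqrt \<epsilon> * lin_fun t)\<^sup>2)" for t
    using n0[of "\<lambda>_. 1" "{t}"] by simp
  have sqX: "sq_rv (?N \<Otimes>\<^sub>M ?N) (X t)" "(\<integral>\<omega>. (X t \<omega>)\<^sup>2 \<partial>(?N \<Otimes>\<^sub>M ?N)) = (sqrt c)\<^sup>2 + (sqrt \<epsilon> * lin_fun t)\<^sup>2" for t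
    using centered_normal_second_moment[OF NN.prob_space_axioms one] m by (auto simp: sq_rv_def)
  have cov: "(\<integral>z. X x z * X y z \<partial>(?N \<Otimes>\<^sub>M ?N)) = kern x y" for x y
  proof (cases "x = y")
    case True
    then show ?thesis using sqX(2)[of x] sqc by (simp add: power2_eq_square kern_def)
  next
    case False
    have cn: "centered_normal (?N \<Otimes>\<^sub>M ?N) (\<lambda>\<omega>. 1 * X x \<omega> + 1 * X y \<omega>)
        ((sqrt c + sqrt c)\<^sup>2 + (sqrt \<epsilon> * lin_fun x + sqrt \<epsilon> * lin_fun y)\<^sup>2)"
      using n0[of "\<lambda>_. 1" "{x, y}"] False by simp
    have ar: "1\<^sup>2 * (a\<^sup>2 + v\<^sup>2) + 2 * 1 * 1 * E + 1\<^sup>2 * (a\<^sup>2 + w\<^sup>2) = (a + a)\<^sup>2 + (v + w)\<^sup>2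
       \<Longrightarrow> 2 * E = 2 * (a * a) + 2 * (v * w)" for a v w E :: real
      by (simp add: power2_eq_square algebra_simps)
    from centered_normal_second_moment(2)[OF NN.prob_space_axioms cn]
    have "2 * (\<integral>z. X x z * X y z \<partial>(?N \<Otimes>\<^sub>M ?N)) = 2 * (sqrt c * sqrt c) + 2 * (sqrt \<epsilon> * lin_fun x * (sqrt \<epsilon> * lin_fun y))"
      unfolding sq_rv_comb(2)[OF sqX(1) sqX(1)] sqX(2) by (rule ar)
    then show ?thesis unfolding sqc by (simp add: kern_def)
  qed
  show ?thesis by (rule that[OF pl(1)]) (simp add: pl(2) cov)
qed

end

lemma base_law_exists:
  assumes \<gamma>: "\<gamma> > 0" and L: "L > 0" and k: "k \<ge> 1" and \<delta>: "0 < \<delta>"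
    and ne: "\<exists>\<delta>'>\<delta>. gaussian_gap_class \<gamma> k L \<delta>' \<noteq> {}"
  obtains P lam A B where "base_law \<gamma> L k \<delta> P lam A B"
proof -
  obtain \<delta>' P0 where \<delta>': "\<delta> < \<delta>'" and P0: "P0 \<in> gaussian_gap_class \<gamma> k L \<delta>'" using ne by auto
  show ?thesis
  proof (cases "k \<ge> 2")
    case True
    show ?thesis by (rule base_law_exists_ge2[OF \<gamma> L True \<delta> \<delta>' P0], rule that)
  next
    case False
    then have k1: "k = 1" using k by simp
    have dL: "\<delta> < L" using gap_one_less[OF \<gamma> L, of \<delta>' P0] P0 \<delta> \<delta>' k1 by simp
    \<comment> \<open>Halfway between \<delta> and L. The first entry of the minimum below keeps the
      gap c - \<epsilon> at least \<delta>, the second keeps the total norm c + 48 \<epsilon> below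
      L.\<close>
    define c where "c = (\<delta> + L) / 2"
    define \<epsilon> where "\<epsilon> = min ((L - \<delta>) / 2) ((L - \<delta>) / 192)"
    have e: "0 < \<epsilon>" "\<epsilon> \<le> (L - \<delta>) / 192" "\<delta> \<le> c - \<epsilon>" "c + \<epsilon> * 16 + \<epsilon> * 32 < L" "\<epsilon> < c"
      using dL \<delta> by (auto simp: \<epsilon>_def c_def min_def field_simps)
    interpret rank_two c \<epsilon> by unfold_locales (use e in auto)
    obtain P where P: "centered_gaussian_process P"
      "\<And>x y. x \<in> {0..1} \<Longrightarrow> y \<in> {0..1} \<Longrightarrow> cov_kernel P x y = kern x y"
      by (rule kern_process, rule that)
    define m \<alpha> where "m = holder_order \<gamma>" and "\<alpha> = \<gamma> - real m"
    have \<alpha>: "0 < \<alpha>" "\<alpha> \<le> 1" using holder_order_props[OF \<gamma>] by (auto simp: \<alpha>_def m_def)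
    have "holder_bounds m \<alpha> (c + \<epsilon> * 16) (\<epsilon> * 32) (cov_kernel P)"
      by (rule holder_bounds_cong[OF _ kern_holder[OF \<alpha>]]) (simp add: P)
    moreover have "eigenvalue_sequence (cov_kernel P) kern_lam"
      by (rule eigenvalue_sequence_kernel_cong[THEN iffD2, OF P(2) kern_eigenvalue_sequence])
    moreover have "\<delta> \<le> spectral_gap kern_lam k" using e k1 by (simp add: spectral_gap_def kern_lam_def)
    moreover have "\<exists>j\<ge>1. 0 < kern_lam j \<and> kern_lam j \<noteq> kern_lam k"
      using e k1 by (intro exI[of _ 2]) (simp add: kern_lam_def)
    ultimately have "base_law \<gamma> L k \<delta> P kern_lam (c + \<epsilon> * 16) (\<epsilon> * 32)"
      using P(1) e(4) unfolding base_law_def m_def[symmetric] \<alpha>_def[symmetric] by simp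
    then show ?thesis by (rule that)
  qed
qed

lemma base_lawD:
  assumes "base_law \<gamma> L k \<delta> P lam A B"
  shows "centered_gaussian_process P"
    "holder_bounds (holder_order \<gamma>) (\<gamma> - real (holder_order \<gamma>)) A B (cov_kernel P)" "A + B < L"
    "eigenvalue_sequence (cov_kernel P) lam" "\<delta> \<le> spectral_gap lam k"
    "\<exists>j\<ge>1. 0 < lam j \<and> lam j \<noteq> lam k"
  using assms by (simp_all add: base_law_def)

text \<open>The perturbation is charged with R to the first Hoelder bound and with 2 R to the
  second; hence the slack of 3 R.\<close>

lemma rotated_class:
  assumes \<gamma>: "\<gamma> > 0" and k: "k \<ge> 1" and \<delta>: "0 < \<delta>"
    and base: "base_law \<gamma> L k \<delta> P lam A B"
    and rot: "rotation (cov_kernel P) e1 e2 c s"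
    and hb: "holder_bounds (holder_order \<gamma>) (\<gamma> - real (holder_order \<gamma>)) (A + R) (B + 2 * R) (rot_kernel (cov_kernel P) e1 e2 c s)"
    and R: "0 \<le> R" "A + B + 3 * R \<le> L"
    and P': "centered_gaussian_process P'"
      "\<And>x y. x \<in> {0..1} \<Longrightarrow> y \<in> {0..1} \<Longrightarrow> cov_kernel P' x y = rot_kernel (cov_kernel P) e1 e2 c s x y"
    and \<phi>: "\<phi> \<in> eigenspace (cov_kernel P) (lam k)" "l2_inner \<phi> \<phi> = 1"
  shows "P' \<in> gaussian_gap_class \<gamma> k L \<delta>"
    "\<bar>eigenfunction P' k t\<bar> = \<bar>rot_fun e1 e2 c s \<phi> t\<bar>"
proof -
  note bd = base_lawD[OF base]
  interpret rotation "cov_kernel P" e1 e2 c s by (rule rot)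
  have hb': "holder_bounds (holder_order \<gamma>) (\<gamma> - real (holder_order \<gamma>)) (A + R) (B + 2 * R) (cov_kernel P')"
    by (rule holder_bounds_cong[OF _ hb]) (simp add: P')
  have AB: "A \<ge> 0" "B \<ge> 0" using holder_bounds_nonneg[OF bd(2)] by auto
  have hc: "cov_kernel P' \<in> holder_class \<gamma> L"
    by (rule holder_bounds_class[OF hb']) (use AB R in auto)
  have es: "eigenvalue_sequence (cov_kernel P') lam"
    by (rule eigenvalue_sequence_kernel_cong[THEN iffD2, OF P'(2) rot_eigenvalue_sequence[THEN iffD2, OF bd(4)]])
  show "P' \<in> gaussian_gap_class \<gamma> k L \<delta>"
    using P'(1) hc es bd(5) by (auto simp: gaussian_gap_class_def gaussian_class_def)
  have \<Gamma>': "continuous_kernel (cov_kernel P')"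
    by (rule holder_bounds_continuous[OF hb']) (use holder_order_props[OF \<gamma>] in simp)
  have \<psi>: "rot_fun e1 e2 c s \<phi> \<in> eigenspace (cov_kernel P') (lam k)"
  proof -
    have "eigenspace (cov_kernel P') (lam k) = eigenspace (rot_kernel (cov_kernel P) e1 e2 c s) (lam k)"
      by (rule eigenspace_cong) (rule P'(2))
    then show ?thesis unfolding rot_eigenspace using \<phi>(1) by simp
  qed
  have n: "l2_inner (rot_fun e1 e2 c s \<phi>) (rot_fun e1 e2 c s \<phi>) = 1"
    using rot_norm[OF eigenspaceD(1)[OF \<phi>(1)]] \<phi>(2) by simp
  have gap: "0 < spectral_gap lam k" using bd(5) \<delta> by simp
  obtain r where r: "r = 1 \<or> r = -1" "eigenfunction P' k = (\<lambda>t. r * rot_fun e1 e2 c s \<phi> t)"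
    by (rule eigenfunction_abs_eq[OF \<Gamma>' es k gap \<psi> n])
  then show "\<bar>eigenfunction P' k t\<bar> = \<bar>rot_fun e1 e2 c s \<phi> t\<bar>" by (auto simp: abs_mult)
qed

subsection \<open>Reduction to events at finitely many points\<close>

lemma continuous_unit_bounded:
  fixes f :: "real \<Rightarrow> real"
  assumes "continuous_on {0..1} f"
  obtains C where "0 < C" "\<And>t. t \<in> {0..1} \<Longrightarrow> \<bar>f t\<bar> \<le> C"
proof -
  have "compact (f ` {0..1})" using assms by (intro compact_continuous_image compact_Icc)
  then obtain C where "\<forall>x\<in>{0..1}. \<bar>f x\<bar> \<le> C"
    by (auto dest!: compact_imp_bounded simp: bounded_iff)
  then show ?thesis by (intro that[of "max C 1"]) (auto simp: le_max_iff_disj)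
qed

text \<open>The absolute values of f and g differ by at most |f - g| and by at most |f + g|, which
  removes the ambiguity of the sign. Boundedness of both functions makes each supremum an upper
  bound for its values.\<close>

lemma sign_dist_ge:
  assumes f: "continuous_on {0..1} f" and g: "\<And>t. t \<in> {0..1} \<Longrightarrow> \<bar>g t\<bar> \<le> C" and t: "t \<in> {0..1}"
  shows "\<bar>\<bar>f t\<bar> - \<bar>g t\<bar>\<bar> \<le> sign_dist f g"
proof -
  obtain D where D: "\<And>t. t \<in> {0..1} \<Longrightarrow> \<bar>f t\<bar> \<le> D"
    using continuous_unit_bounded[OF f] by blast
  have b1: "bdd_above ((\<lambda>t. \<bar>f t - g t\<bar>) ` {0..1})"
  proof (rule bdd_aboveI2)
    fix t :: real assume "t \<in> {0..1}"
    then show "\<bar>f t - g t\<bar> \<le> D + C" using D[of t] g[of t] by linarith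
  qed
  have b2: "bdd_above ((\<lambda>t. \<bar>f t + g t\<bar>) ` {0..1})"
  proof (rule bdd_aboveI2)
    fix t :: real assume "t \<in> {0..1}"
    then show "\<bar>f t + g t\<bar> \<le> D + C" using D[of t] g[of t] by linarith
  qed
  have "\<bar>\<bar>f t\<bar> - \<bar>g t\<bar>\<bar> \<le> \<bar>f t - g t\<bar>" "\<bar>\<bar>f t\<bar> - \<bar>g t\<bar>\<bar> \<le> \<bar>f t + g t\<bar>" by linarith+
  then show ?thesis
    using cSUP_upper[OF t b1] cSUP_upper[OF t b2] unfolding sign_dist_def by simp
qed

text \<open>Testing at finitely many points only keeps the event measurable.\<close>

definition miss_event :: "nat \<Rightarrow> nat \<Rightarrow> ((nat \<times> nat \<Rightarrow> real) \<Rightarrow> real \<Rightarrow> real) \<Rightarrow> real set \<Rightarrow> (real \<Rightarrow> real) \<Rightarrow> real \<Rightarrow> (nat \<times> nat \<Rightarrow> real) set" where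
  "miss_event n p \<Phi> T \<psi> r = {y \<in> space (data_space n p). \<exists>t\<in>T. r \<le> \<bar>\<bar>\<Phi> y t\<bar> - \<bar>\<psi> t\<bar>\<bar>}"

lemma miss_event_sets:
  assumes \<Phi>: "\<Phi> \<in> estimators n p" and T: "finite T" "T \<subseteq> {0..1}"
  shows "miss_event n p \<Phi> T \<psi> r \<in> sets (data_space n p)"
proof -
  have "miss_event n p \<Phi> T \<psi> r = (\<Union>t\<in>T. {y \<in> space (data_space n p). r \<le> \<bar>\<bar>\<Phi> y t\<bar> - \<bar>\<psi> t\<bar>\<bar>})"
    by (auto simp: miss_event_def)
  also have "\<dots> \<in> sets (data_space n p)"
  proof (rule sets.finite_UN[OF T(1)])
    fix t assume "t \<in> T"
    then have [measurable]: "(\<lambda>y. \<Phi> y t) \<in> borel_measurable (data_space n p)"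
      using \<Phi> T by (auto simp: estimators_def)
    show "{y \<in> space (data_space n p). r \<le> \<bar>\<bar>\<Phi> y t\<bar> - \<bar>\<psi> t\<bar>\<bar>} \<in> sets (data_space n p)" by measurable
  qed
  finally show ?thesis .
qed

lemma sets_data_law: "sets (data_law \<mu> x \<sigma> n p P) = sets (data_space n p)"
  by (simp add: data_law_def)

text \<open>Markov's inequality for the weight: on the event the normalised distance is at least b0,
  hence at least b, and there the weight is at least a.\<close>

lemma risk_ge:
  assumes \<Phi>: "\<Phi> \<in> estimators n p" and T: "finite T" "T \<subseteq> {0..1}"
    and \<psi>: "continuous_on {0..1} \<psi>" "\<And>t. \<bar>eigenfunction P k t\<bar> = \<bar>\<psi> t\<bar>"
    and r: "r > 0" and b: "0 < b" "b \<le> b0" and a: "a > 0"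
    and w: "\<forall>t\<ge>0. 0 \<le> w t \<and> a * indicator {b..} t \<le> (w t :: real)"
  shows "ennreal a * emeasure (data_law \<mu> x \<sigma> n p P) (miss_event n p \<Phi> T \<psi> (b0 * r))
    \<le> (\<integral>\<^sup>+ y. ennreal (w (sign_dist (\<Phi> y) (eigenfunction P k) / r)) \<partial>data_law \<mu> x \<sigma> n p P)"
proof -
  let ?Q = "data_law \<mu> x \<sigma> n p P" and ?A = "miss_event n p \<Phi> T \<psi> (b0 * r)"
  have A: "?A \<in> sets ?Q" using miss_event_sets[OF \<Phi> T] by (simp add: sets_data_law)
  obtain C where C: "\<And>t. t \<in> {0..1} \<Longrightarrow> \<bar>\<psi> t\<bar> \<le> C"
    using continuous_unit_bounded[OF \<psi>(1)] by blast
  have "ennreal a * emeasure ?Q ?A = (\<integral>\<^sup>+ y. ennreal a * indicator ?A y \<partial>?Q)"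
    using A by (simp add: nn_integral_cmult_indicator)
  also have "\<dots> \<le> (\<integral>\<^sup>+ y. ennreal (w (sign_dist (\<Phi> y) (eigenfunction P k) / r)) \<partial>?Q)"
  proof (rule nn_integral_mono)
    fix y assume "y \<in> space ?Q"
    show "ennreal a * indicator ?A y \<le> ennreal (w (sign_dist (\<Phi> y) (eigenfunction P k) / r))"
    proof (cases "y \<in> ?A")
      case True
      then obtain t where t: "t \<in> T" "b0 * r \<le> \<bar>\<bar>\<Phi> y t\<bar> - \<bar>\<psi> t\<bar>\<bar>" and ys: "y \<in> space (data_space n p)"
        by (auto simp: miss_event_def)
      have c: "continuous_on {0..1} (\<Phi> y)" using \<Phi> ys by (auto simp: estimators_def)
      have "b0 * r \<le> sign_dist (\<Phi> y) (eigenfunction P k)"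
        using sign_dist_ge[OF c, of "eigenfunction P k" C t] t T C \<psi>(2) by force
      moreover have "b * r \<le> b0 * r" using b r by (intro mult_right_mono) auto
      ultimately have "b * r \<le> sign_dist (\<Phi> y) (eigenfunction P k)" by linarith
      then have ge: "b \<le> sign_dist (\<Phi> y) (eigenfunction P k) / r" using r by (simp add: le_divide_eq)
      then have "0 \<le> sign_dist (\<Phi> y) (eigenfunction P k) / r" using b by simp
      then have "a * indicator {b..} (sign_dist (\<Phi> y) (eigenfunction P k) / r) \<le> w (sign_dist (\<Phi> y) (eigenfunction P k) / r)"
        using w by blast
      then have "a \<le> w (sign_dist (\<Phi> y) (eigenfunction P k) / r)" using ge by simp
      then show ?thesis using True by (simp add: ennreal_leI)
    qed simp
  qed
  finally show ?thesis .
qed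

text \<open>The constants are fixed before the mean, the design and the estimator, whereas the law
  may depend on all of them. \<open>\<psi>\<close> represents the eigenfunction up to its arbitrary
  sign.\<close>

definition lower_bound_rate :: "real \<Rightarrow> nat \<Rightarrow> real \<Rightarrow> real \<Rightarrow> real \<Rightarrow> (nat \<Rightarrow> nat \<Rightarrow> real) \<Rightarrow> bool" where
  "lower_bound_rate \<gamma> k L \<delta> \<sigma> r \<longleftrightarrow> (\<exists>b0>0. \<exists>v>0. \<exists>N. \<forall>n\<ge>N. \<forall>p\<ge>N. \<forall>\<mu> x. design p x \<longrightarrow>
     (\<forall>\<Phi>\<in>estimators n p. \<exists>P\<in>gaussian_gap_class \<gamma> k L \<delta>. \<exists>\<psi> T.
        continuous_on {0..1} \<psi> \<and> (\<forall>t. \<bar>eigenfunction P k t\<bar> = \<bar>\<psi> t\<bar>) \<and> finite T \<and> T \<subseteq> {0..1} \<and>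
        ennreal v \<le> emeasure (data_law \<mu> x \<sigma> n p P) (miss_event n p \<Phi> T \<psi> (b0 * r n p))))"

text \<open>For every n and p the rate equals one of its three terms, and the bound for that term
  applies with the smallest of the constants. The term may change with n and p.\<close>

lemma lower_bound_from_rates:
  fixes \<gamma> L \<delta> \<sigma> :: real and k :: nat
  assumes r1: "lower_bound_rate \<gamma> k L \<delta> \<sigma> (\<lambda>n p. real p powr (- \<gamma>))"
    and r2: "lower_bound_rate \<gamma> k L \<delta> \<sigma> (\<lambda>n p. (ln (real (n * p)) / real (n * p)) powr (\<gamma> / (2 * \<gamma> + 1)))"
    and r3: "lower_bound_rate \<gamma> k L \<delta> \<sigma> (\<lambda>n p. real n powr (- 1 / 2))"
  shows "\<exists>b\<^sub>0>0. \<forall>(\<mu> :: real \<Rightarrow> real) (x :: nat \<Rightarrow> nat \<Rightarrow> nat \<Rightarrow> real) (w :: real \<Rightarrow> real) a b.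
     (\<forall>n p. design p (x n p)) \<longrightarrow> 0 < a \<longrightarrow> 0 < b \<longrightarrow> b \<le> b\<^sub>0 \<longrightarrow>
     (\<forall>t\<ge>0. 0 \<le> w t \<and> a * indicator {b..} t \<le> w t) \<longrightarrow>
     0 < Liminf (sequentially \<times>\<^sub>F sequentially)
           (\<lambda>(n, p).
              INF \<Phi>\<in>estimators n p.
              SUP P\<in>gaussian_gap_class \<gamma> k L \<delta>.
                \<integral>\<^sup>+ y. ennreal (w (sign_dist (\<Phi> y) (eigenfunction P k) / rate \<gamma> n p))
                  \<partial>data_law \<mu> (x n p) \<sigma> n p P)"
proof -
  let ?R1 = "\<lambda>n p::nat. real p powr (- \<gamma>)"
  let ?R2 = "\<lambda>n p. (ln (real (n * p)) / real (n * p)) powr (\<gamma> / (2 * \<gamma> + 1))"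
  let ?R3 = "\<lambda>n p::nat. real n powr (- 1 / 2)"
  define good where "good r b0 v N \<longleftrightarrow> (\<forall>n\<ge>N. \<forall>p\<ge>N. \<forall>\<mu> x. design p x \<longrightarrow>
     (\<forall>\<Phi>\<in>estimators n p. \<exists>P\<in>gaussian_gap_class \<gamma> k L \<delta>. \<exists>\<psi> T.
        continuous_on {0..1} \<psi> \<and> (\<forall>t. \<bar>eigenfunction P k t\<bar> = \<bar>\<psi> t\<bar>) \<and> finite T \<and> T \<subseteq> {0..1} \<and>
        ennreal v \<le> emeasure (data_law \<mu> x \<sigma> n p P) (miss_event n p \<Phi> T \<psi> (b0 * r n p))))" for r b0 v N
  obtain b1 v1 N1 where g1: "b1 > 0" "v1 > 0" "good ?R1 b1 v1 N1"
    using r1 unfolding lower_bound_rate_def good_def[symmetric] by blast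
  obtain b2 v2 N2 where g2: "b2 > 0" "v2 > 0" "good ?R2 b2 v2 N2"
    using r2 unfolding lower_bound_rate_def good_def[symmetric] by blast
  obtain b3 v3 N3 where g3: "b3 > 0" "v3 > 0" "good ?R3 b3 v3 N3"
    using r3 unfolding lower_bound_rate_def good_def[symmetric] by blast
  define v where "v = min v1 (min v2 v3)"
  \<comment> \<open>At least 2, so that np > 1 and the logarithm in the rate is positive.\<close>
  define N where "N = max 2 (max N1 (max N2 N3))"
  have v: "v > 0" "v \<le> v1" "v \<le> v2" "v \<le> v3" using g1 g2 g3 by (auto simp: v_def)
  have N: "2 \<le> N" "N1 \<le> N" "N2 \<le> N" "N3 \<le> N" by (auto simp: N_def)
  show ?thesis
  proof (intro exI[of _ "min b1 (min b2 b3)"] conjI allI impI)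
    show "0 < min b1 (min b2 b3)" using g1 g2 g3 by simp
    fix \<mu> :: "real \<Rightarrow> real" and x :: "nat \<Rightarrow> nat \<Rightarrow> nat \<Rightarrow> real" and w :: "real \<Rightarrow> real" and a b
    assume x: "\<forall>n p. design p (x n p)" and a: "0 < a" and b: "0 < b" "b \<le> min b1 (min b2 b3)"
      and w: "\<forall>t\<ge>0. 0 \<le> w t \<and> a * indicator {b..} t \<le> w t"
    let ?F = "\<lambda>n p \<Phi> P. \<integral>\<^sup>+ y. ennreal (w (sign_dist (\<Phi> y) (eigenfunction P k) / rate \<gamma> n p))
                  \<partial>data_law \<mu> (x n p) \<sigma> n p P"
    have main: "ennreal (a * v) \<le> (SUP P\<in>gaussian_gap_class \<gamma> k L \<delta>. ?F n p \<Phi> P)"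
      if n: "N \<le> n" and p: "N \<le> p" and \<Phi>: "\<Phi> \<in> estimators n p" for n p \<Phi>
    proof -
      have np: "2 \<le> n" "2 \<le> p" "4 \<le> n * p"
        using n p N(1) mult_mono[of 2 n 2 p] by auto
      have "1 < real (n * p)" using np(3) by linarith
      then have "0 < ln (real (n * p)) / real (n * p)" by simp
      then have pos: "0 < ?R1 n p" "0 < ?R2 n p" "0 < ?R3 n p" using np by auto
      have step: "ennreal (a * v) \<le> (SUP P\<in>gaussian_gap_class \<gamma> k L \<delta>. ?F n p \<Phi> P)"
        if g: "good r b0 v0 N0" and b0: "b \<le> b0" and v0: "v \<le> v0" and N0: "N0 \<le> N"
          and rr: "rate \<gamma> n p = r n p" and rp: "0 < r n p" for r b0 v0 N0
      proof -
        have nn: "N0 \<le> n" "N0 \<le> p" using n p N0 by auto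
        have dx: "design p (x n p)" using x by blast
        obtain P \<psi> T where P: "P \<in> gaussian_gap_class \<gamma> k L \<delta>" "continuous_on {0..1} \<psi>"
          "\<And>t. \<bar>eigenfunction P k t\<bar> = \<bar>\<psi> t\<bar>" "finite T" "T \<subseteq> {0..1}"
          "ennreal v0 \<le> emeasure (data_law \<mu> (x n p) \<sigma> n p P) (miss_event n p \<Phi> T \<psi> (b0 * r n p))"
          using g[unfolded good_def, rule_format, OF nn dx \<Phi>] by blast
        have "ennreal (a * v) = ennreal a * ennreal v" using a v by (simp add: ennreal_mult)
        also have "\<dots> \<le> ennreal a * ennreal v0" using v0 by (intro mult_left_mono ennreal_leI) auto
        also have "\<dots> \<le> ennreal a * emeasure (data_law \<mu> (x n p) \<sigma> n p P) (miss_event n p \<Phi> T \<psi> (b0 * r n p))"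
          using P(6) by (intro mult_left_mono) auto
        also have "\<dots> \<le> ?F n p \<Phi> P"
          unfolding rr by (rule risk_ge[OF \<Phi> P(4,5,2,3) rp b(1) b0 a w])
        also have "\<dots> \<le> (SUP P\<in>gaussian_gap_class \<gamma> k L \<delta>. ?F n p \<Phi> P)" by (rule SUP_upper[OF P(1)])
        finally show ?thesis .
      qed
      have "rate \<gamma> n p \<in> {?R1 n p, ?R2 n p, ?R3 n p}" unfolding rate_def by (rule Max_in) auto
      then consider "rate \<gamma> n p = ?R1 n p" | "rate \<gamma> n p = ?R2 n p" | "rate \<gamma> n p = ?R3 n p" by blast
      then show ?thesis
      proof cases
        case 1 show ?thesis by (rule step[OF g1(3) _ v(2) N(2) 1 pos(1)]) (use b in simp)
      next
        case 2 show ?thesis by (rule step[OF g2(3) _ v(3) N(3) 2 pos(2)]) (use b in simp)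
      next
        case 3 show ?thesis by (rule step[OF g3(3) _ v(4) N(4) 3 pos(3)]) (use b in simp)
      qed
    qed
    have "0 < ennreal (a * v)" using a v by simp
    also have "ennreal (a * v) \<le> Liminf (sequentially \<times>\<^sub>F sequentially)
           (\<lambda>(n, p). INF \<Phi>\<in>estimators n p. SUP P\<in>gaussian_gap_class \<gamma> k L \<delta>. ?F n p \<Phi> P)"
    proof (rule Liminf_bounded)
      have "eventually (\<lambda>z. N \<le> fst z \<and> N \<le> snd z) (sequentially \<times>\<^sub>F sequentially)"
        using eventually_prodI[OF eventually_ge_at_top[of N] eventually_ge_at_top[of N]] .
      then show "eventually (\<lambda>z. ennreal (a * v) \<le> (case z of (n, p) \<Rightarrow>
          INF \<Phi>\<in>estimators n p. SUP P\<in>gaussian_gap_class \<gamma> k L \<delta>. ?F n p \<Phi> P)) (sequentially \<times>\<^sub>F sequentially)"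
      proof eventually_elim
        case (elim z)
        then show ?case unfolding split_beta by (intro INF_greatest main) auto
      qed
    qed
    finally show "0 < Liminf (sequentially \<times>\<^sub>F sequentially)
           (\<lambda>(n, p). INF \<Phi>\<in>estimators n p. SUP P\<in>gaussian_gap_class \<gamma> k L \<delta>. ?F n p \<Phi> P)" .
  qed
qed

subsection \<open>The parametric rate\<close>

text \<open>Each pair (C, D) is a smallness condition on \<epsilon>; the perturbations below collect
  their conditions in such a set.\<close>

lemma small_exists:
  fixes S :: "(real \<times> real) set"
  assumes "finite S" "\<And>C D. (C, D) \<in> S \<Longrightarrow> 0 < D"
  shows "\<exists>\<epsilon>>0. \<epsilon> \<le> 1 \<and> (\<forall>(C, D)\<in>S. \<epsilon> * C \<le> D)"
  using assms
proof (induction S rule: finite_induct)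
  case empty
  then show ?case by (intro exI[of _ 1]) auto
next
  case (insert z S)
  obtain C D where z: "z = (C, D)" by (cases z)
  obtain \<epsilon> where e: "\<epsilon> > 0" "\<epsilon> \<le> 1" "\<forall>(C, D)\<in>S. \<epsilon> * C \<le> D" using insert by blast
  have D: "D > 0" using insert.prems[of C D] z by simp
  define \<eta> where "\<eta> = min \<epsilon> (D / (\<bar>C\<bar> + 1))"
  have eta: "\<eta> > 0" "\<eta> \<le> \<epsilon>" "\<eta> \<le> D / (\<bar>C\<bar> + 1)" using e D by (auto simp: \<eta>_def)
  have "\<eta> * C' \<le> D'" if "(C', D') \<in> S" for C' D'
  proof (cases "C' \<ge> 0")
    case True
    have "\<eta> * C' \<le> \<epsilon> * C'" using eta True by (intro mult_right_mono) auto
    then show ?thesis using e(3) that by fastforce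
  next
    case False
    then have "\<eta> * C' \<le> 0" using eta by (simp add: mult_le_0_iff)
    then show ?thesis using insert.prems[of C' D'] that by force
  qed
  moreover have "\<eta> * C \<le> D"
  proof -
    have "\<eta> * C \<le> \<eta> * (\<bar>C\<bar> + 1)" using eta by (intro mult_left_mono) auto
    also have "\<dots> \<le> D" using eta(3) by (simp add: le_divide_eq)
    finally show ?thesis .
  qed
  ultimately show ?case using eta e(2) z by (intro exI[of _ \<eta>]) auto
qed

lemma sqrt_one_minus_square:
  fixes s :: real
  assumes "0 \<le> s" "s \<le> 1"
  defines "c \<equiv> sqrt (1 - s\<^sup>2)"
  shows "0 \<le> c" "c \<le> 1" "c\<^sup>2 + s\<^sup>2 = 1" "1 - c \<le> s\<^sup>2" "\<bar>c - 1\<bar> \<le> \<bar>s\<bar>"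
proof -
  have s2: "s\<^sup>2 \<le> 1" "s\<^sup>2 \<le> s" using assms by (auto simp: power2_eq_square mult_le_one mult_left_le)
  show c0: "0 \<le> c" "c\<^sup>2 + s\<^sup>2 = 1" using s2 by (simp_all add: c_def)
  show c1: "c \<le> 1" using s2 by (simp add: c_def)
  have "s\<^sup>2 = (1 - c) * (1 + c)" using c0(2) by (simp add: power2_eq_square algebra_simps)
  moreover have "(1 - c) * 1 \<le> (1 - c) * (1 + c)" using c0 c1 by (intro mult_left_mono) auto
  ultimately show le: "1 - c \<le> s\<^sup>2" by simp
  then show "\<bar>c - 1\<bar> \<le> \<bar>s\<bar>" using s2 c1 assms by simp
qed

lemma data_law_prob:
  assumes M: "prob_space M" and W: "W \<in> measurable M path_space" and x: "x ` {1..p} \<subseteq> {0..1}" and \<sigma>: "\<sigma> > 0"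
  shows "prob_space (data_law \<mu> x \<sigma> n p (distr M path_space W))"
proof -
  interpret A: prob_space "PiM {1..n} (\<lambda>_. M)" by (intro prob_space_PiM M)
  interpret B: prob_space "PiM ({1..n} \<times> {1..p}) (\<lambda>_. density lborel (normal_density 0 \<sigma>))"
    by (intro prob_space_PiM prob_space_normal_density \<sigma>)
  interpret pair_prob_space "PiM {1..n} (\<lambda>_. M)" "PiM ({1..n} \<times> {1..p}) (\<lambda>_. density lborel (normal_density 0 \<sigma>))"
    by unfold_locales
  show ?thesis unfolding data_law_distr(1)[OF M W x \<sigma>]
    by (intro prob_space_distr data_law_distr(2)[OF M W x \<sigma>])
qed

text \<open>Conditionally on the errors the data are a function of the paths, so the comparison of
  path laws applies to every slice and integrates to a comparison of data laws.\<close>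

lemma data_law_transport:
  assumes M: "prob_space M" and W: "W \<in> measurable M path_space" and h: "h \<in> measurable M M"
    and x: "x ` {1..p} \<subseteq> {0..1}" and \<sigma>: "\<sigma> > 0"
    and bound: "\<And>B. B \<in> sets (PiM {1..n} (\<lambda>_. M)) \<Longrightarrow>
       emeasure (PiM {1..n} (\<lambda>_. M)) {\<omega> \<in> space (PiM {1..n} (\<lambda>_. M)). (\<lambda>i\<in>{1..n}. h (\<omega> i)) \<in> B}
         \<le> C * emeasure (PiM {1..n} (\<lambda>_. M)) B + d"
    and E: "E \<in> sets (data_space n p)"
  shows "emeasure (data_law \<mu> x \<sigma> n p (distr M path_space (\<lambda>w. W (h w)))) E
    \<le> C * emeasure (data_law \<mu> x \<sigma> n p (distr M path_space W)) E + d"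
proof -
  let ?A = "PiM {1..n} (\<lambda>_. M)"
  define N where "N = PiM ({1..n} \<times> {1..p}) (\<lambda>_. density lborel (normal_density 0 \<sigma>))"
  interpret A: prob_space ?A by (intro prob_space_PiM M)
  interpret N: prob_space N unfolding N_def by (intro prob_space_PiM prob_space_normal_density \<sigma>)
  interpret AN: pair_prob_space ?A N by unfold_locales
  have Wh: "(\<lambda>w. W (h w)) \<in> measurable M path_space" using measurable_compose[OF h W] .
  define F0 where "F0 = (\<lambda>(\<omega>, e). \<lambda>(i, j)\<in>{1..n} \<times> {1..p}. \<mu> (x j) + W (\<omega> i) (x j) + e (i, j))"
  define F1 where "F1 = (\<lambda>(\<omega>, e). \<lambda>(i, j)\<in>{1..n} \<times> {1..p}. \<mu> (x j) + W (h (\<omega> i)) (x j) + e (i, j))"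
  note d0 = data_law_distr[OF M W x \<sigma>, where \<mu>=\<mu> and n=n, folded F0_def N_def]
  note d1 = data_law_distr[OF M Wh x \<sigma>, where \<mu>=\<mu> and n=n, folded F1_def N_def]
  define G0 where "G0 = F0 -` E \<inter> space (?A \<Otimes>\<^sub>M N)"
  define G1 where "G1 = F1 -` E \<inter> space (?A \<Otimes>\<^sub>M N)"
  have G0: "G0 \<in> sets (?A \<Otimes>\<^sub>M N)" unfolding G0_def by (rule measurable_sets[OF d0(2) E])
  have G1: "G1 \<in> sets (?A \<Otimes>\<^sub>M N)" unfolding G1_def by (rule measurable_sets[OF d1(2) E])
  have hm: "(\<lambda>\<omega>. \<lambda>i\<in>{1..n}. h (\<omega> i)) \<in> measurable ?A ?A"
    using h by (intro measurable_restrict) (auto intro: measurable_compose[OF measurable_component_singleton])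
  have slice: "emeasure ?A ((\<lambda>\<omega>. (\<omega>, e)) -` G1) \<le> C * emeasure ?A ((\<lambda>\<omega>. (\<omega>, e)) -` G0) + d"
    if e: "e \<in> space N" for e
  proof -
    have B: "(\<lambda>\<omega>. (\<omega>, e)) -` G0 \<in> sets ?A" by (rule sets_Pair2[OF G0])
    have F: "F1 (\<omega>, e) = F0 ((\<lambda>i\<in>{1..n}. h (\<omega> i)), e)" for \<omega>
      by (auto simp: F0_def F1_def fun_eq_iff restrict_def)
    have "(\<lambda>\<omega>. (\<omega>, e)) -` G1 = {\<omega> \<in> space ?A. (\<lambda>i\<in>{1..n}. h (\<omega> i)) \<in> (\<lambda>\<omega>. (\<omega>, e)) -` G0}"
      using measurable_space[OF hm] e by (auto simp: G0_def G1_def space_pair_measure F simp del: restrict_apply)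
    then show ?thesis using bound[OF B] by simp
  qed
  have "emeasure (data_law \<mu> x \<sigma> n p (distr M path_space (\<lambda>w. W (h w)))) E = emeasure (?A \<Otimes>\<^sub>M N) G1"
    unfolding d1(1) G1_def using d1(2) E by (rule emeasure_distr)
  also have "\<dots> = (\<integral>\<^sup>+e. emeasure ?A ((\<lambda>\<omega>. (\<omega>, e)) -` G1) \<partial>N)"
    by (rule AN.emeasure_pair_measure_alt2[OF G1])
  also have "\<dots> \<le> (\<integral>\<^sup>+e. C * emeasure ?A ((\<lambda>\<omega>. (\<omega>, e)) -` G0) + d \<partial>N)"
    by (rule nn_integral_mono) (rule slice)
  also have "\<dots> = C * (\<integral>\<^sup>+e. emeasure ?A ((\<lambda>\<omega>. (\<omega>, e)) -` G0) \<partial>N) + d"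
  proof -
    define \<kappa> where "\<kappa> = (\<lambda>e. emeasure ?A ((\<lambda>\<omega>. (\<omega>, e)) -` G0))"
    have [measurable]: "\<kappa> \<in> borel_measurable N"
      unfolding \<kappa>_def by (rule AN.measurable_emeasure_Pair2[OF G0])
    have "(\<integral>\<^sup>+e. C * \<kappa> e + d \<partial>N) = C * (\<integral>\<^sup>+e. \<kappa> e \<partial>N) + d"
      by (subst nn_integral_add) (auto simp: nn_integral_cmult N.emeasure_space_1)
    then show ?thesis unfolding \<kappa>_def .
  qed
  also have "(\<integral>\<^sup>+e. emeasure ?A ((\<lambda>\<omega>. (\<omega>, e)) -` G0) \<partial>N) = emeasure (?A \<Otimes>\<^sub>M N) G0"
    by (rule AN.emeasure_pair_measure_alt2[OF G0, symmetric])
  also have "\<dots> = emeasure (data_law \<mu> x \<sigma> n p (distr M path_space W)) E"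
    unfolding d0(1) G0_def by (rule emeasure_distr[OF d0(2) E, symmetric])
  finally show ?thesis .
qed

lemma base_law_eigen:
  assumes \<gamma>: "\<gamma> > 0" and k: "k \<ge> 1" and \<delta>: "\<delta> > 0" and base: "base_law \<gamma> L k \<delta> P lam A B"
  shows "continuous_kernel (cov_kernel P)" "0 < lam k" "0 < \<gamma> - real (holder_order \<gamma>)" "\<gamma> - real (holder_order \<gamma>) \<le> 1"
proof -
  note bd = base_lawD[OF base]
  show "0 < \<gamma> - real (holder_order \<gamma>)" "\<gamma> - real (holder_order \<gamma>) \<le> 1" using holder_order_props[OF \<gamma>] by auto
  then show "continuous_kernel (cov_kernel P)" using holder_bounds_continuous[OF bd(2)] by blast
  show "0 < lam k" using spectral_gap_simple(2)[OF bd(4) k] bd(5) \<delta> by simp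
qed

lemma abs_diff_small:
  fixes u v :: real
  assumes "\<bar>u\<bar> \<le> \<bar>v\<bar> \<or> v = 0"
  shows "\<bar>\<bar>v + u\<bar> - \<bar>v\<bar>\<bar> = \<bar>u\<bar>"
  using assms by linarith

text \<open>Le Cam's two-point argument with a one-sided comparison of measures. If both events had
  probability below v, the complement of A1, which lies in A0, would have Q0-probability below v and
  thus Q1-probability at most C v + d, whereas the latter exceeds 1 - v.\<close>

lemma two_point_events:
  assumes Q0: "prob_space Q0" "sets Q0 = sets (data_space n p)" and Q1: "prob_space Q1" "sets Q1 = sets (data_space n p)"
    and A0: "A0 \<in> sets (data_space n p)" and A1: "A1 \<in> sets (data_space n p)"
    and cover: "space (data_space n p) \<subseteq> A0 \<union> A1" and v: "0 < v"
    and le: "emeasure Q1 (space (data_space n p) - A1) \<le> ennreal C * emeasure Q0 (space (data_space n p) - A1) + ennreal d"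
    and C: "0 \<le> C" "0 \<le> d" "C * v + d \<le> 1 - v"
  shows "ennreal v \<le> emeasure Q0 A0 \<or> ennreal v \<le> emeasure Q1 A1"
proof (rule ccontr)
  assume "\<not> ?thesis"
  then have lt: "emeasure Q0 A0 < ennreal v" "emeasure Q1 A1 < ennreal v" by auto
  interpret Q0: prob_space Q0 by fact
  interpret Q1: prob_space Q1 by fact
  let ?S = "space (data_space n p)"
  have sp: "space Q0 = ?S" "space Q1 = ?S" using Q0(2) Q1(2) by (auto dest: sets_eq_imp_space_eq)
  have m: "measure Q0 A0 < v" "measure Q1 A1 < v"
    using lt v by (simp_all add: Q0.emeasure_eq_measure Q1.emeasure_eq_measure ennreal_less_iff)
  have "measure Q1 (?S - A1) = 1 - measure Q1 A1"
    using Q1.prob_compl[of A1] A1 Q1(2) sp by simp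
  moreover have "measure Q0 (?S - A1) \<le> measure Q0 A0"
    using cover A0 A1 Q0(2) sets.sets_into_space[OF A0] by (intro Q0.finite_measure_mono) auto
  moreover have "measure Q1 (?S - A1) \<le> C * measure Q0 (?S - A1) + d"
    using le C by (simp add: Q0.emeasure_eq_measure Q1.emeasure_eq_measure ennreal_mult[symmetric] ennreal_plus[symmetric] ennreal_le_iff del: ennreal_plus)
  moreover have "C * measure Q0 (?S - A1) \<le> C * v"
    using calculation(2) m C by (intro mult_left_mono) auto
  ultimately show False using m C by linarith
qed

lemma miss_event_cover:
  assumes "2 * r \<le> \<bar>\<bar>\<psi> t\<bar> - \<bar>\<phi> t\<bar>\<bar>"
  shows "space (data_space n p) \<subseteq> miss_event n p \<Phi> {t} \<phi> r \<union> miss_event n p \<Phi> {t} \<psi> r"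
proof
  fix y assume y: "y \<in> space (data_space n p)"
  have "r \<le> \<bar>\<bar>\<Phi> y t\<bar> - \<bar>\<phi> t\<bar>\<bar> \<or> r \<le> \<bar>\<bar>\<Phi> y t\<bar> - \<bar>\<psi> t\<bar>\<bar>" using assms by linarith
  then show "y \<in> miss_event n p \<Phi> {t} \<phi> r \<union> miss_event n p \<Phi> {t} \<psi> r" using y by (auto simp: miss_event_def)
qed

lemma lower_bound_rateI:
  assumes "0 < b0" "0 < v"
    and "\<And>n p \<mu> x \<Phi>. N \<le> n \<Longrightarrow> N \<le> p \<Longrightarrow> design p x \<Longrightarrow> \<Phi> \<in> estimators n p \<Longrightarrow>
      \<exists>P\<in>gaussian_gap_class \<gamma> k L \<delta>. \<exists>\<psi> T.
        continuous_on {0..1} \<psi> \<and> (\<forall>t. \<bar>eigenfunction P k t\<bar> = \<bar>\<psi> t\<bar>) \<and> finite T \<and> T \<subseteq> {0..1} \<and>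
        ennreal v \<le> emeasure (data_law \<mu> x \<sigma> n p P) (miss_event n p \<Phi> T \<psi> (b0 * r n p))"
  shows "lower_bound_rate \<gamma> k L \<delta> \<sigma> r"
proof -
  define good where "good v b0 n p \<mu> x \<Phi> \<longleftrightarrow> (\<exists>P\<in>gaussian_gap_class \<gamma> k L \<delta>. \<exists>\<psi> T.
        continuous_on {0..1} \<psi> \<and> (\<forall>t. \<bar>eigenfunction P k t\<bar> = \<bar>\<psi> t\<bar>) \<and> finite T \<and> T \<subseteq> {0..1} \<and>
        ennreal v \<le> emeasure (data_law \<mu> x \<sigma> n p P) (miss_event n p \<Phi> T \<psi> (b0 * r n p)))" for v b0 n p \<mu> x \<Phi>
  show ?thesis using assms unfolding lower_bound_rate_def good_def[symmetric] by blast
qed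

lemma lower_bound_sqrt_n:
  assumes \<gamma>: "\<gamma> > 0" and k: "k \<ge> 1" and \<delta>: "\<delta> > 0" and \<sigma>: "\<sigma> > 0"
    and base: "base_law \<gamma> L k \<delta> P lam A B"
  shows "lower_bound_rate \<gamma> k L \<delta> \<sigma> (\<lambda>n p. real n powr (- 1 / 2))"
proof -
  let ?\<Gamma> = "cov_kernel P" and ?m = "holder_order \<gamma>" and ?\<alpha> = "\<gamma> - real (holder_order \<gamma>)"
  note bd = base_lawD[OF base] and be = base_law_eigen[OF \<gamma> k \<delta> base]
  interpret gauss_process P by unfold_locales (rule bd(1))
  obtain j where j: "1 \<le> j" "0 < lam j" "lam j \<noteq> lam k" using bd(6) by blast
  obtain f1 where f1: "f1 \<in> eigenspace ?\<Gamma> (lam k)" "continuous_on {0..1} f1" "l2_inner f1 f1 = 1"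
    by (rule eigenfunction_exists[OF be(1) bd(4) k be(2)], rule that)
  obtain f2 where f2: "f2 \<in> eigenspace ?\<Gamma> (lam j)" "continuous_on {0..1} f2" "l2_inner f2 f2 = 1"
    by (rule eigenfunction_exists[OF be(1) bd(4) j(1,2)], rule that)
  have f12: "l2_inner f1 f2 = 0"
    by (rule eigenfunctions_orthogonal[OF be(1) cov_kernel_sym f1(1) f2(1)]) (use j in auto)
  note D1 = eigenspaceD[OF f1(1)] and D2 = eigenspaceD[OF f2(1)]
  obtain K1 where K1: "holder_bound1 ?m ?\<alpha> K1 f1" by (rule eigenfunction_holder[OF bd(2) be(3) f1(1) be(2)])
  obtain K2 where K2: "holder_bound1 ?m ?\<alpha> K2 f2" by (rule eigenfunction_holder[OF bd(2) be(3) f2(1) j(2)])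
  define K where "K = max K1 K2"
  have hK: "holder_bound1 ?m ?\<alpha> K f1" "holder_bound1 ?m ?\<alpha> K f2"
    using holder_bound1_mono[OF K1, of K] holder_bound1_mono[OF K2, of K] by (auto simp: K_def)
  define K' where "K' = max (lam k * K) (lam j * K)"
  have tK: "holder_bound1 ?m ?\<alpha> K' (cov_operator ?\<Gamma> f1)" "holder_bound1 ?m ?\<alpha> K' (cov_operator ?\<Gamma> f2)"
  proof -
    have "holder_bound1 ?m ?\<alpha> (\<bar>lam k\<bar> * K) (cov_operator ?\<Gamma> f1)"
      by (rule holder_bound1_cong[OF holder_bound1_scale[OF hK(1)]]) (use D1 in auto)
    then show "holder_bound1 ?m ?\<alpha> K' (cov_operator ?\<Gamma> f1)" by (rule holder_bound1_mono) (use be(2) in \<open>simp add: K'_def\<close>)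
    have "holder_bound1 ?m ?\<alpha> (\<bar>lam j\<bar> * K) (cov_operator ?\<Gamma> f2)"
      by (rule holder_bound1_cong[OF holder_bound1_scale[OF hK(2)]]) (use D2 in auto)
    then show "holder_bound1 ?m ?\<alpha> K' (cov_operator ?\<Gamma> f2)" by (rule holder_bound1_mono) (use j(2) in \<open>simp add: K'_def\<close>)
  qed
  define g where "g = \<bar>l2_inner f1 (cov_operator ?\<Gamma> f1)\<bar> + \<bar>l2_inner f1 (cov_operator ?\<Gamma> f2)\<bar> + \<bar>l2_inner f2 (cov_operator ?\<Gamma> f2)\<bar>"
  have g: "\<bar>l2_inner f1 (cov_operator ?\<Gamma> f1)\<bar> \<le> g" "\<bar>l2_inner f1 (cov_operator ?\<Gamma> f2)\<bar> \<le> g" "\<bar>l2_inner f2 (cov_operator ?\<Gamma> f2)\<bar> \<le> g" "0 \<le> g"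
    by (auto simp: g_def)
  have K0: "0 \<le> K" "0 \<le> K'" using holder_bound1_nonneg[OF hK(1)] holder_bound1_nonneg[OF tK(1)] by auto
  define R0 where "R0 = 8 * (K * K') + 16 * g * (K * K)"
  have R0: "0 \<le> R0" using K0 g by (simp add: R0_def)
  \<comment> \<open>To first order the rotation adds s f2 to the eigenfunction f1, so the change is
    visible at a point where f2 is nonzero.\<close>
  obtain t0 where t0: "t0 \<in> {0..1}" "f2 t0 \<noteq> 0"
  proof -
    have "\<exists>t\<in>{0..1}. f2 t \<noteq> 0"
    proof (rule ccontr)
      assume "\<not> ?thesis"
      then have "f2 = (\<lambda>_. 0)" using D2(2) by (auto simp: fun_eq_iff)
      then show False using f2(3) by (simp add: l2_inner_def)
    qed
    then show ?thesis using that by blast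
  qed
  \<comment> \<open>In the plane of f1 and f2 the standard normal coordinates are stretched by the
    square roots of the eigenvalues, so the rotation acts on them conjugated by this ratio.\<close>
  define r0 where "r0 = sqrt (lam j / lam k)"
  have r0: "r0 > 0" using j be by (simp add: r0_def)
  \<comment> \<open>The conditions in turn: slack in the Hoelder norm; two bounds on the slopes of
    the shears; the first-order term s f2 dominates the second-order change of f1; no change of sign
    at t0. The value 1 keeps D positive when f1 vanishes at t0.\<close>
  let ?S = "{(3 * R0, L - (A + B)), (r0, 1 / 2), (1 / r0, 1 / 2), (\<bar>f1 t0\<bar>, \<bar>f2 t0\<bar> / 2),
     (\<bar>f2 t0\<bar> + \<bar>f1 t0\<bar>, if f1 t0 = 0 then 1 else \<bar>f1 t0\<bar>)}"
  have "\<exists>\<epsilon>>0. \<epsilon> \<le> 1 \<and> (\<forall>(C, D)\<in>?S. \<epsilon> * C \<le> D)"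
    by (rule small_exists) (use bd(3) t0 in \<open>auto split: if_splits\<close>)
  then obtain \<epsilon> where e0: "0 < \<epsilon>" "\<epsilon> \<le> 1" "\<forall>(C, D)\<in>?S. \<epsilon> * C \<le> D" by blast
  have e: "\<epsilon> * (3 * R0) \<le> L - (A + B)" "\<epsilon> * r0 \<le> 1 / 2" "\<epsilon> * (1 / r0) \<le> 1 / 2" "\<epsilon> * \<bar>f1 t0\<bar> \<le> \<bar>f2 t0\<bar> / 2"
    "\<epsilon> * (\<bar>f2 t0\<bar> + \<bar>f1 t0\<bar>) \<le> \<bar>f1 t0\<bar> \<or> f1 t0 = 0"
    using e0(3) by (auto split: if_splits)
  define b0 where "b0 = \<epsilon> * \<bar>f2 t0\<bar> / 4"
  \<comment> \<open>The comparison constant is 16 * 256 * 65536 = 2^28, so C v + d = 1/8 + 3/8 =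
    1/2, which is at most 1 - v.\<close>
  define v where "v = (1 :: real) / 2 ^ 31"
  show ?thesis
  proof (rule lower_bound_rateI[where N=1])
    show "0 < b0" "0 < v" using e0 t0 by (auto simp: b0_def v_def)
    fix n p :: nat and \<mu> x \<Phi>
    assume n: "1 \<le> n" and p: "1 \<le> p" and x: "design p x" and \<Phi>: "\<Phi> \<in> estimators n p"
    have xI: "x ` {1..p} \<subseteq> {0..1}" using x by (simp add: design_def)
    define r where "r = real n powr (- 1 / 2)"
    have r: "0 < r" "r \<le> 1" "real n * r\<^sup>2 = 1"
    proof -
      show "0 < r" using n by (simp add: r_def)
      have "r = 1 / sqrt (real n)" using n by (simp add: r_def powr_minus_divide powr_half_sqrt)
      then show "r \<le> 1" "real n * r\<^sup>2 = 1" using n by (auto simp: power_divide)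
    qed
    define s where "s = \<epsilon> * r"
    have s: "0 < s" "s \<le> \<epsilon>" using e0 r mult_left_le[of r \<epsilon>] by (auto simp: s_def)
    then have "s \<le> 1" using e0(2) by linarith
    note s = s this
    define c where "c = sqrt (1 - s\<^sup>2)"
    have c: "0 \<le> c" "c \<le> 1" "c\<^sup>2 + s\<^sup>2 = 1" "1 - c \<le> s\<^sup>2" "\<bar>c - 1\<bar> \<le> \<bar>s\<bar>"
      unfolding c_def using sqrt_one_minus_square[of s] s by auto
    have rot: "rotation ?\<Gamma> f1 f2 c' s'" if "c'\<^sup>2 + s'\<^sup>2 = 1" for c' s'
      by unfold_locales (use be(1) cov_kernel_sym f1 f2 f12 D1(2) D2(2) that in auto)
    define R where "R = s * R0"
    have R: "0 \<le> R" "A + B + 3 * R \<le> L"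
    proof -
      show "0 \<le> R" using s R0 by (simp add: R_def)
      have "s * (3 * R0) \<le> \<epsilon> * (3 * R0)" using s R0 by (intro mult_right_mono) auto
      then show "A + B + 3 * R \<le> L" using e(1) by (simp add: R_def)
    qed
    have hb: "holder_bounds ?m ?\<alpha> (A + R) (B + 2 * R) (rot_kernel ?\<Gamma> f1 f2 c' s')"
      if "\<bar>s'\<bar> \<le> s" "\<bar>c' - 1\<bar> \<le> \<bar>s'\<bar>" for c' s'
    proof (rule rot_kernel_holder[OF be(3,4) bd(2) hK tK g(1,2,3)])
      show "\<bar>s'\<bar> \<le> 1" "\<bar>c' - 1\<bar> \<le> \<bar>s'\<bar>" using that s by auto
      have "s'\<^sup>2 \<le> s * 1"
        using mult_mono[of "\<bar>s'\<bar>" s "\<bar>s'\<bar>" 1] that s by (simp add: power2_eq_square)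
      then have 2: "16 * s'\<^sup>2 * g * (K * K) \<le> 16 * s * g * (K * K)"
        using K0 g by (intro mult_right_mono) auto
      have "8 * \<bar>s'\<bar> * (K * K') \<le> 8 * s * (K * K')" using that K0 by (intro mult_right_mono) auto
      then show "8 * \<bar>s'\<bar> * (K * K') + 16 * s'\<^sup>2 * g * (K * K) \<le> R" using 2 by (simp add: R_def R0_def algebra_simps)
    qed
    define \<Omega> where "\<Omega> = P \<Otimes>\<^sub>M (std_normal \<Otimes>\<^sub>M std_normal)"
    obtain Rf where Rf: "\<And>t. t \<in> {0..1} \<Longrightarrow> Rf t \<in> borel_measurable P"
      "\<And>c s. c\<^sup>2 + s\<^sup>2 = 1 \<Longrightarrow> centered_gaussian_process
         (distr \<Omega> path_space (\<lambda>(z, a, b). \<lambda>t\<in>{0..1}. Rf t z + sqrt (lam k) * (c * f1 t + s * f2 t) * a + sqrt (lam j) * (c * f2 t - s * f1 t) * b))"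
      "\<And>c s x y. c\<^sup>2 + s\<^sup>2 = 1 \<Longrightarrow> x \<in> {0..1} \<Longrightarrow> y \<in> {0..1} \<Longrightarrow>
       cov_kernel (distr \<Omega> path_space (\<lambda>(z, a, b). \<lambda>t\<in>{0..1}. Rf t z + sqrt (lam k) * (c * f1 t + s * f2 t) * a + sqrt (lam j) * (c * f2 t - s * f1 t) * b)) x y
        = rot_kernel ?\<Gamma> f1 f2 c s x y"
      by (rule decomposed_process[OF be(1) f1(2) f2(2) D1(3) D2(3) f1(3) f12 f2(3) less_imp_le[OF be(2)] less_imp_le[OF j(2)]], assumption, assumption, rule that[unfolded \<Omega>_def])
    define W where "W c s = (\<lambda>(z, a, b). \<lambda>t\<in>{0..1}. Rf t z + sqrt (lam k) * (c * f1 t + s * f2 t) * a + sqrt (lam j) * (c * f2 t - s * f1 t) * b)" for c s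
    note Rf = Rf[folded W_def]
    interpret N: prob_space std_normal by (rule prob_space_std_normal)
    interpret NN: pair_prob_space std_normal std_normal by unfold_locales
    interpret PN: pair_prob_space P "std_normal \<Otimes>\<^sub>M std_normal" by unfold_locales
    have p\<Omega>: "prob_space \<Omega>" unfolding \<Omega>_def by (rule PN.prob_space_axioms)
    have Wm: "W c s \<in> measurable \<Omega> path_space" for c s
    proof -
      have "(\<lambda>w. \<lambda>t\<in>{0..1}. Rf t (fst w) + sqrt (lam k) * (c * f1 t + s * f2 t) * fst (snd w) + sqrt (lam j) * (c * f2 t - s * f1 t) * snd (snd w))
         \<in> measurable \<Omega> path_space"
      proof (rule path_measurable)
        fix t :: real assume "t \<in> {0..1}"
        note [measurable] = Rf(1)[OF this]
        show "(\<lambda>w. Rf t (fst w) + sqrt (lam k) * (c * f1 t + s * f2 t) * fst (snd w) + sqrt (lam j) * (c * f2 t - s * f1 t) * snd (snd w))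
          \<in> borel_measurable \<Omega>" unfolding \<Omega>_def by measurable
      qed
      then show ?thesis by (simp add: W_def split_beta')
    qed
    \<comment> \<open>The reference law is the rotation by the angle 0: it has the covariance of P
      and lives on the same space as the rotated law, so the two differ by a map of that
      space.\<close>
    define P0 where "P0 = distr \<Omega> path_space (W 1 0)"
    define P1 where "P1 = distr \<Omega> path_space (W c s)"
    have one: "(1::real)\<^sup>2 + 0\<^sup>2 = 1" by simp
    have P0: "P0 \<in> gaussian_gap_class \<gamma> k L \<delta>" "\<And>t. \<bar>eigenfunction P0 k t\<bar> = \<bar>rot_fun f1 f2 1 0 f1 t\<bar>"
      unfolding P0_def using s by (intro rotated_class[OF \<gamma> k \<delta> base rot[OF one] hb R Rf(2)[OF one] Rf(3)[OF one] f1(1,3)]; simp)+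
    have P1: "P1 \<in> gaussian_gap_class \<gamma> k L \<delta>" "\<And>t. \<bar>eigenfunction P1 k t\<bar> = \<bar>rot_fun f1 f2 c s f1 t\<bar>"
      unfolding P1_def using s c by (intro rotated_class[OF \<gamma> k \<delta> base rot[OF c(3)] hb R Rf(2)[OF c(3)] Rf(3)[OF c(3)] f1(1,3)]; simp)+
    have psi0: "rot_fun f1 f2 1 0 f1 = f1" by (auto simp: rot_fun_def fun_eq_iff)
    have psi1: "rot_fun f1 f2 c s f1 = (\<lambda>t. f1 t + ((c - 1) * f1 t + s * f2 t))"
      using f1(3) f12 by (auto simp: rot_fun_def fun_eq_iff l2_inner_commute[of f2 f1])
    define \<psi>1 where "\<psi>1 = (\<lambda>t. f1 t + ((c - 1) * f1 t + s * f2 t))"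
    have sep: "2 * (b0 * r) \<le> \<bar>\<bar>\<psi>1 t0\<bar> - \<bar>f1 t0\<bar>\<bar>"
    proof -
      let ?u = "(c - 1) * f1 t0 + s * f2 t0"
      have cf: "\<bar>(c - 1) * f1 t0\<bar> \<le> s * (s * \<bar>f1 t0\<bar>)"
        using c by (simp add: abs_mult power2_eq_square mult.assoc[symmetric] mult_right_mono)
      have sf: "s * \<bar>f1 t0\<bar> \<le> \<bar>f2 t0\<bar> / 2"
        using e(4) s mult_right_mono[of s \<epsilon> "\<bar>f1 t0\<bar>"] by simp
      have "\<bar>?u\<bar> \<le> \<bar>f1 t0\<bar> \<or> f1 t0 = 0"
      proof (cases "f1 t0 = 0")
        case False
        have "\<bar>?u\<bar> \<le> \<bar>(c - 1) * f1 t0\<bar> + \<bar>s * f2 t0\<bar>" by (rule abs_triangle_ineq)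
        also have "\<dots> \<le> s * (s * \<bar>f1 t0\<bar>) + s * \<bar>f2 t0\<bar>" using cf s by (simp add: abs_mult)
        also have "\<dots> \<le> s * (1 * \<bar>f1 t0\<bar>) + s * \<bar>f2 t0\<bar>"
          using s by (intro add_right_mono mult_left_mono mult_right_mono) auto
        also have "\<dots> = s * (\<bar>f2 t0\<bar> + \<bar>f1 t0\<bar>)" by (simp add: distrib_left)
        also have "\<dots> \<le> \<epsilon> * (\<bar>f2 t0\<bar> + \<bar>f1 t0\<bar>)" using s by (intro mult_right_mono) auto
        finally show ?thesis using e(5) by linarith
      qed simp
      then have "\<bar>\<bar>\<psi>1 t0\<bar> - \<bar>f1 t0\<bar>\<bar> = \<bar>?u\<bar>" unfolding \<psi>1_def by (rule abs_diff_small)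
      moreover have "s * \<bar>f2 t0\<bar> - s * (s * \<bar>f1 t0\<bar>) \<le> \<bar>?u\<bar>"
        using cf s abs_mult[of s "f2 t0"] by linarith
      moreover have "s * (s * \<bar>f1 t0\<bar>) \<le> s * (\<bar>f2 t0\<bar> / 2)" using sf s by (intro mult_left_mono) auto
      ultimately show ?thesis by (simp add: b0_def s_def)
    qed
    define A0 where "A0 = miss_event n p \<Phi> {t0} f1 (b0 * r)"
    define A1 where "A1 = miss_event n p \<Phi> {t0} \<psi>1 (b0 * r)"
    define Q0 where "Q0 = data_law \<mu> x \<sigma> n p P0"
    define Q1 where "Q1 = data_law \<mu> x \<sigma> n p P1"
    have As: "A0 \<in> sets (data_space n p)" "A1 \<in> sets (data_space n p)"
      unfolding A0_def A1_def using t0 by (auto intro!: miss_event_sets[OF \<Phi>])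
    have cover: "space (data_space n p) \<subseteq> A0 \<union> A1"
      unfolding A0_def A1_def by (rule miss_event_cover) (rule sep)
    have nsr: "real n * (s * r0)\<^sup>2 \<le> 1 / 4" "real n * (s / r0)\<^sup>2 \<le> 1 / 4"
    proof -
      have "real n * (s * r0)\<^sup>2 = (real n * r\<^sup>2) * (\<epsilon> * r0)\<^sup>2" by (simp add: s_def power_mult_distrib)
      also have "\<dots> \<le> (1 / 2)\<^sup>2" unfolding r(3) using e(2) e0 r0 by (simp add: power_mono)
      finally show "real n * (s * r0)\<^sup>2 \<le> 1 / 4" by (simp add: power2_eq_square)
      have "real n * (s / r0)\<^sup>2 = (real n * r\<^sup>2) * (\<epsilon> * (1 / r0))\<^sup>2" by (simp add: s_def power_mult_distrib power_divide)
      also have "\<dots> \<le> (1 / 2)\<^sup>2" unfolding r(3) using power_mono[OF e(3), of 2] e0 r0 by simp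
      finally show "real n * (s / r0)\<^sup>2 \<le> 1 / 4" by (simp add: power2_eq_square)
    qed
    define h where "h = (\<lambda>(z :: real \<Rightarrow> real, a, b). (z, c * a - s * r0 * b, s / r0 * a + c * b))"
    have hm: "h \<in> measurable \<Omega> \<Omega>" unfolding h_def \<Omega>_def by measurable
    \<comment> \<open>Rotating the functions f1 and f2 amounts to applying the map h to their random
      coordinates a and b.\<close>
    have Wh: "W c s w = W 1 0 (h w)" for w
    proof -
      have q: "sqrt (lam k) * r0 = sqrt (lam j)" "sqrt (lam j) / r0 = sqrt (lam k)"
        using be(2) j(2) by (simp_all add: r0_def real_sqrt_divide)
      obtain z a b where w: "w = (z, a, b)" by (metis surj_pair)
      have "sqrt (lam k) * (c * f1 t + s * f2 t) * a + sqrt (lam j) * (c * f2 t - s * f1 t) * b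
         = sqrt (lam k) * f1 t * (c * a - s * r0 * b) + sqrt (lam j) * f2 t * (s / r0 * a + c * b)" for t
      proof -
        have "sqrt (lam k) * f1 t * (c * a - s * r0 * b) + sqrt (lam j) * f2 t * (s / r0 * a + c * b)
          = sqrt (lam k) * f1 t * c * a - (sqrt (lam k) * r0) * f1 t * s * b + (sqrt (lam j) / r0) * f2 t * s * a + sqrt (lam j) * f2 t * c * b"
          by (simp add: algebra_simps)
        then show ?thesis unfolding q by (simp add: algebra_simps)
      qed
      then show ?thesis by (auto simp: w W_def h_def fun_eq_iff add.assoc)
    qed
    have Q: "prob_space Q0" "prob_space Q1" "sets Q0 = sets (data_space n p)" "sets Q1 = sets (data_space n p)"
      unfolding Q0_def Q1_def P0_def P1_def
      by (intro data_law_prob[OF p\<Omega> Wm xI \<sigma>] sets_data_law)+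
    have le: "emeasure Q1 E \<le> ennreal (16 * 256 * 65536) * emeasure Q0 E + ennreal (3 / 8)"
      if E: "E \<in> sets (data_space n p)" for E
    proof -
      have "P1 = distr \<Omega> path_space (\<lambda>w. W 1 0 (h w))" unfolding P1_def by (simp add: Wh[symmetric])
      moreover have "emeasure (data_law \<mu> x \<sigma> n p (distr \<Omega> path_space (\<lambda>w. W 1 0 (h w)))) E
         \<le> ennreal (16 * 256 * 65536) * emeasure (data_law \<mu> x \<sigma> n p (distr \<Omega> path_space (W 1 0))) E + ennreal (3 / 8)"
      proof (rule data_law_transport[OF p\<Omega> Wm hm xI \<sigma> _ E])
        fix B assume B: "B \<in> sets (PiM {1..n} (\<lambda>_. \<Omega>))"
        show "emeasure (PiM {1..n} (\<lambda>_. \<Omega>)) {\<omega> \<in> space (PiM {1..n} (\<lambda>_. \<Omega>)). (\<lambda>i\<in>{1..n}. h (\<omega> i)) \<in> B}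
         \<le> ennreal (16 * 256 * 65536) * emeasure (PiM {1..n} (\<lambda>_. \<Omega>)) B + ennreal (3 / 8)"
          unfolding h_def \<Omega>_def
          by (rule rotation_bound[OF prob_space_axioms r0 _ c(1,3) nsr B[unfolded \<Omega>_def]]) (use s in simp)
      qed
      ultimately show ?thesis unfolding Q0_def Q1_def P0_def by simp
    qed
    have "ennreal v \<le> emeasure Q0 A0 \<or> ennreal v \<le> emeasure Q1 A1"
    proof (rule two_point_events[OF Q(1,3,2,4) As cover _ le])
      show "space (data_space n p) - A1 \<in> sets (data_space n p)" using As by auto
    qed (auto simp: v_def)
    then show "\<exists>P\<in>gaussian_gap_class \<gamma> k L \<delta>. \<exists>\<psi> T.
        continuous_on {0..1} \<psi> \<and> (\<forall>t. \<bar>eigenfunction P k t\<bar> = \<bar>\<psi> t\<bar>) \<and> finite T \<and> T \<subseteq> {0..1} \<and>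
        ennreal v \<le> emeasure (data_law \<mu> x \<sigma> n p P) (miss_event n p \<Phi> T \<psi> (b0 * real n powr (- 1 / 2)))"
    proof
      assume "ennreal v \<le> emeasure Q0 A0"
      then show ?thesis
        using P0 f1(2) t0 by (intro bexI[OF _ P0(1)] exI[of _ f1] exI[of _ "{t0}"]) (auto simp: psi0 Q0_def A0_def r_def)
    next
      assume "ennreal v \<le> emeasure Q1 A1"
      moreover have "continuous_on {0..1} \<psi>1" unfolding \<psi>1_def using f1(2) f2(2) by (intro continuous_intros)
      ultimately show ?thesis
        using P1 t0 by (intro bexI[OF _ P1(1)] exI[of _ \<psi>1] exI[of _ "{t0}"]) (auto simp: psi1 Q1_def A1_def r_def \<psi>1_def)
    qed
  qed
qed

subsection \<open>Localised rotations\<close>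

text \<open>The rescaled bump stays inside the unit interval, so both integrals extend to the real
  line, where the substitution is affine.\<close>

lemma integral_rescaled:
  fixes g :: "real \<Rightarrow> real"
  assumes g: "continuous_on UNIV g" and zero: "\<And>x :: real. x \<notin> {0<..<1} \<Longrightarrow> g x = 0"
    and h: "0 < h" "0 \<le> y" "y + h \<le> 1"
  shows "(\<integral>x. g ((x - y) / h) \<partial>lebesgue_on {0..1::real}) = h * (\<integral>x. g x \<partial>lebesgue_on {0..1})"
proof -
  have gm: "g \<in> borel_measurable borel" using g by (rule borel_measurable_continuous_onI)
  have whole: "(\<integral>x. f x \<partial>lebesgue_on {0..1}) = (\<integral>x. f x \<partial>lborel)"
    if f: "f \<in> borel_measurable borel" "\<And>x. x \<notin> {0..1} \<Longrightarrow> f x = 0" for f :: "real \<Rightarrow> real"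
  proof -
    have "(\<integral>x. f x \<partial>lebesgue_on {0..1}) = (\<integral>x. indicator {0..1} x *\<^sub>R f x \<partial>lebesgue)"
      by (subst integral_restrict_space) auto
    also have "\<dots> = (\<integral>x. f x \<partial>lebesgue)"
      by (intro Bochner_Integration.integral_cong) (use f(2) in \<open>auto simp: indicator_def\<close>)
    also have "\<dots> = (\<integral>x. f x \<partial>lborel)" using f(1) by (intro integral_completion) simp
    finally show ?thesis .
  qed
  have "(\<integral>x. g ((x - y) / h) \<partial>lebesgue_on {0..1}) = (\<integral>x. g ((x - y) / h) \<partial>lborel)"
  proof (rule whole)
    show "(\<lambda>x. g ((x - y) / h)) \<in> borel_measurable borel"
      by (rule measurable_compose[OF _ gm]) measurable
    fix x :: real assume "x \<notin> {0..1}"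
    then have "(x - y) / h \<notin> {0<..<1}" using h by (auto simp: field_simps)
    then show "g ((x - y) / h) = 0" by (rule zero)
  qed
  also have "\<dots> = h * (\<integral>x. g x \<partial>lborel)"
    using lborel_integral_real_affine[of h "\<lambda>x. g ((x - y) / h)" y] h by simp
  also have "(\<integral>x. g x \<partial>lborel) = (\<integral>x. g x \<partial>lebesgue_on {0..1})"
    by (rule whole[symmetric]) (use gm zero in auto)
  finally show ?thesis .
qed

lemma continuous_integral_pos:
  fixes g :: "real \<Rightarrow> real"
  assumes g: "continuous_on {0..1} g" and nn: "\<And>x. x \<in> {0..1} \<Longrightarrow> 0 \<le> g x" and t: "t \<in> {0..1}" "0 < g t"
  shows "0 < (\<integral>x. g x \<partial>lebesgue_on {0..1})"
proof -
  have eq: "(\<integral>x. g x \<partial>lebesgue_on {0..1}) = integral {0..1} g"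
    by (rule lebesgue_integral_eq_integral)
       (use continuous_imp_integrable_real[OF g] in auto)
  have "integral {0..1} g \<noteq> 0"
    using integral_eq_0_iff[OF g] nn t by fastforce
  moreover have "0 \<le> integral {0..1} g"
    by (rule integral_nonneg) (use integrable_continuous_real[OF g] nn in auto)
  ultimately show ?thesis using eq by simp
qed

lemma l2_inner_abs_le:
  assumes e: "square_integrable e" and f: "square_integrable f" and b: "\<And>x. x \<in> {0..1} \<Longrightarrow> \<bar>f x\<bar> \<le> M"
  shows "\<bar>l2_inner e f\<bar> \<le> M * (\<integral>x. \<bar>e x\<bar> \<partial>lebesgue_on {0..1})"
proof -
  let ?M = "lebesgue_on {0..1::real}"
  have "\<bar>l2_inner e f\<bar> \<le> (\<integral>x. \<bar>e x * f x\<bar> \<partial>?M)" unfolding l2_inner_def by (rule integral_abs_bound)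
  also have "\<dots> \<le> (\<integral>x. M * \<bar>e x\<bar> \<partial>?M)"
  proof (rule integral_mono)
    show "integrable ?M (\<lambda>x. \<bar>e x * f x\<bar>)" using square_integrable_mult[OF e f] by (rule integrable_abs)
    show "integrable ?M (\<lambda>x. M * \<bar>e x\<bar>)" using square_integrable_integrable[OF e] by auto
    fix x assume "x \<in> space ?M"
    then have "\<bar>f x\<bar> \<le> M" using b by simp
    then have "\<bar>e x\<bar> * \<bar>f x\<bar> \<le> \<bar>e x\<bar> * M" by (intro mult_left_mono) auto
    then show "\<bar>e x * f x\<bar> \<le> M * \<bar>e x\<bar>" by (simp add: abs_mult mult.commute)
  qed
  finally show ?thesis by simp
qed

lemma holder_bound1_abs_le:
  assumes "holder_bound1 m \<alpha> K f" "x \<in> {0..1}"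
  shows "\<bar>f x\<bar> \<le> K"
proof -
  obtain d where d: "\<forall>x\<in>{0..1}. d 0 x = f x" "\<forall>i\<le>m. \<forall>x\<in>{0..1}. \<bar>d i x\<bar> \<le> K"
    using assms(1) unfolding holder_bound1_def by blast
  have "\<bar>d 0 x\<bar> \<le> K" using d(2) assms(2) by blast
  then show ?thesis using d(1) assms(2) by simp
qed

lemma base_law_class:
  assumes \<gamma>: "\<gamma> > 0" and k: "k \<ge> 1" and \<delta>: "\<delta> > 0" and base: "base_law \<gamma> L k \<delta> P lam A B"
    and \<phi>: "\<phi> \<in> eigenspace (cov_kernel P) (lam k)" "l2_inner \<phi> \<phi> = 1"
  shows "P \<in> gaussian_gap_class \<gamma> k L \<delta>" "\<bar>eigenfunction P k t\<bar> = \<bar>\<phi> t\<bar>"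
    "distr P path_space (\<lambda>z. \<lambda>t\<in>{0..1}. z t) = P"
proof -
  note bd = base_lawD[OF base] and be = base_law_eigen[OF \<gamma> k \<delta> base]
  have sets: "sets P = sets path_space" using bd(1) by (simp add: centered_gaussian_process_def)
  have "cov_kernel P \<in> holder_class \<gamma> L"
    by (rule holder_bounds_class[OF bd(2)]) (use bd(3) holder_bounds_nonneg[OF bd(2)] in auto)
  then show "P \<in> gaussian_gap_class \<gamma> k L \<delta>"
    using bd by (auto simp: gaussian_gap_class_def gaussian_class_def)
  have gap: "0 < spectral_gap lam k" using bd(5) \<delta> by simp
  obtain r where r: "r = 1 \<or> r = -1" "eigenfunction P k = (\<lambda>t. r * \<phi> t)"
    by (rule eigenfunction_abs_eq[OF be(1) bd(4) k gap \<phi>])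
  then show "\<bar>eigenfunction P k t\<bar> = \<bar>\<phi> t\<bar>" by (auto simp: abs_mult)
  have "distr P path_space (\<lambda>z. \<lambda>t\<in>{0..1}. z t) = distr P path_space (\<lambda>z. z)"
  proof (rule distr_cong)
    fix z assume "z \<in> space P"
    \<comment> \<open>Points of \<open>path_space\<close> are \<open>undefined\<close> off the unit
      interval, so restricting them changes nothing.\<close>
    then have "z \<in> extensional {0..1}"
      using sets_eq_imp_space_eq[OF sets] by (auto simp: path_space_def space_PiM PiE_def)
    then show "(\<lambda>t\<in>{0..1}. z t) = z" by (rule extensional_restrict)
  qed auto
  then show "distr P path_space (\<lambda>z. \<lambda>t\<in>{0..1}. z t) = P" using distr_id2[OF sets[symmetric]] by simp
qed

text \<open>A positive lower bound on an interval makes the inner products of the eigenfunction with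
  bumps there comparable to the integrals of the bumps. The sign may be chosen because
  eigenfunctions are compared through absolute values.\<close>

lemma positive_eigenfunction:
  assumes \<gamma>: "\<gamma> > 0" and k: "k \<ge> 1" and \<delta>: "\<delta> > 0" and base: "base_law \<gamma> L k \<delta> P lam A B"
  obtains \<phi> a b \<kappa> where "\<phi> \<in> eigenspace (cov_kernel P) (lam k)" "continuous_on {0..1} \<phi>" "l2_inner \<phi> \<phi> = 1"
    "0 \<le> a" "a < b" "b \<le> 1" "0 < \<kappa>" "\<And>t. t \<in> {a..b} \<Longrightarrow> \<kappa> \<le> \<phi> t"
proof -
  note bd = base_lawD[OF base] and be = base_law_eigen[OF \<gamma> k \<delta> base]
  obtain f where f: "f \<in> eigenspace (cov_kernel P) (lam k)" "continuous_on {0..1} f" "l2_inner f f = 1"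
    by (rule eigenfunction_exists[OF be(1) bd(4) k be(2)], rule that)
  \<comment> \<open>The point is taken in the interior in order to have two-sided continuity there;
    a function vanishing on the open interval would vanish on its closure.\<close>
  have "\<exists>t\<in>{0<..<1}. f t \<noteq> 0"
  proof (rule ccontr)
    assume "\<not> ?thesis"
    then have z: "f t = 0" if "t \<in> {0<..<1}" for t using that by blast
    have "closure {0<..<1::real} \<subseteq> {t. t \<in> {0..1} \<and> f t = 0}"
    proof (rule closure_minimal)
      show "closed {t. t \<in> {0..1} \<and> f t = 0}"
        using continuous_closed_preimage_constant[OF f(2), of 0] by simp
    qed (use z in auto)
    then have "f t = 0" for t using eigenspaceD(2)[OF f(1), of t] by (cases "t \<in> {0..1}") auto
    then show False using f(3) by (simp add: l2_inner_def)
  qed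
  then obtain t0 where t0: "t0 \<in> {0<..<1}" "f t0 \<noteq> 0" by blast
  define r where "r = sgn (f t0)"
  define \<phi> where "\<phi> = (\<lambda>x. r * f x)"
  have r: "r * r = 1" using t0 by (simp add: r_def sgn_if)
  have p0: "0 < \<phi> t0" using t0 by (simp add: \<phi>_def r_def sgn_if)
  have c: "continuous_on {0..1} \<phi>" unfolding \<phi>_def using f(2) by (intro continuous_intros)
  have "isCont \<phi> t0"
    using continuous_on_interior[OF c, of t0] t0 by simp
  then have "\<forall>\<^sub>F x in nhds t0. \<phi> t0 / 2 < \<phi> x"
    using p0 by (intro order_tendstoD) (auto simp: isCont_def tendsto_at_iff_tendsto_nhds)
  then obtain d where d: "d > 0" "\<And>x. dist x t0 < d \<Longrightarrow> \<phi> t0 / 2 < \<phi> x"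
    unfolding eventually_nhds_metric by blast
  define a where "a = max 0 (t0 - d / 2)"
  define b where "b = min 1 (t0 + d / 2)"
  show ?thesis
  proof (rule that[of \<phi> a b "\<phi> t0 / 2"])
    show "\<phi> \<in> eigenspace (cov_kernel P) (lam k)"
      using f(1) unfolding eigenspace_def \<phi>_def
      by (auto simp: square_integrable_scale cov_operator_def mult.left_commute[of _ r])
    show "continuous_on {0..1} \<phi>" by (rule c)
    have "l2_inner \<phi> \<phi> = (r * r) * l2_inner f f"
      unfolding l2_inner_def \<phi>_def
      by (subst Bochner_Integration.integral_mult_right_zero[symmetric]) (intro Bochner_Integration.integral_cong, auto)
    then show "l2_inner \<phi> \<phi> = 1" using r f(3) by simp
    show "0 \<le> a" "a < b" "b \<le> 1" using t0 d(1) by (auto simp: a_def b_def)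
    show "0 < \<phi> t0 / 2" using p0 by simp
    show "\<phi> t0 / 2 \<le> \<phi> t" if "t \<in> {a..b}" for t
      using d(2)[of t] d(1) that by (auto simp: a_def b_def dist_real_def abs_if less_imp_le)
  qed
qed

text \<open>\<open>S\<close> is the random shift of the paths, supported on two adjacent bumps of
  width \<open>h\<close>; \<open>\<tau>\<close> bounds its second moment. \<open>d\<close> is the
  change of the eigenfunction at y + h / 2, the centre of the left bump.\<close>

definition local_perturbation ::
  "real \<Rightarrow> nat \<Rightarrow> real \<Rightarrow> real \<Rightarrow> (real \<Rightarrow> real) measure \<Rightarrow> (real \<Rightarrow> real) \<Rightarrow> real \<Rightarrow> real \<Rightarrow> real \<Rightarrow> real
    \<Rightarrow> (real \<Rightarrow> (real \<Rightarrow> real) \<Rightarrow> real) \<Rightarrow> (real \<Rightarrow> real) \<Rightarrow> bool" where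
  "local_perturbation \<gamma> k L \<delta> P \<phi> y h \<tau> d S \<psi> \<longleftrightarrow>
     (\<forall>t. S t \<in> borel_measurable P \<and> integrable P (\<lambda>z. (S t z)\<^sup>2) \<and> (\<integral>z. (S t z)\<^sup>2 \<partial>P) \<le> \<tau>) \<and>
     (\<forall>t z. t \<notin> {y<..<y + 2 * h} \<longrightarrow> S t z = 0) \<and>
     distr P path_space (\<lambda>z. \<lambda>t\<in>{0..1}. z t + S t z) \<in> gaussian_gap_class \<gamma> k L \<delta> \<and>
     (\<forall>t. \<bar>eigenfunction (distr P path_space (\<lambda>z. \<lambda>t\<in>{0..1}. z t + S t z)) k t\<bar> = \<bar>\<psi> t\<bar>) \<and>
     continuous_on {0..1} \<psi> \<and> (\<forall>t. t \<notin> {y<..<y + 2 * h} \<longrightarrow> \<psi> t = \<phi> t) \<and>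
     d \<le> \<bar>\<bar>\<psi> (y + h / 2)\<bar> - \<bar>\<phi> (y + h / 2)\<bar>\<bar>"

lemma local_perturbationD:
  assumes "local_perturbation \<gamma> k L \<delta> P \<phi> y h \<tau> d S \<psi>"
  shows "S t \<in> borel_measurable P" "integrable P (\<lambda>z. (S t z)\<^sup>2)" "(\<integral>z. (S t z)\<^sup>2 \<partial>P) \<le> \<tau>"
    "t \<notin> {y<..<y + 2 * h} \<Longrightarrow> S t z = 0"
    "distr P path_space (\<lambda>z. \<lambda>t\<in>{0..1}. z t + S t z) \<in> gaussian_gap_class \<gamma> k L \<delta>"
    "\<bar>eigenfunction (distr P path_space (\<lambda>z. \<lambda>t\<in>{0..1}. z t + S t z)) k t\<bar> = \<bar>\<psi> t\<bar>"
    "continuous_on {0..1} \<psi>" "t \<notin> {y<..<y + 2 * h} \<Longrightarrow> \<psi> t = \<phi> t"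
    "d \<le> \<bar>\<bar>\<psi> (y + h / 2)\<bar> - \<bar>\<phi> (y + h / 2)\<bar>\<bar>"
  using assms unfolding local_perturbation_def by blast+

text \<open>The random coefficients of the bumps have second moments of order s^2 h for the angle s,
  since the quadratic form of T on bumps is bounded by products of their L1 norms. The squared
  height, of order 1/h, cancels the h: the shift has second moment of order s^2, uniformly in
  h.\<close>

lemma bump_perturbation:
  assumes \<gamma>: "\<gamma> > 0" and k: "k \<ge> 1" and \<delta>: "\<delta> > 0" and base: "base_law \<gamma> L k \<delta> P lam A B"
    and \<phi>: "\<phi> \<in> eigenspace (cov_kernel P) (lam k)" "continuous_on {0..1} \<phi>" "l2_inner \<phi> \<phi> = 1"
    and I: "0 \<le> a" "b \<le> 1" "0 < \<kappa>" "\<And>t. t \<in> {a..b} \<Longrightarrow> \<kappa> \<le> \<phi> t"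
  obtains \<epsilon>0 \<kappa>1 \<kappa>3 where "0 < \<epsilon>0" "\<epsilon>0 \<le> 1" "0 < \<kappa>1" "0 \<le> \<kappa>3"
    "\<And>\<epsilon> h y. 0 < \<epsilon> \<Longrightarrow> \<epsilon> \<le> \<epsilon>0 \<Longrightarrow> 0 < h \<Longrightarrow> a \<le> y \<Longrightarrow> y + 2 * h \<le> b \<Longrightarrow>
      \<exists>S \<psi>. local_perturbation \<gamma> k L \<delta> P \<phi> y h (\<kappa>3 * (\<epsilon> * h powr \<gamma>)\<^sup>2) (\<kappa>1 * (\<epsilon> * h powr \<gamma>)) S \<psi>"
proof -
  let ?\<Gamma> = "cov_kernel P" and ?m = "holder_order \<gamma>" and ?\<alpha> = "\<gamma> - real (holder_order \<gamma>)"
  let ?M = "lebesgue_on {0..1::real}"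
  note bd = base_lawD[OF base] and be = base_law_eigen[OF \<gamma> k \<delta> base]
  interpret gauss_process P by unfold_locales (rule bd(1))
  obtain \<beta> :: "real \<Rightarrow> real" and C where \<beta>: "C > 0" "continuous_on UNIV \<beta>"
    "\<And>x. 0 \<le> \<beta> x" "\<And>x. \<beta> x \<le> C" "\<And>x. x \<notin> {0<..<1} \<Longrightarrow> \<beta> x = 0" "\<beta> (1/2) > 0"
    and \<beta>h: "\<And>h y. 0 < h \<Longrightarrow> h \<le> 1 \<Longrightarrow>
       holder_bound1 ?m ?\<alpha> (C * h powr (- (real ?m + ?\<alpha>))) (\<lambda>x. \<beta> ((x - y) / h))"
    by (rule smooth_bump_exists[OF be(3,4), of ?m]) metis
  have \<beta>c: "continuous_on T \<beta>" for T using \<beta>(2) by (rule continuous_on_subset) auto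
  define I1 where "I1 = (\<integral>x. \<beta> x \<partial>?M)"
  define I2 where "I2 = (\<integral>x. (\<beta> x)\<^sup>2 \<partial>?M)"
  define \<nu> where "\<nu> = 1 / sqrt I2"
  have "0 < I2" unfolding I2_def
    by (rule continuous_integral_pos[where t="1/2"]) (use \<beta> in \<open>auto intro!: continuous_intros \<beta>c\<close>)
  then have \<nu>: "0 < \<nu>" "\<nu>\<^sup>2 * I2 = 1" by (auto simp: \<nu>_def power_divide)
  have I1: "0 < I1" unfolding I1_def
    by (rule continuous_integral_pos[where t="1/2"]) (use \<beta> \<beta>c in auto)
  have AB: "0 \<le> A" "0 \<le> B" using holder_bounds_nonneg[OF bd(2)] by auto
  obtain D where D: "0 < D" "\<And>t. t \<in> {0..1} \<Longrightarrow> \<bar>\<phi> t\<bar> \<le> D" by (rule continuous_unit_bounded[OF \<phi>(2)]) metis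
  \<comment> \<open>The bound of \<open>rot_kernel_holder\<close> after all powers of h have
    cancelled; its two terms occur with the factors \<epsilon> and \<epsilon>^2.\<close>
  define R0 where "R0 = 8 * (C * (A + B) * \<nu>\<^sup>2 * I1) + 16 * ((A + B) * \<nu>^4 * I1\<^sup>2 * C\<^sup>2)"
  have R0: "0 \<le> R0" using AB \<beta>(1) I1 by (simp add: R0_def)
  define \<kappa>1 where "\<kappa>1 = \<kappa> * \<nu>\<^sup>2 * I1 * \<beta> (1/2)"
  define \<kappa>3 where "\<kappa>3 = 4 * C\<^sup>2 * \<nu>^4 * (A + B) * I1\<^sup>2"
  \<comment> \<open>The second condition keeps the perturbed eigenfunction nonnegative at the centre
    of the left bump, where the original one is at least \<kappa>.\<close>
  have "\<exists>\<epsilon>>0. \<epsilon> \<le> 1 \<and> (\<forall>(C, D)\<in>{(3 * R0, L - (A + B)), (2 * D * I1 * \<nu>\<^sup>2 * C, \<kappa>)}. \<epsilon> * C \<le> D)"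
    by (rule small_exists) (use bd(3) I in auto)
  then obtain \<epsilon>0 where e0: "0 < \<epsilon>0" "\<epsilon>0 \<le> 1" "\<epsilon>0 * (3 * R0) \<le> L - (A + B)" "\<epsilon>0 * (2 * D * I1 * \<nu>\<^sup>2 * C) \<le> \<kappa>"
    by auto
  show ?thesis
  proof (rule that[of \<epsilon>0 \<kappa>1 \<kappa>3])
    show "0 < \<epsilon>0" "\<epsilon>0 \<le> 1" by fact+
    show "0 < \<kappa>1" using I \<nu> I1 \<beta>(6) by (simp add: \<kappa>1_def)
    show "0 \<le> \<kappa>3" using AB by (simp add: \<kappa>3_def)
    fix \<epsilon> h y assume e: "0 < \<epsilon>" "\<epsilon> \<le> \<epsilon>0" and h0: "0 < h" and y: "a \<le> y" "y + 2 * h \<le> b"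
    have h1: "h \<le> 1" and yI: "0 \<le> y" "y + 2 * h \<le> 1" using y I h0 by auto
    \<comment> \<open>Normalises a bump of width h in L2. Its product with the L1 norm
      \<open>w\<close> introduced below is free of h.\<close>
    define q where "q = \<nu> / sqrt h"
    have q: "0 < q" "q\<^sup>2 * (h * I2) = 1" "q * h = \<nu> * sqrt h"
    proof -
      show "0 < q" using \<nu>(1) h0 by (simp add: q_def)
      have "q\<^sup>2 * h = \<nu>\<^sup>2" using h0 by (simp add: q_def power_divide)
      then show "q\<^sup>2 * (h * I2) = 1" using \<nu>(2) by (simp add: mult.assoc[symmetric])
      have "q * h = \<nu> * (h / sqrt h)" by (simp add: q_def)
      then show "q * h = \<nu> * sqrt h" using real_div_sqrt[of h] h0 by simp
    qed
    define E where "E u x = q * \<beta> ((x - u) / h)" for u x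
    have E0: "E u x = 0" if "x \<notin> {u<..<u + h}" for u x
    proof -
      have "(x - u) / h \<notin> {0<..<1}" using that h0 by (auto simp: field_simps)
      then show ?thesis using \<beta>(5) by (simp add: E_def)
    qed
    have Enn: "0 \<le> E u x" "E u x \<le> q * C" for u x
      using q(1) \<beta>(3,4) by (auto simp: E_def intro!: mult_left_mono)
    have Ec: "continuous_on T (E u)" for T u
      unfolding E_def using h0 by (intro continuous_intros continuous_on_compose2[OF \<beta>(2)]) auto
    have Esi: "square_integrable (E u)" for u by (rule continuous_square_integrable[OF Ec])
    have EI: "(\<integral>x. E u x \<partial>?M) = \<nu> * sqrt h * I1" "l2_inner (E u) (E u) = 1" if u: "0 \<le> u" "u + h \<le> 1" for u
    proof -
      have "(\<integral>x. E u x \<partial>?M) = q * (h * I1)"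
        using integral_rescaled[OF \<beta>(2,5) h0 u] by (simp add: E_def I1_def)
      then show "(\<integral>x. E u x \<partial>?M) = \<nu> * sqrt h * I1" using q(3) by (simp add: mult.assoc[symmetric])
      have "(\<integral>x. (\<beta> ((x - u) / h))\<^sup>2 \<partial>?M) = h * I2"
        unfolding I2_def using integral_rescaled[where g="\<lambda>x. (\<beta> x)\<^sup>2", OF _ _ h0 u] \<beta>(5)
        by (auto intro!: continuous_intros \<beta>c)
      moreover have "l2_inner (E u) (E u) = q\<^sup>2 * (\<integral>x. (\<beta> ((x - u) / h))\<^sup>2 \<partial>?M)"
        unfolding l2_inner_def E_def
        by (subst Bochner_Integration.integral_mult_right_zero[symmetric])
           (intro Bochner_Integration.integral_cong, auto simp: power2_eq_square)
      ultimately show "l2_inner (E u) (E u) = 1" using q(2) by simp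
    qed
    define e1 where "e1 = E y"
    define e2 where "e2 = E (y + h)"
    have u: "0 \<le> y" "y + h \<le> 1" "0 \<le> y + h" "y + h + h \<le> 1" using yI h0 by auto
    have disj: "e1 x = 0 \<or> e2 x = 0" for x
      using E0[of x y] E0[of x "y + h"] unfolding e1_def e2_def by fastforce
    have out: "e1 x = 0" "e2 x = 0" if "x \<notin> {y<..<y + 2 * h}" for x
      unfolding e1_def e2_def by (intro E0; use that h0 in auto)+
    have n12: "l2_inner e1 e2 = 0"
    proof -
      have *: "(\<lambda>x. e1 x * e2 x) = (\<lambda>_. 0)" using disj by fastforce
      show ?thesis unfolding l2_inner_def * by simp
    qed
    have n11: "l2_inner e1 e1 = 1" "l2_inner e2 e2 = 1"
      unfolding e1_def e2_def using EI(2)[OF u(1,2)] EI(2)[OF u(3,4)] by auto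
    define w where "w = \<nu> * sqrt h * I1"
    have w: "0 < w" "q * w = \<nu>\<^sup>2 * I1"
      using \<nu>(1) h0 I1 by (simp_all add: w_def q_def power2_eq_square)
    have int: "(\<integral>x. \<bar>e1 x\<bar> \<partial>?M) = w" "(\<integral>x. \<bar>e2 x\<bar> \<partial>?M) = w"
      using EI(1)[OF u(1,2)] EI(1)[OF u(3,4)] Enn by (simp_all add: e1_def e2_def w_def)
    have si: "square_integrable e1" "square_integrable e2" unfolding e1_def e2_def by (rule Esi)+
    have ii: "integrable ?M e1" "integrable ?M e2" using si square_integrable_integrable by auto
    define K where "K = q * (C * h powr (- \<gamma>))"
    have hK: "holder_bound1 ?m ?\<alpha> K e1" "holder_bound1 ?m ?\<alpha> K e2"
      unfolding e1_def e2_def E_def K_def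
      using holder_bound1_scale[OF \<beta>h[OF h0 h1, of y], of q] holder_bound1_scale[OF \<beta>h[OF h0 h1, of "y + h"], of q] q(1)
      by simp_all
    have tK: "holder_bound1 ?m ?\<alpha> ((A + B) * w) (cov_operator ?\<Gamma> e1)" "holder_bound1 ?m ?\<alpha> ((A + B) * w) (cov_operator ?\<Gamma> e2)"
      using holder_bound1_kernel[OF bd(2) be(3) ii(1)] holder_bound1_kernel[OF bd(2) be(3) ii(2)]
      by (simp_all add: int cov_operator_def[abs_def])
    have tb: "\<bar>cov_operator ?\<Gamma> e1 x\<bar> \<le> (A + B) * w" "\<bar>cov_operator ?\<Gamma> e2 x\<bar> \<le> (A + B) * w" if "x \<in> {0..1}" for x
      using holder_bound1_abs_le[OF tK(1) that] holder_bound1_abs_le[OF tK(2) that] by auto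
    have tsi: "square_integrable (cov_operator ?\<Gamma> e1)" "square_integrable (cov_operator ?\<Gamma> e2)"
      by (intro continuous_square_integrable cov_operator_continuous be(1) si)+
    define g where "g = (A + B) * w * w"
    have g: "\<bar>l2_inner e1 (cov_operator ?\<Gamma> e1)\<bar> \<le> g" "\<bar>l2_inner e1 (cov_operator ?\<Gamma> e2)\<bar> \<le> g" "\<bar>l2_inner e2 (cov_operator ?\<Gamma> e2)\<bar> \<le> g"
      using l2_inner_abs_le[OF si(1) tsi(1) tb(1)] l2_inner_abs_le[OF si(1) tsi(2) tb(2)] l2_inner_abs_le[OF si(2) tsi(2) tb(2)]
      by (simp_all add: int g_def)
    have g0: "0 \<le> g" using AB w by (simp add: g_def)
    define s where "s = \<epsilon> * h powr \<gamma>"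
    have hp: "0 < h powr \<gamma>" "h powr \<gamma> \<le> 1" "h powr (- \<gamma>) = 1 / h powr \<gamma>"
      using h0 h1 \<gamma> by (auto simp: powr_le1 powr_minus_divide)
    have s: "0 < s" "s \<le> \<epsilon>" "s \<le> 1"
    proof -
      show "0 < s" "s \<le> \<epsilon>" using e(1) hp mult_left_le[of "h powr \<gamma>" \<epsilon>] by (auto simp: s_def)
      then show "s \<le> 1" using e e0 by linarith
    qed
    define c where "c = sqrt (1 - s\<^sup>2)"
    have c: "0 \<le> c" "c \<le> 1" "c\<^sup>2 + s\<^sup>2 = 1" "1 - c \<le> s\<^sup>2" "\<bar>c - 1\<bar> \<le> \<bar>s\<bar>"
      unfolding c_def using sqrt_one_minus_square[of s] s by auto
    have rot: "rotation ?\<Gamma> e1 e2 c s"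
    proof unfold_locales
      show "continuous_on {0..1} e1" "continuous_on {0..1} e2" unfolding e1_def e2_def by (rule Ec)+
      show "e1 x = 0" "e2 x = 0" if "x \<notin> {0..1}" for x using out[of x] that yI by auto
    qed (use be(1) cov_kernel_sym n11 n12 c(3) in auto)
    interpret rot: rotation ?\<Gamma> e1 e2 c s by (rule rot)
    define R where "R = \<epsilon> * R0"
    have R: "0 \<le> R" "A + B + 3 * R \<le> L"
    proof -
      show "0 \<le> R" using e R0 by (simp add: R_def)
      have "\<epsilon> * (3 * R0) \<le> \<epsilon>0 * (3 * R0)" using e R0 by (intro mult_right_mono) auto
      then show "A + B + 3 * R \<le> L" using e0(3) by (simp add: R_def)
    qed
    have sK: "s * K = \<epsilon> * C * q" using hp by (simp add: s_def K_def field_simps)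
    have hb: "holder_bounds ?m ?\<alpha> (A + R) (B + 2 * R) (rot_kernel ?\<Gamma> e1 e2 c s)"
    proof (rule rot_kernel_holder[OF be(3,4) bd(2) hK tK g])
      show "\<bar>s\<bar> \<le> 1" "\<bar>c - 1\<bar> \<le> \<bar>s\<bar>" using s c by auto
      have 1: "8 * \<bar>s\<bar> * (K * ((A + B) * w)) = \<epsilon> * (8 * (C * (A + B) * \<nu>\<^sup>2 * I1))"
      proof -
        have "8 * \<bar>s\<bar> * (K * ((A + B) * w)) = 8 * (A + B) * (s * K) * w" using s by simp
        also have "\<dots> = 8 * (A + B) * \<epsilon> * C * (q * w)" unfolding sK by simp
        finally show ?thesis unfolding w(2) by simp
      qed
      have "16 * s\<^sup>2 * g * (K * K) = 16 * (A + B) * (s * K)\<^sup>2 * w\<^sup>2" by (simp add: g_def power2_eq_square)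
      also have "\<dots> = \<epsilon>\<^sup>2 * (16 * ((A + B) * C\<^sup>2 * (q * w)\<^sup>2))" unfolding sK by (simp add: power_mult_distrib)
      also have "\<dots> = \<epsilon>\<^sup>2 * (16 * ((A + B) * \<nu>^4 * I1\<^sup>2 * C\<^sup>2))" unfolding w(2) by (simp add: power_mult_distrib)
      also have "\<dots> \<le> \<epsilon> * (16 * ((A + B) * \<nu>^4 * I1\<^sup>2 * C\<^sup>2))"
      proof (rule mult_right_mono)
        have "\<epsilon> \<le> 1" using e e0 by linarith
        then show "\<epsilon>\<^sup>2 \<le> \<epsilon>" using e by (simp add: power2_eq_square mult_left_le)
      qed (use AB in simp)
      finally show "8 * \<bar>s\<bar> * (K * ((A + B) * w)) + 16 * s\<^sup>2 * g * (K * K) \<le> R"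
        unfolding 1 by (simp add: R_def R0_def distrib_left)
    qed
    obtain \<zeta>1 \<zeta>2 where \<zeta>: "sq_rv P \<zeta>1" "sq_rv P \<zeta>2"
      "(\<integral>z. (\<zeta>1 z)\<^sup>2 \<partial>P) = (c - 1)\<^sup>2 * l2_inner e1 (cov_operator ?\<Gamma> e1)
         - 2 * s * (c - 1) * l2_inner e1 (cov_operator ?\<Gamma> e2) + s\<^sup>2 * l2_inner e2 (cov_operator ?\<Gamma> e2)"
      "(\<integral>z. (\<zeta>2 z)\<^sup>2 \<partial>P) = s\<^sup>2 * l2_inner e1 (cov_operator ?\<Gamma> e1)
         + 2 * s * (c - 1) * l2_inner e1 (cov_operator ?\<Gamma> e2) + (c - 1)\<^sup>2 * l2_inner e2 (cov_operator ?\<Gamma> e2)"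
      "centered_gaussian_process (distr P path_space (\<lambda>z. \<lambda>t\<in>{0..1}. z t + e1 t * \<zeta>1 z + e2 t * \<zeta>2 z))"
      "\<And>x y. x \<in> {0..1} \<Longrightarrow> y \<in> {0..1} \<Longrightarrow>
        cov_kernel (distr P path_space (\<lambda>z. \<lambda>t\<in>{0..1}. z t + e1 t * \<zeta>1 z + e2 t * \<zeta>2 z)) x y
          = rot_kernel ?\<Gamma> e1 e2 c s x y"
      by (rule rotated_process[OF be(1) rot.e1 rot.e2, of c s], rule that)
    have quad: "p * u1 + r * u2 + s\<^sup>2 * u3 \<le> 4 * s\<^sup>2 * g" "s\<^sup>2 * u1 + r * u2 + p * u3 \<le> 4 * s\<^sup>2 * g"
      if "\<bar>u1\<bar> \<le> g" "\<bar>u2\<bar> \<le> g" "\<bar>u3\<bar> \<le> g" "0 \<le> p" "p \<le> s\<^sup>2" "\<bar>r\<bar> \<le> 2 * s\<^sup>2" for u1 u2 u3 p r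
    proof -
      have 1: "p' * u \<le> s\<^sup>2 * g" if "0 \<le> p'" "p' \<le> s\<^sup>2" "\<bar>u\<bar> \<le> g" for p' u
      proof -
        have "p' * u \<le> p' * g" using that by (intro mult_left_mono) auto
        also have "\<dots> \<le> s\<^sup>2 * g" using that g0 by (intro mult_right_mono) auto
        finally show ?thesis .
      qed
      note 1 = 1[OF that(4,5,1)] 1[OF that(4,5,3)] 1[OF zero_le_power2 order_refl that(1)] 1[OF zero_le_power2 order_refl that(3)]
      have "\<bar>r * u2\<bar> \<le> 2 * s\<^sup>2 * g" unfolding abs_mult using that by (intro mult_mono) auto
      then show "p * u1 + r * u2 + s\<^sup>2 * u3 \<le> 4 * s\<^sup>2 * g" "s\<^sup>2 * u1 + r * u2 + p * u3 \<le> 4 * s\<^sup>2 * g"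
        using 1 by linarith+
    qed
    have cs: "(c - 1)\<^sup>2 \<le> s\<^sup>2" "\<bar>2 * s * (c - 1)\<bar> \<le> 2 * s\<^sup>2" "\<bar>- (2 * s * (c - 1))\<bar> \<le> 2 * s\<^sup>2"
    proof -
      show "(c - 1)\<^sup>2 \<le> s\<^sup>2" using c(5) by (rule abs_le_square_iff[THEN iffD1])
      have "\<bar>2 * s * (c - 1)\<bar> = 2 * s * \<bar>c - 1\<bar>" using s by (simp add: abs_mult)
      also have "\<dots> \<le> 2 * s * s" using c(5) s by (intro mult_left_mono) auto
      finally show "\<bar>2 * s * (c - 1)\<bar> \<le> 2 * s\<^sup>2" by (simp add: power2_eq_square)
      then show "\<bar>- (2 * s * (c - 1))\<bar> \<le> 2 * s\<^sup>2" by simp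
    qed
    have \<zeta>le: "(\<integral>z. (\<zeta>1 z)\<^sup>2 \<partial>P) \<le> 4 * s\<^sup>2 * g" "(\<integral>z. (\<zeta>2 z)\<^sup>2 \<partial>P) \<le> 4 * s\<^sup>2 * g"
      unfolding \<zeta>(3,4) using quad(1)[OF g _ cs(1,3)] quad(2)[OF g _ cs(1,2)] by simp_all
    define S where "S t z = e1 t * \<zeta>1 z + e2 t * \<zeta>2 z" for t z
    define P' where "P' = distr P path_space (\<lambda>z. \<lambda>t\<in>{0..1}. z t + S t z)"
    have P'eq: "distr P path_space (\<lambda>z. \<lambda>t\<in>{0..1}. z t + e1 t * \<zeta>1 z + e2 t * \<zeta>2 z) = P'"
      unfolding P'_def S_def by (simp only: add.assoc)
    note \<zeta>P = \<zeta>(5,6)[unfolded P'eq]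
    define \<psi> where "\<psi> = rot_fun e1 e2 c s \<phi>"
    have cls: "P' \<in> gaussian_gap_class \<gamma> k L \<delta>" "\<And>t. \<bar>eigenfunction P' k t\<bar> = \<bar>\<psi> t\<bar>"
      unfolding \<psi>_def by (rule rotated_class[OF \<gamma> k \<delta> base rot hb R \<zeta>P \<phi>(1,3)], assumption, assumption)+
    have sq: "(\<integral>z. (S t z)\<^sup>2 \<partial>P) \<le> \<kappa>3 * s\<^sup>2" for t
    proof -
      have key: "v\<^sup>2 * J \<le> \<kappa>3 * s\<^sup>2" if v: "0 \<le> v" "v \<le> q * C" and J: "J \<le> 4 * s\<^sup>2 * g" for v J
      proof -
        have "v\<^sup>2 * J \<le> v\<^sup>2 * (4 * s\<^sup>2 * g)" using J by (intro mult_left_mono) auto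
        also have "\<dots> \<le> (q * C)\<^sup>2 * (4 * s\<^sup>2 * g)"
          using v g0 by (intro mult_right_mono power_mono) auto
        also have "\<dots> = 4 * C\<^sup>2 * (q * w)\<^sup>2 * (A + B) * s\<^sup>2" by (simp add: g_def power_mult_distrib power2_eq_square)
        also have "\<dots> = \<kappa>3 * s\<^sup>2" unfolding w(2) by (simp add: \<kappa>3_def power_mult_distrib)
        finally show ?thesis .
      qed
      consider "e1 t = 0" | "e2 t = 0" using disj[of t] by blast
      then show ?thesis
      proof cases
        case 1
        have "(\<integral>z. (S t z)\<^sup>2 \<partial>P) = (e2 t)\<^sup>2 * (\<integral>z. (\<zeta>2 z)\<^sup>2 \<partial>P)" by (simp add: S_def 1 power_mult_distrib)
        then show ?thesis using key[OF _ _ \<zeta>le(2), of "e2 t"] Enn by (simp add: e2_def)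
      next
        case 2
        have "(\<integral>z. (S t z)\<^sup>2 \<partial>P) = (e1 t)\<^sup>2 * (\<integral>z. (\<zeta>1 z)\<^sup>2 \<partial>P)" by (simp add: S_def 2 power_mult_distrib)
        then show ?thesis using key[OF _ _ \<zeta>le(1), of "e1 t"] Enn by (simp add: e1_def)
      qed
    qed
    have Srv: "sq_rv P (S t)" for t unfolding S_def by (rule sq_rv_comb(1)[OF \<zeta>(1,2)])
    define p1 where "p1 = l2_inner e1 \<phi>"
    define p2 where "p2 = l2_inner e2 \<phi>"
    have \<phi>si: "square_integrable \<phi>" by (rule eigenspaceD(1)[OF \<phi>(1)])
    have p: "0 \<le> p1" "p1 \<le> D * w" "p2 \<le> D * w" "\<kappa> * w \<le> p2"
    proof -
      show "p1 \<le> D * w" "p2 \<le> D * w"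
        using l2_inner_abs_le[OF si(1) \<phi>si D(2)] l2_inner_abs_le[OF si(2) \<phi>si D(2)] by (simp_all add: int p1_def p2_def)
      have ge: "\<kappa> * e x \<le> e x * \<phi> x" if "x \<in> space ?M" "e = e1 \<or> e = e2" for e x
      proof (cases "x \<in> {y<..<y + 2 * h}")
        case True
        then have "\<kappa> \<le> \<phi> x" using I(4)[of x] y by auto
        moreover have "0 \<le> e x" using that(2) Enn by (auto simp: e1_def e2_def)
        ultimately show ?thesis using mult_right_mono[of \<kappa> "\<phi> x" "e x"] by (simp add: mult.commute)
      next
        case False
        then show ?thesis using out[OF False] that(2) by auto
      qed
      have lo: "\<kappa> * (\<integral>x. e x \<partial>?M) \<le> l2_inner e \<phi>" if "e = e1 \<or> e = e2" for e
      proof -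
        have "(\<integral>x. \<kappa> * e x \<partial>?M) \<le> (\<integral>x. e x * \<phi> x \<partial>?M)"
          by (rule integral_mono)
             (use that ii ge square_integrable_mult[OF si(1) \<phi>si] square_integrable_mult[OF si(2) \<phi>si] in auto)
        then show ?thesis by (simp add: l2_inner_def)
      qed
      have "\<bar>e1 x\<bar> = e1 x" "\<bar>e2 x\<bar> = e2 x" for x using Enn by (simp_all add: e1_def e2_def)
      then have *: "\<kappa> * w \<le> p1" "\<kappa> * w \<le> p2"
        using int lo[of e1] lo[of e2] by (simp_all add: p1_def p2_def)
      then show "\<kappa> * w \<le> p2" "0 \<le> p1" using mult_pos_pos[OF I(3) w(1)] by auto
    qed
    have \<psi>t: "\<psi> t = \<phi> t + ((c - 1) * p1 - s * p2) * e1 t + (s * p1 + (c - 1) * p2) * e2 t" for t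
      by (simp add: \<psi>_def rot_fun_def p1_def p2_def)
    \<comment> \<open>At the centre of the left bump e2 vanishes, and since p1 and p2 are
      nonnegative both (c - 1) p1 and -s p2 lower the eigenfunction: the two contributions add up
      instead of cancelling.\<close>
    have sep: "\<kappa>1 * s \<le> \<bar>\<bar>\<psi> (y + h / 2)\<bar> - \<bar>\<phi> (y + h / 2)\<bar>\<bar>"
    proof -
      let ?t = "y + h / 2"
      define d where "d = (1 - c) * p1 + s * p2"
      have t: "e1 ?t = q * \<beta> (1/2)" "e2 ?t = 0"
        using E0[of ?t "y + h"] h0 by (simp_all add: e1_def e2_def E_def)
      have \<phi>t: "\<kappa> \<le> \<phi> ?t" using I(4)[of ?t] y h0 by auto
      have d1: "s * (\<kappa> * w) \<le> d"
      proof -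
        have "s * (\<kappa> * w) \<le> s * p2" using p(4) s by (intro mult_left_mono) auto
        moreover have "0 \<le> (1 - c) * p1" using c p by simp
        ultimately show ?thesis by (simp add: d_def)
      qed
      have d2: "d \<le> 2 * s * (D * w)"
      proof -
        have "(1 - c) * p1 \<le> s * (D * w)" using c s p by (intro mult_mono) auto
        moreover have "s * p2 \<le> s * (D * w)" using s p by (intro mult_left_mono) auto
        ultimately show ?thesis by (simp add: d_def)
      qed
      have d0: "0 \<le> d" using d1 s I w by (smt (verit) mult_nonneg_nonneg)
      have "d * (q * \<beta> (1/2)) \<le> 2 * s * (D * w) * (q * C)"
        using d2 d0 q \<beta> s D w by (intro mult_mono) auto
      also have "\<dots> = s * (2 * D * I1 * \<nu>\<^sup>2 * C)" using w(2) by (simp add: mult_ac)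
      also have "\<dots> \<le> \<epsilon>0 * (2 * D * I1 * \<nu>\<^sup>2 * C)"
        using s e D I1 \<beta>(1) by (intro mult_right_mono) auto
      also have "\<dots> \<le> \<kappa>" by (rule e0(4))
      finally have le: "d * (q * \<beta> (1/2)) \<le> \<phi> ?t" using \<phi>t by linarith
      have eq: "\<psi> ?t = \<phi> ?t - d * (q * \<beta> (1/2))" unfolding \<psi>t t by (simp add: d_def algebra_simps)
      have nn: "0 \<le> d * (q * \<beta> (1/2))" using d0 q \<beta>(3) by simp
      have "\<kappa>1 * s = s * (\<kappa> * w) * (q * \<beta> (1/2))" using w(2) by (simp add: \<kappa>1_def mult_ac)
      also have "\<dots> \<le> d * (q * \<beta> (1/2))" using d1 q \<beta>(3) by (intro mult_right_mono) auto
      also have "\<dots> = \<bar>\<bar>\<psi> ?t\<bar> - \<bar>\<phi> ?t\<bar>\<bar>" unfolding eq using le nn by linarith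
      finally show ?thesis .
    qed
    have \<psi>c: "continuous_on {0..1} \<psi>"
      unfolding \<psi>t[abs_def] using \<phi>(2) rot.e1 rot.e2 by (intro continuous_intros)
    show "\<exists>S \<psi>. local_perturbation \<gamma> k L \<delta> P \<phi> y h (\<kappa>3 * (\<epsilon> * h powr \<gamma>)\<^sup>2) (\<kappa>1 * (\<epsilon> * h powr \<gamma>)) S \<psi>"
      unfolding local_perturbation_def
    proof (intro exI[of _ S] exI[of _ \<psi>] conjI allI impI)
      show "S t \<in> borel_measurable P" "integrable P (\<lambda>z. (S t z)\<^sup>2)" for t using Srv[of t] by (auto simp: sq_rv_def)
      show "(\<integral>z. (S t z)\<^sup>2 \<partial>P) \<le> \<kappa>3 * (\<epsilon> * h powr \<gamma>)\<^sup>2" for t using sq[of t] by (simp add: s_def)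
      show "S t z = 0" if "t \<notin> {y<..<y + 2 * h}" for t z using out[OF that] by (simp add: S_def)
      show "\<psi> t = \<phi> t" if "t \<notin> {y<..<y + 2 * h}" for t using out[OF that] by (simp add: \<psi>t)
      show "distr P path_space (\<lambda>z. \<lambda>t\<in>{0..1}. z t + S t z) \<in> gaussian_gap_class \<gamma> k L \<delta>"
        using cls(1) by (simp add: P'_def)
      show "\<bar>eigenfunction (distr P path_space (\<lambda>z. \<lambda>t\<in>{0..1}. z t + S t z)) k t\<bar> = \<bar>\<psi> t\<bar>" for t
        using cls(2) by (simp add: P'_def)
      show "\<kappa>1 * (\<epsilon> * h powr \<gamma>) \<le> \<bar>\<bar>\<psi> (y + h / 2)\<bar> - \<bar>\<phi> (y + h / 2)\<bar>\<bar>" using sep by (simp add: s_def)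
    qed (rule \<psi>c)
  qed
qed

subsection \<open>The discretisation rate\<close>

lemma interval_index_unique:
  fixes t a h :: real
  assumes h: "0 < h" and t: "t \<in> {a + h * real m<..<a + h * real m + h}" "t \<in> {a + h * real m'<..<a + h * real m' + h}"
  shows "m = m'"
proof -
  have "h * real m < h * (real m' + 1)" "h * real m' < h * (real m + 1)"
    using t by (auto simp: distrib_left)
  then have "real m < real m' + 1" "real m' < real m + 1" using h by auto
  then show ?thesis by linarith
qed

text \<open>Pigeonhole: m ranges up to p inclusive, which makes p + 1 disjoint intervals for p
  points.\<close>

lemma empty_interval_exists:
  fixes x :: "nat \<Rightarrow> real"
  assumes h: "0 < h"
  obtains m where "m \<le> p" "\<And>j. j \<in> {1..p} \<Longrightarrow> x j \<notin> {a + h * real m<..<a + h * real m + h}"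
proof (rule ccontr)
  assume "\<not> thesis"
  then have "\<forall>m\<in>{..p}. \<exists>j. j \<in> {1..p} \<and> x j \<in> {a + h * real m<..<a + h * real m + h}"
    using that by (meson atMost_iff)
  then obtain f where f: "\<And>m. m \<in> {..p} \<Longrightarrow> f m \<in> {1..p} \<and> x (f m) \<in> {a + h * real m<..<a + h * real m + h}"
    by metis
  have "inj_on f {..p}"
  proof (rule inj_onI)
    fix m m' assume m: "m \<in> {..p}" "m' \<in> {..p}" "f m = f m'"
    show "m = m'"
      by (rule interval_index_unique[OF h]) (use f[OF m(1)] f[OF m(2)] m(3) in auto)
  qed
  moreover have "f ` {..p} \<subseteq> {1..p}" using f by blast
  ultimately have "card {..p} \<le> card {1..p}" by (rule card_inj_on_le) simp
  then show False by simp
qed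

lemma data_law_cong:
  assumes M: "prob_space M" and W: "W \<in> measurable M path_space" "W' \<in> measurable M path_space"
    and x: "x ` {1..p} \<subseteq> {0..1}" and \<sigma>: "\<sigma> > 0"
    and eq: "\<And>\<omega> j. j \<in> {1..p} \<Longrightarrow> W \<omega> (x j) = W' \<omega> (x j)"
  shows "data_law \<mu> x \<sigma> n p (distr M path_space W) = data_law \<mu> x \<sigma> n p (distr M path_space W')"
proof -
  have "(\<lambda>(\<omega>, e). \<lambda>(i, j)\<in>{1..n} \<times> {1..p}. \<mu> (x j) + W (\<omega> i) (x j) + e (i, j))
    = (\<lambda>(\<omega>, e). \<lambda>(i, j)\<in>{1..n} \<times> {1..p}. \<mu> (x j) + W' (\<omega> i) (x j) + e (i, j))"
    using eq by (auto simp: fun_eq_iff restrict_def)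
  then show ?thesis
    unfolding data_law_distr(1)[OF M W(1) x \<sigma>] data_law_distr(1)[OF M W(2) x \<sigma>] by simp
qed

lemma shifted_path_measurable:
  assumes P: "centered_gaussian_process P" and S: "\<And>t. S t \<in> borel_measurable P"
  shows "(\<lambda>z. \<lambda>t\<in>{0..1}. z t + S t z) \<in> measurable P path_space"
proof -
  interpret gauss_process P by unfold_locales (rule P)
  show ?thesis by (rule path_measurable) (intro borel_measurable_add coord_measurable S)
qed

lemma lower_bound_design:
  assumes \<gamma>: "\<gamma> > 0" and k: "k \<ge> 1" and \<delta>: "\<delta> > 0" and \<sigma>: "\<sigma> > 0"
    and base: "base_law \<gamma> L k \<delta> P lam A B"
  shows "lower_bound_rate \<gamma> k L \<delta> \<sigma> (\<lambda>n p. real p powr (- \<gamma>))"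
proof -
  note bd = base_lawD[OF base]
  interpret gauss_process P by unfold_locales (rule bd(1))
  obtain \<phi> a b \<kappa> where \<phi>: "\<phi> \<in> eigenspace (cov_kernel P) (lam k)" "continuous_on {0..1} \<phi>" "l2_inner \<phi> \<phi> = 1"
    and ab: "0 \<le> a" "a < b" "b \<le> 1" "0 < \<kappa>" "\<And>t. t \<in> {a..b} \<Longrightarrow> \<kappa> \<le> \<phi> t"
    by (rule positive_eigenfunction[OF \<gamma> k \<delta> base], rule that)
  note bc = base_law_class[OF \<gamma> k \<delta> base \<phi>(1,3)]
  obtain \<epsilon> \<kappa>1 \<kappa>3 where e: "0 < \<epsilon>" "\<epsilon> \<le> 1" "0 < \<kappa>1" "0 \<le> \<kappa>3"
    and bump: "\<And>\<epsilon>' h y. 0 < \<epsilon>' \<Longrightarrow> \<epsilon>' \<le> \<epsilon> \<Longrightarrow> 0 < h \<Longrightarrow> a \<le> y \<Longrightarrow> y + 2 * h \<le> b \<Longrightarrow>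
      \<exists>S \<psi>. local_perturbation \<gamma> k L \<delta> P \<phi> y h (\<kappa>3 * (\<epsilon>' * h powr \<gamma>)\<^sup>2) (\<kappa>1 * (\<epsilon>' * h powr \<gamma>)) S \<psi>"
    by (rule bump_perturbation[OF \<gamma> k \<delta> base \<phi> ab(1,3,4,5)], assumption, rule that)
  \<comment> \<open>The 4 reflects h \<ge> (b - a) / (4 p), which comes from p + 1 \<le> 2 p; the
    final 2 splits the separation between the two hypotheses.\<close>
  define b0 where "b0 = \<kappa>1 * \<epsilon> * ((b - a) / 4) powr \<gamma> / 2"
  show ?thesis
  proof (rule lower_bound_rateI[where N=1])
    show "0 < b0" using e ab by (simp add: b0_def)
    show "(0::real) < 1 / 2" by simp
    fix n p :: nat and \<mu> x \<Phi>
    assume n: "1 \<le> n" and p: "1 \<le> p" and x: "design p x" and \<Phi>: "\<Phi> \<in> estimators n p"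
    have xI: "x ` {1..p} \<subseteq> {0..1}" using x by (simp add: design_def)
    \<comment> \<open>Exactly p + 1 intervals of length 2 h fit into [a, b].\<close>
    define h where "h = (b - a) / (2 * (real p + 1))"
    have h: "0 < h" "2 * h * (real p + 1) = b - a" "(b - a) / (4 * real p) \<le> h"
    proof -
      show "0 < h" "2 * h * (real p + 1) = b - a" using ab by (simp_all add: h_def field_simps)
      show "(b - a) / (4 * real p) \<le> h" unfolding h_def using ab p by (intro divide_left_mono) auto
    qed
    obtain m where m: "m \<le> p" "\<And>j. j \<in> {1..p} \<Longrightarrow> x j \<notin> {a + 2 * h * real m<..<a + 2 * h * real m + 2 * h}"
      by (rule empty_interval_exists[where h="2 * h" and p=p and x=x and a=a]) (use h in auto)
    define y where "y = a + 2 * h * real m"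
    have y: "a \<le> y" "y + 2 * h \<le> b"
    proof -
      show "a \<le> y" using h by (simp add: y_def)
      have "2 * h * (real m + 1) \<le> 2 * h * (real p + 1)" using h m by (intro mult_left_mono) auto
      moreover have "y + 2 * h = a + 2 * h * (real m + 1)" by (simp add: y_def distrib_left)
      ultimately show "y + 2 * h \<le> b" using h(2) by linarith
    qed
    obtain S \<psi> where "local_perturbation \<gamma> k L \<delta> P \<phi> y h (\<kappa>3 * (\<epsilon> * h powr \<gamma>)\<^sup>2) (\<kappa>1 * (\<epsilon> * h powr \<gamma>)) S \<psi>"
      using bump[OF e(1) order_refl h(1) y] by blast
    note S = local_perturbationD[OF this]
    define P1 where "P1 = distr P path_space (\<lambda>z. \<lambda>t\<in>{0..1}. z t + S t z)"
    define Q where "Q = data_law \<mu> x \<sigma> n p P"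
    have Wm: "(\<lambda>z. \<lambda>t\<in>{0..1}. z t) \<in> measurable P path_space"
      by (rule path_measurable) (rule coord_measurable)
    have W1m: "(\<lambda>z. \<lambda>t\<in>{0..1}. z t + S t z) \<in> measurable P path_space"
      by (rule shifted_path_measurable[OF bd(1) S(1)])
    have eq: "data_law \<mu> x \<sigma> n p P1 = Q"
    proof -
      have "data_law \<mu> x \<sigma> n p P1 = data_law \<mu> x \<sigma> n p (distr P path_space (\<lambda>z. \<lambda>t\<in>{0..1}. z t))"
        unfolding P1_def
      proof (rule data_law_cong[OF prob_space_axioms W1m Wm xI \<sigma>])
        fix \<omega> j assume j: "j \<in> {1..p}"
        then have "S (x j) \<omega> = 0" using m(2)[OF j] by (intro S(4)) (simp add: y_def)
        then show "(\<lambda>t\<in>{0..1}. \<omega> t + S t \<omega>) (x j) = (\<lambda>t\<in>{0..1}. \<omega> t) (x j)" by (simp add: restrict_def)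
      qed
      then show ?thesis by (simp add: bc(3) Q_def)
    qed
    have Q: "prob_space Q" "sets Q = sets (data_space n p)"
      using data_law_prob[OF prob_space_axioms Wm xI \<sigma>, of \<mu> n] bc(3) by (simp_all add: Q_def sets_data_law)
    define r where "r = b0 * real p powr (- \<gamma>)"
    define t where "t = y + h / 2"
    have t: "t \<in> {0..1}" using y ab h by (simp add: t_def)
    have sep: "2 * r \<le> \<bar>\<bar>\<psi> t\<bar> - \<bar>\<phi> t\<bar>\<bar>"
    proof -
      have "2 * r = \<kappa>1 * (\<epsilon> * (((b - a) / 4) powr \<gamma> * real p powr (- \<gamma>)))" by (simp add: r_def b0_def)
      also have "((b - a) / 4) powr \<gamma> * real p powr (- \<gamma>) = ((b - a) / (4 * real p)) powr \<gamma>"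
        using ab p by (simp add: powr_minus_divide powr_divide powr_mult)
      also have "\<kappa>1 * (\<epsilon> * ((b - a) / (4 * real p)) powr \<gamma>) \<le> \<kappa>1 * (\<epsilon> * h powr \<gamma>)"
        using e h ab p \<gamma> by (intro mult_left_mono powr_mono2) auto
      also have "\<dots> \<le> \<bar>\<bar>\<psi> t\<bar> - \<bar>\<phi> t\<bar>\<bar>" unfolding t_def by (rule S(9))
      finally show ?thesis .
    qed
    define A0 where "A0 = miss_event n p \<Phi> {t} \<phi> r"
    define A1 where "A1 = miss_event n p \<Phi> {t} \<psi> r"
    have As: "A0 \<in> sets (data_space n p)" "A1 \<in> sets (data_space n p)"
      unfolding A0_def A1_def using t by (auto intro!: miss_event_sets[OF \<Phi>])
    have cover: "space (data_space n p) \<subseteq> A0 \<union> A1"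
      unfolding A0_def A1_def by (rule miss_event_cover) (rule sep)
    have "ennreal (1 / 2) \<le> emeasure Q A0 \<or> ennreal (1 / 2) \<le> emeasure Q A1"
    \<comment> \<open>Both hypotheses induce the same law of the data, so C = 1 and d = 0, which
      permits v = 1/2.\<close>
    proof (rule two_point_events[OF Q Q As cover])
      show "emeasure Q (space (data_space n p) - A1) \<le> ennreal 1 * emeasure Q (space (data_space n p) - A1) + ennreal 0" by simp
    qed auto
    then show "\<exists>P\<in>gaussian_gap_class \<gamma> k L \<delta>. \<exists>\<psi> T.
        continuous_on {0..1} \<psi> \<and> (\<forall>t. \<bar>eigenfunction P k t\<bar> = \<bar>\<psi> t\<bar>) \<and> finite T \<and> T \<subseteq> {0..1} \<and>
        ennreal (1 / 2) \<le> emeasure (data_law \<mu> x \<sigma> n p P) (miss_event n p \<Phi> T \<psi> (b0 * real p powr (- \<gamma>)))"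
    proof
      assume "ennreal (1 / 2) \<le> emeasure Q A0"
      then show ?thesis
        using \<phi>(2) t bc(2) by (intro bexI[OF _ bc(1)] exI[of _ \<phi>] exI[of _ "{t}"]) (auto simp: Q_def A0_def r_def)
    next
      assume "ennreal (1 / 2) \<le> emeasure Q A1"
      then show ?thesis
        using S(6,7) t by (intro bexI[OF _ S(5)] exI[of _ \<psi>] exI[of _ "{t}"]) (auto simp: eq[unfolded P1_def] A1_def r_def)
    qed
  qed
qed

subsection \<open>The logarithmic rate\<close>

text \<open>Conditionally on the paths, \<open>S\<close> is a mean shift of the Gaussian errors. Its likelihood ratio is
  controlled on the event that its energy is at most \<open>q\<close>; the last term bounds the probability of
  the complement by Markov's inequality.\<close>

lemma data_law_shift:
  fixes n p :: nat and x :: "nat \<Rightarrow> real"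
  assumes P: "centered_gaussian_process P" and id: "distr P path_space (\<lambda>z. \<lambda>t\<in>{0..1}. z t) = P"
    and S: "\<And>t. S t \<in> borel_measurable P" "\<And>t. integrable P (\<lambda>z. (S t z)\<^sup>2)" "\<And>t. (\<integral>z. (S t z)\<^sup>2 \<partial>P) \<le> \<tau>"
      "\<And>t z. t \<notin> J \<Longrightarrow> S t z = 0"
    and x: "x ` {1..p} \<subseteq> {0..1}" and \<sigma>: "\<sigma> > 0" and K: "0 < K" and q: "0 < q" and \<tau>: "0 \<le> \<tau>"
    and E: "E \<in> sets (data_space n p)"
  shows "emeasure (data_law \<mu> x \<sigma> n p (distr P path_space (\<lambda>z. \<lambda>t\<in>{0..1}. z t + S t z))) E
    \<le> ennreal K * emeasure (data_law \<mu> x \<sigma> n p P) E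
      + ennreal (exp q / K + real n * real (card {j\<in>{1..p}. x j \<in> J}) * \<tau> / (\<sigma>\<^sup>2 * q))"
proof -
  interpret gauss_process P by unfold_locales (rule P)
  let ?I = "{1..n} \<times> {1..p}"
  let ?A = "PiM {1..n} (\<lambda>_. P)"
  define N where "N = PiM ?I (\<lambda>_. density lborel (normal_density 0 \<sigma>))"
  interpret A: prob_space ?A by (intro prob_space_PiM prob_space_axioms)
  interpret N: prob_space N unfolding N_def by (intro prob_space_PiM prob_space_normal_density \<sigma>)
  interpret AN: pair_prob_space ?A N by unfold_locales
  define W0 where "W0 = (\<lambda>z :: real \<Rightarrow> real. \<lambda>t\<in>{0..1::real}. z t)"
  define W1 where "W1 = (\<lambda>z. \<lambda>t\<in>{0..1}. z t + S t z)"
  have W0: "W0 \<in> measurable P path_space" unfolding W0_def by (rule path_measurable) (rule coord_measurable)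
  have W1: "W1 \<in> measurable P path_space" unfolding W1_def by (rule shifted_path_measurable[OF P S(1)])
  define F0 where "F0 = (\<lambda>(\<omega>, e). \<lambda>(i, j)\<in>?I. \<mu> (x j) + W0 (\<omega> i) (x j) + e (i, j))"
  define F1 where "F1 = (\<lambda>(\<omega>, e). \<lambda>(i, j)\<in>?I. \<mu> (x j) + W1 (\<omega> i) (x j) + e (i, j))"
  note d0 = data_law_distr[OF prob_space_axioms W0 x \<sigma>, where \<mu>=\<mu> and n=n, folded F0_def N_def]
  note d1 = data_law_distr[OF prob_space_axioms W1 x \<sigma>, where \<mu>=\<mu> and n=n, folded F1_def N_def]
  define G0 where "G0 = F0 -` E \<inter> space (?A \<Otimes>\<^sub>M N)"
  define G1 where "G1 = F1 -` E \<inter> space (?A \<Otimes>\<^sub>M N)"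
  have G0: "G0 \<in> sets (?A \<Otimes>\<^sub>M N)" unfolding G0_def by (rule measurable_sets[OF d0(2) E])
  have G1: "G1 \<in> sets (?A \<Otimes>\<^sub>M N)" unfolding G1_def by (rule measurable_sets[OF d1(2) E])
  define a where "a \<omega> = (\<lambda>(i, j). S (x j) (\<omega> i))" for \<omega> :: "nat \<Rightarrow> real \<Rightarrow> real"
  \<comment> \<open>The sum of u over all observations is the energy of the shift divided by q,
    hence at least 1 wherever the energy exceeds q. Adding it to the bound covers the bad paths, and
    its expectation is the Markov term.\<close>
  define u where "u = (\<lambda>ij \<omega>. ennreal ((a \<omega> ij)\<^sup>2 / (\<sigma>\<^sup>2 * q)))"
  define \<kappa> where "\<kappa> = (\<lambda>\<omega>. emeasure N (Pair \<omega> -` G0))"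
  have slice: "emeasure N (Pair \<omega> -` G1) \<le> ennreal K * \<kappa> \<omega> + (ennreal (exp q / K) + (\<Sum>ij\<in>?I. u ij \<omega>))"
    if \<omega>: "\<omega> \<in> space ?A" for \<omega>
  proof -
    have B: "Pair \<omega> -` G0 \<in> sets N" by (rule sets_Pair1[OF G0])
    have shift: "(\<lambda>ij\<in>?I. e ij + a \<omega> ij) \<in> space N" for e
      by (simp add: N_def space_PiM)
    have F: "F1 (\<omega>, e) = F0 (\<omega>, \<lambda>ij\<in>?I. e ij + a \<omega> ij)" for e
    proof -
      have "W1 (\<omega> i) (x j) = W0 (\<omega> i) (x j) + a \<omega> (i, j)" if "j \<in> {1..p}" for i j
      proof -
        have "x j \<in> {0..1}" using x that by blast
        then show ?thesis by (simp add: W0_def W1_def a_def)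
      qed
      then show ?thesis by (auto simp: F0_def F1_def fun_eq_iff restrict_def)
    qed
    have eq: "Pair \<omega> -` G1 = {e \<in> space N. (\<lambda>ij\<in>?I. e ij + a \<omega> ij) \<in> Pair \<omega> -` G0}"
      using shift \<omega> by (auto simp: G0_def G1_def space_pair_measure F simp del: restrict_apply)
    have su: "(\<Sum>ij\<in>?I. u ij \<omega>) = ennreal ((\<Sum>ij\<in>?I. (a \<omega> ij)\<^sup>2) / \<sigma>\<^sup>2 / q)"
      unfolding u_def using q by (subst sum_ennreal) (auto simp: sum_divide_distrib)
    show ?thesis
    proof (cases "(\<Sum>ij\<in>?I. (a \<omega> ij)\<^sup>2) / \<sigma>\<^sup>2 \<le> q")
      case True
      have "emeasure N (Pair \<omega> -` G1)
        \<le> ennreal K * \<kappa> \<omega> + ennreal (exp ((\<Sum>ij\<in>?I. (a \<omega> ij)\<^sup>2) / \<sigma>\<^sup>2)) / ennreal K"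
        unfolding eq \<kappa>_def using B unfolding N_def by (intro gauss_shift_bound \<sigma> K) auto
      also have "ennreal (exp ((\<Sum>ij\<in>?I. (a \<omega> ij)\<^sup>2) / \<sigma>\<^sup>2)) / ennreal K \<le> ennreal (exp q / K)"
        using True K by (subst divide_ennreal) (auto intro!: ennreal_leI divide_right_mono)
      finally show ?thesis by (meson add_left_mono add_increasing2 order_trans zero_le le_iff_add)
    next
      case False
      then have "1 \<le> (\<Sum>ij\<in>?I. (a \<omega> ij)\<^sup>2) / \<sigma>\<^sup>2 / q" using q by (subst le_divide_eq) simp
      then have "1 \<le> (\<Sum>ij\<in>?I. u ij \<omega>)" unfolding su by (metis ennreal_1 ennreal_leI)
      have "emeasure N (Pair \<omega> -` G1) \<le> 1" by (rule N.emeasure_le_1)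
      also have "\<dots> \<le> (\<Sum>ij\<in>?I. u ij \<omega>)" by fact
      finally show ?thesis by (meson add_increasing zero_le order_trans)
    qed
  qed
  have am: "(\<lambda>\<omega>. a \<omega> ij) \<in> borel_measurable ?A" if mem: "ij \<in> ?I" for ij
  proof -
    obtain i j where ij: "ij = (i, j)" "i \<in> {1..n}" using mem by auto
    show ?thesis unfolding a_def ij(1) prod.case
      by (rule measurable_compose[OF _ S(1)[of "x j"]]) (rule measurable_component_singleton[OF ij(2)])
  qed
  have um: "u ij \<in> borel_measurable ?A" if "ij \<in> ?I" for ij
  proof -
    note [measurable] = am[OF that]
    show ?thesis unfolding u_def by measurable
  qed
  have \<kappa>m: "\<kappa> \<in> borel_measurable ?A"
    unfolding \<kappa>_def by (rule N.measurable_emeasure_Pair[OF G0])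
  have ui: "(\<integral>\<^sup>+\<omega>. u ij \<omega> \<partial>?A) \<le> ennreal ((if x (snd ij) \<in> J then \<tau> else 0) / (\<sigma>\<^sup>2 * q))" if mem: "ij \<in> ?I" for ij
  proof -
    obtain i j where ij: "ij = (i, j)" "i \<in> {1..n}" using mem by auto
    let ?f = "\<lambda>z. ennreal ((S (x j) z)\<^sup>2 / (\<sigma>\<^sup>2 * q))"
    note [measurable] = S(1)
    have "(\<integral>\<^sup>+\<omega>. u ij \<omega> \<partial>?A) = (\<integral>\<^sup>+\<omega>. ?f (\<omega> i) \<partial>?A)" by (simp add: u_def a_def ij)
    also have "\<dots> = (\<integral>\<^sup>+z. ?f z \<partial>distr ?A P (\<lambda>\<omega>. \<omega> i))"
      by (rule nn_integral_distr[symmetric]) (use ij(2) in \<open>auto intro: measurable_component_singleton\<close>)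
    also have "distr ?A P (\<lambda>\<omega>. \<omega> i) = P"
      by (rule distr_PiM_component) (use ij(2) prob_space_axioms in auto)
    also have "(\<integral>\<^sup>+z. ?f z \<partial>P) = ennreal (\<integral>z. (S (x j) z)\<^sup>2 / (\<sigma>\<^sup>2 * q) \<partial>P)"
      by (rule nn_integral_eq_integral) (use S(2) q in auto)
    also have "\<dots> \<le> ennreal ((if x (snd ij) \<in> J then \<tau> else 0) / (\<sigma>\<^sup>2 * q))"
      using S(3)[of "x j"] S(4)[of "x j"] q by (auto simp: ij intro!: ennreal_leI divide_right_mono)
    finally show ?thesis .
  qed
  have tot: "(\<Sum>ij\<in>?I. (if x (snd ij) \<in> J then \<tau> else 0) / (\<sigma>\<^sup>2 * q)) = real n * real (card {j\<in>{1..p}. x j \<in> J}) * \<tau> / (\<sigma>\<^sup>2 * q)"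
  proof -
    have "(\<Sum>ij\<in>?I. (if x (snd ij) \<in> J then \<tau> else 0) / (\<sigma>\<^sup>2 * q))
      = (\<Sum>i\<in>{1..n}. \<Sum>j\<in>{1..p}. (if x j \<in> J then \<tau> else 0) / (\<sigma>\<^sup>2 * q))"
      by (subst sum.cartesian_product') simp
    also have "\<dots> = real n * ((\<Sum>j\<in>{1..p}. if x j \<in> J then \<tau> else 0) / (\<sigma>\<^sup>2 * q))"
      by (simp add: sum_divide_distrib)
    also have "(\<Sum>j\<in>{1..p}. if x j \<in> J then \<tau> else 0) = real (card {j\<in>{1..p}. x j \<in> J}) * \<tau>"
      by (subst sum.inter_filter[symmetric]) auto
    finally show ?thesis by simp
  qed
  have "emeasure (data_law \<mu> x \<sigma> n p (distr P path_space W1)) E = emeasure (?A \<Otimes>\<^sub>M N) G1"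
    unfolding d1(1) G1_def using d1(2) E by (rule emeasure_distr)
  also have "\<dots> = (\<integral>\<^sup>+\<omega>. emeasure N (Pair \<omega> -` G1) \<partial>?A)"
    by (rule N.emeasure_pair_measure_alt[OF G1])
  also have "\<dots> \<le> (\<integral>\<^sup>+\<omega>. ennreal K * \<kappa> \<omega> + (ennreal (exp q / K) + (\<Sum>ij\<in>?I. u ij \<omega>)) \<partial>?A)"
    by (rule nn_integral_mono) (rule slice)
  also have "\<dots> = ennreal K * (\<integral>\<^sup>+\<omega>. \<kappa> \<omega> \<partial>?A) + (ennreal (exp q / K) + (\<Sum>ij\<in>?I. \<integral>\<^sup>+\<omega>. u ij \<omega> \<partial>?A))"
  proof -
    have split: "(\<integral>\<^sup>+\<omega>. ennreal K * \<kappa> \<omega> + (c + v \<omega>) \<partial>?A) = ennreal K * (\<integral>\<^sup>+\<omega>. \<kappa> \<omega> \<partial>?A) + (c + (\<integral>\<^sup>+\<omega>. v \<omega> \<partial>?A))"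
      if [measurable]: "v \<in> borel_measurable ?A" for v c
    proof -
      note [measurable] = \<kappa>m
      have "(\<integral>\<^sup>+\<omega>. ennreal K * \<kappa> \<omega> + (c + v \<omega>) \<partial>?A)
        = (\<integral>\<^sup>+\<omega>. ennreal K * \<kappa> \<omega> \<partial>?A) + (\<integral>\<^sup>+\<omega>. c + v \<omega> \<partial>?A)"
        by (rule nn_integral_add) measurable
      also have "(\<integral>\<^sup>+\<omega>. c + v \<omega> \<partial>?A) = c + (\<integral>\<^sup>+\<omega>. v \<omega> \<partial>?A)"
        by (subst nn_integral_add) (simp_all add: that A.emeasure_space_1 del: One_nat_def)
      finally show ?thesis by (simp only: nn_integral_cmult[OF \<kappa>m])
    qed
    have "(\<lambda>\<omega>. \<Sum>ij\<in>?I. u ij \<omega>) \<in> borel_measurable ?A" using um by (intro borel_measurable_sum) auto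
    from split[OF this] show ?thesis by (simp only: nn_integral_sum[OF um])
  qed
  also have "(\<integral>\<^sup>+\<omega>. \<kappa> \<omega> \<partial>?A) = emeasure (?A \<Otimes>\<^sub>M N) G0"
    unfolding \<kappa>_def by (rule N.emeasure_pair_measure_alt[OF G0, symmetric])
  also have "\<dots> = emeasure (data_law \<mu> x \<sigma> n p (distr P path_space W0)) E"
    unfolding d0(1) G0_def by (rule emeasure_distr[OF d0(2) E, symmetric])
  also have "distr P path_space W0 = P" unfolding W0_def by (rule id)
  finally have le: "emeasure (data_law \<mu> x \<sigma> n p (distr P path_space W1)) E
    \<le> ennreal K * emeasure (data_law \<mu> x \<sigma> n p P) E + (ennreal (exp q / K) + (\<Sum>ij\<in>?I. \<integral>\<^sup>+\<omega>. u ij \<omega> \<partial>?A))" .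
  have "(\<Sum>ij\<in>?I. \<integral>\<^sup>+\<omega>. u ij \<omega> \<partial>?A) \<le> (\<Sum>ij\<in>?I. ennreal ((if x (snd ij) \<in> J then \<tau> else 0) / (\<sigma>\<^sup>2 * q)))"
    by (rule sum_mono) (rule ui)
  also have "\<dots> = ennreal (real n * real (card {j\<in>{1..p}. x j \<in> J}) * \<tau> / (\<sigma>\<^sup>2 * q))"
    unfolding tot[symmetric] using q \<tau> by (intro sum_ennreal) auto
  finally have "ennreal (exp q / K) + (\<Sum>ij\<in>?I. \<integral>\<^sup>+\<omega>. u ij \<omega> \<partial>?A)
    \<le> ennreal (exp q / K) + ennreal (real n * real (card {j\<in>{1..p}. x j \<in> J}) * \<tau> / (\<sigma>\<^sup>2 * q))"
    by (rule add_left_mono)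
  also have "\<dots> = ennreal (exp q / K + real n * real (card {j\<in>{1..p}. x j \<in> J}) * \<tau> / (\<sigma>\<^sup>2 * q))"
    using K q \<tau> by (intro ennreal_plus[symmetric]) auto
  finally show ?thesis using order_trans[OF le add_left_mono] unfolding W1_def by blast
qed

lemma exists_below_mean:
  fixes f :: "nat \<Rightarrow> real"
  assumes M: "0 < M" and sum: "(\<Sum>m<M. f m) \<le> c"
  shows "\<exists>m<M. f m \<le> c / real M"
proof (rule ccontr)
  assume "\<not> ?thesis"
  then have gt: "c / real M < f m" if "m < M" for m using that by force
  have "(\<Sum>m<M. c / real M) < (\<Sum>m<M. f m)"
    by (rule sum_strict_mono) (use M gt in auto)
  then show False using M sum by simp
qed

text \<open>With X = np and \<rho> = 1 / (2 \<gamma> + 1), the width is h = (ln X / X) powr \<rho>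
  and l / (4 h) bounds the number M of intervals from below. Its logarithm grows like \<rho> ln X,
  so half of that is eventually exceeded; 12^4 serves to make M^(-1/4) at most 1/12.\<close>

lemma log_rate_asymptotics:
  fixes l \<rho> :: real
  assumes l: "0 < l" and \<rho>: "0 < \<rho>"
  obtains X0 where "\<And>X. X0 \<le> X \<Longrightarrow> 1 < X \<and> 12 ^ 4 \<le> l / (4 * (ln X / X) powr \<rho>)
    \<and> \<rho> / 2 * ln X \<le> ln (l / (4 * (ln X / X) powr \<rho>))"
proof -
  have "((\<lambda>X::real. (ln X / X) powr \<rho>) \<longlongrightarrow> 0) at_top" using \<rho> by real_asymp
  then have e1: "\<forall>\<^sub>F X::real in at_top. (ln X / X) powr \<rho> < l / (4 * 12 ^ 4)"
    by (rule order_tendstoD(2)) (use l in simp)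
  have "filterlim (\<lambda>X::real. ln (l / 4) + \<rho> * (ln X - ln (ln X)) - \<rho> / 2 * ln X) at_top at_top"
    using \<rho> by real_asymp
  then have e2: "\<forall>\<^sub>F X::real in at_top. 0 \<le> ln (l / 4) + \<rho> * (ln X - ln (ln X)) - \<rho> / 2 * ln X"
    unfolding filterlim_at_top by (rule spec)
  have "\<forall>\<^sub>F X::real in at_top. 1 < X \<and> 12 ^ 4 \<le> l / (4 * (ln X / X) powr \<rho>)
    \<and> \<rho> / 2 * ln X \<le> ln (l / (4 * (ln X / X) powr \<rho>))"
    using e1 e2 eventually_gt_at_top[of 1]
  proof eventually_elim
    case (elim X)
    define h where "h = (ln X / X) powr \<rho>"
    have lX: "0 < ln X" "0 < X" using elim(3) by auto
    then have h: "0 < h" by (simp add: h_def)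
    have "12 ^ 4 * (4 * h) \<le> l" using elim(1) by (simp add: h_def)
    then have 1: "12 ^ 4 \<le> l / (4 * h)" using h by (simp add: le_divide_eq)
    have "ln (l / (4 * h)) = ln (l / 4) - ln h" using l h by (simp add: ln_div ln_mult)
    also have "ln h = \<rho> * (ln (ln X) - ln X)" unfolding h_def using lX by (simp add: ln_powr ln_div)
    finally have "ln (l / (4 * h)) = ln (l / 4) + \<rho> * (ln X - ln (ln X))" by (simp add: algebra_simps)
    then show ?case using elim 1 by (simp add: h_def)
  qed
  then obtain X0 where "\<forall>X\<ge>X0. 1 < X \<and> 12 ^ 4 \<le> l / (4 * (ln X / X) powr \<rho>)
    \<and> \<rho> / 2 * ln X \<le> ln (l / (4 * (ln X / X) powr \<rho>))"
    by (auto simp: eventually_at_top_linorder)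
  then show ?thesis using that by blast
qed

text \<open>Averaging takes the place of Fano's inequality. The M events of accurate estimation are
  disjoint, and so are the M groups of affected design points; hence some index m has both an event
  of Q0-probability at most 2/M and at most a fraction 2/M of the design points. Comparing the m-th
  law with Q0 suffices.\<close>

lemma lower_bound_log:
  assumes \<gamma>: "\<gamma> > 0" and k: "k \<ge> 1" and \<delta>: "\<delta> > 0" and \<sigma>: "\<sigma> > 0"
    and base: "base_law \<gamma> L k \<delta> P lam A B"
  shows "lower_bound_rate \<gamma> k L \<delta> \<sigma> (\<lambda>n p. (ln (real (n * p)) / real (n * p)) powr (\<gamma> / (2 * \<gamma> + 1)))"
proof -
  note bd = base_lawD[OF base]
  interpret gauss_process P by unfold_locales (rule bd(1))
  obtain \<phi> a b \<kappa> where \<phi>: "\<phi> \<in> eigenspace (cov_kernel P) (lam k)" "continuous_on {0..1} \<phi>" "l2_inner \<phi> \<phi> = 1"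
    and ab: "0 \<le> a" "a < b" "b \<le> 1" "0 < \<kappa>" "\<And>t. t \<in> {a..b} \<Longrightarrow> \<kappa> \<le> \<phi> t"
    by (rule positive_eigenfunction[OF \<gamma> k \<delta> base], rule that)
  note bc = base_law_class[OF \<gamma> k \<delta> base \<phi>(1,3)]
  obtain \<epsilon>0 \<kappa>1 \<kappa>3 where e0: "0 < \<epsilon>0" "\<epsilon>0 \<le> 1" "0 < \<kappa>1" "0 \<le> \<kappa>3"
    and bump: "\<And>\<epsilon> h y. 0 < \<epsilon> \<Longrightarrow> \<epsilon> \<le> \<epsilon>0 \<Longrightarrow> 0 < h \<Longrightarrow> a \<le> y \<Longrightarrow> y + 2 * h \<le> b \<Longrightarrow>
      \<exists>S \<psi>. local_perturbation \<gamma> k L \<delta> P \<phi> y h (\<kappa>3 * (\<epsilon> * h powr \<gamma>)\<^sup>2) (\<kappa>1 * (\<epsilon> * h powr \<gamma>)) S \<psi>"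
    by (rule bump_perturbation[OF \<gamma> k \<delta> base \<phi> ab(1,3,4,5)], assumption, rule that)
  define l where "l = b - a"
  define \<rho> where "\<rho> = 1 / (2 * \<gamma> + 1)"
  have l: "0 < l" using ab by (simp add: l_def)
  have \<rho>: "0 < \<rho>" using \<gamma> by (simp add: \<rho>_def)
  \<comment> \<open>The first condition bounds the Markov term \<open>t3\<close> by 1/4: the
    expected energy is of order \<epsilon>^2 ln X, while the threshold q is at least (\<rho> / 4) ln
    X.\<close>
  have "\<exists>\<epsilon>>0. \<epsilon> \<le> 1 \<and> (\<forall>(C, D)\<in>{(32 * \<kappa>3 / (l * \<sigma>\<^sup>2 * \<rho>), 1 / 4), (1, \<epsilon>0)}. \<epsilon> * C \<le> D)"
    by (rule small_exists) (use e0 in auto)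
  then obtain \<epsilon> where e: "0 < \<epsilon>" "\<epsilon> \<le> 1" "\<epsilon> * (32 * \<kappa>3 / (l * \<sigma>\<^sup>2 * \<rho>)) \<le> 1 / 4" "\<epsilon> \<le> \<epsilon>0"
    by auto
  obtain X0 where X0: "\<And>X. X0 \<le> X \<Longrightarrow> 1 < X \<and> 12 ^ 4 \<le> l / (4 * (ln X / X) powr \<rho>)
    \<and> \<rho> / 2 * ln X \<le> ln (l / (4 * (ln X / X) powr \<rho>))"
    by (rule log_rate_asymptotics[OF l \<rho>]) metis
  define b0 where "b0 = \<kappa>1 * \<epsilon> / 2"
  show ?thesis
  proof (rule lower_bound_rateI[where N="max 1 (nat \<lceil>X0\<rceil>)"])
    show "0 < b0" using e e0 by (simp add: b0_def)
    show "(0::real) < 1 / 2" by simp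
    fix n p :: nat and \<mu> x \<Phi>
    assume n: "max 1 (nat \<lceil>X0\<rceil>) \<le> n" and p: "max 1 (nat \<lceil>X0\<rceil>) \<le> p" and x: "design p x" and \<Phi>: "\<Phi> \<in> estimators n p"
    have xI: "x ` {1..p} \<subseteq> {0..1}" using x by (simp add: design_def)
    define X where "X = real (n * p)"
    define h where "h = (ln X / X) powr \<rho>"
    have "X0 \<le> X"
    proof -
      have "nat \<lceil>X0\<rceil> \<le> n * 1" using n by simp
      also have "\<dots> \<le> n * p" using p by (intro mult_le_mono2) simp
      finally show ?thesis unfolding X_def by linarith
    qed
    note X = X0[OF this, folded h_def]
    have lX: "0 < ln X" "0 < X" using X by auto
    have h: "0 < h" using lX by (simp add: h_def)
    have hX: "h powr \<gamma> = (ln X / X) powr (\<gamma> / (2 * \<gamma> + 1))" "X * (h * (h powr \<gamma>)\<^sup>2) = ln X"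
    proof -
      show "h powr \<gamma> = (ln X / X) powr (\<gamma> / (2 * \<gamma> + 1))" by (simp add: h_def powr_powr \<rho>_def)
      have "h * (h powr \<gamma>)\<^sup>2 = h powr 1 * (h powr \<gamma> * h powr \<gamma>)" using h by (simp add: power2_eq_square)
      also have "\<dots> = h powr (1 + (\<gamma> + \<gamma>))" unfolding powr_add by simp
      also have "\<dots> = (ln X / X) powr (\<rho> * (2 * \<gamma> + 1))" unfolding h_def powr_powr by (simp add: algebra_simps)
      also have "\<rho> * (2 * \<gamma> + 1) = 1" using \<gamma> by (simp add: \<rho>_def)
      finally show "X * (h * (h powr \<gamma>)\<^sup>2) = ln X" using lX by simp
    qed
    define r where "r = b0 * h powr \<gamma>"
    \<comment> \<open>The number of adjacent intervals of length 2 h that fit into [a, b].\<close>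
    define M where "M = nat \<lfloor>l / (2 * h)\<rfloor>"
    have M: "real M \<le> l / (2 * h)" "l / (4 * h) \<le> real M" "12 ^ 4 \<le> real M"
    proof -
      define u where "u = l / (4 * h)"
      have u: "l / (2 * h) = 2 * u" "12 ^ 4 \<le> u" using X by (simp_all add: u_def)
      then have "real M = of_int \<lfloor>2 * u\<rfloor>" by (simp add: M_def)
      then have f: "real M \<le> 2 * u" "2 * u - 1 < real M" by linarith+
      then show "real M \<le> l / (2 * h)" using u by simp
      have u1: "20736 \<le> u" using u(2) by simp
      then have "20736 \<le> real M" using f by linarith
      then show "12 ^ 4 \<le> real M" by simp
      show "l / (4 * h) \<le> real M" unfolding u_def[symmetric] using f u1 by linarith
    qed
    have M0: "0 < M" using M(3) by (cases M) auto
    define y where "y m = a + 2 * h * real m" for m :: nat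
    define J where "J m = {y m<..<y m + 2 * h}" for m
    define t where "t m = y m + h / 2" for m
    have y: "a \<le> y m" "y m + 2 * h \<le> b" if "m < M" for m
    proof -
      show "a \<le> y m" using h by (simp add: y_def)
      have "real m + 1 \<le> real M" using that by linarith
      then have "2 * h * (real m + 1) \<le> 2 * h * real M" using h by (intro mult_left_mono) auto
      also have "\<dots> \<le> l" using M(1) h by (simp add: le_divide_eq mult.commute)
      finally have "2 * h * (real m + 1) \<le> l" .
      moreover have "y m + 2 * h = a + 2 * h * (real m + 1)" by (simp add: y_def distrib_left)
      ultimately show "y m + 2 * h \<le> b" unfolding l_def by linarith
    qed
    define \<tau> where "\<tau> = \<kappa>3 * (\<epsilon> * h powr \<gamma>)\<^sup>2"
    have "2 * r = \<kappa>1 * (\<epsilon> * h powr \<gamma>)" by (simp add: r_def b0_def)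
    then have "\<forall>m. \<exists>S \<psi>. m < M \<longrightarrow> local_perturbation \<gamma> k L \<delta> P \<phi> (y m) h \<tau> (2 * r) S \<psi>"
      using bump[OF e(1,4) h y] unfolding \<tau>_def by metis
    then obtain S \<psi> where pert: "\<And>m. m < M \<Longrightarrow> local_perturbation \<gamma> k L \<delta> P \<phi> (y m) h \<tau> (2 * r) (S m) (\<psi> m)"
      by metis
    note S = local_perturbationD[OF pert, folded J_def t_def]
    have Juniq: "m = m'" if "t' \<in> J m" "t' \<in> J m'" for t' m m'
      by (rule interval_index_unique[of "2 * h" t' a]) (use h that in \<open>simp_all add: J_def y_def\<close>)
    \<comment> \<open>All hypotheses are tested at all centres, so that the accuracy required on
      \<open>E m\<close> includes the centres belonging to the other hypotheses.\<close>
    define T where "T = t ` {..<M}"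
    have T: "finite T" "T \<subseteq> {0..1}"
    proof -
      show "T \<subseteq> {0..1}" unfolding T_def
      proof (rule image_subsetI)
        fix m assume "m \<in> {..<M}"
        then have "m < M" by simp
        from y[OF this] show "t m \<in> {0..1}" using h ab by (simp add: t_def)
      qed
    qed (simp add: T_def)
    define Miss where "Miss m = miss_event n p \<Phi> T (\<psi> m) r" for m
    define E where "E m = space (data_space n p) - Miss m" for m
    have Es: "Miss m \<in> sets (data_space n p)" "E m \<in> sets (data_space n p)" for m
      unfolding E_def Miss_def using miss_event_sets[OF \<Phi> T] by auto
    \<comment> \<open>At the centre t m the m-th candidate is 2 r away from |\<phi>| in modulus,
      while every other candidate equals \<phi> there; no estimate is within r of both.\<close>
    have disj: "disjoint_family_on E {..<M}"
      unfolding disjoint_family_on_def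
    proof (intro ballI impI)
      fix m m' assume m: "m \<in> {..<M}" "m' \<in> {..<M}" "m \<noteq> m'"
      show "E m \<inter> E m' = {}"
      proof (rule ccontr)
        assume "E m \<inter> E m' \<noteq> {}"
        then obtain z where z: "z \<in> E m" "z \<in> E m'" by blast
        have tT: "t m \<in> T" using m by (simp add: T_def)
        have "\<bar>\<bar>\<Phi> z (t m)\<bar> - \<bar>\<psi> m (t m)\<bar>\<bar> < r" "\<bar>\<bar>\<Phi> z (t m)\<bar> - \<bar>\<psi> m' (t m)\<bar>\<bar> < r"
          using z tT by (force simp: E_def Miss_def miss_event_def)+
        moreover have "t m \<in> J m" using h by (simp add: t_def J_def)
        then have "t m \<notin> J m'" using Juniq m(3) by blast
        then have "\<psi> m' (t m) = \<phi> (t m)" using S(8) m(2) by simp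
        moreover have "2 * r \<le> \<bar>\<bar>\<psi> m (t m)\<bar> - \<bar>\<phi> (t m)\<bar>\<bar>" using S(9) m(1) by simp
        ultimately show False by linarith
      qed
    qed
    define Q0 where "Q0 = data_law \<mu> x \<sigma> n p P"
    have Wm: "(\<lambda>z. \<lambda>t\<in>{0..1}. z t) \<in> measurable P path_space"
      by (rule path_measurable) (rule coord_measurable)
    have Q0: "prob_space Q0" "sets Q0 = sets (data_space n p)"
      using data_law_prob[OF prob_space_axioms Wm xI \<sigma>, of \<mu> n] bc(3) by (simp_all add: Q0_def sets_data_law)
    interpret Q0: prob_space Q0 by (rule Q0(1))
    define C where "C m = {j \<in> {1..p}. x j \<in> J m}" for m
    have "(\<Sum>m<M. measure Q0 (E m)) = measure Q0 (\<Union>m<M. E m)"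
      by (rule Q0.finite_measure_finite_Union[symmetric]) (use disj Es Q0(2) in auto)
    then have s1: "(\<Sum>m<M. measure Q0 (E m)) \<le> 1" by simp
    have "(\<Sum>m<M. card (C m)) = card (\<Union>m<M. C m)"
      by (rule card_UN_disjoint[symmetric]) (use Juniq in \<open>auto simp: C_def\<close>)
    also have "\<dots> \<le> card {1..p}" by (rule card_mono) (auto simp: C_def)
    finally have "(\<Sum>m<M. card (C m)) \<le> p" by simp
    then have "real (\<Sum>m<M. card (C m)) \<le> real p" by (rule of_nat_mono)
    then have s2: "(\<Sum>m<M. real (card (C m)) / real p) \<le> 1" using p by (simp add: sum_divide_distrib[symmetric] divide_le_eq)
    \<comment> \<open>The two averages are taken of the sum of both quantities, so that a single
      index is good for both.\<close>
    have "(\<Sum>m<M. real (card (C m)) / real p + measure Q0 (E m)) \<le> 2" using s1 s2 by (simp add: sum.distrib)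
    from exists_below_mean[OF M0 this] obtain m where m: "m < M" "real (card (C m)) / real p + measure Q0 (E m) \<le> 2 / real M" by blast
    have Cm: "real (card (C m)) \<le> 2 / real M * real p" and Em: "measure Q0 (E m) \<le> 2 / real M"
    proof -
      have "0 \<le> real (card (C m)) / real p" by simp
      then have "real (card (C m)) / real p \<le> 2 / real M" using m(2) measure_nonneg[of Q0 "E m"] by linarith
      then show "real (card (C m)) \<le> 2 / real M * real p" using p by (simp add: divide_le_eq)
      show "measure Q0 (E m) \<le> 2 / real M" using m(2) \<open>0 \<le> real (card (C m)) / real p\<close> by linarith
    qed
    define P1 where "P1 = distr P path_space (\<lambda>z. \<lambda>t\<in>{0..1}. z t + S m t z)"
    define Q1 where "Q1 = data_law \<mu> x \<sigma> n p P1"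
    have W1m: "(\<lambda>z. \<lambda>t\<in>{0..1}. z t + S m t z) \<in> measurable P path_space"
      by (rule shifted_path_measurable[OF bd(1) S(1)[OF m(1)]])
    have Q1: "prob_space Q1" "sets Q1 = sets (data_space n p)"
      unfolding Q1_def P1_def by (intro data_law_prob[OF prob_space_axioms W1m xI \<sigma>] sets_data_law)+
    interpret Q1: prob_space Q1 by (rule Q1(1))
    \<comment> \<open>This K and q balance the terms: K * (2 / M) = 2 M^(-1/4) and exp q / K =
      M^(-1/4). With the Markov term the total is 2/12 + 1/12 + 1/4 = 1/2.\<close>
    define K where "K = real M powr (3 / 4)"
    define q where "q = ln (real M) / 2"
    have K: "0 < K" using M0 by (simp add: K_def)
    have lM: "\<rho> / 2 * ln X \<le> ln (real M)"
    proof -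
      have "ln (l / (4 * h)) \<le> ln (real M)" using M(2) l h by (intro ln_mono) auto
      then show ?thesis using X by linarith
    qed
    have q: "0 < q" "\<rho> / 4 * ln X \<le> q"
    proof -
      have "0 < \<rho> / 2 * ln X" using \<rho> lX by (intro mult_pos_pos) auto
      then show "0 < q" unfolding q_def using lM by linarith
      show "\<rho> / 4 * ln X \<le> q" unfolding q_def using lM by linarith
    qed
    have \<tau>: "0 \<le> \<tau>" using e0 by (simp add: \<tau>_def)
    have M4: "real M powr (- (1 / 4)) \<le> 1 / 12"
    proof -
      have "(12::real) = (12 powr 4) powr (1 / 4)" by (simp add: powr_powr)
      also have "(12::real) powr 4 = 12 ^ 4" by (simp add: powr_numeral)
      also have "(12 ^ 4) powr (1 / 4) \<le> real M powr (1 / 4)" using M(3) by (intro powr_mono2) auto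
      finally show ?thesis using M0 by (simp add: powr_minus_divide divide_le_eq)
    qed
    have t1: "K * measure Q0 (E m) \<le> 2 / 12"
    proof -
      have "K * measure Q0 (E m) \<le> K * (2 / real M)" using Em K by (intro mult_left_mono) auto
      also have "\<dots> = 2 * (real M powr (3 / 4) / real M powr 1)" using M0 by (simp add: K_def)
      also have "real M powr (3 / 4) / real M powr 1 = real M powr (- (1 / 4))" by (subst powr_diff[symmetric]) simp
      finally show ?thesis using M4 by simp
    qed
    have t2: "exp q / K \<le> 1 / 12"
    proof -
      have "exp q = real M powr (1 / 2)" using M0 by (simp add: q_def powr_def)
      then have "exp q / K = real M powr (- (1 / 4))" unfolding K_def by (simp add: powr_diff[symmetric])
      then show ?thesis using M4 by simp
    qed
    have t3: "real n * real (card (C m)) * \<tau> / (\<sigma>\<^sup>2 * q) \<le> 1 / 4"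
    proof -
      have "1 / real M \<le> 4 * h / l"
        using M(2) M0 l h by (simp add: field_simps)
      then have "real (card (C m)) \<le> 8 * h / l * real p"
        using Cm mult_right_mono[of "1 / real M" "4 * h / l" "2 * real p"] by (simp add: algebra_simps)
      then have "real n * real (card (C m)) * \<tau> \<le> real n * (8 * h / l * real p) * \<tau>"
        using \<tau> by (intro mult_right_mono mult_left_mono) auto
      also have "\<dots> = 8 * \<kappa>3 * \<epsilon>\<^sup>2 / l * (X * (h * (h powr \<gamma>)\<^sup>2))"
        by (simp add: \<tau>_def X_def power_mult_distrib)
      also have "\<dots> = 8 * \<kappa>3 * \<epsilon>\<^sup>2 / l * ln X" unfolding hX(2) ..
      finally have le: "real n * real (card (C m)) * \<tau> \<le> 8 * \<kappa>3 * \<epsilon>\<^sup>2 / l * ln X" .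
      have nn: "0 \<le> 8 * \<kappa>3 * \<epsilon>\<^sup>2 / l * ln X"
        using e0 l lX by (intro mult_nonneg_nonneg divide_nonneg_nonneg) auto
      have "real n * real (card (C m)) * \<tau> / (\<sigma>\<^sup>2 * q) \<le> (8 * \<kappa>3 * \<epsilon>\<^sup>2 / l * ln X) / (\<sigma>\<^sup>2 * (\<rho> / 4 * ln X))"
        using le nn q \<sigma> \<rho> lX by (intro frac_le) auto
      also have "\<dots> = \<epsilon>\<^sup>2 * (32 * \<kappa>3 / (l * \<sigma>\<^sup>2 * \<rho>))" using lX \<rho> l \<sigma> by (simp add: field_simps)
      also have "\<dots> \<le> \<epsilon> * (32 * \<kappa>3 / (l * \<sigma>\<^sup>2 * \<rho>))"
        using e e0 l \<rho> by (intro mult_right_mono) (auto simp: power2_eq_square mult_left_le)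
      finally show ?thesis using e(3) by linarith
    qed
    have "emeasure Q1 (E m) \<le> ennreal K * emeasure Q0 (E m) + ennreal (exp q / K + real n * real (card (C m)) * \<tau> / (\<sigma>\<^sup>2 * q))"
      unfolding Q1_def Q0_def P1_def C_def
      by (rule data_law_shift[OF bd(1) bc(3) S(1,2)[OF m(1)] S(3)[OF m(1)] S(4)[OF m(1)] xI \<sigma> K q(1) \<tau> Es(2)])
    then have "measure Q1 (E m) \<le> K * measure Q0 (E m) + (exp q / K + real n * real (card (C m)) * \<tau> / (\<sigma>\<^sup>2 * q))"
      using K q(1) \<tau> by (simp add: Q0.emeasure_eq_measure Q1.emeasure_eq_measure ennreal_mult[symmetric] ennreal_plus[symmetric] ennreal_le_iff del: ennreal_plus)
    then have "measure Q1 (E m) \<le> 1 / 2" using t1 t2 t3 by linarith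
    moreover have "measure Q1 (E m) = 1 - measure Q1 (Miss m)"
      using Q1.prob_compl[of "Miss m"] Es(1) Q1(2) sets_eq_imp_space_eq[OF Q1(2)] by (simp add: E_def)
    ultimately have "1 / 2 \<le> measure Q1 (Miss m)" by simp
    then have ge: "ennreal (1 / 2) \<le> emeasure Q1 (Miss m)"
      unfolding Q1.emeasure_eq_measure by (rule ennreal_leI)
    show "\<exists>P\<in>gaussian_gap_class \<gamma> k L \<delta>. \<exists>\<psi> T.
        continuous_on {0..1} \<psi> \<and> (\<forall>t. \<bar>eigenfunction P k t\<bar> = \<bar>\<psi> t\<bar>) \<and> finite T \<and> T \<subseteq> {0..1} \<and>
        ennreal (1 / 2) \<le> emeasure (data_law \<mu> x \<sigma> n p P)
          (miss_event n p \<Phi> T \<psi> (b0 * (ln (real (n * p)) / real (n * p)) powr (\<gamma> / (2 * \<gamma> + 1))))"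
    proof (intro bexI[of _ P1] exI[of _ "\<psi> m"] exI[of _ T] conjI)
      show "P1 \<in> gaussian_gap_class \<gamma> k L \<delta>" unfolding P1_def by (rule S(5)[OF m(1)])
      show "\<forall>t. \<bar>eigenfunction P1 k t\<bar> = \<bar>\<psi> m t\<bar>" unfolding P1_def using S(6)[OF m(1)] by blast
      show "ennreal (1 / 2) \<le> emeasure (data_law \<mu> x \<sigma> n p P1)
          (miss_event n p \<Phi> T (\<psi> m) (b0 * (ln (real (n * p)) / real (n * p)) powr (\<gamma> / (2 * \<gamma> + 1))))"
        using ge unfolding Miss_def r_def hX(1) X_def Q1_def .
    qed (use S(7)[OF m(1)] T in auto)
  qed
qed

theorem theorem9:
  fixes \<gamma> L \<delta> \<sigma>\<^sub>0 :: real and k :: nat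
  assumes "\<gamma> > 0" and "L > 0" and "k \<ge> 1" and "\<delta> > 0" and "\<sigma>\<^sub>0 > 0"
    and nondegenerate: "\<exists>\<delta>'>\<delta>. gaussian_gap_class \<gamma> k L \<delta>' \<noteq> {}"
  shows "\<exists>b\<^sub>0>0. \<forall>(\<mu> :: real \<Rightarrow> real) (x :: nat \<Rightarrow> nat \<Rightarrow> nat \<Rightarrow> real) (w :: real \<Rightarrow> real) a b.
     (\<forall>n p. design p (x n p)) \<longrightarrow> 0 < a \<longrightarrow> 0 < b \<longrightarrow> b \<le> b\<^sub>0 \<longrightarrow>
     (\<forall>t\<ge>0. 0 \<le> w t \<and> a * indicator {b..} t \<le> w t) \<longrightarrow>
     0 < Liminf (sequentially \<times>\<^sub>F sequentially)
           (\<lambda>(n, p).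
              INF \<Phi>\<in>estimators n p.
              SUP P\<in>gaussian_gap_class \<gamma> k L \<delta>.
                \<integral>\<^sup>+ y. ennreal (w (sign_dist (\<Phi> y) (eigenfunction P k) / rate \<gamma> n p))
                  \<partial>data_law \<mu> (x n p) \<sigma>\<^sub>0 n p P)"
proof -
  obtain P lam A B where base: "base_law \<gamma> L k \<delta> P lam A B"
    by (rule base_law_exists[OF assms(1-4) nondegenerate])
  note rates = lower_bound_design[OF assms(1,3,4,5) base] lower_bound_log[OF assms(1,3,4,5) base]
    lower_bound_sqrt_n[OF assms(1,3,4,5) base]
  show ?thesis by (rule lower_bound_from_rates[OF rates])
qed

end
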